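(* Consider the nearest-neighbour discrete NLS lattice on the periodic ring $\mathcal J=\{-N,\dots,N\}$ with $6\le N\le 10$, i.e. $\mathrm i\dot\psi_j=\partial H/\partial\overline{\psi_j}$ with $$H=\sum_{j\in\mathcal J}|\psi_j|^2+\tfrac12\sum_{j\in\mathcal J}|\psi_j|^4+\varepsilon\sum_{j\in\mathcal J}|\psi_{j+1}-\psi_j|^2 .$$ Let $I^*>0$ be such that $\omega=1+I^*$ satisfies $k\omega\pm1\neq0$ and $k\omega\pm2\neq0$ for all $k\in\mathbb Z\setminus\{0\}$, let $T=2\pi/\omega$, and consider the unperturbed resonant 3-torus with excited sites $-1,0,1$ having actions $(I^*,1+2I^*,I^* )$ and hence frequencies $\omega(1,2,1)$. For $q_3\in\mathbb R/2\pi\mathbb Z$ let $\mathcal T_0(q_3)$ be its 2-dimensional invariant subtorus $$\mathcal T_0(q_3)=\bigl\{\psi:\ \psi_{-1}=\sqrt{I^*}e^{-\mathrm i\alpha},\ \psi_0=\sqrt{1+2I^*}\,e^{-\mathrm i\beta},\ \psi_1=\sqrt{I^*}\,e^{-\mathrm i(\alpha+q_3)},\ \psi_j=0\ (j\neq-1,0,1),\ \alpha,\beta\in\mathbb R/2\pi\mathbb Z\bigr\}.$$ Then for $q_3=0$ and for $q_3=\pi$ there is $\varepsilon^*>0$ such that for every $0<\varepsilon<\varepsilon^*$ the system has an invariant 2-dimensional torus $\mathcal T_\varepsilon(q_3)$, foliated by $T$-periodic orbits, converging to $\mathcal T_0(q_3)$ as $\varepsilon\to0^+$. For $\varepsilon>0$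 small, $\mathcal T_\varepsilon(0)$ is linearly unstable and $\mathcal T_\varepsilon(\pi)$ is linearly stable.
   Context: Site indices are taken modulo $2N+1$ (periodic boundary conditions). Convergence of tori is in the Hausdorff sense in phase space. The torus $\mathcal T_\varepsilon(q_3)$ is called linearly stable if all Floquet multipliers (over the period $T$, viewing the system as a real Hamiltonian system) of the periodic orbits foliating it lie on the unit circle, and linearly unstable if these periodic orbits have at least one Floquet multiplier outside the unit circle. *)

theory Defs
  imports "HOL-Analysis.Analysis" "Berlekamp_Zassenhaus.Finite_Field"
begin

text \<open>
  The ring of sites is \<open>'a mod_ring\<close>, the integers modulo \<open>CARD('a)\<close>.  With \<open>CARD('a) = 2 * N + 1\<close>
  its elements are the residues of \<open>-N, \<dots>, N\<close>, and \<open>j + 1\<close> is the periodic right neighbour of \<open>j\<close>.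
  Phase space is \<open>complex ^ 'a mod_ring\<close>, regarded as a real normed vector space.
\<close>

definition dnls_energy :: "real \<Rightarrow> complex ^ ('a::nontriv) mod_ring \<Rightarrow> real" where
  "dnls_energy \<epsilon> \<psi> =
     (\<Sum>j\<in>UNIV. (cmod (\<psi> $ j))\<^sup>2) + 1/2 * (\<Sum>j\<in>UNIV. (cmod (\<psi> $ j)) ^ 4)
     + \<epsilon> * (\<Sum>j\<in>UNIV. (cmod (\<psi> $ (j + 1) - \<psi> $ j))\<^sup>2)"

text \<open>The Wirtinger derivative with respect to the conjugate of the \<open>j\<close>-th coordinate
  \<open>x\<^sub>j + i y\<^sub>j\<close>, that is, half of \<open>\<partial>/\<partial>x\<^sub>j + i \<partial>/\<partial>y\<^sub>j\<close>.\<close>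

definition wirtinger_cnj :: "(complex ^ 'k \<Rightarrow> real) \<Rightarrow> 'k::finite \<Rightarrow> complex ^ 'k \<Rightarrow> complex" where
  "wirtinger_cnj H j \<psi> =
     (of_real (frechet_derivative H (at \<psi>) (axis j 1))
      + \<i> * of_real (frechet_derivative H (at \<psi>) (axis j \<i>))) / 2"

text \<open>The vector field of \<open>i d\<psi>\<^sub>j/dt = \<partial>H/\<partial>cnj \<psi>\<^sub>j\<close>.\<close>

definition hamiltonian_field :: "(complex ^ 'k \<Rightarrow> real) \<Rightarrow> complex ^ 'k \<Rightarrow> complex ^ ('k::finite)" where
  "hamiltonian_field H \<psi> = (\<chi> j. - \<i> * wirtinger_cnj H j \<psi>)"

abbreviation dnls_field :: "real \<Rightarrow> complex ^ 'a mod_ring \<Rightarrow> complex ^ ('a::nontriv) mod_ring" where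
  "dnls_field \<epsilon> \<equiv> hamiltonian_field (dnls_energy \<epsilon>)"

definition solution_of :: "('e \<Rightarrow> 'e) \<Rightarrow> (real \<Rightarrow> 'e::real_normed_vector) \<Rightarrow> bool" where
  "solution_of X \<gamma> \<longleftrightarrow> (\<forall>t. (\<gamma> has_vector_derivative X (\<gamma> t)) (at t))"

text \<open>Equilibria are not counted as periodic orbits.\<close>

definition periodic_orbit :: "('e \<Rightarrow> 'e) \<Rightarrow> real \<Rightarrow> (real \<Rightarrow> 'e::real_normed_vector) \<Rightarrow> bool" where
  "periodic_orbit X T \<gamma> \<longleftrightarrow>
     solution_of X \<gamma> \<and> (\<forall>t. \<gamma> (t + T) = \<gamma> t) \<and> (\<exists>t. \<gamma> t \<noteq> \<gamma> 0)"

definition invariant_under :: "('e \<Rightarrow> 'e) \<Rightarrow> 'e::real_normed_vector set \<Rightarrow> bool" where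
  "invariant_under X S \<longleftrightarrow> (\<forall>\<gamma>. solution_of X \<gamma> \<and> \<gamma> 0 \<in> S \<longrightarrow> range \<gamma> \<subseteq> S)"

definition foliated_by_periodic_orbits ::
    "('e \<Rightarrow> 'e) \<Rightarrow> real \<Rightarrow> 'e::real_normed_vector set \<Rightarrow> bool" where
  "foliated_by_periodic_orbits X T S \<longleftrightarrow>
     (\<forall>x\<in>S. \<exists>\<gamma>. periodic_orbit X T \<gamma> \<and> \<gamma> 0 = x \<and> range \<gamma> \<subseteq> S)"

text \<open>A two-dimensional torus is a \<open>C\<^sup>1\<close>-embedded copy of \<open>(\<real>/2\<pi>\<int>)\<^sup>2\<close>: the image of an immersion of the
  plane whose fibres are exactly the cosets of \<open>(2\<pi>\<int>)\<^sup>2\<close>.\<close>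

definition torus2 :: "'e::real_normed_vector set \<Rightarrow> bool" where
  "torus2 S \<longleftrightarrow> (\<exists>F :: real \<times> real \<Rightarrow> 'e. \<exists>F' :: real \<times> real \<Rightarrow> (real \<times> real) \<Rightarrow>\<^sub>L 'e.
     (\<forall>p. (F has_derivative blinfun_apply (F' p)) (at p) \<and> inj (blinfun_apply (F' p))) \<and>
     continuous_on UNIV F' \<and>
     (\<forall>a b a' b'. F (a, b) = F (a', b') \<longleftrightarrow>
        (\<exists>m n :: int. a - a' = 2 * pi * of_int m \<and> b - b' = 2 * pi * of_int n)) \<and>
     S = range F)"

definition hausdorff_distance :: "'e::metric_space set \<Rightarrow> 'e set \<Rightarrow> real" where
  "hausdorff_distance A B = max (SUP x\<in>A. infdist x B) (SUP y\<in>B. infdist y A)"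

text \<open>\<open>\<Phi>\<close> is the principal fundamental solution of the equation linearised along \<open>\<gamma>\<close>;
  \<open>\<Phi> T\<close> is then the monodromy operator.\<close>

definition fundamental_solution ::
    "('e \<Rightarrow> 'e) \<Rightarrow> (real \<Rightarrow> 'e) \<Rightarrow> (real \<Rightarrow> 'e \<Rightarrow> 'e::real_normed_vector) \<Rightarrow> bool" where
  "fundamental_solution X \<gamma> \<Phi> \<longleftrightarrow>
     (\<forall>v. \<Phi> 0 v = v \<and>
        (\<forall>t. ((\<lambda>s. \<Phi> s v) has_vector_derivative
                frechet_derivative X (at (\<gamma> t)) (\<Phi> t v)) (at t)))"

text \<open>Complex eigenvalues of a real linear operator: \<open>A (u + i v) = \<mu> (u + i v)\<close> in the
  complexification, separated into real and imaginary parts.  For phase space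
  \<open>complex ^ 'k\<close> the formal \<open>i\<close> of the complexification is unrelated to the
  complex structure of the coordinates, as the linearisation is only real linear.\<close>

definition complex_eigenvalue :: "('e \<Rightarrow> 'e::real_vector) \<Rightarrow> complex \<Rightarrow> bool" where
  "complex_eigenvalue A \<mu> \<longleftrightarrow> (\<exists>u v. (u, v) \<noteq> (0, 0) \<and>
     A u = Re \<mu> *\<^sub>R u - Im \<mu> *\<^sub>R v \<and> A v = Im \<mu> *\<^sub>R u + Re \<mu> *\<^sub>R v)"

definition floquet_multiplier ::
    "('e \<Rightarrow> 'e) \<Rightarrow> real \<Rightarrow> (real \<Rightarrow> 'e::real_normed_vector) \<Rightarrow> complex \<Rightarrow> bool" where
  "floquet_multiplier X T \<gamma> \<mu> \<longleftrightarrow>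
     (\<exists>\<Phi>. fundamental_solution X \<gamma> \<Phi> \<and> complex_eigenvalue (\<Phi> T) \<mu>)"

definition linearly_stable :: "('e \<Rightarrow> 'e) \<Rightarrow> real \<Rightarrow> 'e::real_normed_vector set \<Rightarrow> bool" where
  "linearly_stable X T S \<longleftrightarrow>
     (\<forall>\<gamma>. periodic_orbit X T \<gamma> \<and> range \<gamma> \<subseteq> S \<longrightarrow>
        (\<forall>\<mu>. floquet_multiplier X T \<gamma> \<mu> \<longrightarrow> cmod \<mu> = 1))"

definition linearly_unstable :: "('e \<Rightarrow> 'e) \<Rightarrow> real \<Rightarrow> 'e::real_normed_vector set \<Rightarrow> bool" where
  "linearly_unstable X T S \<longleftrightarrow>
     (\<forall>\<gamma>. periodic_orbit X T \<gamma> \<and> range \<gamma> \<subseteq> S \<longrightarrow>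
        (\<exists>\<mu>. floquet_multiplier X T \<gamma> \<mu> \<and> cmod \<mu> > 1))"

definition unperturbed_torus :: "real \<Rightarrow> real \<Rightarrow> (complex ^ ('a::nontriv) mod_ring) set" where
  "unperturbed_torus I q = {\<psi>. \<exists>\<alpha> \<beta> :: real.
     \<psi> $ (-1) = of_real (sqrt I) * exp (- \<i> * of_real \<alpha>) \<and>
     \<psi> $ 0 = of_real (sqrt (1 + 2 * I)) * exp (- \<i> * of_real \<beta>) \<and>
     \<psi> $ 1 = of_real (sqrt I) * exp (- \<i> * of_real (\<alpha> + q)) \<and>
     (\<forall>j. j \<notin> {-1, 0, 1} \<longrightarrow> \<psi> $ j = 0)}"

end

theory Submission
  imports Defs
begin

text \<open>
  In coordinates that rotate with site \<open>j\<close> at its unperturbed frequency \<open>k\<^sub>j \<omega>\<close>, with \<open>k = 1, 2, 1\<close> on the excited sites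
  and \<open>0\<close> elsewhere, the unperturbed motion is a constant real profile \<open>r\<close>, and \<open>q = 0\<close> and \<open>q = \<pi>\<close> become the two signs
  \<open>s = 1\<close> and \<open>s = -1\<close> of \<open>r 1\<close>.  The coupling turns the equation into a \<open>T\<close>-periodic one.

  \<^bold>\<open>Existence.\<close>  A periodic solution near \<open>r\<close> is a fixed point of the solution operator of the decoupled linear problem
  (\<open>slv_fixpoint\<close>).  At an empty site this problem is a rotation with multiplier \<open>cis (- T) \<noteq> 1\<close>.  At an excited site it is a
  twist, whose only obstruction is the mean force on the phase; a constant \<open>m\<^sub>j\<close> is added to compensate that force and the phase at time
  0 is prescribed.  Time reversal composed with conjugation preserves \<open>r\<close>, because \<open>r\<close> is real, and changes the sign of \<open>m\<close>.
  By uniqueness \<open>m = 0\<close>, so the fixed point is an orbit (\<open>orbit_exists\<close>).  Its images under the gauge rotation and the flow form the torus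
  (\<open>tor_torus2\<close>), which is foliated by \<open>T\<close>-periodic orbits because the frequencies of the two phases are \<open>\<omega>\<close> and \<open>2 \<omega>\<close>.

  \<^bold>\<open>The decisive balance.\<close>  Without coupling the multiplier 1 has multiplicity six: three phases and three actions.  The gauge
  and the time translation remain exact symmetries, so only the phase of site 1 relative to site -1 matters; its slow rate is
  written \<open>\<kappa>\<close>.  These sites interact through site 0, to second order in \<open>\<epsilon>\<close>.  Averaging the norm balance of
  site 1, with the forced first harmonics of the orbit and of the perturbation inserted, gives
  \<open>\<kappa>\<^sup>2 = 4 s I\<^sup>2 \<epsilon>\<^sup>2 / \<omega>\<^sup>2\<close> up to third order (\<open>flux_balance\<close>, \<open>exponent_eq\<close>).

  \<^bold>\<open>Stability for\<close> \<open>s = -1\<close>.  A multiplier inside the unit circle gives a solution with \<open>Re \<kappa> < 0\<close>, on which the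
  conserved Krein form vanishes (\<open>krein_zero\<close>).  Multipliers away from 1 are excluded because the empty sites carry multipliers near
  \<open>cis T\<close> and \<open>cis (- T)\<close> with Krein forms of opposite signs (\<open>large_exponents\<close>; this uses \<open>2 T \<notin> 2 \<pi> \<int>\<close>).  For multipliers near 1
  the balance makes \<open>\<kappa>\<^sup>2\<close> nearly negative, whereas the vanishing of the Krein form, which is a multiple of \<open>Im \<kappa>\<close> to leading
  order, forces \<open>Im \<kappa>\<close> to be of second order (\<open>no_small_exponents\<close>).  Multipliers outside the circle are reduced to these by time
  reversal.

  \<^bold>\<open>Instability for\<close> \<open>s = 1\<close>.  The same fixed point argument solves the linearised equation for every real \<open>\<kappa> \<ge> 0\<close> of order \<open>\<epsilon>\<close>, at the price
  of constant forces \<open>m\<^sub>j\<close>; reflection symmetry leaves one of them free.  The balance shows that it changes sign as \<open>\<kappa>\<close> passes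
  the predicted value, so it vanishes for some \<open>\<kappa> > 0\<close> (\<open>growing_mode\<close>), and \<open>exp (\<kappa> T) > 1\<close> is a multiplier.
\<close>

section \<open>Means and a priori bounds for periodic scalar equations\<close>

definition avg :: "real \<Rightarrow> (real \<Rightarrow> complex) \<Rightarrow> complex" where
  "avg T h = integral {0..T} h / of_real T"

lemma integrable_cont: "continuous_on UNIV (h :: real \<Rightarrow> complex) \<Longrightarrow> h integrable_on {0..T}"
  by (meson continuous_on_subset integrable_continuous_real subset_UNIV)

lemma avg_add:
  "continuous_on UNIV f \<Longrightarrow> continuous_on UNIV g \<Longrightarrow> avg T (\<lambda>t. f t + g t) = avg T f + avg T g"
  by (simp add: avg_def integral_add integrable_cont add_divide_distrib)

lemma avg_diff:
  "continuous_on UNIV f \<Longrightarrow> continuous_on UNIV g \<Longrightarrow> avg T (\<lambda>t. f t - g t) = avg T f - avg T g"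
  by (simp add: avg_def integral_diff integrable_cont diff_divide_distrib)

lemma avg_cmult: "avg T (\<lambda>t. c * f t) = c * avg T f"
  by (simp add: avg_def)

lemma avg_uminus: "avg T (\<lambda>t. - f t) = - avg T f"
  using avg_cmult[of T "-1" f] by simp

lemma avg_const: "T > 0 \<Longrightarrow> avg T (\<lambda>t. c) = c"
  by (simp add: avg_def scaleR_conv_of_real)

lemma avg_sum:
  assumes "finite A" "\<And>i. i \<in> A \<Longrightarrow> continuous_on UNIV (f i)"
  shows "avg T (\<lambda>t. \<Sum>i\<in>A. f i t) = (\<Sum>i\<in>A. avg T (f i))"
  using assms by (simp add: avg_def integral_sum integrable_cont sum_divide_distrib)

lemma avg_lin:
  assumes "continuous_on UNIV f" "continuous_on UNIV g" "continuous_on UNIV k"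
  shows "avg T (\<lambda>t. a * (b * (f t + g t) + k t)) = a * (b * (avg T f + avg T g) + avg T k)"
proof -
  have "avg T (\<lambda>t. b * (f t + g t) + k t) = avg T (\<lambda>t. b * (f t + g t)) + avg T k"
    by (rule avg_add) (intro continuous_intros assms)+
  then show ?thesis using avg_cmult[of T a "\<lambda>t. b * (f t + g t) + k t"] avg_cmult[of T b "\<lambda>t. f t + g t"]
      avg_add[OF assms(1,2), of T] by simp
qed

lemma avg_cnj: "avg T (\<lambda>t. cnj (f t)) = cnj (avg T f)"
  by (simp add: avg_def integral_cnj)

lemma avg_bound:
  assumes "T > 0" "\<And>t. norm (h t) \<le> B"
  shows "norm (avg T h) \<le> B"
proof (cases "h integrable_on {0..T}")
  case True
  have B: "B \<ge> 0" using assms(2)[of 0] norm_ge_zero order_trans by blast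
  have "norm (integral {0..T} h) \<le> B * measure lborel {0..T}"
    by (rule has_integral_bound_real[OF B, of "{}"])
       (use True assms in \<open>auto intro: integrable_integral\<close>)
  then show ?thesis using assms(1) by (simp add: avg_def norm_divide field_simps)
next
  case False
  have B: "B \<ge> 0" using assms(2)[of 0] norm_ge_zero order_trans by blast
  show ?thesis using False B by (simp add: avg_def not_integrable_integral)
qed

lemma avg_deriv:
  assumes "T > 0" "\<And>t. (f has_vector_derivative D t) (at t)" "f T = f 0"
  shows "avg T D = 0"
proof -
  have "(D has_integral (f T - f 0)) {0..T}"
    using assms by (intro fundamental_theorem_of_calculus)
      (auto intro: has_vector_derivative_at_within)
  then show ?thesis using assms(3) by (simp add: avg_def integral_unique)
qed

lemma cis_vderiv [derivative_intros]:
  "((\<lambda>t. cis (a * t)) has_vector_derivative (\<i> * of_real a * cis (a * t))) (at t)"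
proof -
  have "((\<lambda>z. exp (\<i> * of_real a * z)) has_field_derivative (\<i> * of_real a * exp (\<i> * of_real a * of_real t))) (at (of_real t))"
    by (auto intro!: derivative_eq_intros)
  from has_vector_derivative_real_field[OF this] show ?thesis
    by (simp add: cis_conv_exp mult_ac)
qed

lemma cont_deriv: "(\<And>t. (f has_vector_derivative D t) (at t)) \<Longrightarrow> continuous_on UNIV f"
  by (meson continuous_at_imp_continuous_on has_vector_derivative_continuous)

lemma cont_cis [continuous_intros]: "continuous_on UNIV (\<lambda>t::real. cis (a * t))"
  by (rule cont_deriv[OF cis_vderiv])

lemma cis_period: "w * T = 2 * pi \<Longrightarrow> cis (of_int m * w * T) = 1"
  using cis_multiple_2pi[of "of_int m"] by (simp only: mult.assoc) (simp add: mult_ac)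

lemma avg_fourier_deriv:
  assumes T: "T > 0" "w * T = 2 * pi"
    and f: "\<And>t. (f has_vector_derivative D t) (at t)" "f T = f 0" and D: "continuous_on UNIV D"
  shows "avg T (\<lambda>t. D t * cis (- (of_int m * w) * t)) = \<i> * of_int m * of_real w * avg T (\<lambda>t. f t * cis (- (of_int m * w) * t))"
proof -
  let ?e = "\<lambda>t. cis (- (of_int m * w) * t)"
  have cf: "continuous_on UNIV f" by (rule cont_deriv[OF f(1)])
  have "avg T (\<lambda>t. D t * ?e t + (- \<i> * of_int m * of_real w) * (f t * ?e t)) = 0"
  proof (rule avg_deriv[OF T(1), of "\<lambda>t. f t * ?e t"])
    show "((\<lambda>t. f t * ?e t) has_vector_derivative D t * ?e t + (- \<i> * of_int m * of_real w) * (f t * ?e t)) (at t)" for t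
      by (rule has_vector_derivative_eq_rhs[OF has_vector_derivative_mult[OF f(1) cis_vderiv]])
         (simp add: algebra_simps)
    show "f T * ?e T = f 0 * ?e 0" using cis_period[OF T(2), of "-m"] f(2) by simp
  qed
  moreover have "avg T (\<lambda>t. D t * ?e t + (- \<i> * of_int m * of_real w) * (f t * ?e t)) =
     avg T (\<lambda>t. D t * ?e t) + avg T (\<lambda>t. (- \<i> * of_int m * of_real w) * (f t * ?e t))"
    by (intro avg_add continuous_intros cf D)
  ultimately show ?thesis unfolding avg_cmult
    by (simp add: add_eq_0_iff)
qed

lemma avg_cis:
  assumes T: "T > 0" "w * T = 2 * pi" and m: "m \<noteq> 0"
  shows "avg T (\<lambda>t. cis (of_int m * w * t)) = 0"
proof -
  have "avg T (\<lambda>t. 0 * cis (- (of_int (-m) * w) * t)) = \<i> * of_int (-m) * of_real w * avg T (\<lambda>t. 1 * cis (- (of_int (-m) * w) * t))"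
    by (rule avg_fourier_deriv[OF T, of "\<lambda>_. 1"]) (auto intro: continuous_intros)
  moreover have "w \<noteq> 0" using T by auto
  ultimately show ?thesis using m by (simp add: avg_const[OF T(1)])
qed

lemma vderiv_bound:
  fixes f :: "real \<Rightarrow> 'e::real_normed_vector"
  assumes "\<And>t. (f has_vector_derivative D t) (at t)" "\<And>t. t \<in> {a..b} \<Longrightarrow> norm (D t) \<le> B" "a \<le> b"
  shows "norm (f b - f a) \<le> B * (b - a)"
proof -
  have "norm (f b - f a) \<le> B * norm (b - a)"
  proof (rule differentiable_bound[of "{a..b}" f "\<lambda>t h. h *\<^sub>R D t" B])
    show "(f has_derivative (\<lambda>h. h *\<^sub>R D x)) (at x within {a..b})" for x
      using assms(1) unfolding has_vector_derivative_def by (metis has_derivative_at_withinI)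
    show "onorm (\<lambda>h. h *\<^sub>R D x) \<le> B" if "x \<in> {a..b}" for x
      using assms(2)[OF that] by (simp add: onorm_scaleR_left onorm_id)
  qed (use assms in auto)
  then show ?thesis using assms(3) by simp
qed

lemma periodic_int:
  fixes f :: "real \<Rightarrow> 'b"
  assumes "\<And>t. f (t + T) = f t" shows "f (t + of_int n * T) = f t"
proof -
  have nat: "f (t + of_nat k * T) = f t" for k t
  proof (induction k)
    case (Suc k)
    have "t + of_nat (Suc k) * T = (t + of_nat k * T) + T" by (simp add: algebra_simps)
    then show ?case using assms[of "t + of_nat k * T"] Suc by presburger
  qed simp
  show ?thesis
  proof (cases "n \<ge> 0")
    case True then show ?thesis using nat[of t "nat n"] by simp
  next
    case False then show ?thesis using nat[of "t + of_int n * T" "nat (-n)"] by simp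
  qed
qed

lemma reduce_period:
  assumes "T > 0" shows "\<exists>n. (t::real) + of_int n * T \<in> {0..T}"
proof -
  have "of_int \<lfloor>t/T\<rfloor> * T \<le> t" "t \<le> (of_int \<lfloor>t/T\<rfloor> + 1) * T"
  proof -
    have "of_int \<lfloor>t/T\<rfloor> \<le> t/T" "t/T \<le> of_int \<lfloor>t/T\<rfloor> + 1" by linarith+
    then show "of_int \<lfloor>t/T\<rfloor> * T \<le> t" "t \<le> (of_int \<lfloor>t/T\<rfloor> + 1) * T"
      unfolding pos_le_divide_eq[OF assms] pos_divide_le_eq[OF assms] .
  qed
  then show ?thesis by (intro exI[of _ "-\<lfloor>t/T\<rfloor>"]) (auto simp: algebra_simps)
qed

text \<open>A periodic function varies by at most one period of its derivative, so no mean value is involved.\<close>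

lemma periodic_osc:
  fixes f :: "real \<Rightarrow> 'e::real_normed_vector"
  assumes T: "T > 0" and f: "\<And>t. (f has_vector_derivative D t) (at t)" "\<And>t. f (t + T) = f t"
    and B: "\<And>t. norm (D t) \<le> B"
  shows "norm (f t - f s) \<le> B * T"
proof -
  obtain n where n: "(t - s) + of_int n * T \<in> {0..T}" using reduce_period[OF T] by blast
  have "norm (f (t + of_int n * T) - f s) \<le> B * (t + of_int n * T - s)"
    by (rule vderiv_bound[OF f(1) B]) (use n in auto)
  also have "\<dots> \<le> B * T" using n order_trans[OF norm_ge_zero B] by (intro mult_left_mono) auto
  finally show ?thesis by (simp add: periodic_int[of f, OF f(2)])
qed

lemma avg_osc:
  assumes T: "T > 0" and f: "\<And>t. (f has_vector_derivative D t) (at t)" "\<And>t. f (t + T) = f t"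
    and B: "\<And>t. norm (D t) \<le> B"
  shows "norm (f t - avg T f) \<le> B * T"
proof -
  have cf: "continuous_on UNIV f" by (rule cont_deriv[OF f(1)])
  have "f t - avg T f = avg T (\<lambda>s. f t - f s)"
    by (subst avg_diff) (auto intro: cf continuous_intros simp: avg_const[OF T])
  then show ?thesis using avg_bound[OF T, of "\<lambda>s. f t - f s" "B * T"] periodic_osc[OF assms] by simp
qed

text \<open>The factor \<open>1 - exp (\<nu> T)\<close> measures the distance from resonance.  It is kept on the left so that the bound is usable
  uniformly near resonance.\<close>

lemma periodic_linear_bound:
  assumes T: "T > 0" and x: "\<And>t. (x has_vector_derivative (h t - \<nu> * x t)) (at t)" "\<And>t. x (t + T) = x t"
    and B: "\<And>t. norm (h t) \<le> B" and nu: "Re \<nu> \<le> 0"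
  shows "norm (1 - exp (\<nu> * of_real T)) * norm (x t) \<le> B * T"
proof -
  define y where "y = (\<lambda>s. exp (\<nu> * of_real (s - t)) * x s)"
  have e: "((\<lambda>s. exp (\<nu> * of_real (s - t))) has_vector_derivative \<nu> * exp (\<nu> * of_real (s - t))) (at s)" for s
  proof -
    have "((\<lambda>z. exp (\<nu> * (z - of_real t))) has_field_derivative \<nu> * exp (\<nu> * (of_real s - of_real t))) (at (of_real s))"
      by (auto intro!: derivative_eq_intros)
    from has_vector_derivative_real_field[OF this] show ?thesis by simp
  qed
  have y: "(y has_vector_derivative exp (\<nu> * of_real (s - t)) * h s) (at s)" for s
    unfolding y_def by (rule has_vector_derivative_eq_rhs[OF has_vector_derivative_mult[OF e x(1)]]) (simp add: algebra_simps)
  have "norm (y (t + T) - y t) \<le> B * (t + T - t)"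
  proof (rule vderiv_bound[OF y])
    fix s assume s: "s \<in> {t..t + T}"
    have "norm (exp (\<nu> * of_real (s - t))) \<le> 1" using s nu by (simp add: mult_nonpos_nonneg)
    then show "norm (exp (\<nu> * of_real (s - t)) * h s) \<le> B"
      using B[of s] by (smt (verit) mult_left_le_one_le norm_ge_zero norm_mult)
  qed (use T in auto)
  moreover have "y (t + T) - y t = - ((1 - exp (\<nu> * of_real T)) * x t)" by (simp add: y_def x(2) left_diff_distrib)
  ultimately show ?thesis by (simp add: norm_mult)
qed

lemma i_solve1: "0 = (- 2 * \<i> * c) * X + (- \<i>) * Y \<Longrightarrow> 2 * c * X = - Y" for c X Y :: complex
proof -
  assume "0 = (- 2 * \<i> * c) * X + (- \<i>) * Y"
  then have "\<i> * ((- 2 * \<i> * c) * X + (- \<i>) * Y) = 0" by simp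
  then have "2 * c * X + Y = 0" by (simp add: algebra_simps)
  then show ?thesis by (simp add: add_eq_0_iff)
qed

text \<open>For real data, where \<open>G\<close> is the conjugate of \<open>F\<close>, the sum \<open>F + G\<close> is the action and \<open>F - G\<close> the phase of a perturbed twist.
  Periodicity of the action determines \<open>m\<close>, periodicity of the phase determines the mean action, and the phase is then controlled by its value at 0.\<close>

lemma phase_action_bound:
  fixes F G :: "real \<Rightarrow> complex" and m :: complex
  assumes T: "T > 0" and c: "c > 0"
    and F: "\<And>t. (F has_vector_derivative (- \<i> * (of_real c * (F t + G t) + h1 t) - m)) (at t)" "\<And>t. F (t + T) = F t"
    and G: "\<And>t. (G has_vector_derivative (\<i> * (of_real c * (F t + G t) + h2 t) - m)) (at t)" "\<And>t. G (t + T) = G t"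
    and h: "continuous_on UNIV h1" "continuous_on UNIV h2" "\<And>t. norm (h1 t) \<le> B" "\<And>t. norm (h2 t) \<le> B"
    and D0: "F 0 - G 0 = 0"
  shows "norm m \<le> B" "norm (F t) \<le> (1/c + 4*T + T) * (1 + c * T) * B" "norm (G t) \<le> (1/c + 4*T + T) * (1 + c * T) * B"
proof -
  have B: "B \<ge> 0" using order_trans[OF norm_ge_zero h(3)] .
  have cF: "continuous_on UNIV F" and cG: "continuous_on UNIV G" by (rule cont_deriv[OF F(1)] cont_deriv[OF G(1)])+
  have S: "((\<lambda>t. F t + G t) has_vector_derivative - \<i> * (h1 t - h2 t) + (- 2 * m)) (at t)" for t
    by (rule has_vector_derivative_eq_rhs[OF has_vector_derivative_add[OF F(1) G(1)]]) (simp add: algebra_simps)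
  have D: "((\<lambda>t. F t - G t) has_vector_derivative (- 2 * \<i> * of_real c) * (F t + G t) + (- \<i>) * (h1 t + h2 t)) (at t)" for t
    by (rule has_vector_derivative_eq_rhs[OF has_vector_derivative_diff[OF F(1) G(1)]]) (simp add: algebra_simps)
  have per0: "F T = F 0" "G T = G 0" using F(2)[of 0] G(2)[of 0] by simp_all
  have "0 = avg T (\<lambda>t. - \<i> * (h1 t - h2 t) + (- 2 * m))"
    by (rule avg_deriv[OF T S, symmetric]) (simp add: per0)
  also have "\<dots> = - \<i> * avg T (\<lambda>t. h1 t - h2 t) - 2 * m"
    by (subst avg_add) (auto intro!: continuous_intros h simp: avg_const[OF T] avg_uminus avg_cmult)
  finally have m: "2 * m = - \<i> * avg T (\<lambda>t. h1 t - h2 t)" by (simp add: algebra_simps)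
  have "norm (avg T (\<lambda>t. h1 t - h2 t)) \<le> 2 * B"
    by (rule avg_bound[OF T]) (smt (verit) h norm_triangle_ineq4)
  then have "norm (2 * m) \<le> 2 * B" unfolding m by (simp add: norm_mult)
  then show mB: "norm m \<le> B" by (simp add: norm_mult)
  have "0 = avg T (\<lambda>t. (- 2 * \<i> * of_real c) * (F t + G t) + (- \<i>) * (h1 t + h2 t))"
    by (rule avg_deriv[OF T D, symmetric]) (simp add: per0)
  also have "\<dots> = (- 2 * \<i> * of_real c) * avg T (\<lambda>t. F t + G t) + (- \<i>) * avg T (\<lambda>t. h1 t + h2 t)"
    by (subst avg_add) (auto intro!: continuous_intros h cF cG simp: avg_cmult avg_uminus)
  finally have "(2 * of_real c) * avg T (\<lambda>t. F t + G t) = - avg T (\<lambda>t. h1 t + h2 t)"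
    by (rule i_solve1)
  then have "norm ((2 * of_real c) * avg T (\<lambda>t. F t + G t)) = norm (avg T (\<lambda>t. h1 t + h2 t))" by simp
  moreover have "norm (avg T (\<lambda>t. h1 t + h2 t)) \<le> 2 * B"
    by (rule avg_bound[OF T]) (smt (verit) h norm_triangle_ineq)
  ultimately have aS: "norm (avg T (\<lambda>t. F t + G t)) \<le> B / c" using c by (simp add: norm_mult field_simps)
  have "norm (F t + G t - avg T (\<lambda>t. F t + G t)) \<le> (4 * B) * T" for t
  proof (rule avg_osc[OF T S])
    fix t
    have "norm (- \<i> * (h1 t - h2 t) + (- 2 * m)) \<le> norm (h1 t - h2 t) + 2 * norm m"
      by (rule order_trans[OF norm_triangle_ineq]) (simp add: norm_mult)
    then show "norm (- \<i> * (h1 t - h2 t) + (- 2 * m)) \<le> 4 * B"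
      using mB h(3)[of t] h(4)[of t] norm_triangle_ineq4[of "h1 t" "h2 t"] by linarith
  qed (simp add: F G)
  then have Sb: "norm (F t + G t) \<le> B / c + 4 * B * T" for t
    using aS norm_triangle_ineq[of "F t + G t - avg T (\<lambda>t. F t + G t)" "avg T (\<lambda>t. F t + G t)"] by (smt (verit) diff_add_cancel)
  have Db: "norm (F t - G t) \<le> (2 * c * (B / c + 4 * B * T) + 2 * B) * T" for t
  proof -
    have "norm ((F t - G t) - (F 0 - G 0)) \<le> (2 * c * (B / c + 4 * B * T) + 2 * B) * T"
    proof (rule periodic_osc[OF T D])
      fix t
      have "norm ((- 2 * \<i> * of_real c) * (F t + G t) + (- \<i>) * (h1 t + h2 t)) \<le> 2 * c * norm (F t + G t) + norm (h1 t + h2 t)"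
        by (rule order_trans[OF norm_triangle_ineq]) (use c in \<open>simp add: norm_mult\<close>)
      also have "\<dots> \<le> 2 * c * (B / c + 4 * B * T) + 2 * B"
        using Sb[of t] h(3)[of t] h(4)[of t] norm_triangle_ineq[of "h1 t" "h2 t"] c by (smt (verit) mult_left_mono mult_nonneg_nonneg)
      finally show "norm ((- 2 * \<i> * of_real c) * (F t + G t) + (- \<i>) * (h1 t + h2 t)) \<le> 2 * c * (B / c + 4 * B * T) + 2 * B" .
    qed (simp add: F G)
    then show ?thesis using D0 by simp
  qed
  have fin: "(B / c + 4 * B * T + (2 * c * (B / c + 4 * B * T) + 2 * B) * T) / 2 \<le> (1/c + 4*T + T) * (1 + c * T) * B"
  proof -
    have "(1/c + 4*T + T) * (1 + c * T) * B - (B / c + 4 * B * T + (2 * c * (B / c + 4 * B * T) + 2 * B) * T) / 2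
      = (B / c + 4 * B * T) / 2 + B * c * T * T"
      using c by (simp add: field_simps)
    moreover have "\<dots> \<ge> 0" using B c T by simp
    ultimately show ?thesis by linarith
  qed
  have "norm (F t) \<le> (norm (F t + G t) + norm (F t - G t)) / 2"
    using norm_triangle_ineq[of "F t + G t" "F t - G t"] by simp
  then show "norm (F t) \<le> (1/c + 4*T + T) * (1 + c * T) * B"
    by (rule order_trans[OF order_trans[OF _ divide_right_mono[OF add_mono[OF Sb[of t] Db[of t]]]] fin]) simp
  have "norm (2 * G t) \<le> norm (F t + G t) + norm (F t - G t)"
    using norm_triangle_ineq4[of "F t + G t" "F t - G t"] by (simp add: algebra_simps)
  then have "norm (G t) \<le> (norm (F t + G t) + norm (F t - G t)) / 2" by (simp add: norm_mult)
  then show "norm (G t) \<le> (1/c + 4*T + T) * (1 + c * T) * B"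
    by (rule order_trans[OF order_trans[OF _ divide_right_mono[OF add_mono[OF Sb[of t] Db[of t]]]] fin]) simp
qed

lemma frac_solve: "W \<noteq> 0 \<Longrightarrow> W\<^sup>2 * x = W * a + b \<Longrightarrow> x = a / W + b / W\<^sup>2" for W x a b :: complex
proof -
  assume W: "W \<noteq> 0" and e: "W\<^sup>2 * x = W * a + b"
  have "x = (W\<^sup>2 * x) / W\<^sup>2" using W by simp
  also have "\<dots> = a / W + b / W\<^sup>2" unfolding e using W by (simp add: add_divide_distrib power2_eq_square)
  finally show ?thesis .
qed

text \<open>The linear system for the Fourier coefficients at frequency \<open>m w\<close>, \<open>m \<noteq> 0\<close>, has determinant \<open>m\<^sup>2 w\<^sup>2\<close>, whatever the twist \<open>c\<close>.\<close>

lemma phase_action_fourier: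
  fixes F G :: "real \<Rightarrow> complex" and m :: int and w :: real
  assumes T: "T > 0" "w * T = 2 * pi" and m: "m \<noteq> 0"
    and F: "\<And>t. (F has_vector_derivative (- \<i> * (of_real c * (F t + G t) + h1 t))) (at t)" "F T = F 0"
    and G: "\<And>t. (G has_vector_derivative (\<i> * (of_real c * (F t + G t) + h2 t))) (at t)" "G T = G 0"
    and h: "continuous_on UNIV h1" "continuous_on UNIV h2"
  defines "ft \<equiv> \<lambda>h. avg T (\<lambda>t. h t * cis (- (of_int m * w) * t))"
  shows "ft F = - ft h1 / of_real (of_int m * w) - of_real c * (ft h2 - ft h1) / (of_real (of_int m * w))\<^sup>2"
    and "ft G = ft h2 / of_real (of_int m * w) + of_real c * (ft h2 - ft h1) / (of_real (of_int m * w))\<^sup>2"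
proof -
  have cF: "continuous_on UNIV F" and cG: "continuous_on UNIV G" by (rule cont_deriv[OF F(1)] cont_deriv[OF G(1)])+
  define W where "W = complex_of_real (of_int m * w)"
  have W: "W \<noteq> 0" using m T by (auto simp: W_def)
  have ftadd: "ft (\<lambda>t. a * (b * (f t + g t) + k t)) = a * (b * (ft f + ft g) + ft k)"
    if "continuous_on UNIV f" "continuous_on UNIV g" "continuous_on UNIV k" for a b f g k
  proof -
    have "ft (\<lambda>t. a * (b * (f t + g t) + k t)) = avg T (\<lambda>t. a * (b * (f t * cis (- (of_int m * w) * t) + g t * cis (- (of_int m * w) * t)) + k t * cis (- (of_int m * w) * t)))"
      unfolding ft_def by (rule arg_cong[of _ _ "avg T"]) (auto simp: algebra_simps)
    also have "\<dots> = a * (b * (ft f + ft g) + ft k)"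
      unfolding ft_def by (rule avg_lin) (intro continuous_on_mult cont_cis that)+
    finally show ?thesis .
  qed
  have e1: "ft (\<lambda>t. - \<i> * (of_real c * (F t + G t) + h1 t)) = \<i> * of_int m * of_real w * ft F"
    unfolding ft_def by (rule avg_fourier_deriv[OF T F]) (intro continuous_intros cF cG h)
  have 1: "W * ft F = - (of_real c * (ft F + ft G) + ft h1)"
  proof -
    from e1[unfolded ftadd[OF cF cG h(1)]] have "\<i> * (- \<i> * (of_real c * (ft F + ft G) + ft h1)) = \<i> * (\<i> * of_int m * of_real w * ft F)" by simp
    then show ?thesis by (simp add: W_def algebra_simps)
  qed
  have e2: "ft (\<lambda>t. \<i> * (of_real c * (F t + G t) + h2 t)) = \<i> * of_int m * of_real w * ft G"
    unfolding ft_def by (rule avg_fourier_deriv[OF T G]) (intro continuous_intros cF cG h)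
  have 2: "W * ft G = of_real c * (ft F + ft G) + ft h2"
  proof -
    from e2[unfolded ftadd[OF cF cG h(2)]] have "of_real c * (ft F + ft G) + ft h2 = of_int m * of_real w * ft G"
      by (simp add: mult.assoc)
    then show ?thesis by (simp add: W_def)
  qed
  have s: "W * (ft F + ft G) = ft h2 - ft h1" using 1 2 by (simp add: distrib_left)
  have F': "W\<^sup>2 * ft F = W * (- ft h1) + (- (of_real c * (ft h2 - ft h1)))"
  proof -
    have "W\<^sup>2 * ft F = W * (W * ft F)" by (simp add: power2_eq_square)
    also have "\<dots> = W * (- ft h1) + (- (of_real c * (W * (ft F + ft G))))" unfolding 1 by (simp add: algebra_simps)
    finally show ?thesis unfolding s .
  qed
  have G': "W\<^sup>2 * ft G = W * ft h2 + of_real c * (ft h2 - ft h1)"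
  proof -
    have "W\<^sup>2 * ft G = W * (W * ft G)" by (simp add: power2_eq_square)
    also have "\<dots> = W * ft h2 + of_real c * (W * (ft F + ft G))" unfolding 2 by (simp add: algebra_simps)
    finally show ?thesis unfolding s .
  qed
  show "ft F = - ft h1 / of_real (of_int m * w) - of_real c * (ft h2 - ft h1) / (of_real (of_int m * w))\<^sup>2"
    using frac_solve[OF W F'] unfolding W_def[symmetric] by simp
  show "ft G = ft h2 / of_real (of_int m * w) + of_real c * (ft h2 - ft h1) / (of_real (of_int m * w))\<^sup>2"
    using frac_solve[OF W G'] unfolding W_def[symmetric] by simp
qed

section \<open>Primitives and linear differential equations on the line\<close>

definition prim :: "(real \<Rightarrow> 'e::banach) \<Rightarrow> real \<Rightarrow> 'e" where
  "prim f t = (if 0 \<le> t then integral {0..t} f else - integral {t..0} f)"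

lemma prim_0 [simp]: "prim f 0 = 0"
  by (simp add: prim_def)

lemma prim_deriv:
  fixes f :: "real \<Rightarrow> 'e::banach"
  assumes f: "continuous_on UNIV f"
  shows "(prim f has_vector_derivative f t) (at t)"
proof -
  define n where "n = \<bar>t\<bar> + 1"
  have int: "f integrable_on {a..b}" for a b
    by (meson continuous_on_subset f integrable_continuous_real subset_UNIV)
  have eq: "integral {-n..s} f - integral {-n..0} f = prim f s" if "s \<in> {-n<..<n}" for s
  proof (cases "0 \<le> s")
    case True
    have "integral {-n..0} f + integral {0..s} f = integral {-n..s} f"
      by (rule Henstock_Kurzweil_Integration.integral_combine) (use that True int in \<open>auto simp: n_def\<close>)
    then show ?thesis using True by (simp add: prim_def algebra_simps)
  next
    case False
    have "integral {-n..s} f + integral {s..0} f = integral {-n..0} f"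
      by (rule Henstock_Kurzweil_Integration.integral_combine) (use that False int in \<open>auto simp: n_def\<close>)
    then show ?thesis using False by (simp add: prim_def algebra_simps)
  qed
  have "((\<lambda>s. integral {-n..s} f) has_vector_derivative f t) (at t within {-n..n})"
    by (rule integral_has_vector_derivative) (use continuous_on_subset[OF f] in \<open>auto simp: n_def\<close>)
  then have "((\<lambda>s. integral {-n..s} f) has_vector_derivative f t) (at t)"
    by (subst (asm) at_within_interior) (auto simp: n_def)
  then have "((\<lambda>s. integral {-n..s} f - integral {-n..0} f) has_vector_derivative f t) (at t)"
    by (auto intro: derivative_eq_intros)
  then show ?thesis
    by (rule has_vector_derivative_transform_within_open[of _ _ _ "{-n<..<n}"])
       (use eq in \<open>auto simp: n_def\<close>)
qed

lemma cont_prim: "continuous_on UNIV f \<Longrightarrow> continuous_on UNIV (prim f)"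
  by (meson continuous_at_imp_continuous_on has_vector_derivative_continuous prim_deriv)

text \<open>Integration gains the factor \<open>1 / (2 L)\<close> in the norm with weight \<open>exp (2 L \<bar>t\<bar>)\<close>.\<close>

lemma prim_exp_bound:
  fixes f :: "real \<Rightarrow> 'e::banach"
  assumes f: "continuous_on UNIV f" and L: "L > 0" and d: "\<And>s. norm (f s) \<le> d * (L * exp (2 * L * \<bar>s\<bar>))"
  shows "norm (prim f t) \<le> d * exp (2 * L * \<bar>t\<bar>) / 2"
proof -
  have d0: "d \<ge> 0" using order_trans[OF norm_ge_zero d[of 0]] L by (simp add: zero_le_mult_iff)
  have cp: "continuous_on A (prim f)" for A using cont_prim[OF f] continuous_on_subset by blast
  consider "t = 0" | "t > 0" | "t < 0" by linarith
  then show ?thesis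
  proof cases
    case 1 then show ?thesis using d0 by simp
  next
    case 2
    have "norm (prim f t - prim f 0) \<le> d * exp (2 * L * t) / 2 - d * exp (2 * L * 0) / 2"
    proof (rule differentiable_bound_general[OF 2, of "prim f" "\<lambda>s. d * exp (2 * L * s) / 2" f "\<lambda>s. d * (L * exp (2 * L * \<bar>s\<bar>))"])
      show "((\<lambda>s. d * exp (2 * L * s) / 2) has_vector_derivative d * (L * exp (2 * L * \<bar>x\<bar>))) (at x)" if "0 < x" for x
        using that unfolding has_real_derivative_iff_has_vector_derivative[symmetric]
        by (auto intro!: derivative_eq_intros)
      show "norm (f x) \<le> d * (L * exp (2 * L * \<bar>x\<bar>))" for x by (rule d)
    qed (auto intro!: continuous_intros cp prim_deriv f)
    then show ?thesis using 2 d0 by simp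
  next
    case 3
    have "norm (prim f 0 - prim f t) \<le> - (d * exp (- (2 * L * 0)) / 2) - (- (d * exp (- (2 * L * t)) / 2))"
    proof (rule differentiable_bound_general[OF 3, of "prim f" "\<lambda>s. - (d * exp (- (2 * L * s)) / 2)" f "\<lambda>s. d * (L * exp (2 * L * \<bar>s\<bar>))"])
      show "((\<lambda>s. - (d * exp (- (2 * L * s)) / 2)) has_vector_derivative d * (L * exp (2 * L * \<bar>x\<bar>))) (at x)" if "x < 0" for x
        using that unfolding has_real_derivative_iff_has_vector_derivative[symmetric]
        by (auto intro!: derivative_eq_intros)
      show "norm (f x) \<le> d * (L * exp (2 * L * \<bar>x\<bar>))" for x by (rule d)
    qed (auto intro!: continuous_intros cp prim_deriv f)
    then show ?thesis using 3 d0 by simp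
  qed
qed

text \<open>The exponential weight makes the Picard map a contraction on the whole line at once.\<close>

lemma linear_ode_exists:
  fixes A :: "real \<Rightarrow> 'e::banach \<Rightarrow> 'e"
  assumes lin: "\<And>t. bounded_linear (A t)" and L: "L > 0" "\<And>t x. norm (A t x) \<le> L * norm x"
    and cont: "\<And>x. continuous_on UNIV x \<Longrightarrow> continuous_on UNIV (\<lambda>t. A t (x t))"
  shows "\<exists>x. x 0 = v \<and> (\<forall>t. (x has_vector_derivative A t (x t)) (at t))"
proof -
  define W where "W = (\<lambda>t. exp (2 * L * \<bar>t\<bar>))"
  have W: "W t \<ge> 1" "W t > 0" for t using L by (auto simp: W_def)
  have cW: "continuous_on UNIV W" unfolding W_def by (intro continuous_intros)
  define P where "P = (\<lambda>y :: real \<Rightarrow>\<^sub>C 'e. \<lambda>t. v + prim (\<lambda>s. A s (W s *\<^sub>R y s)) t)"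
  have ci: "continuous_on UNIV (\<lambda>s. A s (W s *\<^sub>R y s))" for y :: "real \<Rightarrow>\<^sub>C 'e"
    by (intro cont continuous_intros cW) (simp add: continuous_on_apply_bcontfun)
  have Pd: "(P y has_vector_derivative A t (W t *\<^sub>R y t)) (at t)" for y t
    unfolding P_def by (auto intro!: derivative_eq_intros prim_deriv[OF ci])
  have diffb: "norm (P y t - P z t) \<le> norm (y - z) * W t / 2" for y z t
  proof -
    have "P y t - P z t = prim (\<lambda>s. A s (W s *\<^sub>R (y - z) s)) t"
    proof -
      have i: "(\<lambda>s. A s (W s *\<^sub>R y s)) integrable_on {a..b}" for a b and y :: "real \<Rightarrow>\<^sub>C 'e"
        by (rule integrable_continuous_real, rule continuous_on_subset[OF ci]) simp
      have "(\<lambda>s. A s (W s *\<^sub>R (y - z) s)) = (\<lambda>s. A s (W s *\<^sub>R y s) - A s (W s *\<^sub>R z s))"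
        by (auto simp: fun_eq_iff scaleR_diff_right linear_diff[OF bounded_linear.linear[OF lin]])
      then show ?thesis by (simp add: P_def prim_def Henstock_Kurzweil_Integration.integral_diff i)
    qed
    also have "norm \<dots> \<le> norm (y - z) * W t / 2"
      unfolding W_def
    proof (rule prim_exp_bound[OF ci[of "y - z", unfolded W_def] L(1)])
      fix s
      have "norm (A s (exp (2 * L * \<bar>s\<bar>) *\<^sub>R (y - z) s)) \<le> L * (exp (2 * L * \<bar>s\<bar>) * norm ((y - z) s))"
        using L(2)[of s "exp (2 * L * \<bar>s\<bar>) *\<^sub>R (y - z) s"] by simp
      also have "\<dots> \<le> L * (exp (2 * L * \<bar>s\<bar>) * norm (y - z))"
        using L by (intro mult_left_mono norm_bounded) auto
      finally show "norm (A s (exp (2 * L * \<bar>s\<bar>) *\<^sub>R (y - z) s)) \<le> norm (y - z) * (L * exp (2 * L * \<bar>s\<bar>))"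
        by (simp add: mult_ac)
    qed
    finally show ?thesis .
  qed
  define G where "G = (\<lambda>y. Bcontfun (\<lambda>t. (1 / W t) *\<^sub>R P y t))"
  have bc: "(\<lambda>t. (1 / W t) *\<^sub>R P y t) \<in> bcontfun" for y
  proof (rule bcontfun_normI)
    show "continuous_on UNIV (\<lambda>t. (1 / W t) *\<^sub>R P y t)"
      using W(2) by (intro continuous_intros cW continuous_at_imp_continuous_on ballI has_vector_derivative_continuous[OF Pd])
        (metis less_irrefl)
    fix t
    have "P 0 t = v" by (simp add: P_def prim_def linear_0[OF bounded_linear.linear[OF lin]])
    then have "norm (P y t) \<le> norm v + norm y * W t / 2"
      using diffb[of y t 0] norm_triangle_ineq[of "P y t - P 0 t" "P 0 t"] by simp
    then have "norm (P y t) / W t \<le> (norm v + norm y * W t / 2) / W t" using W(2)[of t] by (simp add: divide_right_mono)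
    also have "\<dots> = norm v / W t + norm y / 2" using W(2)[of t] by (simp add: field_simps)
    also have "\<dots> \<le> norm v + norm y / 2" using W[of t] by (simp add: divide_le_eq mult_left_le mult_le_cancel_left1)
    finally show "norm ((1 / W t) *\<^sub>R P y t) \<le> norm v + norm y / 2" using W(2)[of t] by simp
  qed
  have Gapp: "apply_bcontfun (G y) t = (1 / W t) *\<^sub>R P y t" for y t
    unfolding G_def using bc[of y] by (simp add: Bcontfun_inverse)
  have "\<exists>!y. G y = y"
  proof (rule banach_fix_type[of "1/2"])
    show "\<forall>x y. dist (G x) (G y) \<le> 1/2 * dist x y"
    proof (intro allI)
      fix x y
      have "norm (G x - G y) \<le> norm (x - y) / 2"
      proof (rule norm_bound)
        fix t
        have "(G x - G y) t = (1 / W t) *\<^sub>R (P x t - P y t)" by (simp add: Gapp scaleR_diff_right)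
        then have "norm ((G x - G y) t) = (1 / W t) * norm (P x t - P y t)" using W(2)[of t] by simp
        also have "\<dots> \<le> (1 / W t) * (norm (x - y) * W t / 2)"
          using W(2)[of t] by (intro mult_left_mono diffb) simp
        finally have "norm ((G x - G y) t) \<le> (1 / W t) * (norm (x - y) * W t / 2)" .
        then show "norm ((G x - G y) t) \<le> norm (x - y) / 2" using W(2)[of t] by (simp add: pos_divide_le_eq[OF W(2)] mult_ac)
      qed
      then show "dist (G x) (G y) \<le> 1/2 * dist x y" by (simp add: dist_norm)
    qed
  qed auto
  then obtain y where y: "G y = y" by blast
  have x: "P y t = W t *\<^sub>R y t" for t using Gapp[of y t] W(2)[of t] y by simp
  show ?thesis
  proof (intro exI[of _ "P y"] conjI allI)
    show "P y 0 = v" by (simp add: P_def)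
    show "(P y has_vector_derivative A t (P y t)) (at t)" for t using Pd[of y t] unfolding x .
  qed
qed

section \<open>The lattice vector field\<close>

type_synonym 'a chain = "'a mod_ring \<Rightarrow> real \<Rightarrow> complex"

lemma sum_shift: "(\<Sum>j\<in>UNIV. f (j + 1)) = (\<Sum>j\<in>UNIV. f j)" for f :: "'a::nontriv mod_ring \<Rightarrow> 'b::comm_monoid_add"
  by (rule sum.reindex_bij_witness[of _ "\<lambda>j. j - 1" "\<lambda>j. j + 1"]) auto

lemma sum_axis: "(\<Sum>k\<in>UNIV. a k \<bullet> (axis j c $ k)) = a j \<bullet> c" for a :: "'k::finite \<Rightarrow> complex"
proof -
  have "(\<Sum>k\<in>UNIV. a k \<bullet> (axis j c $ k)) = (\<Sum>k\<in>UNIV. if k = j then a j \<bullet> c else 0)"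
    by (rule sum.cong) (auto simp: axis_def)
  then show ?thesis by simp
qed

lemma nth_deriv: "((\<lambda>x. x $ j) has_derivative (\<lambda>h. h $ j)) (at x)" for x :: "complex ^ 'k"
  by (rule bounded_linear.has_derivative[OF bounded_linear_vec_nth has_derivative_ident])

lemma energy_deriv:
  fixes \<psi> :: "complex ^ ('a::nontriv) mod_ring"
  shows "(dnls_energy \<epsilon> has_derivative (\<lambda>h. (\<Sum>j\<in>UNIV. (2 * (1 + (cmod (\<psi> $ j))\<^sup>2)) * (\<psi> $ j \<bullet> h $ j)) +
     \<epsilon> * (\<Sum>j\<in>UNIV. 2 * ((\<psi> $ (j + 1) - \<psi> $ j) \<bullet> (h $ (j + 1) - h $ j))))) (at \<psi>)"
proof -
  have E: "dnls_energy \<epsilon> = (\<lambda>\<psi> :: complex ^ 'a mod_ring. (\<Sum>j\<in>UNIV. \<psi> $ j \<bullet> \<psi> $ j) + 1/2 * (\<Sum>j\<in>UNIV. (\<psi> $ j \<bullet> \<psi> $ j) * (\<psi> $ j \<bullet> \<psi> $ j))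
     + \<epsilon> * (\<Sum>j\<in>UNIV. (\<psi> $ (j + 1) - \<psi> $ j) \<bullet> (\<psi> $ (j + 1) - \<psi> $ j)))"
    by (simp add: fun_eq_iff dnls_energy_def power2_norm_eq_inner[symmetric] power4_eq_xxxx power2_eq_square mult.assoc)
  show ?thesis unfolding E
    by (rule has_derivative_eq_rhs, (rule derivative_intros nth_deriv)+)
       (simp add: fun_eq_iff power2_norm_eq_inner inner_commute sum.distrib[symmetric] sum_distrib_left algebra_simps)
qed

lemma energy_deriv_axis:
  fixes \<psi> :: "complex ^ ('a::nontriv) mod_ring"
  shows "frechet_derivative (dnls_energy \<epsilon>) (at \<psi>) (axis j c) =
    2 * ((of_real (1 + (cmod (\<psi> $ j))\<^sup>2) * \<psi> $ j + of_real \<epsilon> * (2 * \<psi> $ j - \<psi> $ (j + 1) - \<psi> $ (j - 1))) \<bullet> c)"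
proof -
  let ?h = "axis j c :: complex ^ 'a mod_ring"
  have 1: "(\<Sum>k\<in>UNIV. (2 * (1 + (cmod (\<psi> $ k))\<^sup>2)) * (\<psi> $ k \<bullet> ?h $ k)) = 2 * (1 + (cmod (\<psi> $ j))\<^sup>2) * (\<psi> $ j \<bullet> c)"
    using sum_axis[of "\<lambda>k. (2 * (1 + (cmod (\<psi> $ k))\<^sup>2)) *\<^sub>R \<psi> $ k" j c] by simp
  have "(\<Sum>k\<in>UNIV. 2 * ((\<psi> $ (k + 1) - \<psi> $ k) \<bullet> (?h $ (k + 1) - ?h $ k)))
    = (\<Sum>k\<in>UNIV. (2 *\<^sub>R (\<psi> $ (k + 1) - \<psi> $ (k + 1 - 1))) \<bullet> ?h $ (k + 1)) - (\<Sum>k\<in>UNIV. (2 *\<^sub>R (\<psi> $ (k + 1) - \<psi> $ k)) \<bullet> ?h $ k)"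
    by (simp add: sum_subtractf[symmetric] inner_diff_right algebra_simps)
  also have "\<dots> = (2 *\<^sub>R (\<psi> $ j - \<psi> $ (j - 1))) \<bullet> c - (2 *\<^sub>R (\<psi> $ (j + 1) - \<psi> $ j)) \<bullet> c"
    by (subst sum_shift[of "\<lambda>k. (2 *\<^sub>R (\<psi> $ k - \<psi> $ (k - 1))) \<bullet> ?h $ k"]) (simp only: sum_axis)
  finally have 2: "(\<Sum>k\<in>UNIV. 2 * ((\<psi> $ (k + 1) - \<psi> $ k) \<bullet> (?h $ (k + 1) - ?h $ k)))
    = 2 * ((2 * \<psi> $ j - \<psi> $ (j + 1) - \<psi> $ (j - 1)) \<bullet> c)"
    by (simp add: inner_complex_def algebra_simps)
  show ?thesis unfolding frechet_derivative_at[OF energy_deriv, symmetric] 1 2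
    by (simp add: inner_complex_def algebra_simps)
qed

lemma dnls_field_nth:
  fixes \<psi> :: "complex ^ ('a::nontriv) mod_ring"
  shows "dnls_field \<epsilon> \<psi> $ j = - \<i> * ((1 + 2 * of_real \<epsilon>) * \<psi> $ j + (\<psi> $ j)\<^sup>2 * cnj (\<psi> $ j)
     - of_real \<epsilon> * (\<psi> $ (j + 1) + \<psi> $ (j - 1)))"
proof -
  have e: "(of_real (2 * (z \<bullet> 1)) + \<i> * of_real (2 * (z \<bullet> \<i>))) / 2 = z" for z
    by (simp add: inner_complex_def complex_eq_iff)
  have "dnls_field \<epsilon> \<psi> $ j = - \<i> * (of_real (1 + (cmod (\<psi> $ j))\<^sup>2) * \<psi> $ j + of_real \<epsilon> * (2 * \<psi> $ j - \<psi> $ (j + 1) - \<psi> $ (j - 1)))"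
    unfolding hamiltonian_field_def wirtinger_cnj_def energy_deriv_axis by (simp only: vec_lambda_beta e)
  then have "dnls_field \<epsilon> \<psi> $ j = - \<i> * ((1 + \<psi> $ j * cnj (\<psi> $ j)) * \<psi> $ j + of_real \<epsilon> * (2 * \<psi> $ j - \<psi> $ (j + 1) - \<psi> $ (j - 1)))"
    by (simp only: of_real_add of_real_1 complex_norm_square)
  then show ?thesis by (simp add: algebra_simps power2_eq_square)
qed

lemma chi_deriv:
  fixes f :: "'b::real_normed_vector \<Rightarrow> 'k::finite \<Rightarrow> complex"
  assumes "\<And>j. ((\<lambda>x. f x j) has_derivative f' j) F"
  shows "((\<lambda>x. \<chi> j. f x j) has_derivative (\<lambda>h. \<chi> j. f' j h)) F"
proof -
  have e: "(\<chi> j. g j) = (\<Sum>j\<in>UNIV. axis j (g j))" for g :: "'k \<Rightarrow> complex"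
    by (simp add: vec_eq_iff axis_def)
  have bl: "bounded_linear (axis j :: complex \<Rightarrow> complex ^ 'k)" for j
    by (rule linear_conv_bounded_linear[THEN iffD1]) (auto intro!: linearI simp: vec_eq_iff axis_def)
  show ?thesis unfolding e
    by (intro has_derivative_sum bounded_linear.has_derivative[OF bl] assms)
qed

lemma chi_vderiv:
  fixes f :: "real \<Rightarrow> 'k::finite \<Rightarrow> complex"
  assumes "\<And>j. ((\<lambda>x. f x j) has_vector_derivative f' j) F"
  shows "((\<lambda>x. \<chi> j. f x j) has_vector_derivative (\<chi> j. f' j)) F"
  using chi_deriv[of f "\<lambda>j h. h *\<^sub>R f' j" F] assms unfolding has_vector_derivative_def
  by (simp add: scaleR_vec_def)

lemma nth_vderiv: "(f has_vector_derivative f') F \<Longrightarrow> ((\<lambda>t. f t $ j) has_vector_derivative f' $ j) F" for f' :: "complex ^ 'k"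
  by (rule bounded_linear.has_vector_derivative[OF bounded_linear_vec_nth])

text \<open>The linearised field is only real linear in \<open>w\<close>, because of the term with \<open>cnj (w $ j)\<close>.\<close>

definition lin_field :: "real \<Rightarrow> complex ^ 'a mod_ring \<Rightarrow> complex ^ 'a mod_ring \<Rightarrow> complex ^ ('a::nontriv) mod_ring" where
  "lin_field \<epsilon> \<psi> w = (\<chi> j. - \<i> * ((1 + 2 * of_real \<epsilon> + 2 * \<psi> $ j * cnj (\<psi> $ j)) * w $ j + (\<psi> $ j)\<^sup>2 * cnj (w $ j)
     - of_real \<epsilon> * (w $ (j + 1) + w $ (j - 1))))"

lemma field_deriv: "frechet_derivative (dnls_field \<epsilon>) (at \<psi>) = lin_field \<epsilon> \<psi>" for \<psi> :: "complex ^ ('a::nontriv) mod_ring"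
proof -
  have X: "dnls_field \<epsilon> = (\<lambda>\<psi> :: complex ^ 'a mod_ring. \<chi> j. - \<i> * ((1 + 2 * of_real \<epsilon>) * \<psi> $ j + (\<psi> $ j)\<^sup>2 * cnj (\<psi> $ j)
     - of_real \<epsilon> * (\<psi> $ (j + 1) + \<psi> $ (j - 1))))"
    by (auto simp: fun_eq_iff vec_eq_iff dnls_field_nth)
  have "(dnls_field \<epsilon> has_derivative lin_field \<epsilon> \<psi>) (at \<psi>)" unfolding X lin_field_def power2_eq_square
    by (rule chi_deriv, rule has_derivative_eq_rhs, (rule derivative_intros nth_deriv has_derivative_cnj)+)
       (simp add: fun_eq_iff algebra_simps)
  then show ?thesis by (rule frechet_derivative_at[symmetric])
qed

lemma inner_vderiv:
  fixes x :: "real \<Rightarrow> 'e::real_inner"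
  assumes "(x has_vector_derivative D) (at s)"
  shows "((\<lambda>s. x s \<bullet> x s) has_real_derivative 2 * (x s \<bullet> D)) (at s)"
proof -
  have "((\<lambda>s. x s \<bullet> x s) has_derivative (\<lambda>h. x s \<bullet> (h *\<^sub>R D) + (h *\<^sub>R D) \<bullet> x s)) (at s)"
    by (rule has_derivative_inner) (use assms in \<open>simp_all add: has_vector_derivative_def\<close>)
  also have "(\<lambda>h. x s \<bullet> (h *\<^sub>R D) + (h *\<^sub>R D) \<bullet> x s) = (*) (2 * (x s \<bullet> D))"
    by (auto simp: fun_eq_iff inner_commute)
  finally show ?thesis unfolding has_field_derivative_def .
qed

lemma norm_triangle3: "norm (a + b - c) \<le> norm a + norm b + norm c" for a b c :: "'e::real_normed_vector"
  using norm_triangle_ineq4[of "a + b" c] norm_triangle_ineq[of a b] by linarith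

lemma gronwall_zero:
  fixes x :: "real \<Rightarrow> 'e::real_inner"
  assumes x: "\<And>t. (x has_vector_derivative D t) (at t)" and L: "\<And>t. norm (D t) \<le> L * norm (x t)" and 0: "x 0 = 0"
  shows "x t = 0"
proof -
  have *: "x t = 0" if t: "t \<ge> 0" and x: "\<And>t. (x has_vector_derivative D t) (at t)" and L: "\<And>t. norm (D t) \<le> L * norm (x t)" and 0: "x 0 = 0"
    for x D :: "real \<Rightarrow> 'e" and t
  proof -
    let ?f = "\<lambda>s. exp (- 2 * L * s) * (x s \<bullet> x s)"
    have "?f t \<le> ?f 0"
    proof (rule DERIV_nonpos_imp_nonincreasing[OF t])
      fix s
      have "x s \<bullet> D s \<le> norm (x s) * (L * norm (x s))"
        using norm_cauchy_schwarz[of "x s" "D s"] L[of s] by (meson mult_left_mono norm_ge_zero order_trans)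
      then have le: "2 * (x s \<bullet> D s) - 2 * L * (x s \<bullet> x s) \<le> 0"
        by (simp add: power2_norm_eq_inner[symmetric] power2_eq_square mult_ac)
      have "(?f has_real_derivative (exp (- 2 * L * s) * (2 * (x s \<bullet> D s) - 2 * L * (x s \<bullet> x s)))) (at s)"
        by (rule DERIV_cong[OF DERIV_mult[OF _ inner_vderiv[OF x]]])
           (auto intro!: derivative_eq_intros simp: algebra_simps)
      then show "\<exists>y. (?f has_real_derivative y) (at s) \<and> y \<le> 0"
        using le by (intro exI conjI) (auto simp: mult_nonneg_nonpos)
    qed
    then have "exp (- 2 * L * t) * (x t \<bullet> x t) \<le> 0" using 0 by simp
    then show ?thesis using inner_ge_zero[of "x t"] by (simp add: mult_le_0_iff not_le[symmetric] del: inner_ge_zero)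
  qed
  show ?thesis
  proof (cases "t \<ge> 0")
    case True then show ?thesis using *[OF True x L 0] by blast
  next
    case False
    have r: "((\<lambda>t. x (- t)) has_vector_derivative - D (- t)) (at t)" for t
      using vector_diff_chain_at[of uminus "-1" t x "D (-t)"] x[of "-t"]
      by (simp add: o_def has_vector_derivative_minus has_vector_derivative_id)
    have "x (- (- t)) = 0" by (rule *[of "- t" "\<lambda>t. x (- t)" "\<lambda>t. - D (- t)"]) (use False L 0 r in auto)
    then show ?thesis by simp
  qed
qed

text \<open>Gauge invariance.  The bound it gives on solutions makes the cubic field effectively Lipschitz, which yields uniqueness of solutions and of
  solutions of the linearised equation.\<close>

lemma norm_conserved:
  fixes \<gamma> :: "real \<Rightarrow> complex ^ ('a::nontriv) mod_ring"
  assumes s: "solution_of (dnls_field \<epsilon>) \<gamma>"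
  shows "norm (\<gamma> t) = norm (\<gamma> 0)"
proof -
  have orth: "\<psi> \<bullet> dnls_field \<epsilon> \<psi> = 0" for \<psi> :: "complex ^ 'a mod_ring"
  proof -
    define B where "B = (\<lambda>z w :: complex. \<epsilon> * (z \<bullet> (\<i> * w)))"
    have "\<psi> $ j \<bullet> dnls_field \<epsilon> \<psi> $ j = B (\<psi> $ j) (\<psi> $ (j + 1)) + B (\<psi> $ j) (\<psi> $ (j - 1))" for j
      unfolding dnls_field_nth B_def by (simp add: inner_complex_def power2_eq_square algebra_simps)
    then have "\<psi> \<bullet> dnls_field \<epsilon> \<psi> = (\<Sum>j\<in>UNIV. B (\<psi> $ j) (\<psi> $ (j + 1))) + (\<Sum>j\<in>UNIV. B (\<psi> $ j) (\<psi> $ (j - 1)))"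
      by (simp add: inner_vec_def sum.distrib)
    also have "(\<Sum>j\<in>UNIV. B (\<psi> $ j) (\<psi> $ (j - 1))) = (\<Sum>j\<in>UNIV. B (\<psi> $ (j + 1)) (\<psi> $ j))"
      by (subst sum_shift[symmetric]) simp
    also have "(\<Sum>j\<in>UNIV. B (\<psi> $ j) (\<psi> $ (j + 1))) + \<dots> = 0"
      by (simp add: sum.distrib[symmetric] B_def inner_complex_def algebra_simps)
    finally show ?thesis .
  qed
  have d: "((\<lambda>t. \<gamma> t \<bullet> \<gamma> t) has_real_derivative 0) (at t)" for t
    using inner_vderiv[of \<gamma> "dnls_field \<epsilon> (\<gamma> t)" t] s orth[of "\<gamma> t"] by (simp add: solution_of_def)
  have "\<gamma> t \<bullet> \<gamma> t = \<gamma> 0 \<bullet> \<gamma> 0" by (rule DERIV_isconst_all[OF allI[OF d]])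
  then show ?thesis by (simp add: norm_eq_sqrt_inner)
qed

lemma vec_norm_le:
  fixes x :: "complex ^ 'k::finite"
  assumes "\<And>j. norm (x $ j) \<le> B" shows "norm x \<le> real CARD('k) * B"
proof -
  have "norm x \<le> (\<Sum>j\<in>UNIV. norm (x $ j))" unfolding norm_vec_def by (rule L2_set_le_sum) auto
  also have "\<dots> \<le> (\<Sum>j\<in>(UNIV :: 'k set). B)" by (rule sum_mono) (use assms in auto)
  finally show ?thesis by simp
qed

lemma cubic_diff: "norm (a\<^sup>2 * cnj a - b\<^sup>2 * cnj b) \<le> 3 * R\<^sup>2 * norm (a - b)" if "norm a \<le> R" "norm b \<le> R" for a b :: complex
proof -
  have R: "0 \<le> R" using that(1) norm_ge_zero order_trans by blast
  have "a\<^sup>2 * cnj a - b\<^sup>2 * cnj b = a\<^sup>2 * cnj (a - b) + (a - b) * ((a + b) * cnj b)"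
    by (simp add: algebra_simps power2_eq_square)
  also have "norm \<dots> \<le> norm a ^ 2 * norm (a - b) + norm (a - b) * (norm (a + b) * norm b)"
    by (rule order_trans[OF norm_triangle_ineq])
       (simp add: norm_mult norm_power complex_mod_cnj del: complex_cnj_diff)
  also have "\<dots> \<le> R ^ 2 * norm (a - b) + norm (a - b) * ((R + R) * R)"
    using that R norm_triangle_ineq[of a b] by (intro add_mono mult_right_mono mult_left_mono mult_mono power_mono) auto
  finally show ?thesis by (simp add: power2_eq_square algebra_simps)
qed

lemma solution_unique:
  fixes \<gamma> \<eta> :: "real \<Rightarrow> complex ^ ('a::nontriv) mod_ring"
  assumes s: "solution_of (dnls_field \<epsilon>) \<gamma>" "solution_of (dnls_field \<epsilon>) \<eta>" and 0: "\<gamma> 0 = \<eta> 0"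
  shows "\<gamma> = \<eta>"
proof -
  define R where "R = norm (\<gamma> 0)"
  have b: "norm (\<gamma> t $ j) \<le> R" "norm (\<eta> t $ j) \<le> R" for t j
    using Finite_Cartesian_Product.norm_nth_le[of "\<gamma> t" j] Finite_Cartesian_Product.norm_nth_le[of "\<eta> t" j]
      norm_conserved[OF s(1), of t] norm_conserved[OF s(2), of t] 0 by (auto simp: R_def)
  define L where "L = 1 + 2 * \<bar>\<epsilon>\<bar> + 3 * R\<^sup>2 + \<bar>\<epsilon>\<bar> * 2"
  have "\<gamma> t - \<eta> t = 0" for t
  proof (rule gronwall_zero[of "\<lambda>t. \<gamma> t - \<eta> t"])
    show "((\<lambda>t. \<gamma> t - \<eta> t) has_vector_derivative dnls_field \<epsilon> (\<gamma> t) - dnls_field \<epsilon> (\<eta> t)) (at t)" for t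
      using s unfolding solution_of_def by (auto intro: has_vector_derivative_diff)
    show "norm (dnls_field \<epsilon> (\<gamma> t) - dnls_field \<epsilon> (\<eta> t)) \<le> (real CARD('a mod_ring) * L) * norm (\<gamma> t - \<eta> t)" for t
    proof (rule order_trans[OF vec_norm_le[of _ "L * norm (\<gamma> t - \<eta> t)"]])
      fix j
      let ?d = "\<lambda>j. \<gamma> t $ j - \<eta> t $ j" and ?n = "norm (\<gamma> t - \<eta> t)"
      have n: "norm (?d j) \<le> ?n" for j
        using Finite_Cartesian_Product.norm_nth_le[of "\<gamma> t - \<eta> t" j] by simp
      have "(dnls_field \<epsilon> (\<gamma> t) - dnls_field \<epsilon> (\<eta> t)) $ j = - \<i> * ((1 + 2 * of_real \<epsilon>) * ?d j + ((\<gamma> t $ j)\<^sup>2 * cnj (\<gamma> t $ j) - (\<eta> t $ j)\<^sup>2 * cnj (\<eta> t $ j))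
        - of_real \<epsilon> * (?d (j + 1) + ?d (j - 1)))"
        by (simp add: dnls_field_nth algebra_simps)
      then have "norm ((dnls_field \<epsilon> (\<gamma> t) - dnls_field \<epsilon> (\<eta> t)) $ j) = norm ((1 + 2 * of_real \<epsilon>) * ?d j + ((\<gamma> t $ j)\<^sup>2 * cnj (\<gamma> t $ j) - (\<eta> t $ j)\<^sup>2 * cnj (\<eta> t $ j))
        - of_real \<epsilon> * (?d (j + 1) + ?d (j - 1)))" by (simp only: norm_mult) simp
      also have "\<dots> \<le> norm ((1 + 2 * of_real \<epsilon>) * ?d j) + norm ((\<gamma> t $ j)\<^sup>2 * cnj (\<gamma> t $ j) - (\<eta> t $ j)\<^sup>2 * cnj (\<eta> t $ j)) + norm (of_real \<epsilon> * (?d (j + 1) + ?d (j - 1)))"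
        by (rule norm_triangle3)
      also have "\<dots> \<le> (1 + 2 * \<bar>\<epsilon>\<bar>) * ?n + 3 * R\<^sup>2 * ?n + \<bar>\<epsilon>\<bar> * (?n + ?n)"
      proof (intro add_mono)
        have "norm (1 + 2 * complex_of_real \<epsilon>) \<le> 1 + 2 * \<bar>\<epsilon>\<bar>"
          by (rule order_trans[OF norm_triangle_ineq]) (simp add: norm_mult)
        then show "norm ((1 + 2 * of_real \<epsilon>) * ?d j) \<le> (1 + 2 * \<bar>\<epsilon>\<bar>) * ?n" unfolding norm_mult using n by (intro mult_mono) auto
        show "norm ((\<gamma> t $ j)\<^sup>2 * cnj (\<gamma> t $ j) - (\<eta> t $ j)\<^sup>2 * cnj (\<eta> t $ j)) \<le> 3 * R\<^sup>2 * ?n"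
          using cubic_diff[OF b(1)[of t j] b(2)[of t j]] n[of j] by (smt (verit) mult_left_mono zero_le_power2)
        have "norm (?d (j + 1) + ?d (j - 1)) \<le> ?n + ?n" by (rule norm_triangle_mono[OF n n])
        then show "norm (of_real \<epsilon> * (?d (j + 1) + ?d (j - 1))) \<le> \<bar>\<epsilon>\<bar> * (?n + ?n)" unfolding norm_mult by (simp add: mult_left_mono)
      qed
      finally show "norm ((dnls_field \<epsilon> (\<gamma> t) - dnls_field \<epsilon> (\<eta> t)) $ j) \<le> L * ?n" by (simp add: L_def algebra_simps)
    qed simp
  qed (use 0 in simp)
  then show ?thesis by (auto simp: fun_eq_iff)
qed

section \<open>Periodic solutions of nonresonant and of twist oscillators\<close>

text \<open>An a priori bound \<open>M0\<close>, however large, improves itself to \<open>2 B\<close>.\<close>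

lemma halving:
  fixes h :: "'x \<Rightarrow> real"
  assumes bd: "\<And>x. h x \<le> M0" and step: "\<And>M. (\<And>x. h x \<le> M) \<Longrightarrow> (\<And>x. h x \<le> B + M / 2)"
  shows "h x \<le> 2 * B"
proof -
  let ?S = "Sup (range h)"
  have bdd: "bdd_above (range h)" by (rule bdd_aboveI2[where M = M0]) (rule bd)
  have up: "h y \<le> ?S" for y by (rule cSup_upper) (use bdd in auto)
  have "?S \<le> B + ?S / 2" by (rule cSup_least) (use step[OF up] in auto)
  then show ?thesis using up[of x] by linarith
qed

lemma shift_vderiv: "(\<And>t. (f has_vector_derivative D t) (at t)) \<Longrightarrow> ((\<lambda>t. f (t + a)) has_vector_derivative D (t + a)) (at t)"
proof -
  assume f: "\<And>t. (f has_vector_derivative D t) (at t)"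
  have "((\<lambda>t. t + a) has_vector_derivative 1) (at t)"
    by (auto intro!: derivative_eq_intros)
  from vector_diff_chain_at[OF this f] show ?thesis by (simp add: o_def)
qed

lemma prim_periodic:
  fixes f :: "real \<Rightarrow> 'e::euclidean_space"
  assumes f: "continuous_on UNIV f" and per: "\<And>t. f (t + T) = f t" and 0: "prim f T = 0"
  shows "prim f (t + T) = prim f t"
proof -
  have d: "((\<lambda>t. prim f (t + T) - prim f t) has_vector_derivative 0) (at t)" for t
  proof -
    have "((\<lambda>t. prim f (t + T)) has_vector_derivative f (t + T)) (at t)"
      by (rule shift_vderiv[OF prim_deriv[OF f]])
    from has_vector_derivative_diff[OF this prim_deriv[OF f]] show ?thesis by (simp add: per)
  qed
  have "prim f (t + T) - prim f t - 0 = 0"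
    using gronwall_zero[of "\<lambda>t. prim f (t + T) - prim f t" "\<lambda>_. 0" 0 t] d 0 by simp
  then show ?thesis by simp
qed

lemma flip_vderiv: "(\<And>t. (f has_vector_derivative D t) (at t)) \<Longrightarrow> ((\<lambda>t. f (- t)) has_vector_derivative - D (- t)) (at t)"
proof -
  assume f: "\<And>t. (f has_vector_derivative D t) (at t)"
  have "(uminus has_vector_derivative (- 1 :: real)) (at t)"
    by (auto intro!: derivative_eq_intros)
  from vector_diff_chain_at[OF this f] show ?thesis by (simp add: o_def)
qed

lemma cnj_vderiv: "(f has_vector_derivative D) F \<Longrightarrow> ((\<lambda>t. cnj (f t)) has_vector_derivative cnj D) F"
  by (rule bounded_linear.has_vector_derivative[OF bounded_linear_cnj])

lemma rotation_solution:
  assumes T: "T > 0" "cis T \<noteq> 1" and h: "continuous_on UNIV h" "\<And>t. h (t + T) = h t"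
  shows "\<exists>u. (\<forall>t. u (t + T) = u t) \<and> (\<forall>t. (u has_vector_derivative - \<i> * (u t + h t)) (at t))"
proof -
  define P where "P = prim (\<lambda>s. - \<i> * cis s * h s)"
  have ch: "continuous_on UNIV (\<lambda>s. - \<i> * cis s * h s)" using cont_cis[of 1] by (intro continuous_intros h)
  define x0 where "x0 = cis (- T) * P T / (1 - cis (- T))"
  define u where "u = (\<lambda>t. cis (- t) * (x0 + P t))"
  have u: "(u has_vector_derivative - \<i> * (u t + h t)) (at t)" for t
  proof -
    have "((\<lambda>t. x0 + P t) has_vector_derivative - \<i> * cis t * h t) (at t)"
      unfolding P_def by (rule has_vector_derivative_eq_rhs[OF has_vector_derivative_add[OF has_vector_derivative_const prim_deriv[OF ch]]]) simp
    from has_vector_derivative_mult[OF cis_vderiv[of "-1" t, simplified] this]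
    show ?thesis unfolding u_def
      by (rule has_vector_derivative_eq_rhs) (simp_all add: algebra_simps cis_mult)
  qed
  have ne: "1 - cis (- T) \<noteq> 0" using T(2) by (simp add: cis_cnj[symmetric] complex_eq_iff)
  have "u (t + T) - u t = 0" for t
  proof (rule gronwall_zero[of "\<lambda>t. u (t + T) - u t" _ 1])
    show "((\<lambda>t. u (t + T) - u t) has_vector_derivative - \<i> * (u (t + T) - u t)) (at t)" for t
      by (rule has_vector_derivative_eq_rhs[OF has_vector_derivative_diff[OF shift_vderiv[OF u] u]]) (unfold h, simp add: algebra_simps)
    have "cis (- T) * (x0 + P T) = x0" using ne by (simp add: x0_def field_simps)
    then show "u (0 + T) - u 0 = 0" by (simp add: u_def P_def)
  qed (simp add: norm_mult)
  then show ?thesis using u by (intro exI[of _ u]) auto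
qed

lemma twist_solution:
  assumes T: "T > 0" and c: "c > 0" and h: "continuous_on UNIV h" "\<And>t. h (t + T) = h t"
  shows "\<exists>u m. (\<forall>t. u (t + T) = u t) \<and> Im (u 0) = 0 \<and>
    (\<forall>t. (u has_vector_derivative - \<i> * (of_real c * (u t + cnj (u t)) + h t) - of_real m) (at t))"
proof -
  define m where "m = prim (\<lambda>s. Im (h s)) T / T"
  define X where "X = prim (\<lambda>s. Im (h s) - m)"
  have c1: "continuous_on UNIV (\<lambda>s. Im (h s) - m)" by (intro continuous_intros h)
  have c0: "continuous_on UNIV (\<lambda>s. Im (h s))" by (intro continuous_intros h)
  have int: "g integrable_on {0..T}" if "continuous_on UNIV g" for g :: "real \<Rightarrow> real"
    by (rule integrable_continuous_real, rule continuous_on_subset[OF that]) simp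
  have "integral {0..T} (\<lambda>s. Im (h s) - m) = integral {0..T} (\<lambda>s. Im (h s)) - integral {0..T} (\<lambda>s. m)"
    by (rule Henstock_Kurzweil_Integration.integral_diff[OF int[OF c0] int]) (intro continuous_intros)
  then have "X T = integral {0..T} (\<lambda>s. Im (h s)) - integral {0..T} (\<lambda>s. m)" unfolding X_def using T
    by (simp only: prim_def) simp
  then have "X T = 0" using T by (simp add: m_def prim_def)
  then have Xp: "X (t + T) = X t" for t unfolding X_def by (intro prim_periodic c1) (simp_all add: h)
  have cX: "continuous_on UNIV X" unfolding X_def by (rule cont_prim[OF c1])
  define \<kappa> where "\<kappa> = - (prim (\<lambda>s. 2 * c * X s + Re (h s)) T / T) / (2 * c)"
  define Y where "Y = prim (\<lambda>s. - (2 * c * X s + Re (h s)) - 2 * c * \<kappa>)"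
  have c2: "continuous_on UNIV (\<lambda>s. 2 * c * X s + Re (h s))" by (intro continuous_intros h cX)
  have c3: "continuous_on UNIV (\<lambda>s. - (2 * c * X s + Re (h s)) - 2 * c * \<kappa>)" by (intro continuous_intros h cX)
  have "integral {0..T} (\<lambda>s. - (2 * c * X s + Re (h s)) - 2 * c * \<kappa>) = integral {0..T} (\<lambda>s. - (2 * c * X s + Re (h s))) - integral {0..T} (\<lambda>s. 2 * c * \<kappa>)"
    by (rule Henstock_Kurzweil_Integration.integral_diff[OF int int]) (intro continuous_intros h cX)+
  also have "integral {0..T} (\<lambda>s. - (2 * c * X s + Re (h s))) = - integral {0..T} (\<lambda>s. 2 * c * X s + Re (h s))"
    by (rule Henstock_Kurzweil_Integration.integral_neg)
  finally have "Y T = - integral {0..T} (\<lambda>s. 2 * c * X s + Re (h s)) - integral {0..T} (\<lambda>s. 2 * c * \<kappa>)" unfolding Y_def using T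
    by (simp only: prim_def) simp
  then have "Y T = 0" using T c by (simp add: \<kappa>_def prim_def)
  then have Yp: "Y (t + T) = Y t" for t unfolding Y_def by (intro prim_periodic c3) (simp_all add: h Xp)
  define u where "u = (\<lambda>t. complex_of_real (X t + \<kappa>) + \<i> * complex_of_real (Y t))"
  have "(u has_vector_derivative - \<i> * (of_real c * (u t + cnj (u t)) + h t) - of_real m) (at t)" for t
  proof -
    have X': "((\<lambda>t. complex_of_real (X t + \<kappa>)) has_vector_derivative complex_of_real (Im (h t) - m)) (at t)"
      by (rule bounded_linear.has_vector_derivative[OF bounded_linear_of_real])
         (auto simp: X_def intro!: derivative_eq_intros prim_deriv[OF c1])
    have Y': "((\<lambda>t. \<i> * complex_of_real (Y t)) has_vector_derivative \<i> * complex_of_real (- (2 * c * X t + Re (h t)) - 2 * c * \<kappa>)) (at t)"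
      by (rule has_vector_derivative_mult_right, rule bounded_linear.has_vector_derivative[OF bounded_linear_of_real])
         (unfold Y_def, rule prim_deriv[OF c3])
    show ?thesis unfolding u_def
      by (rule has_vector_derivative_eq_rhs[OF has_vector_derivative_add[OF X' Y']])
         (simp add: complex_eq_iff algebra_simps)
  qed
  moreover have "u (t + T) = u t" for t by (simp add: u_def Xp Yp)
  moreover have "Im (u 0) = 0" by (simp add: u_def Y_def)
  ultimately show ?thesis by blast
qed

text \<open>Periodic solutions of the decoupled forced problem.  Sites with \<open>c j = 0\<close> rotate with frequency 1; at the others \<open>c j\<close> is the
  twist, the phase at time 0 is prescribed, and the constant \<open>m j\<close> compensates the mean of the force on the phase, which no periodic solution can absorb.\<close>

definition slv :: "real \<Rightarrow> ('k::finite \<Rightarrow> real) \<Rightarrow> (real \<Rightarrow> complex ^ 'k) \<Rightarrow> (real \<Rightarrow> complex ^ 'k) \<Rightarrow> ('k \<Rightarrow> real) \<Rightarrow> bool" where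
  "slv T c h u m \<longleftrightarrow> (\<forall>t. u (t + T) = u t) \<and>
    (\<forall>j. if c j = 0 then m j = 0 \<and> (\<forall>t. ((\<lambda>t. u t $ j) has_vector_derivative - \<i> * (u t $ j + h t $ j)) (at t))
     else Im (u 0 $ j) = 0 \<and>
       (\<forall>t. ((\<lambda>t. u t $ j) has_vector_derivative - \<i> * (of_real (c j) * (u t $ j + cnj (u t $ j)) + h t $ j) - of_real (m j)) (at t)))"

lemma slv_exists:
  fixes c :: "'k::finite \<Rightarrow> real"
  assumes T: "T > 0" "cis T \<noteq> 1" and c: "\<And>j. c j \<ge> 0" and h: "continuous_on UNIV h" "\<And>t. h (t + T) = h t"
  shows "\<exists>u m. slv T c h u m"
proof -
  have ch: "continuous_on UNIV (\<lambda>t. h t $ j)" for j by (intro continuous_intros h)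
  have "\<exists>u m. (\<forall>t. u (t + T) = u t) \<and> (if c j = 0 then m = 0 \<and> (\<forall>t. (u has_vector_derivative - \<i> * (u t + h t $ j)) (at t))
     else Im (u 0) = 0 \<and> (\<forall>t. (u has_vector_derivative - \<i> * (of_real (c j) * (u t + cnj (u t)) + h t $ j) - of_real m) (at t)))" for j
  proof (cases "c j = 0")
    case True
    from rotation_solution[OF T ch[of j]] h(2) show ?thesis using True by (auto intro!: exI[of _ "0::real"])
  next
    case False
    then have "c j > 0" using c[of j] by simp
    from twist_solution[OF T(1) this ch[of j]] h(2) show ?thesis using False by simp
  qed
  then obtain u m where "\<And>j. (\<forall>t. u j (t + T) = u j t) \<and> (if c j = 0 then m j = 0 \<and> (\<forall>t. (u j has_vector_derivative - \<i> * (u j t + h t $ j)) (at t))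
     else Im (u j 0) = 0 \<and> (\<forall>t. (u j has_vector_derivative - \<i> * (of_real (c j) * (u j t + cnj (u j t)) + h t $ j) - of_real (m j)) (at t)))"
    by metis
  note U = this
  have "slv T c h (\<lambda>t. \<chi> j. u j t) m" unfolding slv_def
  proof (intro conjI allI)
    show "(\<chi> j. u j (t + T)) = (\<chi> j. u j t)" for t using U by (simp add: vec_eq_iff)
    fix j
    show "if c j = 0 then m j = 0 \<and> (\<forall>t. ((\<lambda>t. (\<chi> j. u j t) $ j) has_vector_derivative - \<i> * ((\<chi> j. u j t) $ j + h t $ j)) (at t))
     else Im ((\<chi> j. u j 0) $ j) = 0 \<and>
       (\<forall>t. ((\<lambda>t. (\<chi> j. u j t) $ j) has_vector_derivative - \<i> * (of_real (c j) * ((\<chi> j. u j t) $ j + cnj ((\<chi> j. u j t) $ j)) + h t $ j) - of_real (m j)) (at t))"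
      using U[of j] unfolding vec_lambda_beta by blast
  qed
  then show ?thesis by blast
qed

lemma slv_diff:
  assumes "slv T c h u m" "slv T c h' u' m'"
  shows "slv T c (\<lambda>t. h t - h' t) (\<lambda>t. u t - u' t) (\<lambda>j. m j - m' j)"
  unfolding slv_def
proof (intro conjI allI)
  show "u (t + T) - u' (t + T) = u t - u' t" for t using assms by (simp add: slv_def)
  fix j
  show "if c j = 0 then m j - m' j = 0 \<and> (\<forall>t. ((\<lambda>t. (u t - u' t) $ j) has_vector_derivative - \<i> * ((u t - u' t) $ j + (h t - h' t) $ j)) (at t))
     else Im ((u 0 - u' 0) $ j) = 0 \<and>
       (\<forall>t. ((\<lambda>t. (u t - u' t) $ j) has_vector_derivative - \<i> * (of_real (c j) * ((u t - u' t) $ j + cnj ((u t - u' t) $ j)) + (h t - h' t) $ j) - of_real (m j - m' j)) (at t))"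
  proof (cases "c j = 0")
    case True
    then have "((\<lambda>t. u t $ j) has_vector_derivative - \<i> * (u t $ j + h t $ j)) (at t)"
      "((\<lambda>t. u' t $ j) has_vector_derivative - \<i> * (u' t $ j + h' t $ j)) (at t)" "m j = 0" "m' j = 0" for t
      using assms unfolding slv_def by presburger+
    note has_vector_derivative_diff[OF this(1,2)] this(3,4)
    then show ?thesis using True by (simp add: algebra_simps)
  next
    case False
    then have "((\<lambda>t. u t $ j) has_vector_derivative - \<i> * (of_real (c j) * (u t $ j + cnj (u t $ j)) + h t $ j) - of_real (m j)) (at t)"
      "((\<lambda>t. u' t $ j) has_vector_derivative - \<i> * (of_real (c j) * (u' t $ j + cnj (u' t $ j)) + h' t $ j) - of_real (m' j)) (at t)"
      "Im (u 0 $ j) = 0" "Im (u' 0 $ j) = 0" for t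
      using assms unfolding slv_def by presburger+
    note has_vector_derivative_diff[OF this(1,2)] this(3,4)
    then show ?thesis using False by (simp add: algebra_simps)
  qed
qed

lemma slv_cont: "slv T c h u m \<Longrightarrow> continuous_on UNIV u"
proof -
  assume s: "slv T c h u m"
  have "continuous_on UNIV (\<lambda>t. u t $ j)" for j
  proof (cases "c j = 0")
    case True
    then have "((\<lambda>t. u t $ j) has_vector_derivative - \<i> * (u t $ j + h t $ j)) (at t)" for t
      using s unfolding slv_def by presburger
    then show ?thesis by (rule cont_deriv)
  next
    case False
    then have "((\<lambda>t. u t $ j) has_vector_derivative - \<i> * (of_real (c j) * (u t $ j + cnj (u t $ j)) + h t $ j) - of_real (m j)) (at t)" for t
      using s unfolding slv_def by presburger
    then show ?thesis by (rule cont_deriv)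
  qed
  then have "continuous_on UNIV (\<lambda>t. \<chi> j. u t $ j)" by (rule continuous_on_vec_lambda)
  then show ?thesis by simp
qed

definition slv_const :: "real \<Rightarrow> ('k::finite \<Rightarrow> real) \<Rightarrow> real" where
  "slv_const T c = real CARD('k) * (T / cmod (1 - cis T) + (\<Sum>j\<in>UNIV. (1 / c j + 4 * T + T) * (1 + c j * T)))"

lemma slv_bound:
  fixes c :: "'k::finite \<Rightarrow> real"
  assumes T: "T > 0" "cis T \<noteq> 1" and c: "\<And>j. c j \<ge> 0" and s: "slv T c h u m"
    and h: "continuous_on UNIV h" "\<And>t. norm (h t) \<le> B"
  shows "norm (u t) \<le> slv_const T c * B" "\<bar>m j\<bar> \<le> B"
proof -
  have B: "B \<ge> 0" using order_trans[OF norm_ge_zero h(2)] .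
  have per: "u (t + T) = u t" for t using s by (simp add: slv_def)
  have ch: "continuous_on UNIV (\<lambda>t. h t $ j)" for j by (intro continuous_intros h)
  have hb: "norm (h t $ j) \<le> B" for t j using Finite_Cartesian_Product.norm_nth_le[of "h t" j] h(2)[of t] by linarith
  define K where "K = T / cmod (1 - cis T) + (\<Sum>j\<in>UNIV. (1 / c j + 4 * T + T) * (1 + c j * T))"
  have K1: "T / cmod (1 - cis T) \<le> K" unfolding K_def using T c by (simp add: sum_nonneg)
  have K2: "(1 / c j + 4 * T + T) * (1 + c j * T) \<le> K" for j
  proof -
    have "(1 / c j + 4 * T + T) * (1 + c j * T) \<le> (\<Sum>j\<in>UNIV. (1 / c j + 4 * T + T) * (1 + c j * T))"
      by (rule member_le_sum) (use T c in auto)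
    then show ?thesis unfolding K_def using T by (simp add: add_increasing)
  qed
  have *: "norm (u t $ j) \<le> K * B \<and> \<bar>m j\<bar> \<le> B" for j t
  proof (cases "c j = 0")
    case True
    then have d: "((\<lambda>t. u t $ j) has_vector_derivative - \<i> * (u t $ j + h t $ j)) (at t)" and m: "m j = 0" for t
      using s unfolding slv_def by presburger+
    have "norm (1 - exp (\<i> * of_real T)) * norm (u t $ j) \<le> B * T"
      by (rule periodic_linear_bound[OF T(1), where h = "\<lambda>t. - \<i> * h t $ j" and x = "\<lambda>t. u t $ j"])
         (use d per hb in \<open>auto simp: algebra_simps norm_mult\<close>)
    then have "norm (u t $ j) \<le> T / cmod (1 - cis T) * B"
      using T(2) by (simp add: cis_conv_exp field_simps)
    also have "\<dots> \<le> K * B" using K1 B by (rule mult_right_mono)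
    finally show ?thesis using m B by simp
  next
    case False
    then have d: "((\<lambda>t. u t $ j) has_vector_derivative - \<i> * (of_real (c j) * (u t $ j + cnj (u t $ j)) + h t $ j) - of_real (m j)) (at t)"
      and i: "Im (u 0 $ j) = 0" for t
      using s unfolding slv_def by presburger+
    have d2: "((\<lambda>t. cnj (u t $ j)) has_vector_derivative \<i> * (of_real (c j) * (u t $ j + cnj (u t $ j)) + cnj (h t $ j)) - of_real (m j)) (at t)" for t
      by (rule has_vector_derivative_eq_rhs[OF cnj_vderiv[OF d]]) (simp add: algebra_simps)
    have cj: "c j > 0" using False c[of j] by simp
    have cc: "continuous_on UNIV (\<lambda>t. cnj (h t $ j))" by (intro continuous_intros h)
    have "norm (u t $ j) \<le> (1 / c j + 4 * T + T) * (1 + c j * T) * B"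
      by (rule phase_action_bound(2)[OF T(1) cj d _ d2 _ ch cc]) (use per hb i in \<open>auto simp: complex_eq_iff\<close>)
    moreover have "norm (complex_of_real (m j)) \<le> B"
      by (rule phase_action_bound(1)[OF T(1) cj d _ d2 _ ch cc]) (use per hb i in \<open>auto simp: complex_eq_iff\<close>)
    moreover have "(1 / c j + 4 * T + T) * (1 + c j * T) * B \<le> K * B" by (rule mult_right_mono[OF K2 B])
    ultimately show ?thesis by simp
  qed
  then show "\<bar>m j\<bar> \<le> B" by blast
  show "norm (u t) \<le> slv_const T c * B"
    using vec_norm_le[of "u t" "K * B"] * by (simp add: slv_const_def K_def mult.assoc)
qed

lemma slv_const_nonneg: "T > 0 \<Longrightarrow> (\<And>j. c j \<ge> 0) \<Longrightarrow> slv_const T c \<ge> 0"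
  unfolding slv_const_def by (intro mult_nonneg_nonneg add_nonneg_nonneg sum_nonneg divide_nonneg_nonneg) auto

text \<open>Uniqueness and continuous dependence in one: \<open>\<delta> = 0\<close> gives uniqueness.\<close>

lemma slv_perturb:
  fixes c :: "'k::finite \<Rightarrow> real"
  assumes T: "T > 0" "cis T \<noteq> 1" and c: "\<And>j. c j \<ge> 0"
    and s: "slv T c (\<lambda>t. n t (u t)) u m" "slv T c (\<lambda>t. n' t (u' t)) u' m'"
    and cont: "\<And>u. continuous_on UNIV u \<Longrightarrow> continuous_on UNIV (\<lambda>t. n t (u t))" "\<And>u. continuous_on UNIV u \<Longrightarrow> continuous_on UNIV (\<lambda>t. n' t (u t))"
    and R: "\<And>t. norm (u t) \<le> R" "\<And>t. norm (u' t) \<le> R"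
    and lip: "\<And>t x y. norm x \<le> R \<Longrightarrow> norm y \<le> R \<Longrightarrow> norm (n t x - n t y) \<le> q * norm (x - y)" "q \<ge> 0" "slv_const T c * q \<le> 1/2"
    and d: "\<And>t x. norm x \<le> R \<Longrightarrow> norm (n t x - n' t x) \<le> \<delta>"
  shows "norm (u t - u' t) \<le> 2 * (slv_const T c * \<delta>)" "\<bar>m j - m' j\<bar> \<le> q * (2 * (slv_const T c * \<delta>)) + \<delta>"
proof -
  note cu = slv_cont[OF s(1)] slv_cont[OF s(2)]
  have ch: "continuous_on UNIV (\<lambda>t. n t (u t) - n' t (u' t))" by (intro continuous_intros cont cu)
  have hb: "norm (n t (u t) - n' t (u' t)) \<le> q * M + \<delta>" if "\<And>t. norm (u t - u' t) \<le> M" for M t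
  proof -
    have "norm (n t (u t) - n' t (u' t)) \<le> norm (n t (u t) - n t (u' t)) + norm (n t (u' t) - n' t (u' t))"
      using norm_triangle_ineq[of "n t (u t) - n t (u' t)" "n t (u' t) - n' t (u' t)"] by simp
    also have "\<dots> \<le> q * norm (u t - u' t) + \<delta>" by (intro add_mono lip d R)
    also have "\<dots> \<le> q * M + \<delta>" using that[of t] lip(2) by (simp add: mult_left_mono)
    finally show ?thesis .
  qed
  have step: "norm (u t - u' t) \<le> slv_const T c * \<delta> + M / 2" if "\<And>t. norm (u t - u' t) \<le> M" for M t
  proof -
    have M: "M \<ge> 0" using order_trans[OF norm_ge_zero that] .
    have "norm (u t - u' t) \<le> slv_const T c * (q * M + \<delta>)"
      by (rule slv_bound(1)[OF T c slv_diff[OF s] ch hb]) (rule that)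
    also have "\<dots> = slv_const T c * \<delta> + slv_const T c * q * M" by (simp add: algebra_simps)
    also have "\<dots> \<le> slv_const T c * \<delta> + 1/2 * M" using lip(3) M by (intro add_left_mono mult_right_mono)
    finally show ?thesis by simp
  qed
  have bd: "norm (u t - u' t) \<le> R + R" for t by (rule order_trans[OF norm_triangle_ineq4 add_mono[OF R]])
  show U: "norm (u t - u' t) \<le> 2 * (slv_const T c * \<delta>)" for t
    by (rule halving[of "\<lambda>t. norm (u t - u' t)", OF bd step])
  show "\<bar>m j - m' j\<bar> \<le> q * (2 * (slv_const T c * \<delta>)) + \<delta>"
    by (rule slv_bound(2)[OF T c slv_diff[OF s] ch hb[OF U]])
qed

text \<open>Banach's theorem for \<open>f \<mapsto> g\<close>, where \<open>g\<close> solves the decoupled problem forced by \<open>n t (f t)\<close>, on the periodic functions of norm at most \<open>R\<close>.\<close>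

lemma slv_fixpoint:
  fixes c :: "'k::finite \<Rightarrow> real"
  assumes T: "T > 0" "cis T \<noteq> 1" and c: "\<And>j. c j \<ge> 0"
    and cont: "\<And>u. continuous_on UNIV u \<Longrightarrow> continuous_on UNIV (\<lambda>t. n t (u t))"
    and per: "\<And>t x. n (t + T) x = n t x"
    and lip: "\<And>t x y. norm x \<le> R \<Longrightarrow> norm y \<le> R \<Longrightarrow> norm (n t x - n t y) \<le> q * norm (x - y)" "q \<ge> 0" "slv_const T c * q \<le> 1/2"
    and B: "\<And>t. norm (n t 0) \<le> B" "2 * slv_const T c * B \<le> R"
  shows "\<exists>u m. slv T c (\<lambda>t. n t (u t)) u m \<and> (\<forall>t. norm (u t) \<le> R)"
proof -
  let ?K = "slv_const T c"
  have K: "?K \<ge> 0" by (rule slv_const_nonneg[OF T(1) c])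
  have B0: "B \<ge> 0" using order_trans[OF norm_ge_zero B(1)] .
  have R: "R \<ge> 0" using B0 K B(2) by (smt (verit) mult_nonneg_nonneg)
  define S where "S = {f :: real \<Rightarrow>\<^sub>C (complex ^ 'k). (\<forall>t. f (t + T) = f t) \<and> (\<forall>t. f t \<in> cball 0 R)}"
  have clS: "closed S"
  proof -
    have ce: "continuous_on UNIV (\<lambda>f :: real \<Rightarrow>\<^sub>C (complex ^ 'k). apply_bcontfun f s)" for s
      unfolding continuous_on_iff using dist_fun_lt_imp_dist_val_lt by blast
    have "S = (\<Inter>t. {f :: real \<Rightarrow>\<^sub>C (complex ^ 'k). f (t + T) = f t}) \<inter> (\<Inter>t. {f :: real \<Rightarrow>\<^sub>C (complex ^ 'k). norm (f t) \<le> R})"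
      by (auto simp: S_def)
    moreover have "closed {f :: real \<Rightarrow>\<^sub>C (complex ^ 'k). f (t + T) = f t}" for t
      by (intro closed_Collect_eq ce)
    moreover have "closed {f :: real \<Rightarrow>\<^sub>C (complex ^ 'k). norm (f t) \<le> R}" for t
      by (intro closed_Collect_le continuous_on_norm ce continuous_on_const)
    ultimately show ?thesis by (auto intro!: closed_INT closed_Int)
  qed
  have Sne: "0 \<in> S" using R by (simp add: S_def)
  define ok where "ok = (\<lambda>f g :: real \<Rightarrow>\<^sub>C (complex ^ 'k). \<exists>m. slv T c (\<lambda>t. n t (f t)) g m)"
  have cn: "continuous_on UNIV (\<lambda>t. n t (apply_bcontfun f t))" for f :: "real \<Rightarrow>\<^sub>C (complex ^ 'k)"
    by (intro cont) (simp add: continuous_on_apply_bcontfun)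
  have nb: "norm (n t x) \<le> q * norm x + B" if "norm x \<le> R" for t x
    using lip(1)[OF that, of 0 t] R B(1)[of t] norm_triangle_ineq[of "n t x - n t 0" "n t 0"] by simp
  have ex: "\<exists>g\<in>S. ok f g" if f: "f \<in> S" for f
  proof -
    have "\<exists>u m. slv T c (\<lambda>t. n t (f t)) u m"
      by (rule slv_exists[OF T c cn]) (use f per in \<open>auto simp: S_def\<close>)
    then obtain u m where um: "slv T c (\<lambda>t. n t (f t)) u m" by blast
    have ub: "norm (u t) \<le> R" for t
    proof -
      have "norm (n t (f t)) \<le> q * R + B" for t
        using nb[of "f t" t] f lip(2) mult_left_mono[of "norm (f t)" R q] unfolding S_def by auto
      from slv_bound(1)[OF T c um cn this]
      have "norm (u t) \<le> ?K * (q * R + B)" .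
      also have "\<dots> = ?K * q * R + ?K * B" by (simp add: algebra_simps)
      also have "\<dots> \<le> 1/2 * R + R / 2" using lip(3) B(2) R by (intro add_mono mult_right_mono) auto
      finally show ?thesis by simp
    qed
    have ub': "u \<in> bcontfun" by (rule bcontfun_normI[OF slv_cont[OF um] ub])
    have "Bcontfun u \<in> S" using ub' ub um by (auto simp: S_def Bcontfun_inverse slv_def)
    moreover have "ok f (Bcontfun u)" using um ub' by (auto simp: ok_def Bcontfun_inverse)
    ultimately show ?thesis by blast
  qed
  define G where "G = (\<lambda>f :: real \<Rightarrow>\<^sub>C (complex ^ 'k). SOME g. g \<in> S \<and> ok f g)"
  have G: "G f \<in> S \<and> ok f (G f)" if "f \<in> S" for f
    unfolding G_def by (rule someI_ex) (use ex[OF that] in blast)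
  have "\<exists>!f\<in>S. G f = f"
  proof (rule Banach_fix[of S "1/2" G])
    show "complete S" using clS by (simp add: complete_eq_closed)
    show "S \<noteq> {}" using Sne by blast
    show "G ` S \<subseteq> S" using G by blast
    show "dist (G f) (G g) \<le> 1/2 * dist f g" if fg: "f \<in> S" "g \<in> S" for f g
    proof -
      obtain m m' where s: "slv T c (\<lambda>t. n t (f t)) (G f) m" "slv T c (\<lambda>t. n t (g t)) (G g) m'"
        using G[OF fg(1)] G[OF fg(2)] by (auto simp: ok_def)
      have b: "norm (n t (f t) - n t (g t)) \<le> q * norm (f - g)" for t
      proof -
        have "norm (n t (f t) - n t (g t)) \<le> q * norm (f t - g t)" by (rule lip(1)) (use fg in \<open>auto simp: S_def\<close>)
        also have "\<dots> \<le> q * norm (f - g)" using lip(2) norm_bounded[of "f - g" t] by (simp add: mult_left_mono)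
        finally show ?thesis .
      qed
      have cd: "continuous_on UNIV (\<lambda>t. n t (f t) - n t (g t))" by (intro continuous_on_diff cn)
      have "norm (G f - G g) \<le> ?K * (q * norm (f - g))"
        by (rule norm_bound) (use slv_bound(1)[OF T c slv_diff[OF s] cd b] in simp)
      also have "\<dots> = ?K * q * norm (f - g)" by simp
      also have "\<dots> \<le> 1/2 * norm (f - g)" using lip(3) by (intro mult_right_mono) auto
      finally show ?thesis by (simp add: dist_norm)
    qed
  qed auto
  then obtain f where "f \<in> S" "G f = f" by blast
  then show ?thesis using G[of f] by (auto simp: ok_def S_def)
qed

text \<open>Time reversal composed with conjugation changes the sign of the force \<open>m\<close>.\<close>

lemma slv_reverse:
  assumes "slv T c h u m"
  shows "slv T c (\<lambda>t. \<chi> j. cnj (h (- t) $ j)) (\<lambda>t. \<chi> j. cnj (u (- t) $ j)) (\<lambda>j. - m j)"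
  unfolding slv_def vec_lambda_beta
proof (intro conjI allI)
  fix t
  have "u (- (t + T)) = u (- (t + T) + T)" using assms unfolding slv_def by metis
  then show "(\<chi> j. cnj (u (- (t + T)) $ j)) = (\<chi> j. cnj (u (- t) $ j))" by simp
next
  fix j
  show "if c j = 0 then - m j = 0 \<and> (\<forall>t. ((\<lambda>t. cnj (u (- t) $ j)) has_vector_derivative - \<i> * (cnj (u (- t) $ j) + cnj (h (- t) $ j))) (at t))
     else Im (cnj (u (- 0) $ j)) = 0 \<and>
       (\<forall>t. ((\<lambda>t. cnj (u (- t) $ j)) has_vector_derivative - \<i> * (of_real (c j) * (cnj (u (- t) $ j) + cnj (cnj (u (- t) $ j))) + cnj (h (- t) $ j)) - of_real (- m j)) (at t))"
  proof (cases "c j = 0")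
    case True
    then have d: "((\<lambda>t. u t $ j) has_vector_derivative - \<i> * (u t $ j + h t $ j)) (at t)" "m j = 0" for t
      using assms unfolding slv_def by presburger+
    have "((\<lambda>t. cnj (u (- t) $ j)) has_vector_derivative - \<i> * (cnj (u (- t) $ j) + cnj (h (- t) $ j))) (at t)" for t
      by (rule has_vector_derivative_eq_rhs[OF cnj_vderiv[OF flip_vderiv[OF d(1)]]]) (simp add: algebra_simps)
    then show ?thesis using True d(2) by simp
  next
    case False
    then have d: "((\<lambda>t. u t $ j) has_vector_derivative - \<i> * (of_real (c j) * (u t $ j + cnj (u t $ j)) + h t $ j) - of_real (m j)) (at t)" "Im (u 0 $ j) = 0" for t
      using assms unfolding slv_def by presburger+
    have "((\<lambda>t. cnj (u (- t) $ j)) has_vector_derivative - \<i> * (of_real (c j) * (cnj (u (- t) $ j) + cnj (cnj (u (- t) $ j))) + cnj (h (- t) $ j)) - of_real (- m j)) (at t)" for t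
      by (rule has_vector_derivative_eq_rhs[OF cnj_vderiv[OF flip_vderiv[OF d(1)]]]) (simp add: algebra_simps)
    then show ?thesis using False d(2) by simp
  qed
qed

lemma slv_permute:
  assumes "slv T c h u m" and p: "\<And>j. c (p j) = c j"
  shows "slv T c (\<lambda>t. \<chi> j. h t $ p j) (\<lambda>t. \<chi> j. u t $ p j) (\<lambda>j. m (p j))"
  unfolding slv_def vec_lambda_beta
proof (intro conjI allI)
  show "(\<chi> j. u (t + T) $ p j) = (\<chi> j. u t $ p j)" for t using assms(1) by (simp add: slv_def)
  fix j
  show "if c j = 0 then m (p j) = 0 \<and> (\<forall>t. ((\<lambda>t. u t $ p j) has_vector_derivative - \<i> * (u t $ p j + h t $ p j)) (at t))
     else Im (u 0 $ p j) = 0 \<and>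
       (\<forall>t. ((\<lambda>t. u t $ p j) has_vector_derivative - \<i> * (of_real (c j) * (u t $ p j + cnj (u t $ p j)) + h t $ p j) - of_real (m (p j))) (at t))"
    using assms(1) p[of j] unfolding slv_def by metis
qed

lemma slv_uminus: "slv T c h u m \<Longrightarrow> slv T c (\<lambda>t. - h t) (\<lambda>t. - u t) (\<lambda>j. - m j)"
proof -
  assume "slv T c h u m"
  moreover have "slv T c (\<lambda>_. 0) (\<lambda>_. 0) (\<lambda>_. 0)" by (simp add: slv_def)
  ultimately show ?thesis using slv_diff[of T c "\<lambda>_. 0" "\<lambda>_. 0" "\<lambda>_. 0" h u m] by (simp only: diff_0)
qed

section \<open>The periodic orbits\<close>

lemma of_nat_mod_ring_eq_0: "of_nat n = (0 :: 'a::nontriv mod_ring) \<longleftrightarrow> CARD('a) dvd n"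
proof -
  have "of_nat n = (0 :: 'a mod_ring) \<longleftrightarrow> int n mod int CARD('a) = 0" by transfer simp
  then show ?thesis by (metis dvd_eq_mod_eq_0 int_dvd_int_iff)
qed

text \<open>The frequency of site \<open>j\<close> is \<open>k j * \<omega>\<close>, and \<open>s = cos q\<close> distinguishes the two tori.  More than four sites are
  required so that \<open>-2, -1, 0, 1, 2\<close> are distinct.\<close>

locale resonant_chain =
  fixes I \<omega> T s :: real and r :: "'a::nontriv mod_ring \<Rightarrow> real" and k :: "'a mod_ring \<Rightarrow> int"
  assumes I: "I > 0" and \<omega>: "\<omega> = 1 + I" and T: "T = 2 * pi / \<omega>"
    and nonres: "cis T \<noteq> 1" "cis (2 * T) \<noteq> 1" and s: "s = 1 \<or> s = -1"
    and r: "r = (\<lambda>j. if j = 0 then sqrt (1 + 2 * I) else if j = 1 then s * sqrt I else if j = -1 then sqrt I else 0)"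
    and k: "k = (\<lambda>j. if j = 0 then 2 else if j = 1 \<or> j = -1 then 1 else 0)"
    and card: "CARD('a) > 4"
begin

lemma \<omega>_pos: "\<omega> > 0" and T_pos: "T > 0" and \<omega>T: "\<omega> * T = 2 * pi"
  using I by (auto simp: \<omega> T)

lemma numerals_neq_0: "(2 :: 'a mod_ring) \<noteq> 0" "(3 :: 'a mod_ring) \<noteq> 0" "(4 :: 'a mod_ring) \<noteq> 0"
proof -
  have "\<not> CARD('a) dvd n" if "0 < n" "n < 5" for n using card that by (auto dest: dvd_imp_le)
  then show "(2 :: 'a mod_ring) \<noteq> 0" "(3 :: 'a mod_ring) \<noteq> 0" "(4 :: 'a mod_ring) \<noteq> 0"
    using of_nat_mod_ring_eq_0[of 2, where 'a = 'a] of_nat_mod_ring_eq_0[of 3, where 'a = 'a] of_nat_mod_ring_eq_0[of 4, where 'a = 'a]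
    by auto
qed

lemma sites_distinct [simp]:
  "(1 :: 'a mod_ring) \<noteq> -1" "(-1 :: 'a mod_ring) \<noteq> 1" "(-1 :: 'a mod_ring) \<noteq> 0" "(0 :: 'a mod_ring) \<noteq> -1"
  "(2 :: 'a mod_ring) \<noteq> 0" "(2 :: 'a mod_ring) \<noteq> 1" "(2 :: 'a mod_ring) \<noteq> -1"
  "(-2 :: 'a mod_ring) \<noteq> 0" "(-2 :: 'a mod_ring) \<noteq> 1" "(-2 :: 'a mod_ring) \<noteq> -1"
  "(2 :: 'a mod_ring) \<noteq> -2" "(-2 :: 'a mod_ring) \<noteq> 2" "(-1 :: 'a mod_ring) \<noteq> 2" "(1 :: 'a mod_ring) \<noteq> 2"
  "(1 :: 'a mod_ring) \<noteq> -2" "(-1 :: 'a mod_ring) \<noteq> -2" "(0 :: 'a mod_ring) \<noteq> 2" "(0 :: 'a mod_ring) \<noteq> -2"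
proof -
  have e: "a = b \<Longrightarrow> a - b = 0" for a b :: "'a mod_ring" by simp
  have n: "(1 :: 'a mod_ring) + 1 = 2" "(2 :: 'a mod_ring) + 1 = 3" "(2 :: 'a mod_ring) + 2 = 4" by simp_all
  show "(1 :: 'a mod_ring) \<noteq> -1" using e[of 1 "-1"] numerals_neq_0 n by auto
  then show "(-1 :: 'a mod_ring) \<noteq> 1" by metis
  show "(-1 :: 'a mod_ring) \<noteq> 0" "(0 :: 'a mod_ring) \<noteq> -1" by simp_all
  show a: "(2 :: 'a mod_ring) \<noteq> 0" by (rule numerals_neq_0)
  show b: "(2 :: 'a mod_ring) \<noteq> 1"
  proof
    assume "(2 :: 'a mod_ring) = 1"
    then have "(2 :: 'a mod_ring) - 1 = 0" by (rule e)
    moreover have "(2 :: 'a mod_ring) - 1 = 1" by simp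
    ultimately show False by simp
  qed
  show c: "(2 :: 'a mod_ring) \<noteq> -1" using e[of 2 "-1"] numerals_neq_0 n by auto
  show "(-2 :: 'a mod_ring) \<noteq> 0" using a by simp
  show "(-2 :: 'a mod_ring) \<noteq> 1" using c by (metis minus_minus)
  show "(-2 :: 'a mod_ring) \<noteq> -1" using b by (metis minus_minus)
  show d: "(2 :: 'a mod_ring) \<noteq> -2" using e[of 2 "-2"] numerals_neq_0 n by auto
  show "(-2 :: 'a mod_ring) \<noteq> 2" "(-1 :: 'a mod_ring) \<noteq> 2" "(1 :: 'a mod_ring) \<noteq> 2" "(1 :: 'a mod_ring) \<noteq> -2"
    "(-1 :: 'a mod_ring) \<noteq> -2" "(0 :: 'a mod_ring) \<noteq> 2" "(0 :: 'a mod_ring) \<noteq> -2"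
    using a b c d by (metis minus_minus neg_equal_0_iff_equal)+
qed

lemma r_eqs [simp]: "r 0 = sqrt (1 + 2 * I)" "r 1 = s * sqrt I" "r (-1) = sqrt I" "r 2 = 0" "r (-2) = 0"
  and k_eqs [simp]: "k 0 = 2" "k 1 = 1" "k (-1) = 1" "k 2 = 0" "k (-2) = 0"
  by (simp_all add: r k)

lemma r_sq: "j \<in> {-1, 0, 1} \<Longrightarrow> (r j)\<^sup>2 = of_int (k j) * \<omega> - 1" "j \<in> {-1, 0, 1} \<Longrightarrow> (r j)\<^sup>2 > 0" "j \<notin> {-1, 0, 1} \<Longrightarrow> r j = 0"
  "j \<notin> {-1, 0, 1} \<Longrightarrow> k j = 0"
  using I s by (auto simp: r k \<omega> power_mult_distrib)

lemma r_eq_0_iff: "r j = 0 \<longleftrightarrow> j \<notin> {-1, 0, 1}"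
  using r_sq[of j] by (metis less_irrefl power_zero_numeral)

lemma r_bound: "\<bar>r j\<bar> \<le> 1 + 2 * I" "(r j)\<^sup>2 \<le> 1 + 2 * I"
proof -
  show 1: "(r j)\<^sup>2 \<le> 1 + 2 * I" using I s by (auto simp: r power_mult_distrib)
  have "\<bar>r j\<bar>\<^sup>2 \<le> (1 + 2 * I)\<^sup>2"
  proof -
    have "1 + 2 * I \<le> (1 + 2 * I)\<^sup>2" using I by (simp add: power2_eq_square algebra_simps)
    then show ?thesis using 1 by simp
  qed
  then show "\<bar>r j\<bar> \<le> 1 + 2 * I" using I by (metis abs_le_square_iff abs_of_nonneg abs_abs add_nonneg_nonneg less_imp_le mult_nonneg_nonneg zero_le_numeral zero_le_one)
qed

text \<open>The phase factor that bond \<open>(j, n)\<close> acquires in the rotating frame.\<close>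

definition \<theta> :: "'a mod_ring \<Rightarrow> 'a chain" where
  "\<theta> j n t = cis (of_int (k j - k n) * \<omega> * t)"

lemma \<theta>_norm [simp]: "cmod (\<theta> j n t) = 1" by (simp add: \<theta>_def)

lemma \<theta>_period: "\<theta> j n (t + T) = \<theta> j n t"
proof -
  have "of_int (k j - k n) * \<omega> * (t + T) = of_int (k j - k n) * \<omega> * t + of_int (k j - k n) * \<omega> * T" by (simp add: algebra_simps)
  then show ?thesis unfolding \<theta>_def by (simp only: cis_mult[symmetric] cis_period[OF \<omega>T]) simp
qed

lemma \<theta>_cont [continuous_intros]: "continuous_on UNIV (\<theta> j n)"
  unfolding \<theta>_def using cont_cis by blast

lemma \<theta>_minus: "\<theta> j n (- t) = cnj (\<theta> j n t)" by (simp add: \<theta>_def cis_cnj)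

lemma cnj_\<theta>: "cnj (\<theta> j n t) = \<theta> n j t" by (simp add: \<theta>_def cis_cnj algebra_simps)

lemma k_minus: "k (- j) = k j"
proof -
  have "- j = 1 \<longleftrightarrow> j = -1" "- j = -1 \<longleftrightarrow> j = 1" by (metis minus_minus)+
  then show ?thesis unfolding k neg_equal_0_iff_equal by presburger
qed

lemma \<theta>_reflect: "\<theta> (- j) (- n) t = \<theta> j n t" by (simp add: \<theta>_def k_minus)

lemma r_reflect: "s = 1 \<Longrightarrow> r (- j) = r j"
proof -
  have "- j = 1 \<longleftrightarrow> j = -1" "- j = -1 \<longleftrightarrow> j = 1" by (metis minus_minus)+
  moreover have "r i = (if i = 0 then sqrt (1 + 2 * I) else if i = 1 \<or> i = -1 then sqrt I else 0)" if "s = 1" for i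
    using that by (simp add: r)
  ultimately show "s = 1 \<Longrightarrow> r (- j) = r j" by (metis neg_equal_0_iff_equal)
qed

definition nbr :: "'a mod_ring \<Rightarrow> 'a chain \<Rightarrow> real \<Rightarrow> complex" where
  "nbr j f t = \<theta> j (j + 1) t * f (j + 1) t + \<theta> j (j - 1) t * f (j - 1) t"

definition orbit_rhs :: "real \<Rightarrow> 'a chain \<Rightarrow> 'a chain" where
  "orbit_rhs \<epsilon> \<rho> j t = - \<i> * ((1 - of_int (k j) * of_real \<omega> + 2 * of_real \<epsilon>) * \<rho> j t + (\<rho> j t)\<^sup>2 * cnj (\<rho> j t)
     - of_real \<epsilon> * nbr j \<rho> t)"

text \<open>Besides solving the equation in the rotating frame, an orbit is required to be reversible, to be even in \<open>j\<close> for \<open>s = 1\<close>, and to be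
  close to \<open>r\<close> in \<open>C\<^sup>1\<close>.\<close>

definition orbit :: "real \<Rightarrow> real \<Rightarrow> 'a chain \<Rightarrow> bool" where
  "orbit C \<epsilon> \<rho> \<longleftrightarrow> (\<forall>j t. (\<rho> j has_vector_derivative orbit_rhs \<epsilon> \<rho> j t) (at t)) \<and> (\<forall>j t. \<rho> j (t + T) = \<rho> j t) \<and>
     (\<forall>j t. \<rho> j (- t) = cnj (\<rho> j t)) \<and> (s = 1 \<longrightarrow> (\<forall>j. \<rho> (- j) = \<rho> j)) \<and>
     (\<forall>j t. cmod (\<rho> j t - of_real (r j)) \<le> C * \<epsilon>) \<and> (\<forall>j t. cmod (orbit_rhs \<epsilon> \<rho> j t) \<le> C * \<epsilon>)"

text \<open>What remains of the equation for \<open>x = \<rho> - r\<close> after the linear part at \<open>\<epsilon> = 0\<close> has been split off.\<close>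

definition nl :: "real \<Rightarrow> real \<Rightarrow> complex ^ 'a mod_ring \<Rightarrow> complex ^ 'a mod_ring" where
  "nl \<epsilon> t x = (\<chi> j. 2 * of_real (r j) * (x $ j * cnj (x $ j)) + of_real (r j) * (x $ j)\<^sup>2 + (x $ j)\<^sup>2 * cnj (x $ j)
     + of_real \<epsilon> * (2 * (of_real (r j) + x $ j) - (\<theta> j (j + 1) t * (of_real (r (j + 1)) + x $ (j + 1)) + \<theta> j (j - 1) t * (of_real (r (j - 1)) + x $ (j - 1)))))"

text \<open>The twists, i.e. the strength of the dependence of frequency on amplitude.\<close>

abbreviation "cc \<equiv> \<lambda>j. (r j)\<^sup>2"

lemma nl_cont: "continuous_on UNIV u \<Longrightarrow> continuous_on UNIV (\<lambda>t. nl \<epsilon> t (u t))"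
  unfolding nl_def by (intro continuous_intros \<theta>_cont)

lemma nl_lip:
  assumes R: "norm x \<le> R" "norm y \<le> R" "R \<le> 1" and \<epsilon>: "\<epsilon> \<ge> 0"
  shows "norm (nl \<epsilon> t x - nl \<epsilon> t y) \<le> (real CARD('a mod_ring) * ((6 * (1 + 2 * I) + 3) * R + 4 * \<epsilon>)) * norm (x - y)"
proof (rule order_trans[OF vec_norm_le])
  fix j
  let ?A = "1 + 2 * I" and ?d = "norm (x - y)"
  have R0: "R \<ge> 0" using R(1) norm_ge_zero order_trans by blast
  have d: "norm (x $ i - y $ i) \<le> ?d" for i using Finite_Cartesian_Product.norm_nth_le[of "x - y" i] by simp
  have bx: "norm (x $ j) \<le> R" and yb: "norm (y $ j) \<le> R"
    using R Finite_Cartesian_Product.norm_nth_le[of x j] Finite_Cartesian_Product.norm_nth_le[of y j] by linarith+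
  define P where "P = 2 * complex_of_real (r j) * (x $ j * cnj (x $ j - y $ j) + (x $ j - y $ j) * cnj (y $ j))"
  define Q where "Q = complex_of_real (r j) * ((x $ j - y $ j) * (x $ j + y $ j))"
  define S where "S = (x $ j)\<^sup>2 * cnj (x $ j) - (y $ j)\<^sup>2 * cnj (y $ j)"
  define E where "E = of_real \<epsilon> * (2 * (x $ j - y $ j) - (\<theta> j (j + 1) t * (x $ (j + 1) - y $ (j + 1)) + \<theta> j (j - 1) t * (x $ (j - 1) - y $ (j - 1))))"
  have eq: "(nl \<epsilon> t x - nl \<epsilon> t y) $ j = P + Q + S + E"
    unfolding P_def Q_def S_def E_def by (simp add: nl_def algebra_simps power2_eq_square)
  have P: "norm P \<le> 4 * ?A * R * ?d"
  proof -
    have "norm (x $ j * cnj (x $ j - y $ j) + (x $ j - y $ j) * cnj (y $ j)) \<le> R * ?d + ?d * R"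
      by (rule norm_triangle_mono) (use bx yb d R0 in \<open>auto simp: norm_mult complex_mod_cnj simp del: complex_cnj_diff intro!: mult_mono\<close>)
    then have "norm P \<le> 2 * ?A * (R * ?d + ?d * R)" unfolding P_def norm_mult
      using r_bound(1)[of j] I R0 by (intro mult_mono) auto
    then show ?thesis by (simp add: algebra_simps)
  qed
  have Q: "norm Q \<le> 2 * ?A * R * ?d"
  proof -
    have "norm ((x $ j - y $ j) * (x $ j + y $ j)) \<le> ?d * (R + R)" unfolding norm_mult
      using d[of j] norm_triangle_mono[OF bx yb] by (intro mult_mono) auto
    then have "norm Q \<le> ?A * (?d * (R + R))" unfolding Q_def norm_mult[of "complex_of_real (r j)"]
      using r_bound(1)[of j] I R0 by (intro mult_mono) auto
    then show ?thesis by (simp add: algebra_simps)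
  qed
  have S: "norm S \<le> 3 * R * ?d"
  proof -
    have "norm S \<le> 3 * R\<^sup>2 * norm (x $ j - y $ j)" unfolding S_def by (rule cubic_diff[OF bx yb])
    also have "\<dots> \<le> 3 * R * ?d" using R0 R(3) d[of j] by (intro mult_mono) (auto simp: power2_eq_square mult_left_le)
    finally show ?thesis .
  qed
  have E: "norm E \<le> 4 * \<epsilon> * ?d"
  proof -
    have 1: "norm (2 * (x $ j - y $ j)) \<le> 2 * ?d" by (subst norm_mult) (use d[of j] in simp)
    have 2: "norm (\<theta> j (j + 1) t * (x $ (j + 1) - y $ (j + 1)) + \<theta> j (j - 1) t * (x $ (j - 1) - y $ (j - 1))) \<le> ?d + ?d"
      by (rule norm_triangle_mono) (use d in \<open>simp_all add: norm_mult\<close>)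
    have "norm (2 * (x $ j - y $ j) - (\<theta> j (j + 1) t * (x $ (j + 1) - y $ (j + 1)) + \<theta> j (j - 1) t * (x $ (j - 1) - y $ (j - 1)))) \<le> 2 * ?d + (?d + ?d)"
      by (rule order_trans[OF norm_triangle_ineq4 add_mono[OF 1 2]])
    then have "norm E \<le> \<epsilon> * (2 * ?d + (?d + ?d))" unfolding E_def norm_mult[of "of_real \<epsilon>"] using \<epsilon> by (simp add: mult_left_mono)
    then show ?thesis by (simp add: algebra_simps)
  qed
  have "norm (P + Q + S + E) \<le> 4 * ?A * R * ?d + 2 * ?A * R * ?d + 3 * R * ?d + 4 * \<epsilon> * ?d"
    by (intro norm_triangle_mono P Q S E)
  then show "norm ((nl \<epsilon> t x - nl \<epsilon> t y) $ j) \<le> ((6 * (1 + 2 * I) + 3) * R + 4 * \<epsilon>) * ?d"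
    unfolding eq by (simp add: algebra_simps)
qed simp

lemma nl_0: "\<epsilon> \<ge> 0 \<Longrightarrow> norm (nl \<epsilon> t 0) \<le> real CARD('a mod_ring) * (4 * (1 + 2 * I)) * \<epsilon>"
proof -
  assume \<epsilon>: "\<epsilon> \<ge> 0"
  have "norm (nl \<epsilon> t 0 $ j) \<le> (4 * (1 + 2 * I)) * \<epsilon>" for j
  proof -
    have 1: "norm (2 * complex_of_real (r j)) \<le> 2 * (1 + 2 * I)" using r_bound(1)[of j] by (simp add: norm_mult)
    have 2: "norm (\<theta> j (j + 1) t * complex_of_real (r (j + 1)) + \<theta> j (j - 1) t * complex_of_real (r (j - 1))) \<le> (1 + 2 * I) + (1 + 2 * I)"
      by (rule norm_triangle_mono) (use r_bound(1) in \<open>simp_all add: norm_mult\<close>)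
    have "nl \<epsilon> t 0 $ j = of_real \<epsilon> * (2 * complex_of_real (r j) - (\<theta> j (j + 1) t * complex_of_real (r (j + 1)) + \<theta> j (j - 1) t * complex_of_real (r (j - 1))))"
      by (simp add: nl_def)
    also have "norm \<dots> \<le> \<epsilon> * (2 * (1 + 2 * I) + ((1 + 2 * I) + (1 + 2 * I)))" unfolding norm_mult[of "of_real \<epsilon>"]
      using \<epsilon> order_trans[OF norm_triangle_ineq4 add_mono[OF 1 2]] by (simp add: mult_left_mono)
    finally show ?thesis by (simp add: algebra_simps)
  qed
  from vec_norm_le[OF this] show ?thesis by (simp add: mult.assoc)
qed

lemma nl_period: "nl \<epsilon> (t + T) x = nl \<epsilon> t x" by (simp add: nl_def \<theta>_period)

lemma frame_expand:
  "- \<i> * ((if r j = 0 then u else of_real ((r j)\<^sup>2) * (u + cnj u)) +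
    (2 * of_real (r j) * (u * cnj u) + of_real (r j) * u\<^sup>2 + u\<^sup>2 * cnj u + of_real \<epsilon> * (2 * (of_real (r j) + u) - X)))
   = - \<i> * ((1 - of_int (k j) * of_real \<omega> + 2 * of_real \<epsilon>) * (of_real (r j) + u) + (of_real (r j) + u)\<^sup>2 * cnj (of_real (r j) + u) - of_real \<epsilon> * X)"
proof (cases "r j = 0")
  case True
  then have "k j = 0" using r_sq(4) r_eq_0_iff by blast
  then show ?thesis using True by (simp add: algebra_simps)
next
  case False
  then have "of_int (k j) * \<omega> = 1 + (r j)\<^sup>2" using r_sq(1)[of j] r_eq_0_iff by fastforce
  then have "of_int (k j) * complex_of_real \<omega> = 1 + (of_real (r j))\<^sup>2"
    by (metis of_real_1 of_real_add of_real_mult of_real_of_int_eq of_real_power)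
  then show ?thesis using False by (simp add: algebra_simps power2_eq_square)
qed

text \<open>Reversibility of the fixed point forces \<open>m = - m\<close>, hence \<open>m = 0\<close>, and then no compensating force is present.\<close>

lemma orbit_exists: "\<exists>C>0. \<exists>\<epsilon>0>0. \<forall>\<epsilon>. 0 < \<epsilon> \<and> \<epsilon> < \<epsilon>0 \<longrightarrow> (\<exists>\<rho>. orbit C \<epsilon> \<rho>)"
proof -
  let ?A = "1 + 2 * I"
  define K where "K = slv_const T cc"
  define n where "n = real CARD('a mod_ring)"
  have K0: "K \<ge> 0" unfolding K_def by (rule slv_const_nonneg[OF T_pos]) simp
  have n0: "n \<ge> 0" by (simp add: n_def)
  define C1 where "C1 = 2 * K * n * (4 * ?A) + 1"
  have C1: "C1 > 0" unfolding C1_def using K0 n0 I by (auto intro!: add_nonneg_pos mult_nonneg_nonneg)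
  define Q where "Q = n * ((6 * ?A + 3) * C1 + 4)"
  have Q0: "Q \<ge> 0" unfolding Q_def using n0 C1 I by (auto intro!: mult_nonneg_nonneg add_nonneg_nonneg)
  define C where "C = 2 * ?A * C1 + C1 + Q + n * (4 * ?A)"
  have CC1: "C1 \<le> C" unfolding C_def using C1 I n0 Q0 by auto
  define \<epsilon>0 where "\<epsilon>0 = min (1 / C1) (1 / (2 * (K * Q + 1)))"
  have \<epsilon>0: "\<epsilon>0 > 0" unfolding \<epsilon>0_def using C1 K0 Q0 by (simp add: add_nonneg_pos)
  have "\<exists>\<rho>. orbit C \<epsilon> \<rho>" if \<epsilon>: "0 < \<epsilon>" "\<epsilon> < \<epsilon>0" for \<epsilon>
  proof -
    define R where "R = C1 * \<epsilon>"
    define q where "q = n * ((6 * ?A + 3) * R + 4 * \<epsilon>)"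
    have R1: "R \<le> 1" using \<epsilon> C1 unfolding R_def \<epsilon>0_def by (simp add: field_simps)
    have R0: "R \<ge> 0" unfolding R_def using C1 \<epsilon> by simp
    have q: "q = Q * \<epsilon>" unfolding q_def Q_def R_def by (simp add: algebra_simps)
    have q0: "q \<ge> 0" unfolding q using Q0 \<epsilon> by simp
    have Kq: "K * q \<le> 1/2"
    proof -
      have p: "2 * (K * Q + 1) > 0" using K0 Q0 by (simp add: add_nonneg_pos)
      have "\<epsilon> < 1 / (2 * (K * Q + 1))" using \<epsilon>(2) by (simp add: \<epsilon>0_def)
      then have "\<epsilon> * (2 * (K * Q + 1)) < 1" unfolding pos_less_divide_eq[OF p] .
      then show ?thesis unfolding q using \<epsilon> by (simp add: algebra_simps)
    qed
    have cc0: "\<And>j. cc j \<ge> 0" by simp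
    have B: "2 * K * (n * (4 * ?A) * \<epsilon>) \<le> R" unfolding R_def C1_def using \<epsilon> by (simp add: algebra_simps)
    have lip: "norm (nl \<epsilon> t x - nl \<epsilon> t y) \<le> q * norm (x - y)" if "norm x \<le> R" "norm y \<le> R" for t x y
      using nl_lip[OF that R1] \<epsilon> unfolding q_def n_def by simp
    have "\<exists>u m. slv T cc (\<lambda>t. nl \<epsilon> t (u t)) u m \<and> (\<forall>t. norm (u t) \<le> R)"
      by (rule slv_fixpoint[OF T_pos nonres(1) cc0 nl_cont nl_period lip q0 Kq[unfolded K_def] nl_0 B[unfolded K_def n_def]]) (use \<epsilon> in auto)
    then obtain u m where u: "slv T cc (\<lambda>t. nl \<epsilon> t (u t)) u m" and uR: "\<And>t. norm (u t) \<le> R" by blast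
    have uniq: "u' = u \<and> m' = m" if "slv T cc (\<lambda>t. nl \<epsilon> t (u' t)) u' m'" "\<And>t. norm (u' t) \<le> R" for u' m'
    proof -
      have "norm (u' t - u t) \<le> 2 * (slv_const T cc * 0)" for t
        by (rule slv_perturb(1)[where n = "nl \<epsilon>" and n' = "nl \<epsilon>", OF T_pos nonres(1) cc0 that(1) u nl_cont nl_cont that(2) uR lip q0 Kq[unfolded K_def]]) auto
      moreover have "\<bar>m' j - m j\<bar> \<le> q * (2 * (slv_const T cc * 0)) + 0" for j
        by (rule slv_perturb(2)[where n = "nl \<epsilon>" and n' = "nl \<epsilon>", OF T_pos nonres(1) cc0 that(1) u nl_cont nl_cont that(2) uR lip q0 Kq[unfolded K_def]]) auto
      ultimately show ?thesis by (auto simp: fun_eq_iff)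
    qed
    have norm_cnj: "norm (\<chi> j. cnj (x $ j)) = norm x" for x :: "complex ^ 'a mod_ring" by (simp add: norm_vec_def)
    have rev: "(\<lambda>t. \<chi> j. cnj (u (- t) $ j)) = u \<and> (\<lambda>j. - m j) = m"
    proof (rule uniq)
      have "(\<lambda>t. \<chi> j. cnj (nl \<epsilon> (- t) (u (- t)) $ j)) = (\<lambda>t. nl \<epsilon> t (\<chi> j. cnj (u (- t) $ j)))"
        by (auto simp: fun_eq_iff vec_eq_iff nl_def \<theta>_minus)
      then show "slv T cc (\<lambda>t. nl \<epsilon> t (\<chi> j. cnj (u (- t) $ j))) (\<lambda>t. \<chi> j. cnj (u (- t) $ j)) (\<lambda>j. - m j)"
        using slv_reverse[OF u] by simp
      show "norm (\<chi> j. cnj (u (- t) $ j)) \<le> R" for t using uR by (simp add: norm_cnj)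
    qed
    then have m: "m j = 0" for j by (metis (mono_tags) equal_neg_zero)
    have urev: "cnj (u (- t) $ j) = u t $ j" for t j
      using rev by (metis (mono_tags, lifting) vec_lambda_beta)
    have refl: "u t $ (- j) = u t $ j" if "s = 1" for t j
    proof -
      have "(\<lambda>t. \<chi> j. u t $ (- j)) = u \<and> (\<lambda>j. m (- j)) = m"
      proof (rule uniq)
        have th: "\<theta> (- j) (1 - j) t = \<theta> j (j - 1) t" "\<theta> (- j) (- j - 1) t = \<theta> j (j + 1) t" for j t
          using \<theta>_reflect[of j "j - 1" t] \<theta>_reflect[of j "j + 1" t] by simp_all
        have rr: "r (1 - j) = r (j - 1)" "r (- j - 1) = r (j + 1)" for j
          using r_reflect[OF that, of "j - 1"] r_reflect[OF that, of "j + 1"] by simp_all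
        have "(\<lambda>t. \<chi> j. nl \<epsilon> t (u t) $ (- j)) = (\<lambda>t. nl \<epsilon> t (\<chi> j. u t $ (- j)))"
          by (simp add: fun_eq_iff vec_eq_iff nl_def th rr r_reflect[OF that])
        then show "slv T cc (\<lambda>t. nl \<epsilon> t (\<chi> j. u t $ (- j))) (\<lambda>t. \<chi> j. u t $ (- j)) (\<lambda>j. m (- j))"
          using slv_permute[OF u, of uminus] by (simp add: r_reflect[OF that])
        have "norm (\<chi> j. x $ (- j)) = norm x" for x :: "complex ^ 'a mod_ring"
          unfolding norm_vec_def L2_set_def vec_lambda_beta
          by (rule arg_cong[of _ _ sqrt], rule sum.reindex_bij_witness[of _ uminus uminus]) auto
        then show "norm (\<chi> j. u t $ (- j)) \<le> R" for t using uR by simp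
      qed
      then show ?thesis by (metis (mono_tags, lifting) vec_lambda_beta)
    qed
    define \<rho> where "\<rho> = (\<lambda>j t. complex_of_real (r j) + u t $ j)"
    have ub: "cmod (u t $ j) \<le> R" for t j using Finite_Cartesian_Product.norm_nth_le[of "u t" j] uR[of t] by linarith
    have rhs: "orbit_rhs \<epsilon> \<rho> j t = - \<i> * ((if r j = 0 then u t $ j else of_real ((r j)\<^sup>2) * (u t $ j + cnj (u t $ j))) + nl \<epsilon> t (u t) $ j)" for j t
      unfolding nl_def vec_lambda_beta frame_expand orbit_rhs_def \<rho>_def nbr_def ..
    have d: "(\<rho> j has_vector_derivative orbit_rhs \<epsilon> \<rho> j t) (at t)" for j t
    proof -
      have "((\<lambda>t. u t $ j) has_vector_derivative orbit_rhs \<epsilon> \<rho> j t) (at t)"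
      proof (cases "r j = 0")
        case True
        then have "cc j = 0" by simp
        then have "((\<lambda>t. u t $ j) has_vector_derivative - \<i> * (u t $ j + nl \<epsilon> t (u t) $ j)) (at t)"
          using u unfolding slv_def by presburger
        then show ?thesis using True by (simp add: rhs)
      next
        case False
        then have "cc j \<noteq> 0" by simp
        then have "((\<lambda>t. u t $ j) has_vector_derivative - \<i> * (of_real (cc j) * (u t $ j + cnj (u t $ j)) + nl \<epsilon> t (u t) $ j) - of_real (m j)) (at t)"
          using u unfolding slv_def by presburger
        then show ?thesis using False by (simp add: rhs m)
      qed
      then show ?thesis unfolding \<rho>_def
        using has_vector_derivative_add[OF has_vector_derivative_const[of "complex_of_real (r j)"]] by simp
    qed
    have db: "cmod (orbit_rhs \<epsilon> \<rho> j t) \<le> C * \<epsilon>" for j t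
    proof -
      have "cmod (nl \<epsilon> t (u t) $ j) \<le> norm (nl \<epsilon> t (u t) - nl \<epsilon> t 0) + norm (nl \<epsilon> t 0)"
        using Finite_Cartesian_Product.norm_nth_le[of "nl \<epsilon> t (u t)" j] norm_triangle_ineq[of "nl \<epsilon> t (u t) - nl \<epsilon> t 0" "nl \<epsilon> t 0"] by simp
      also have "\<dots> \<le> q * norm (u t - 0) + n * (4 * ?A) * \<epsilon>"
        using nl_0[of \<epsilon> t] \<epsilon> R0 uR unfolding n_def by (intro add_mono lip) auto
      also have "q * norm (u t - 0) \<le> Q * \<epsilon> * 1"
        unfolding q using uR[of t] R1 Q0 \<epsilon> by (intro mult_left_mono) auto
      finally have 1: "cmod (nl \<epsilon> t (u t) $ j) \<le> Q * \<epsilon> + n * (4 * ?A) * \<epsilon>" by simp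
      have 2: "cmod (if r j = 0 then u t $ j else of_real ((r j)\<^sup>2) * (u t $ j + cnj (u t $ j))) \<le> R + ?A * (R + R)"
      proof (cases "r j = 0")
        case True
        then show ?thesis using ub[of t j] R0 I by (simp add: add_increasing2)
      next
        case False
        have "cmod (u t $ j + cnj (u t $ j)) \<le> R + R" by (rule norm_triangle_mono) (use ub in \<open>simp_all add: complex_mod_cnj\<close>)
        then have "cmod (of_real ((r j)\<^sup>2) * (u t $ j + cnj (u t $ j))) \<le> ?A * (R + R)"
          unfolding norm_mult norm_of_real using r_bound(2)[of j] I by (intro mult_mono) auto
        then show ?thesis using False R0 by simp
      qed
      have "cmod (orbit_rhs \<epsilon> \<rho> j t) \<le> (R + ?A * (R + R)) + (Q * \<epsilon> + n * (4 * ?A) * \<epsilon>)"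
        unfolding rhs norm_mult using norm_triangle_mono[OF 2 1] by simp
      then show ?thesis unfolding C_def R_def by (simp add: algebra_simps)
    qed
    have "orbit C \<epsilon> \<rho>" unfolding orbit_def
    proof (intro conjI allI impI)
      fix j t
      show "(\<rho> j has_vector_derivative orbit_rhs \<epsilon> \<rho> j t) (at t)" by (rule d)
      show "\<rho> j (t + T) = \<rho> j t" using u by (simp add: \<rho>_def slv_def)
      show "\<rho> j (- t) = cnj (\<rho> j t)" unfolding \<rho>_def using urev[of "- t" j] by simp
      have "C1 * \<epsilon> \<le> C * \<epsilon>" using CC1 \<epsilon>(1) by (intro mult_right_mono) auto
      then show "cmod (\<rho> j t - of_real (r j)) \<le> C * \<epsilon>"
        using ub[of t j] unfolding R_def \<rho>_def by simp
      show "cmod (orbit_rhs \<epsilon> \<rho> j t) \<le> C * \<epsilon>" by (rule db)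
    next
      fix j assume "s = 1"
      then show "\<rho> (- j) = \<rho> j" by (simp add: \<rho>_def fun_eq_iff refl r_reflect)
    qed
    then show ?thesis by blast
  qed
  then show ?thesis using C1 CC1 \<epsilon>0 by (intro exI[of _ C] conjI exI[of _ \<epsilon>0]) auto
qed

end

section \<open>The invariant tori\<close>

lemma hausdorff_le:
  assumes "\<And>p. dist (F p) (G p) \<le> D"
  shows "0 \<le> hausdorff_distance (range F) (range G)" "hausdorff_distance (range F) (range G) \<le> D"
proof -
  have D: "D \<ge> 0" using assms order_trans zero_le_dist by blast
  have 1: "infdist x (range G) \<le> D" if "x \<in> range F" for x
    using that assms by (auto intro: order_trans[OF infdist_le])
  have 2: "infdist x (range F) \<le> D" if "x \<in> range G" for x
    using that assms by (auto intro!: order_trans[OF infdist_le] simp: dist_commute)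
  have "(SUP x\<in>range F. infdist x (range G)) \<le> D" by (rule cSUP_least) (use 1 in auto)
  moreover have "(SUP x\<in>range G. infdist x (range F)) \<le> D" by (rule cSUP_least) (use 2 in auto)
  ultimately show "hausdorff_distance (range F) (range G) \<le> D" by (simp add: hausdorff_distance_def)
  obtain x where x: "x \<in> range F" by blast
  have "0 \<le> infdist x (range G)" by (rule infdist_nonneg)
  also have "\<dots> \<le> (SUP x\<in>range F. infdist x (range G))"
    by (rule cSUP_upper[OF x]) (use 1 in \<open>auto intro!: bdd_aboveI2\<close>)
  finally show "0 \<le> hausdorff_distance (range F) (range G)" by (simp add: hausdorff_distance_def)
qed

lemma sin_ge_half: "0 \<le> x \<Longrightarrow> x \<le> pi / 4 \<Longrightarrow> x / 2 \<le> sin x"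
proof -
  assume x: "0 \<le> x" "x \<le> pi / 4"
  have "sin 0 - 0 / 2 \<le> sin x - x / 2"
  proof (rule DERIV_nonneg_imp_nondecreasing[OF x(1), of "\<lambda>x. sin x - x / 2"])
    fix y assume y: "0 \<le> y" "y \<le> x"
    have "cos (pi / 3) \<le> cos y" by (rule cos_monotone_0_pi_le) (use x y pi_gt_zero in auto)
    then have "1 / 2 \<le> cos y" by (simp add: cos_60)
    then show "\<exists>z. ((\<lambda>x. sin x - x / 2) has_real_derivative z) (at y) \<and> 0 \<le> z"
      by (intro exI[of _ "cos y - 1/2"] conjI) (auto intro!: derivative_eq_intros)
  qed
  then show ?thesis by simp
qed

text \<open>A linear lower bound, so that equality of two points on the torus controls the difference of their angles.\<close>

lemma cis_minus_one_ge:
  assumes "\<bar>x\<bar> \<le> pi" shows "\<bar>x\<bar> / 4 \<le> cmod (cis x - 1)"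
proof -
  define y where "y = \<bar>x\<bar> / 4"
  have y: "0 \<le> y" "y \<le> pi / 4" using assms by (auto simp: y_def)
  have c: "1 / 2 \<le> cos y"
  proof -
    have "cos (pi / 3) \<le> cos y" by (rule cos_monotone_0_pi_le) (use y pi_gt_zero in auto)
    then show ?thesis by (simp add: cos_60)
  qed
  have "(cmod (cis x - 1))\<^sup>2 = (cos x - 1)\<^sup>2 + (sin x)\<^sup>2" by (simp add: cmod_power2)
  also have "\<dots> = 2 - 2 * cos x" using sin_cos_squared_add[of x] by (simp add: power2_eq_square algebra_simps)
  also have "cos x = cos (2 * (2 * y))" by (simp add: y_def)
  also have "2 - 2 * cos (2 * (2 * y)) = (4 * sin y * cos y)\<^sup>2" by (simp only: cos_double_sin sin_double) (simp add: power2_eq_square)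
  finally have sq: "(cmod (cis x - 1))\<^sup>2 = (4 * sin y * cos y)\<^sup>2" .
  have s: "y / 2 \<le> sin y" by (rule sin_ge_half[OF y])
  have "4 * (y / 2) * (1 / 2) \<le> 4 * sin y * cos y" using s c y by (intro mult_mono) auto
  then have le: "y \<le> 4 * sin y * cos y" by simp
  then have "cmod (cis x - 1) = 4 * sin y * cos y" using sq y by (smt (verit) norm_ge_zero power2_eq_iff_nonneg)
  then show ?thesis using le by (simp add: y_def)
qed

lemma reduce_angle: "\<exists>n::int. \<bar>x + of_int n * (2 * pi)\<bar> \<le> pi"
proof -
  obtain n where "(x + pi) + of_int n * (2 * pi) \<in> {0..2 * pi}" using reduce_period[of "2 * pi" "x + pi"] by auto
  then show ?thesis by (intro exI[of _ n]) auto
qed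

lemma cis_eq_cis: "cis a = cis b \<Longrightarrow> \<exists>m::int. a - b = 2 * pi * of_int m"
proof -
  assume "cis a = cis b"
  then have "cos (a - b) = 1" by (metis cis.sel(1) cis_divide cis_neq_zero divide_self_if one_complex.sel(1))
  then show ?thesis by (metis cos_one_2pi_int mult.commute mult.left_commute)
qed

lemma cis_add_2pi_int: "cis (a + 2 * pi * of_int m) = cis a"
  using cis_multiple_2pi[of "of_int m"] by (simp add: cis_mult[symmetric])

lemma solution_gauge_shift:
  assumes "solution_of (dnls_field \<epsilon>) \<gamma>" "cmod c = 1"
  shows "solution_of (dnls_field \<epsilon>) (\<lambda>t. \<chi> j. c * \<gamma> (t + a) $ j)"
  unfolding solution_of_def
proof
  fix t
  have cc: "c * cnj c = 1" using assms(2) by (metis complex_norm_square of_real_1 power_one)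
  have d: "(\<gamma> has_vector_derivative dnls_field \<epsilon> (\<gamma> t)) (at t)" for t using assms(1) by (simp add: solution_of_def)
  have "((\<lambda>t. \<chi> j. c * \<gamma> (t + a) $ j) has_vector_derivative (\<chi> j. c * dnls_field \<epsilon> (\<gamma> (t + a)) $ j)) (at t)"
    by (intro chi_vderiv has_vector_derivative_mult_right nth_vderiv shift_vderiv[OF d])
  also have "(\<chi> j. c * dnls_field \<epsilon> (\<gamma> (t + a)) $ j) = dnls_field \<epsilon> (\<chi> j. c * \<gamma> (t + a) $ j)"
  proof (subst vec_eq_iff, intro allI)
    fix j
    have "(c * z)\<^sup>2 * cnj (c * z) = c * (z\<^sup>2 * cnj z) * (c * cnj c)" for z by (simp add: power2_eq_square mult_ac)
    then have "(c * z)\<^sup>2 * cnj (c * z) = c * (z\<^sup>2 * cnj z)" for z by (simp add: cc)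
    then show "(\<chi> j. c * dnls_field \<epsilon> (\<gamma> (t + a)) $ j) $ j = dnls_field \<epsilon> (\<chi> j. c * \<gamma> (t + a) $ j) $ j"
      unfolding dnls_field_nth vec_lambda_beta by (simp add: algebra_simps)
  qed
  finally show "((\<lambda>t. \<chi> j. c * \<gamma> (t + a) $ j) has_vector_derivative dnls_field \<epsilon> (\<chi> j. c * \<gamma> (t + a) $ j)) (at t)" .
qed

context resonant_chain
begin

definition gam :: "'a chain \<Rightarrow> real \<Rightarrow> complex ^ 'a mod_ring" where
  "gam \<rho> t = (\<chi> j. cis (- (of_int (k j) * \<omega>) * t) * \<rho> j t)"

text \<open>The angle \<open>fst p\<close> is the phase of the sites \<open>-1, 1\<close> and \<open>snd p\<close> that of site 0.  Their difference is \<open>\<omega>\<close> times the time along the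
  periodic orbit; the remaining direction is the gauge rotation.\<close>

definition tor :: "'a chain \<Rightarrow> real \<times> real \<Rightarrow> complex ^ 'a mod_ring" where
  "tor \<rho> p = (\<chi> j. cis ((1 - of_int (k j)) * snd p + (of_int (k j) - 2) * fst p) * \<rho> j ((snd p - fst p) / \<omega>))"

lemma orbitD:
  assumes "orbit C \<epsilon> \<rho>"
  shows "(\<rho> j has_vector_derivative orbit_rhs \<epsilon> \<rho> j t) (at t)" "\<rho> j (t + T) = \<rho> j t" "\<rho> j (- t) = cnj (\<rho> j t)"
    "s = 1 \<Longrightarrow> \<rho> (- j) = \<rho> j" "cmod (\<rho> j t - of_real (r j)) \<le> C * \<epsilon>" "cmod (orbit_rhs \<epsilon> \<rho> j t) \<le> C * \<epsilon>"
  using assms unfolding orbit_def by blast+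

lemma orbit_cont: assumes "orbit C \<epsilon> \<rho>" shows "continuous_on UNIV (\<rho> j)" "continuous_on UNIV (orbit_rhs \<epsilon> \<rho> j)"
proof -
  show c: "continuous_on UNIV (\<rho> j)" for j by (rule cont_deriv[OF orbitD(1)[OF assms]])
  show "continuous_on UNIV (orbit_rhs \<epsilon> \<rho> j)" unfolding orbit_rhs_def nbr_def by (intro continuous_intros c \<theta>_cont)
qed

lemma gam_solution:
  assumes "orbit C \<epsilon> \<rho>" shows "solution_of (dnls_field \<epsilon>) (gam \<rho>)"
  unfolding solution_of_def
proof
  fix t
  have "(gam \<rho> has_vector_derivative (\<chi> j. cis (- (of_int (k j) * \<omega>) * t) * orbit_rhs \<epsilon> \<rho> j t
      + \<i> * of_real (- (of_int (k j) * \<omega>)) * cis (- (of_int (k j) * \<omega>) * t) * \<rho> j t)) (at t)"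
    unfolding gam_def by (rule chi_vderiv, rule has_vector_derivative_mult[OF cis_vderiv orbitD(1)[OF assms]])
  also have "(\<chi> j. cis (- (of_int (k j) * \<omega>) * t) * orbit_rhs \<epsilon> \<rho> j t
      + \<i> * of_real (- (of_int (k j) * \<omega>)) * cis (- (of_int (k j) * \<omega>) * t) * \<rho> j t) = dnls_field \<epsilon> (gam \<rho> t)"
  proof (subst vec_eq_iff, intro allI)
    fix j
    let ?c = "\<lambda>j. cis (- (of_int (k j) * \<omega>) * t)"
    have cc: "?c j * cnj (?c j) = 1" for j by (metis complex_norm_square norm_cis of_real_1 power_one)
    have "(?c j * z)\<^sup>2 * cnj (?c j * z) = ?c j * (z\<^sup>2 * cnj z) * (?c j * cnj (?c j))" for z
      by (simp only: power2_eq_square complex_cnj_mult mult_ac)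
    then have cub: "(?c j * z)\<^sup>2 * cnj (?c j * z) = ?c j * (z\<^sup>2 * cnj z)" for z by (simp only: cc mult_1_right)
    have nb: "?c n = ?c j * \<theta> j n t" for n unfolding \<theta>_def cis_mult by (simp add: algebra_simps)
    have nbr: "?c (j + 1) * \<rho> (j + 1) t + ?c (j - 1) * \<rho> (j - 1) t = ?c j * nbr j \<rho> t"
      unfolding nbr_def nb[of "j + 1"] nb[of "j - 1"] by (simp add: algebra_simps)
    have "dnls_field \<epsilon> (gam \<rho> t) $ j = - \<i> * ((1 + 2 * of_real \<epsilon>) * (?c j * \<rho> j t) + ?c j * ((\<rho> j t)\<^sup>2 * cnj (\<rho> j t)) - of_real \<epsilon> * (?c j * nbr j \<rho> t))"
      unfolding dnls_field_nth gam_def vec_lambda_beta cub nbr ..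
    then show "(\<chi> j. ?c j * orbit_rhs \<epsilon> \<rho> j t + \<i> * of_real (- (of_int (k j) * \<omega>)) * ?c j * \<rho> j t) $ j = dnls_field \<epsilon> (gam \<rho> t) $ j"
      unfolding orbit_rhs_def vec_lambda_beta by (simp add: algebra_simps)
  qed
  finally show "(gam \<rho> has_vector_derivative dnls_field \<epsilon> (gam \<rho> t)) (at t)" .
qed

text \<open>The angles advance with frequencies \<open>\<omega>\<close> and \<open>2 \<omega>\<close>, and each orbit on the torus is a rotated and time-shifted copy of one
  solution.\<close>

lemma tor_flow: "tor \<rho> (a + \<omega> * t, b + 2 * \<omega> * t) = (\<chi> j. cis (b - 2 * a) * gam \<rho> (t + (b - a) / \<omega>) $ j)"
proof (subst vec_eq_iff, intro allI)
  fix j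
  have 1: "(b + 2 * \<omega> * t - (a + \<omega> * t)) / \<omega> = t + (b - a) / \<omega>" using \<omega>_pos by (simp add: field_simps)
  have "\<omega> * (t + (b - a) / \<omega>) = \<omega> * t + (b - a)" using \<omega>_pos by (simp add: field_simps)
  then have ph: "- (of_int (k j) * \<omega>) * (t + (b - a) / \<omega>) = - of_int (k j) * (\<omega> * t + (b - a))"
    by (metis minus_mult_left mult.assoc)
  have 2: "cis (b - 2 * a) * cis (- (of_int (k j) * \<omega>) * (t + (b - a) / \<omega>)) =
     cis ((1 - of_int (k j)) * (b + 2 * \<omega> * t) + (of_int (k j) - 2) * (a + \<omega> * t))"
    unfolding cis_mult ph by (simp add: algebra_simps)
  show "tor \<rho> (a + \<omega> * t, b + 2 * \<omega> * t) $ j = (\<chi> j. cis (b - 2 * a) * gam \<rho> (t + (b - a) / \<omega>) $ j) $ j"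
    unfolding tor_def gam_def vec_lambda_beta fst_conv snd_conv 1 mult.assoc[symmetric] 2 ..
qed

lemma tor_solution:
  assumes "orbit C \<epsilon> \<rho>" shows "solution_of (dnls_field \<epsilon>) (\<lambda>t. tor \<rho> (a + \<omega> * t, b + 2 * \<omega> * t))"
  unfolding tor_flow by (rule solution_gauge_shift[OF gam_solution[OF assms]]) simp

lemma tor_solution_unique:
  assumes "orbit C \<epsilon> \<rho>" "solution_of (dnls_field \<epsilon>) \<eta>" "\<eta> 0 \<in> range (tor \<rho>)"
  obtains a b where "\<eta> = (\<lambda>t. tor \<rho> (a + \<omega> * t, b + 2 * \<omega> * t))"
proof -
  obtain a b where ab: "\<eta> 0 = tor \<rho> (a, b)" using assms(3) by auto
  have "\<eta> = (\<lambda>t. tor \<rho> (a + \<omega> * t, b + 2 * \<omega> * t))"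
    by (rule solution_unique[OF assms(2) tor_solution[OF assms(1)]]) (simp add: ab)
  then show ?thesis by (rule that)
qed

lemma tor_invariant: "orbit C \<epsilon> \<rho> \<Longrightarrow> invariant_under (dnls_field \<epsilon>) (range (tor \<rho>))"
  unfolding invariant_under_def by (metis (mono_tags, lifting) image_subsetI rangeI tor_solution_unique)

lemma tor_lattice:
  assumes "orbit C \<epsilon> \<rho>" "a - a' = 2 * pi * of_int m" "b - b' = 2 * pi * of_int n"
  shows "tor \<rho> (a, b) = tor \<rho> (a', b')"
proof -
  have a: "a = a' + 2 * pi * of_int m" and b: "b = b' + 2 * pi * of_int n" using assms by auto
  have 1: "(b - a) / \<omega> = (b' - a') / \<omega> + of_int (n - m) * T" unfolding a b T using \<omega>_pos by (simp add: field_simps)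
  have 2: "(1 - of_int l) * b + (of_int l - 2) * a = ((1 - of_int l) * b' + (of_int l - 2) * a') + 2 * pi * of_int ((1 - l) * n + (l - 2) * m)" for l
    unfolding a b by (simp add: algebra_simps)
  have 3: "\<rho> j ((b' - a') / \<omega> + of_int (n - m) * T) = \<rho> j ((b' - a') / \<omega>)" for j
    by (rule periodic_int[of "\<rho> j" T, OF orbitD(2)[OF assms(1)]])
  show ?thesis unfolding tor_def fst_conv snd_conv 1 2 3 cis_add_2pi_int ..
qed

lemma tor_dist: "orbit C \<epsilon> \<rho> \<Longrightarrow> dist (tor \<rho> p) (tor (\<lambda>j t. of_real (r j)) p) \<le> real CARD('a mod_ring) * (C * \<epsilon>)"
  unfolding dist_norm
proof (rule vec_norm_le)
  fix j assume o: "orbit C \<epsilon> \<rho>"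
  have "(tor \<rho> p - tor (\<lambda>j t. of_real (r j)) p) $ j = cis ((1 - of_int (k j)) * snd p + (of_int (k j) - 2) * fst p) * (\<rho> j ((snd p - fst p) / \<omega>) - of_real (r j))"
    by (simp add: tor_def algebra_simps)
  then show "cmod ((tor \<rho> p - tor (\<lambda>j t. of_real (r j)) p) $ j) \<le> C * \<epsilon>"
    using orbitD(5)[OF o] by (simp add: norm_mult)
qed

lemma unperturbed_torus_eq:
  assumes "s = cos q" "sin q = 0" shows "unperturbed_torus I q = range (tor (\<lambda>j t. of_real (r j)))"
proof -
  have e: "exp (- \<i> * of_real x) = cis (- x)" for x by (simp add: cis_conv_exp)
  have q: "cis (- (a + q)) = of_real s * cis (- a)" for a
    using assms by (simp add: complex_eq_iff cos_diff sin_diff)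
  have "\<psi> \<in> unperturbed_torus I q \<longleftrightarrow> (\<exists>a b. \<psi> = tor (\<lambda>j t. of_real (r j)) (a, b))" for \<psi> :: "complex ^ 'a mod_ring"
    unfolding unperturbed_torus_def mem_Collect_eq
  proof (intro ex_cong1)
    fix a b
    show "(\<psi> $ (-1) = of_real (sqrt I) * exp (- \<i> * of_real a) \<and> \<psi> $ 0 = of_real (sqrt (1 + 2 * I)) * exp (- \<i> * of_real b) \<and>
      \<psi> $ 1 = of_real (sqrt I) * exp (- \<i> * of_real (a + q)) \<and> (\<forall>j. j \<notin> {- 1, 0, 1} \<longrightarrow> \<psi> $ j = 0)) \<longleftrightarrow> \<psi> = tor (\<lambda>j t. of_real (r j)) (a, b)"
      (is "?L \<longleftrightarrow> ?R")
    proof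
      assume ?R
      then show ?L unfolding e q by (simp add: tor_def r_sq(3) mult_ac)
    next
      assume L: ?L
      show ?R
      proof (subst vec_eq_iff, intro allI)
        fix j show "\<psi> $ j = tor (\<lambda>j t. of_real (r j)) (a, b) $ j"
        proof (cases "j \<in> {-1, 0, 1}")
          case True then show ?thesis using L unfolding e q by (auto simp: tor_def mult_ac)
        next
          case False then show ?thesis using L by (simp add: tor_def r_sq(3))
        qed
      qed
    qed
  qed
  then show ?thesis by (auto simp: image_iff)
qed

text \<open>The smallness that makes the torus embedded and separates the time mode from the gauge mode.\<close>

definition small :: "real \<Rightarrow> bool" where
  "small \<delta> \<longleftrightarrow> \<delta> \<le> sqrt I / 2 \<and> \<delta> \<le> 1 \<and> 2 * \<delta> / \<omega> < sqrt I / 2 \<and> (2 * (2 + 2 * I)) * \<delta> / \<omega> < (sqrt I / 2)\<^sup>2 / 4"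

lemma small_eventually: "\<exists>\<delta>0>0. \<forall>\<delta>. 0 \<le> \<delta> \<and> \<delta> < \<delta>0 \<longrightarrow> small \<delta>"
proof -
  have a: "sqrt I / 2 > 0" using I by simp
  define \<delta>0 where "\<delta>0 = min (min (sqrt I / 2) 1) (min ((sqrt I / 2) * \<omega> / 2) ((sqrt I / 2)\<^sup>2 / 4 * \<omega> / (2 * (2 + 2 * I))))"
  have "\<delta>0 > 0" unfolding \<delta>0_def using a \<omega>_pos I by auto
  moreover have "small \<delta>" if "0 \<le> \<delta>" "\<delta> < \<delta>0" for \<delta>
    using that I \<omega>_pos unfolding small_def \<delta>0_def by (simp add: field_simps)
  ultimately show ?thesis by blast
qed

lemma orbit_lower:
  assumes "orbit C \<epsilon> \<rho>" "small (C * \<epsilon>)" "j \<in> {-1, 0}"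
  shows "sqrt I / 2 \<le> cmod (\<rho> j t)" "cmod (\<rho> j t) \<le> 2 + 2 * I"
proof -
  have r1: "sqrt I \<le> r j" using assms(3) I by (auto simp: r)
  have "\<bar>cmod (\<rho> j t) - cmod (of_real (r j))\<bar> \<le> C * \<epsilon>"
    using orbitD(5)[OF assms(1), of j t] norm_triangle_ineq3[of "\<rho> j t" "of_real (r j)"] by linarith
  moreover have "cmod (of_real (r j)) = \<bar>r j\<bar>" by simp
  ultimately show "sqrt I / 2 \<le> cmod (\<rho> j t)" "cmod (\<rho> j t) \<le> 2 + 2 * I"
    using r1 r_bound(1)[of j] assms(2) unfolding small_def by linarith+
qed

text \<open>Without coupling, the components at \<open>-1\<close> and \<open>0\<close> determine the angles.  With coupling their amplitudes depend slowly on the time \<open>t\<close> along the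
  orbit, and comparing the phases shows that the time difference is a multiple of the period.\<close>

lemma tor_inj:
  assumes o: "orbit C \<epsilon> \<rho>" and sm: "small (C * \<epsilon>)" and eq: "tor \<rho> (a, b) = tor \<rho> (a', b')"
  shows "\<exists>m n :: int. a - a' = 2 * pi * of_int m \<and> b - b' = 2 * pi * of_int n"
proof -
  let ?m = "sqrt I / 2" and ?M = "2 + 2 * I" and ?\<delta> = "C * \<epsilon>"
  have m: "?m > 0" using I by simp
  have e1: "cis (- a) * \<rho> (-1) ((b - a) / \<omega>) = cis (- a') * \<rho> (-1) ((b' - a') / \<omega>)"
    using arg_cong[OF eq, of "\<lambda>v. v $ (-1)"] by (simp add: tor_def)
  have e0: "cis (- b) * \<rho> 0 ((b - a) / \<omega>) = cis (- b') * \<rho> 0 ((b' - a') / \<omega>)"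
    using arg_cong[OF eq, of "\<lambda>v. v $ 0"] by (simp add: tor_def)
  obtain n :: int where n: "\<bar>((b' - a') - (b - a)) + of_int n * (2 * pi)\<bar> \<le> pi" using reduce_angle by blast
  define \<Delta> where "\<Delta> = ((b' - a') - (b - a)) + of_int n * (2 * pi)"
  have nD: "\<bar>\<Delta>\<bar> \<le> pi" using n by (simp add: \<Delta>_def)
  define t where "t = (b - a) / \<omega>"
  define t' where "t' = t + \<Delta> / \<omega>"
  have t': "\<rho> j ((b' - a') / \<omega>) = \<rho> j t'" for j
  proof -
    have "t' = (b' - a') / \<omega> + of_int n * T" unfolding t'_def t_def \<Delta>_def T using \<omega>_pos by (simp add: field_simps)
    then show ?thesis by (simp add: periodic_int[of "\<rho> j" T, OF orbitD(2)[OF o]])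
  qed
  have cisD: "cis (- b) * cis (- a') * cis (- \<Delta>) = cis (- b') * cis (- a)"
  proof -
    have "- b + - a' + - \<Delta> = (- b' + - a) + 2 * pi * of_int (- n)" unfolding \<Delta>_def by simp
    then show ?thesis unfolding cis_mult by (simp only: cis_add_2pi_int)
  qed
  have "(cis (- b) * \<rho> 0 t) * (cis (- a') * \<rho> (-1) t') = (cis (- b') * \<rho> 0 t') * (cis (- a) * \<rho> (-1) t)"
    using e0 e1 unfolding t' t_def[symmetric] by simp
  then have "(cis (- b) * cis (- a')) * (\<rho> 0 t * \<rho> (-1) t') = (cis (- b) * cis (- a')) * (cis (- \<Delta>) * (\<rho> 0 t' * \<rho> (-1) t))"
    using cisD by (simp add: mult_ac)
  then have key: "\<rho> 0 t * \<rho> (-1) t' = cis (- \<Delta>) * (\<rho> 0 t' * \<rho> (-1) t)" by (simp add: cis_neq_zero)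
  then have id: "(cis (- \<Delta>) - 1) * (\<rho> 0 t' * \<rho> (-1) t) = \<rho> 0 t * (\<rho> (-1) t' - \<rho> (-1) t) - (\<rho> 0 t' - \<rho> 0 t) * \<rho> (-1) t"
    by (simp add: algebra_simps)
  have lip: "cmod (\<rho> j t' - \<rho> j t) \<le> ?\<delta> * (\<bar>\<Delta>\<bar> / \<omega>)" for j
  proof (cases "t \<le> t'")
    case True
    have "cmod (\<rho> j t' - \<rho> j t) \<le> ?\<delta> * (t' - t)" by (rule vderiv_bound[OF orbitD(1)[OF o] orbitD(6)[OF o] True])
    then show ?thesis using True \<omega>_pos unfolding t'_def by (simp add: zero_le_divide_iff)
  next
    case False
    have "cmod (\<rho> j t - \<rho> j t') \<le> ?\<delta> * (t - t')" by (rule vderiv_bound[OF orbitD(1)[OF o] orbitD(6)[OF o]]) (use False in simp)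
    moreover have "t - t' = \<bar>\<Delta>\<bar> / \<omega>" using False \<omega>_pos unfolding t'_def by (simp add: zero_le_divide_iff)
    ultimately show ?thesis by (simp add: norm_minus_commute)
  qed
  note lo = orbit_lower[OF o sm]
  have d0: "0 \<le> ?\<delta>" using orbitD(5)[OF o] norm_ge_zero order_trans by blast
  have Dw: "0 \<le> \<bar>\<Delta>\<bar> / \<omega>" using \<omega>_pos by simp
  have dDw: "0 \<le> ?\<delta> * (\<bar>\<Delta>\<bar> / \<omega>)" by (rule mult_nonneg_nonneg[OF d0 Dw])
  have "cmod ((cis (- \<Delta>) - 1) * (\<rho> 0 t' * \<rho> (-1) t)) \<le> ?M * (?\<delta> * (\<bar>\<Delta>\<bar> / \<omega>)) + (?\<delta> * (\<bar>\<Delta>\<bar> / \<omega>)) * ?M"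
    unfolding id by (rule order_trans[OF norm_triangle_ineq4 add_mono]) (unfold norm_mult, (intro mult_mono lip lo; (rule dDw | use I in simp))+)
  moreover have "\<bar>\<Delta>\<bar> / 4 * (?m * ?m) \<le> cmod ((cis (- \<Delta>) - 1) * (\<rho> 0 t' * \<rho> (-1) t))"
    unfolding norm_mult using cis_minus_one_ge[of "- \<Delta>"] lo(1)[of 0 t'] lo(1)[of "-1" t] m
      nD by (intro mult_mono) auto
  ultimately have U: "\<bar>\<Delta>\<bar> / 4 * (?m * ?m) \<le> ?M * (?\<delta> * (\<bar>\<Delta>\<bar> / \<omega>)) + (?\<delta> * (\<bar>\<Delta>\<bar> / \<omega>)) * ?M" by (rule order_trans[rotated])
  have "x * (m\<^sup>2 / 4) = x / 4 * (m * m)" "x * ((2 * M) * d / w) = M * (d * (x / w)) + (d * (x / w)) * M" for x m M d w :: real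
    by (simp_all add: power2_eq_square algebra_simps)
  with U have "\<bar>\<Delta>\<bar> * (?m\<^sup>2 / 4) \<le> \<bar>\<Delta>\<bar> * ((2 * ?M) * ?\<delta> / \<omega>)" by presburger
  moreover have "(2 * ?M) * ?\<delta> / \<omega> < ?m\<^sup>2 / 4" using sm by (simp add: small_def)
  ultimately have D0: "\<Delta> = 0" by (metis abs_ge_zero abs_le_zero_iff linorder_not_less mult_left_le_imp_le order_less_le)
  have tt: "t' = t" using D0 by (simp add: t'_def)
  have nz: "\<rho> (-1) t \<noteq> 0" "\<rho> 0 t \<noteq> 0" using lo(1)[of "-1" t] lo(1)[of 0 t] m by auto
  have "cis (- a) = cis (- a')" using e1 nz unfolding t' t_def[symmetric] tt by simp
  then obtain m1 :: int where "- a - (- a') = 2 * pi * of_int m1" using cis_eq_cis by blast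
  moreover have "cis (- b) = cis (- b')" using e0 nz unfolding t' t_def[symmetric] tt by simp
  then obtain m2 :: int where "- b - (- b') = 2 * pi * of_int m2" using cis_eq_cis by blast
  ultimately show ?thesis by (intro exI[of _ "- m1"] exI[of _ "- m2"]) (auto simp: algebra_simps)
qed

lemma tor_foliated:
  assumes o: "orbit C \<epsilon> \<rho>" and sm: "small (C * \<epsilon>)"
  shows "foliated_by_periodic_orbits (dnls_field \<epsilon>) T (range (tor \<rho>))"
  unfolding foliated_by_periodic_orbits_def
proof
  fix x assume "x \<in> range (tor \<rho>)"
  then obtain a b where x: "x = tor \<rho> (a, b)" by auto
  let ?\<gamma> = "\<lambda>t. tor \<rho> (a + \<omega> * t, b + 2 * \<omega> * t)"
  have "periodic_orbit (dnls_field \<epsilon>) T ?\<gamma>" unfolding periodic_orbit_def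
  proof (intro conjI allI)
    show "solution_of (dnls_field \<epsilon>) ?\<gamma>" by (rule tor_solution[OF o])
    show "?\<gamma> (t + T) = ?\<gamma> t" for t
      by (rule tor_lattice[OF o, of _ _ 1 _ _ 2]) (use \<omega>T in \<open>simp_all add: algebra_simps\<close>)
    show "\<exists>t. ?\<gamma> t \<noteq> ?\<gamma> 0"
    proof (rule exI[of _ "T / 2"], rule notI)
      assume "?\<gamma> (T / 2) = ?\<gamma> 0"
      from tor_inj[OF o sm this] obtain m :: int where "\<omega> * (T / 2) = 2 * pi * of_int m" by auto
      then have "pi * 1 = pi * (2 * of_int m)" using \<omega>T by simp
      then have "1 = 2 * real_of_int m" by (simp only: mult_cancel_left) simp
      then have "real_of_int 1 = real_of_int (2 * m)" by simp
      then have "1 = 2 * m" by (simp only: of_int_eq_iff)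
      then show False by presburger
    qed
  qed
  then show "\<exists>\<gamma>. periodic_orbit (dnls_field \<epsilon>) T \<gamma> \<and> \<gamma> 0 = x \<and> range \<gamma> \<subseteq> range (tor \<rho>)"
    by (intro exI[of _ ?\<gamma>]) (auto simp: x)
qed

lemma tor_torus2:
  assumes o: "orbit C \<epsilon> \<rho>" and sm: "small (C * \<epsilon>)"
  shows "torus2 (range (tor \<rho>))"
proof -
  define ph where "ph = (\<lambda>j p. cis ((1 - of_int (k j)) * snd p + (of_int (k j) - 2) * fst p))"
  define tm where "tm = (\<lambda>p :: real \<times> real. (snd p - fst p) / \<omega>)"
  define V1 where "V1 = (\<lambda>p. \<chi> j. ph j p * (\<i> * of_real (of_int (k j) - 2) * \<rho> j (tm p) - orbit_rhs \<epsilon> \<rho> j (tm p) / of_real \<omega>))"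
  define V2 where "V2 = (\<lambda>p. \<chi> j. ph j p * (\<i> * of_real (1 - of_int (k j)) * \<rho> j (tm p) + orbit_rhs \<epsilon> \<rho> j (tm p) / of_real \<omega>))"
  define F' where "F' = (\<lambda>p. Blinfun (\<lambda>h :: real \<times> real. fst h *\<^sub>R V1 p + snd h *\<^sub>R V2 p))"
  have F': "blinfun_apply (F' p) = (\<lambda>h. fst h *\<^sub>R V1 p + snd h *\<^sub>R V2 p)" for p
    unfolding F'_def by (rule bounded_linear_Blinfun_apply) (intro bounded_linear_intros)
  have ctm: "continuous_on UNIV tm" unfolding tm_def using \<omega>_pos by (intro continuous_intros) auto
  have ccis: "continuous_on UNIV (\<lambda>x. cis (f x))" if "continuous_on UNIV f" for f :: "real \<times> real \<Rightarrow> real"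
    using continuous_on_compose2[OF cont_cis[of 1] that] by simp
  have cph: "continuous_on UNIV (ph j)" for j unfolding ph_def by (intro ccis continuous_intros)
  have cr: "continuous_on UNIV (\<lambda>p. \<rho> j (tm p))" "continuous_on UNIV (\<lambda>p. orbit_rhs \<epsilon> \<rho> j (tm p))" for j
    using continuous_on_compose2[OF orbit_cont(1)[OF o] ctm] continuous_on_compose2[OF orbit_cont(2)[OF o] ctm] by auto
  have w0: "complex_of_real \<omega> \<noteq> 0" using \<omega>_pos by simp
  have cV: "continuous_on UNIV V1" "continuous_on UNIV V2" unfolding V1_def V2_def
    by (intro continuous_on_vec_lambda continuous_intros cph cr ballI w0)+
  have cF': "continuous_on UNIV F'"
  proof (rule continuous_on_blinfun_componentwise)
    show "continuous_on UNIV (\<lambda>x. blinfun_apply (F' x) i)" for i unfolding F' by (intro continuous_intros cV)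
  qed
  have deriv: "(tor \<rho> has_derivative blinfun_apply (F' p)) (at p)" for p
  proof -
    have "((\<lambda>p. ph j p * \<rho> j (tm p)) has_derivative (\<lambda>h. ph j p * ((tm h) *\<^sub>R orbit_rhs \<epsilon> \<rho> j (tm p)) +
        (((1 - of_int (k j)) * snd h + (of_int (k j) - 2) * fst h) *\<^sub>R (\<i> * of_real 1 * ph j p)) * \<rho> j (tm p))) (at p)" for j
    proof (rule has_derivative_mult)
      have "((\<lambda>p :: real \<times> real. (1 - of_int (k j)) * snd p + (of_int (k j) - 2) * fst p) has_derivative (\<lambda>h. (1 - of_int (k j)) * snd h + (of_int (k j) - 2) * fst h)) (at p)"
        by (auto intro!: derivative_eq_intros)
      from has_derivative_compose[OF this cis_vderiv[of 1, unfolded has_vector_derivative_def]]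
      show "(ph j has_derivative (\<lambda>h. ((1 - of_int (k j)) * snd h + (of_int (k j) - 2) * fst h) *\<^sub>R (\<i> * of_real 1 * ph j p))) (at p)"
        unfolding ph_def by simp
      have "(tm has_derivative tm) (at p)" unfolding tm_def using \<omega>_pos by (auto intro!: derivative_eq_intros)
      from has_derivative_compose[OF this orbitD(1)[OF o, unfolded has_vector_derivative_def]]
      show "((\<lambda>p. \<rho> j (tm p)) has_derivative (\<lambda>h. (tm h) *\<^sub>R orbit_rhs \<epsilon> \<rho> j (tm p))) (at p)" .
    qed
    from chi_deriv[OF this] have "(tor \<rho> has_derivative (\<lambda>h. \<chi> j. ph j p * ((tm h) *\<^sub>R orbit_rhs \<epsilon> \<rho> j (tm p)) +
        (((1 - of_int (k j)) * snd h + (of_int (k j) - 2) * fst h) *\<^sub>R (\<i> * of_real 1 * ph j p)) * \<rho> j (tm p))) (at p)"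
      unfolding tor_def ph_def tm_def .
    also have "(\<lambda>h. \<chi> j. ph j p * ((tm h) *\<^sub>R orbit_rhs \<epsilon> \<rho> j (tm p)) +
        (((1 - of_int (k j)) * snd h + (of_int (k j) - 2) * fst h) *\<^sub>R (\<i> * of_real 1 * ph j p)) * \<rho> j (tm p)) = blinfun_apply (F' p)"
      unfolding F' V1_def V2_def fun_eq_iff vec_eq_iff vector_add_component vector_scaleR_component vec_lambda_beta
      by (simp add: scaleR_conv_of_real tm_def diff_divide_distrib algebra_simps)
    finally show ?thesis .
  qed
  have inj: "inj (blinfun_apply (F' p))" for p
  proof -
    have "h = 0" if h: "blinfun_apply (F' p) h = 0" for h
    proof -
      let ?x = "fst h" and ?y = "snd h" and ?d = "C * \<epsilon>"
      note lo = orbit_lower(1)[OF o sm]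
      have phn: "cmod (ph j p) = 1" for j by (simp add: ph_def)
      then have ph0: "ph j p \<noteq> 0" for j by (metis norm_zero zero_neq_one)
      have dd: "cmod (of_real ((?y - ?x) / \<omega>) * orbit_rhs \<epsilon> \<rho> j (tm p)) \<le> ((\<bar>?x\<bar> + \<bar>?y\<bar>) / \<omega>) * ?d" for j
      proof -
        have "\<bar>(?y - ?x) / \<omega>\<bar> \<le> (\<bar>?x\<bar> + \<bar>?y\<bar>) / \<omega>" using \<omega>_pos by (simp add: abs_divide divide_right_mono)
        then show ?thesis unfolding norm_mult norm_of_real using orbitD(6)[OF o, of j "tm p"] \<omega>_pos
          by (intro mult_mono) auto
      qed
      have hj: "of_real ?x * V1 p $ j + of_real ?y * V2 p $ j = 0" for j
      proof -
        have "(?x *\<^sub>R V1 p + ?y *\<^sub>R V2 p) $ j = 0" using h by (simp only: F' zero_index)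
        then show ?thesis unfolding vector_add_component vector_scaleR_component by (simp only: scaleR_conv_of_real)
      qed
      have "of_real ?x * (ph (-1) p * (- \<i> * \<rho> (-1) (tm p) - orbit_rhs \<epsilon> \<rho> (-1) (tm p) / of_real \<omega>)) + of_real ?y * (ph (-1) p * (orbit_rhs \<epsilon> \<rho> (-1) (tm p) / of_real \<omega>)) = 0"
        using hj[of "-1"] unfolding V1_def V2_def by simp
      then have "ph (-1) p * (of_real ?x * (- \<i> * \<rho> (-1) (tm p)) + of_real ((?y - ?x) / \<omega>) * orbit_rhs \<epsilon> \<rho> (-1) (tm p)) = 0"
        by (simp add: algebra_simps diff_divide_distrib)
      then have "of_real ?x * (\<i> * \<rho> (-1) (tm p)) = of_real ((?y - ?x) / \<omega>) * orbit_rhs \<epsilon> \<rho> (-1) (tm p)" using ph0 by simp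
      then have "\<bar>?x\<bar> * cmod (\<rho> (-1) (tm p)) \<le> ((\<bar>?x\<bar> + \<bar>?y\<bar>) / \<omega>) * ?d"
        using dd[of "-1"] by (metis (no_types, lifting) mult_1 norm_ii norm_mult norm_of_real)
      then have x: "\<bar>?x\<bar> * (sqrt I / 2) \<le> ((\<bar>?x\<bar> + \<bar>?y\<bar>) / \<omega>) * ?d"
        by (rule order_trans[rotated]) (rule mult_left_mono, use lo in auto)
      have "of_real ?x * (ph 0 p * (- orbit_rhs \<epsilon> \<rho> 0 (tm p) / of_real \<omega>)) + of_real ?y * (ph 0 p * (- \<i> * \<rho> 0 (tm p) + orbit_rhs \<epsilon> \<rho> 0 (tm p) / of_real \<omega>)) = 0"
        using hj[of 0] unfolding V1_def V2_def by simp
      then have "ph 0 p * (of_real ?y * (- \<i> * \<rho> 0 (tm p)) + of_real ((?y - ?x) / \<omega>) * orbit_rhs \<epsilon> \<rho> 0 (tm p)) = 0"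
        by (simp add: algebra_simps diff_divide_distrib)
      then have "of_real ?y * (\<i> * \<rho> 0 (tm p)) = of_real ((?y - ?x) / \<omega>) * orbit_rhs \<epsilon> \<rho> 0 (tm p)" using ph0 by simp
      then have "\<bar>?y\<bar> * cmod (\<rho> 0 (tm p)) \<le> ((\<bar>?x\<bar> + \<bar>?y\<bar>) / \<omega>) * ?d"
        using dd[of 0] by (metis (no_types, lifting) mult_1 norm_ii norm_mult norm_of_real)
      then have y: "\<bar>?y\<bar> * (sqrt I / 2) \<le> ((\<bar>?x\<bar> + \<bar>?y\<bar>) / \<omega>) * ?d"
        by (rule order_trans[rotated]) (rule mult_left_mono, use lo in auto)
      have "(\<bar>?x\<bar> + \<bar>?y\<bar>) * (sqrt I / 2) \<le> (\<bar>?x\<bar> + \<bar>?y\<bar>) * (2 * ?d / \<omega>)" using x y by (simp add: algebra_simps)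
      moreover have "2 * ?d / \<omega> < sqrt I / 2" using sm by (simp add: small_def)
      ultimately have "\<bar>?x\<bar> + \<bar>?y\<bar> \<le> 0" by (meson linorder_not_less mult_less_cancel_left_pos)
      then have "?x = 0" "?y = 0" by linarith+
      then show "h = 0" by (simp add: prod_eq_iff)
    qed
    then show ?thesis by (metis (no_types) blinfun.diff_right eq_iff_diff_eq_0 injI)
  qed
  show ?thesis unfolding torus2_def
  proof (rule exI[of _ "tor \<rho>"], rule exI[of _ F'], intro conjI allI)
    fix a b a' b'
    show "tor \<rho> (a, b) = tor \<rho> (a', b') \<longleftrightarrow> (\<exists>m n :: int. a - a' = 2 * pi * of_int m \<and> b - b' = 2 * pi * of_int n)"
      using tor_inj[OF o sm] tor_lattice[OF o] by blast
  qed (use deriv inj cF' in auto)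
qed

section \<open>The linearised equation in the rotating frame\<close>

definition nbr' :: "'a mod_ring \<Rightarrow> 'a chain \<Rightarrow> real \<Rightarrow> complex" where
  "nbr' j f t = cnj (\<theta> j (j + 1) t) * f (j + 1) t + cnj (\<theta> j (j - 1) t) * f (j - 1) t"

text \<open>The linearised equation with \<open>w\<close> and \<open>cnj w\<close> replaced by independent functions \<open>F\<close> and \<open>G\<close>, so that complex multipliers are
  treated like real ones.\<close>

definition linF :: "real \<Rightarrow> 'a chain \<Rightarrow> 'a chain \<Rightarrow> 'a chain \<Rightarrow> 'a chain" where
  "linF \<epsilon> \<rho> F G j t = (1 - of_int (k j) * of_real \<omega> + 2 * of_real \<epsilon> + 2 * \<rho> j t * cnj (\<rho> j t)) * F j t + (\<rho> j t)\<^sup>2 * G j t - of_real \<epsilon> * nbr j F t"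

definition linG :: "real \<Rightarrow> 'a chain \<Rightarrow> 'a chain \<Rightarrow> 'a chain \<Rightarrow> 'a chain" where
  "linG \<epsilon> \<rho> F G j t = (1 - of_int (k j) * of_real \<omega> + 2 * of_real \<epsilon> + 2 * \<rho> j t * cnj (\<rho> j t)) * G j t + (cnj (\<rho> j t))\<^sup>2 * F j t - of_real \<epsilon> * nbr' j G t"

text \<open>Solutions \<open>exp (\<kappa> t) (F, G)\<close> of the linearised equation with forcing \<open>(H, K)\<close>, in terms of \<open>F\<close> and \<open>G\<close>.\<close>

definition lin_sol :: "real \<Rightarrow> 'a chain \<Rightarrow> complex \<Rightarrow> 'a chain \<Rightarrow> 'a chain \<Rightarrow>
    'a chain \<Rightarrow> 'a chain \<Rightarrow> bool" where
  "lin_sol \<epsilon> \<rho> \<kappa> H K F G \<longleftrightarrow> (\<forall>j t. (F j has_vector_derivative - \<i> * (linF \<epsilon> \<rho> F G j t + H j t) - \<kappa> * F j t) (at t) \<and>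
     (G j has_vector_derivative \<i> * (linG \<epsilon> \<rho> F G j t + K j t) - \<kappa> * G j t) (at t))"

abbreviation "free_sol \<epsilon> \<rho> \<kappa> \<equiv> lin_sol \<epsilon> \<rho> \<kappa> (\<lambda>_ _. 0) (\<lambda>_ _. 0)"

lemma lin_solD:
  assumes "lin_sol \<epsilon> \<rho> \<kappa> H K F G"
  shows "(F j has_vector_derivative - \<i> * (linF \<epsilon> \<rho> F G j t + H j t) - \<kappa> * F j t) (at t)"
    "(G j has_vector_derivative \<i> * (linG \<epsilon> \<rho> F G j t + K j t) - \<kappa> * G j t) (at t)"
  using assms unfolding lin_sol_def by blast+

lemma lin_sol_cont:
  assumes "lin_sol \<epsilon> \<rho> \<kappa> H K F G" shows "continuous_on UNIV (F j)" "continuous_on UNIV (G j)"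
  by (rule cont_deriv[OF lin_solD(1)[OF assms]] cont_deriv[OF lin_solD(2)[OF assms]])+

lemma lin_sol_comb:
  assumes "lin_sol \<epsilon> \<rho> \<kappa> H K F G" "lin_sol \<epsilon> \<rho> \<kappa> H' K' F' G'"
  shows "lin_sol \<epsilon> \<rho> \<kappa> (\<lambda>j t. H j t - c * H' j t) (\<lambda>j t. K j t - c * K' j t) (\<lambda>j t. F j t - c * F' j t) (\<lambda>j t. G j t - c * G' j t)"
  unfolding lin_sol_def
proof (intro allI conjI)
  fix j t
  show "((\<lambda>t. F j t - c * F' j t) has_vector_derivative - \<i> * (linF \<epsilon> \<rho> (\<lambda>j t. F j t - c * F' j t) (\<lambda>j t. G j t - c * G' j t) j t + (H j t - c * H' j t)) - \<kappa> * (F j t - c * F' j t)) (at t)"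
    by (rule has_vector_derivative_eq_rhs[OF has_vector_derivative_diff[OF lin_solD(1)[OF assms(1)] has_vector_derivative_mult_right[OF lin_solD(1)[OF assms(2)]]]])
       (simp add: linF_def nbr_def algebra_simps)
  show "((\<lambda>t. G j t - c * G' j t) has_vector_derivative \<i> * (linG \<epsilon> \<rho> (\<lambda>j t. F j t - c * F' j t) (\<lambda>j t. G j t - c * G' j t) j t + (K j t - c * K' j t)) - \<kappa> * (G j t - c * G' j t)) (at t)"
    by (rule has_vector_derivative_eq_rhs[OF has_vector_derivative_diff[OF lin_solD(2)[OF assms(1)] has_vector_derivative_mult_right[OF lin_solD(2)[OF assms(2)]]]])
       (simp add: linG_def nbr'_def algebra_simps)
qed

lemma lin_sol_exponent:
  assumes "lin_sol \<epsilon> \<rho> 0 H K F G"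
  shows "lin_sol \<epsilon> \<rho> \<kappa> (\<lambda>j t. H j t + \<i> * \<kappa> * F j t) (\<lambda>j t. K j t - \<i> * \<kappa> * G j t) F G"
  unfolding lin_sol_def
proof (intro allI conjI)
  fix j t
  show "(F j has_vector_derivative - \<i> * (linF \<epsilon> \<rho> F G j t + (H j t + \<i> * \<kappa> * F j t)) - \<kappa> * F j t) (at t)"
    by (rule has_vector_derivative_eq_rhs[OF lin_solD(1)[OF assms]]) (simp add: algebra_simps)
  show "(G j has_vector_derivative \<i> * (linG \<epsilon> \<rho> F G j t + (K j t - \<i> * \<kappa> * G j t)) - \<kappa> * G j t) (at t)"
    by (rule has_vector_derivative_eq_rhs[OF lin_solD(2)[OF assms]]) (simp add: algebra_simps)
qed

text \<open>The currents through the bonds at which the rotation angle \<open>\<sigma>\<close> jumps.\<close>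

definition resid :: "'a chain \<Rightarrow> ('a mod_ring \<Rightarrow> real) \<Rightarrow> 'a chain" where
  "resid \<rho> \<sigma> j t = \<i> * (\<theta> j (j + 1) t * \<rho> (j + 1) t * of_real (\<sigma> j - \<sigma> (j + 1)) + \<theta> j (j - 1) t * \<rho> (j - 1) t * of_real (\<sigma> j - \<sigma> (j - 1)))"

text \<open>Rotating the phases of a part of the lattice only solves the linearised equation up to the currents through the bonds at which the
  rotation angle jumps.\<close>

lemma partial_gauge:
  assumes o: "orbit C \<epsilon> \<rho>"
  shows "lin_sol \<epsilon> \<rho> 0 (\<lambda>j t. - of_real \<epsilon> * resid \<rho> \<sigma> j t) (\<lambda>j t. - of_real \<epsilon> * cnj (resid \<rho> \<sigma> j t))
    (\<lambda>j t. \<i> * of_real (\<sigma> j) * \<rho> j t) (\<lambda>j t. - \<i> * of_real (\<sigma> j) * cnj (\<rho> j t))"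
  unfolding lin_sol_def
proof (intro allI conjI)
  fix j t
  show "((\<lambda>t. \<i> * of_real (\<sigma> j) * \<rho> j t) has_vector_derivative - \<i> * (linF \<epsilon> \<rho> (\<lambda>j t. \<i> * of_real (\<sigma> j) * \<rho> j t) (\<lambda>j t. - \<i> * of_real (\<sigma> j) * cnj (\<rho> j t)) j t +
      - of_real \<epsilon> * resid \<rho> \<sigma> j t) - 0 * (\<i> * of_real (\<sigma> j) * \<rho> j t)) (at t)"
    by (rule has_vector_derivative_eq_rhs[OF has_vector_derivative_mult_right[OF orbitD(1)[OF o]]])
       (simp add: orbit_rhs_def linF_def nbr_def resid_def algebra_simps power2_eq_square)
  show "((\<lambda>t. - \<i> * of_real (\<sigma> j) * cnj (\<rho> j t)) has_vector_derivative \<i> * (linG \<epsilon> \<rho> (\<lambda>j t. \<i> * of_real (\<sigma> j) * \<rho> j t) (\<lambda>j t. - \<i> * of_real (\<sigma> j) * cnj (\<rho> j t)) j t +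
      - of_real \<epsilon> * cnj (resid \<rho> \<sigma> j t)) - 0 * (- \<i> * of_real (\<sigma> j) * cnj (\<rho> j t))) (at t)"
    by (rule has_vector_derivative_eq_rhs[OF has_vector_derivative_mult_right[OF cnj_vderiv[OF orbitD(1)[OF o]]]])
       (simp add: orbit_rhs_def linG_def nbr_def nbr'_def resid_def algebra_simps power2_eq_square)
qed

text \<open>The time derivative of the orbit in the original frame, up to the factor \<open>- \<i>\<close> and the rotation of the frame.\<close>

definition Zt :: "real \<Rightarrow> 'a chain \<Rightarrow> 'a chain" where
  "Zt \<epsilon> \<rho> j t = of_int (k j) * of_real \<omega> * \<rho> j t + \<i> * orbit_rhs \<epsilon> \<rho> j t"

lemma \<theta>_deriv: "(\<theta> j n has_vector_derivative \<i> * (of_int (k j) - of_int (k n)) * of_real \<omega> * \<theta> j n t) (at t)"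
  unfolding \<theta>_def using cis_vderiv[of "of_int (k j - k n) * \<omega>" t] by (simp add: mult.assoc)

lemma Zt_deriv:
  assumes o: "orbit C \<epsilon> \<rho>"
  shows "(Zt \<epsilon> \<rho> j has_vector_derivative - \<i> * ((1 - of_int (k j) * of_real \<omega> + 2 * of_real \<epsilon> + 2 * \<rho> j t * cnj (\<rho> j t)) * Zt \<epsilon> \<rho> j t
     - (\<rho> j t)\<^sup>2 * cnj (Zt \<epsilon> \<rho> j t) - of_real \<epsilon> * nbr j (Zt \<epsilon> \<rho>) t)) (at t)"
proof -
  note d = orbitD(1)[OF o]
  let ?D = "orbit_rhs \<epsilon> \<rho>" and ?Z = "Zt \<epsilon> \<rho>"
  have Z: "?Z = (\<lambda>j t. (1 + 2 * of_real \<epsilon>) * \<rho> j t + \<rho> j t * \<rho> j t * cnj (\<rho> j t) - of_real \<epsilon> * (\<theta> j (j + 1) t * \<rho> (j + 1) t + \<theta> j (j - 1) t * \<rho> (j - 1) t))"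
    by (simp add: fun_eq_iff Zt_def orbit_rhs_def nbr_def algebra_simps power2_eq_square)
  have D: "?D i t = - \<i> * (?Z i t - of_int (k i) * of_real \<omega> * \<rho> i t)" for i
    by (simp add: Zt_def algebra_simps)
  have "((\<lambda>t. (1 + 2 * of_real \<epsilon>) * \<rho> j t + \<rho> j t * \<rho> j t * cnj (\<rho> j t) - of_real \<epsilon> * (\<theta> j (j + 1) t * \<rho> (j + 1) t + \<theta> j (j - 1) t * \<rho> (j - 1) t))
     has_vector_derivative (1 + 2 * of_real \<epsilon>) * ?D j t + (\<rho> j t * \<rho> j t * cnj (?D j t) + (\<rho> j t * ?D j t + ?D j t * \<rho> j t) * cnj (\<rho> j t))
       - of_real \<epsilon> * ((\<theta> j (j + 1) t * ?D (j + 1) t + \<i> * (of_int (k j) - of_int (k (j + 1))) * of_real \<omega> * \<theta> j (j + 1) t * \<rho> (j + 1) t) +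
          (\<theta> j (j - 1) t * ?D (j - 1) t + \<i> * (of_int (k j) - of_int (k (j - 1))) * of_real \<omega> * \<theta> j (j - 1) t * \<rho> (j - 1) t))) (at t)"
    by (intro has_vector_derivative_diff has_vector_derivative_add has_vector_derivative_mult_right has_vector_derivative_mult d cnj_vderiv \<theta>_deriv)
  then have *: "(?Z j has_vector_derivative (1 + 2 * of_real \<epsilon>) * ?D j t + (\<rho> j t * \<rho> j t * cnj (?D j t) + (\<rho> j t * ?D j t + ?D j t * \<rho> j t) * cnj (\<rho> j t))
       - of_real \<epsilon> * ((\<theta> j (j + 1) t * ?D (j + 1) t + \<i> * (of_int (k j) - of_int (k (j + 1))) * of_real \<omega> * \<theta> j (j + 1) t * \<rho> (j + 1) t) +
          (\<theta> j (j - 1) t * ?D (j - 1) t + \<i> * (of_int (k j) - of_int (k (j - 1))) * of_real \<omega> * \<theta> j (j - 1) t * \<rho> (j - 1) t))) (at t)"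
    by (simp only: Z)
  have Zj: "of_real \<epsilon> * (\<theta> j (j + 1) t * \<rho> (j + 1) t + \<theta> j (j - 1) t * \<rho> (j - 1) t) = (1 + 2 * of_real \<epsilon>) * \<rho> j t + \<rho> j t * \<rho> j t * cnj (\<rho> j t) - ?Z j t"
    by (subst Z) simp
  have ring: "(1 + 2 * e) * (- \<i> * (z - kj * w * p)) + (p * p * (\<i> * (z' - kj * w * p')) + (p * (- \<i> * (z - kj * w * p)) + (- \<i> * (z - kj * w * p)) * p) * p')
       - e * ((t1 * (- \<i> * (z1 - k1 * w * p1)) + \<i> * (kj - k1) * w * t1 * p1) + (t2 * (- \<i> * (z2 - k2 * w * p2)) + \<i> * (kj - k2) * w * t2 * p2))
     = - \<i> * ((1 - kj * w + 2 * e + 2 * p * p') * z - p\<^sup>2 * z' - e * (t1 * z1 + t2 * z2))"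
    if "e * (t1 * p1 + t2 * p2) = (1 + 2 * e) * p + p * p * p' - z" for e z kj w p p' z' t1 t2 z1 z2 k1 k2 p1 p2 :: complex
  proof -
    have "(1 + 2 * e) * (- \<i> * (z - kj * w * p)) + (p * p * (\<i> * (z' - kj * w * p')) + (p * (- \<i> * (z - kj * w * p)) + (- \<i> * (z - kj * w * p)) * p) * p')
       - e * ((t1 * (- \<i> * (z1 - k1 * w * p1)) + \<i> * (kj - k1) * w * t1 * p1) + (t2 * (- \<i> * (z2 - k2 * w * p2)) + \<i> * (kj - k2) * w * t2 * p2))
     - (- \<i> * ((1 - kj * w + 2 * e + 2 * p * p') * z - p\<^sup>2 * z' - e * (t1 * z1 + t2 * z2)))
     = \<i> * kj * w * ((1 + 2 * e) * p + p * p * p' - z - e * (t1 * p1 + t2 * p2))"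
      by (simp add: algebra_simps power2_eq_square)
    also have "\<dots> = 0" using that by simp
    finally show ?thesis by (rule eq_iff_diff_eq_0[THEN iffD2])
  qed
  show ?thesis
    by (rule has_vector_derivative_eq_rhs[OF *]) (unfold D nbr_def, simp only: complex_cnj_mult complex_cnj_diff complex_cnj_minus complex_cnj_i complex_cnj_of_int complex_cnj_complex_of_real minus_minus, rule ring[OF Zj])
qed

lemma time_mode:
  assumes o: "orbit C \<epsilon> \<rho>"
  shows "free_sol \<epsilon> \<rho> 0 (\<lambda>j t. \<i> * Zt \<epsilon> \<rho> j t) (\<lambda>j t. - \<i> * cnj (Zt \<epsilon> \<rho> j t))"
  unfolding lin_sol_def
proof (intro allI conjI)
  fix j t
  show "((\<lambda>t. \<i> * Zt \<epsilon> \<rho> j t) has_vector_derivative - \<i> * (linF \<epsilon> \<rho> (\<lambda>j t. \<i> * Zt \<epsilon> \<rho> j t) (\<lambda>j t. - \<i> * cnj (Zt \<epsilon> \<rho> j t)) j t + 0) - 0 * (\<i> * Zt \<epsilon> \<rho> j t)) (at t)"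
    by (rule has_vector_derivative_eq_rhs[OF has_vector_derivative_mult_right[OF Zt_deriv[OF o]]])
       (simp add: linF_def nbr_def algebra_simps)
  show "((\<lambda>t. - \<i> * cnj (Zt \<epsilon> \<rho> j t)) has_vector_derivative \<i> * (linG \<epsilon> \<rho> (\<lambda>j t. \<i> * Zt \<epsilon> \<rho> j t) (\<lambda>j t. - \<i> * cnj (Zt \<epsilon> \<rho> j t)) j t + 0) - 0 * (- \<i> * cnj (Zt \<epsilon> \<rho> j t))) (at t)"
    by (rule has_vector_derivative_eq_rhs[OF has_vector_derivative_mult_right[OF cnj_vderiv[OF Zt_deriv[OF o]]]])
       (simp add: linG_def nbr_def nbr'_def algebra_simps)
qed

lemma nbr_adjoint: "(\<Sum>j\<in>UNIV. G j t * nbr j F t) = (\<Sum>j\<in>UNIV. F j t * nbr' j G t)"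
proof -
  have "(\<Sum>j\<in>UNIV. F j t * nbr' j G t) = (\<Sum>j\<in>UNIV. F j t * (cnj (\<theta> j (j + 1) t) * G (j + 1) t)) + (\<Sum>j\<in>UNIV. F j t * (cnj (\<theta> j (j - 1) t) * G (j - 1) t))"
    by (simp add: nbr'_def distrib_left sum.distrib)
  also have "(\<Sum>j\<in>UNIV. F j t * (cnj (\<theta> j (j - 1) t) * G (j - 1) t)) = (\<Sum>j\<in>UNIV. F (j + 1) t * (cnj (\<theta> (j + 1) j t) * G j t))"
    by (subst sum_shift[symmetric]) simp
  also have "(\<Sum>j\<in>UNIV. F j t * (cnj (\<theta> j (j + 1) t) * G (j + 1) t)) = (\<Sum>j\<in>UNIV. F (j - 1) t * (cnj (\<theta> (j - 1) j t) * G j t))"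
    by (subst sum_shift[of "\<lambda>j. F (j - 1) t * (cnj (\<theta> (j - 1) j t) * G j t)", symmetric]) simp
  finally show ?thesis by (simp add: nbr_def cnj_\<theta> sum.distrib[symmetric] algebra_simps)
qed

text \<open>The symplectic form of two solutions is conserved up to the exponents that have been factored out.\<close>

lemma symplectic_deriv:
  assumes 1: "free_sol \<epsilon> \<rho> \<kappa> F G" and 2: "free_sol \<epsilon> \<rho> \<kappa>' F' G'"
  defines "W \<equiv> \<lambda>t. \<Sum>j\<in>UNIV. F' j t * G j t - G' j t * F j t"
  shows "(W has_vector_derivative - (\<kappa> + \<kappa>') * W t) (at t)"
proof -
  have "(W has_vector_derivative (\<Sum>j\<in>UNIV. (F' j t * (\<i> * (linG \<epsilon> \<rho> F G j t + 0) - \<kappa> * G j t) + (- \<i> * (linF \<epsilon> \<rho> F' G' j t + 0) - \<kappa>' * F' j t) * G j t)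
     - (G' j t * (- \<i> * (linF \<epsilon> \<rho> F G j t + 0) - \<kappa> * F j t) + (\<i> * (linG \<epsilon> \<rho> F' G' j t + 0) - \<kappa>' * G' j t) * F j t))) (at t)"
    unfolding W_def
    by (intro has_vector_derivative_sum has_vector_derivative_diff has_vector_derivative_mult
        lin_solD(1)[OF 1] lin_solD(2)[OF 1] lin_solD(1)[OF 2] lin_solD(2)[OF 2])
  also have "(\<Sum>j\<in>UNIV. (F' j t * (\<i> * (linG \<epsilon> \<rho> F G j t + 0) - \<kappa> * G j t) + (- \<i> * (linF \<epsilon> \<rho> F' G' j t + 0) - \<kappa>' * F' j t) * G j t)
     - (G' j t * (- \<i> * (linF \<epsilon> \<rho> F G j t + 0) - \<kappa> * F j t) + (\<i> * (linG \<epsilon> \<rho> F' G' j t + 0) - \<kappa>' * G' j t) * F j t))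
    = (\<Sum>j\<in>UNIV. - (\<kappa> + \<kappa>') * (F' j t * G j t - G' j t * F j t) + \<i> * of_real \<epsilon> * ((G j t * nbr j F' t - F' j t * nbr' j G t) + (F j t * nbr' j G' t - G' j t * nbr j F t)))"
    by (rule sum.cong) (simp_all add: linF_def linG_def algebra_simps power2_eq_square)
  also have "\<dots> = - (\<kappa> + \<kappa>') * W t + \<i> * of_real \<epsilon> * (((\<Sum>j\<in>UNIV. G j t * nbr j F' t) - (\<Sum>j\<in>UNIV. F' j t * nbr' j G t)) + ((\<Sum>j\<in>UNIV. F j t * nbr' j G' t) - (\<Sum>j\<in>UNIV. G' j t * nbr j F t)))"
    unfolding W_def sum.distrib sum_distrib_left[symmetric] sum_subtractf ..
  also have "\<dots> = - (\<kappa> + \<kappa>') * W t" by (simp add: nbr_adjoint)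
  finally show ?thesis .
qed

text \<open>The norm balance of a single site: only the currents to its neighbours and the forcing change its norm.\<close>

lemma flux_deriv:
  assumes o: "orbit C \<epsilon> \<rho>" and l: "lin_sol \<epsilon> \<rho> \<kappa> H K F G"
  shows "((\<lambda>t. cnj (\<rho> j t) * F j t + \<rho> j t * G j t) has_vector_derivative
    - \<i> * of_real \<epsilon> * (F j t * nbr' j (\<lambda>j t. cnj (\<rho> j t)) t - cnj (\<rho> j t) * nbr j F t - G j t * nbr j \<rho> t + \<rho> j t * nbr' j G t)
    - \<i> * (cnj (\<rho> j t) * H j t - \<rho> j t * K j t) - \<kappa> * (cnj (\<rho> j t) * F j t + \<rho> j t * G j t)) (at t)"
proof -
  have cn: "cnj (nbr j \<rho> t) = nbr' j (\<lambda>j t. cnj (\<rho> j t)) t" by (simp add: nbr_def nbr'_def)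
  show ?thesis
    by (rule has_vector_derivative_eq_rhs[OF has_vector_derivative_add[OF has_vector_derivative_mult[OF cnj_vderiv[OF orbitD(1)[OF o]] lin_solD(1)[OF l]]
        has_vector_derivative_mult[OF orbitD(1)[OF o] lin_solD(2)[OF l]]]])
       (simp add: orbit_rhs_def linF_def linG_def cn algebra_simps power2_eq_square)
qed

lemma periodic_linear_zero:
  assumes "\<And>t. (x has_vector_derivative - \<nu> * x t) (at t)" "\<And>t. x (t + T) = x t" "Re \<nu> \<le> 0" "exp (\<nu> * of_real T) \<noteq> 1"
  shows "x t = 0"
proof -
  have "norm (1 - exp (\<nu> * of_real T)) * norm (x t) \<le> 0 * T"
    by (rule periodic_linear_bound[OF T_pos, of x "\<lambda>_. 0"]) (use assms in auto)
  then show ?thesis using assms(4) by (simp add: mult_le_0_iff)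
qed

end

section \<open>Uniform error bounds along a sequence\<close>

text \<open>A Landau symbol along a sequence, uniform in time.\<close>

definition ubig :: "(nat \<Rightarrow> real \<Rightarrow> complex) \<Rightarrow> (nat \<Rightarrow> real) \<Rightarrow> bool" where
  "ubig f g \<longleftrightarrow> (\<exists>C\<ge>0. \<forall>\<^sub>F n in sequentially. \<forall>t. cmod (f n t) \<le> C * g n)"

lemma ubigI: "(\<And>n t. cmod (f n t) \<le> C * g n) \<Longrightarrow> C \<ge> 0 \<Longrightarrow> ubig f g"
  unfolding ubig_def by (auto intro!: exI[of _ C] always_eventually)

lemma ubig_add: "ubig f g \<Longrightarrow> ubig f' g \<Longrightarrow> ubig (\<lambda>n t. f n t + f' n t) g"
proof -
  assume "ubig f g" "ubig f' g"
  then obtain C C' where C: "C \<ge> 0" "\<forall>\<^sub>F n in sequentially. \<forall>t. cmod (f n t) \<le> C * g n" "C' \<ge> 0" "\<forall>\<^sub>F n in sequentially. \<forall>t. cmod (f' n t) \<le> C' * g n"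
    unfolding ubig_def by blast
  have "\<forall>\<^sub>F n in sequentially. \<forall>t. cmod (f n t + f' n t) \<le> (C + C') * g n"
    using C(2,4) by eventually_elim (auto simp: distrib_right intro!: norm_triangle_mono)
  then show ?thesis unfolding ubig_def using C by (intro exI[of _ "C + C'"]) auto
qed

lemma ubig_mult: "ubig f g \<Longrightarrow> ubig f' g' \<Longrightarrow> ubig (\<lambda>n t. f n t * f' n t) (\<lambda>n. g n * g' n)"
proof -
  assume "ubig f g" "ubig f' g'"
  then obtain C C' where C: "C \<ge> 0" "\<forall>\<^sub>F n in sequentially. \<forall>t. cmod (f n t) \<le> C * g n" "C' \<ge> 0" "\<forall>\<^sub>F n in sequentially. \<forall>t. cmod (f' n t) \<le> C' * g' n"
    unfolding ubig_def by blast
  have "\<forall>\<^sub>F n in sequentially. \<forall>t. cmod (f n t * f' n t) \<le> (C * C') * (g n * g' n)"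
    using C(2,4)
  proof eventually_elim
    case (elim n)
    have "cmod (f n t) * cmod (f' n t) \<le> (C * g n) * (C' * g' n)" for t
      using elim order_trans[OF norm_ge_zero, of "f n t" "C * g n"] by (intro mult_mono) auto
    then show ?case by (simp add: norm_mult mult_ac)
  qed
  then show ?thesis unfolding ubig_def using C by (intro exI[of _ "C * C'"]) auto
qed

lemma ubig_trans: "ubig f g \<Longrightarrow> \<forall>\<^sub>F n in sequentially. g n \<le> K * g' n \<Longrightarrow> K \<ge> 0 \<Longrightarrow> ubig f g'"
proof -
  assume "ubig f g" and g: "\<forall>\<^sub>F n in sequentially. g n \<le> K * g' n" "K \<ge> 0"
  then obtain C where C: "C \<ge> 0" "\<forall>\<^sub>F n in sequentially. \<forall>t. cmod (f n t) \<le> C * g n" unfolding ubig_def by blast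
  have "\<forall>\<^sub>F n in sequentially. \<forall>t. cmod (f n t) \<le> (C * K) * g' n"
    using C(2) g(1)
  proof eventually_elim
    case (elim n)
    have "C * g n \<le> C * (K * g' n)" using elim C(1) by (intro mult_left_mono) auto
    then show ?case using elim(1) by (metis (no_types, lifting) dual_order.trans mult.assoc)
  qed
  then show ?thesis unfolding ubig_def using C g(2) by (intro exI[of _ "C * K"]) auto
qed

lemma ubig_le: "ubig f g \<Longrightarrow> (\<And>n. g n \<le> g' n) \<Longrightarrow> ubig f g'"
  by (rule ubig_trans[of f g 1]) auto

lemma ubig_dom: "ubig f g \<Longrightarrow> (\<And>n t. cmod (f' n t) \<le> cmod (f n t)) \<Longrightarrow> ubig f' g"
proof -
  assume "ubig f g" and d: "\<And>n t. cmod (f' n t) \<le> cmod (f n t)"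
  then obtain C where C: "C \<ge> 0" "\<forall>\<^sub>F n in sequentially. \<forall>t. cmod (f n t) \<le> C * g n" unfolding ubig_def by blast
  have "\<forall>\<^sub>F n in sequentially. \<forall>t. cmod (f' n t) \<le> C * g n"
    using C(2) by eventually_elim (meson d order_trans)
  then show ?thesis unfolding ubig_def using C(1) by blast
qed

lemma ubig_cmult: "ubig f g \<Longrightarrow> ubig (\<lambda>n t. c * f n t) g"
  using ubig_mult[OF ubigI[of "\<lambda>_ _. c" "cmod c" "\<lambda>_. 1"], of f g] by simp

lemma ubig_uminus: "ubig f g \<Longrightarrow> ubig (\<lambda>n t. - f n t) g"
  by (erule ubig_dom) simp

lemma ubig_diff: "ubig f g \<Longrightarrow> ubig f' g \<Longrightarrow> ubig (\<lambda>n t. f n t - f' n t) g"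
  using ubig_add[OF _ ubig_uminus, of f g f'] by simp

lemma ubig_cnj: "ubig f g \<Longrightarrow> ubig (\<lambda>n t. cnj (f n t)) g"
  by (erule ubig_dom) simp

lemma ubig_sum: "finite A \<Longrightarrow> (\<And>i. i \<in> A \<Longrightarrow> ubig (f i) g) \<Longrightarrow> ubig (\<lambda>n t. \<Sum>i\<in>A. f i n t) g"
proof (induction A rule: finite_induct)
  case empty then show ?case by (auto simp: ubig_def intro!: exI[of _ 0])
next
  case (insert a A) then show ?case using ubig_add[of "f a" g "\<lambda>n t. \<Sum>i\<in>A. f i n t"] by simp
qed

lemma ubig_avg: "T > 0 \<Longrightarrow> ubig f g \<Longrightarrow> ubig (\<lambda>n t. avg T (f n)) g"
proof -
  assume T: "T > 0" and "ubig f g"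
  then obtain C where C: "C \<ge> 0" "\<forall>\<^sub>F n in sequentially. \<forall>t. cmod (f n t) \<le> C * g n" unfolding ubig_def by blast
  have "\<forall>\<^sub>F n in sequentially. \<forall>t::real. cmod (avg T (f n)) \<le> C * g n"
    using C(2) by eventually_elim (use avg_bound[OF T] in blast)
  then show ?thesis unfolding ubig_def using C(1) by blast
qed

lemma ubig_eq: "ubig f g \<Longrightarrow> (\<And>n t. f' n t = f n t) \<Longrightarrow> ubig f' g"
  by (erule ubig_dom) simp

lemma ubig_mult_le: "ubig f g \<Longrightarrow> ubig f' g' \<Longrightarrow> (\<And>n. g n * g' n \<le> G n) \<Longrightarrow> ubig (\<lambda>n t. f n t * f' n t) G"
  by (rule ubig_le[OF ubig_mult])

lemma periodic_bounded:
  fixes f :: "real \<Rightarrow> complex"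
  assumes "T > 0" "continuous_on UNIV f" "\<And>t. f (t + T) = f t"
  shows "\<exists>B. \<forall>t. cmod (f t) \<le> B"
proof -
  have "compact (f ` {0..T})" using assms(2) by (intro compact_continuous_image continuous_on_subset[OF assms(2)]) auto
  then obtain B where B: "\<forall>x\<in>f ` {0..T}. cmod x \<le> B" using compact_imp_bounded bounded_iff by blast
  have "cmod (f t) \<le> B" for t
  proof -
    obtain n where n: "t + of_int n * T \<in> {0..T}" using reduce_period[OF assms(1)] by blast
    then have "cmod (f (t + of_int n * T)) \<le> B" using B by blast
    then show ?thesis using periodic_int[of f T, OF assms(3)] by simp
  qed
  then show ?thesis by blast
qed

context resonant_chain
begin

lemma ubig_fourier:
  assumes h: "\<And>n. continuous_on UNIV (h n)" and m: "m \<noteq> 0"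
    and a: "ubig (\<lambda>n t. h n t - (a n * cis (of_int p * \<omega> * t) + b n)) g"
  shows "ubig (\<lambda>n t. avg T (\<lambda>t. h n t * cis (- (of_int m * \<omega>) * t)) - (if p = m then a n else 0)) g"
proof (rule ubig_eq[OF ubig_avg[OF T_pos]])
  show "ubig (\<lambda>n t. (h n t - (a n * cis (of_int p * \<omega> * t) + b n)) * cis (- (of_int m * \<omega>) * t)) g"
    by (rule ubig_dom[OF a]) (simp add: norm_mult)
  fix n and t :: real
  have e: "cis (of_int p * \<omega> * t) * cis (- (of_int m * \<omega>) * t) = cis (of_int (p - m) * \<omega> * t)" for t
    unfolding cis_mult by (simp add: algebra_simps)
  have f: "(\<lambda>t. (h n t - (a n * cis (of_int p * \<omega> * t) + b n)) * cis (- (of_int m * \<omega>) * t)) =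
     (\<lambda>t. h n t * cis (- (of_int m * \<omega>) * t) - (a n * cis (of_int (p - m) * \<omega> * t) + b n * cis (of_int (- m) * \<omega> * t)))"
    by (simp only: fun_eq_iff e[symmetric]) (simp add: algebra_simps)
  have c1: "continuous_on UNIV (\<lambda>t. h n t * cis (- (of_int m * \<omega>) * t))" "continuous_on UNIV (\<lambda>t. a n * cis (of_int (p - m) * \<omega> * t))" "continuous_on UNIV (\<lambda>t. b n * cis (of_int (- m) * \<omega> * t))"
    by (intro continuous_on_mult continuous_on_const h cont_cis)+
  have z1: "avg T (\<lambda>t. cis (of_int (- m) * \<omega> * t)) = 0" using m by (intro avg_cis[OF T_pos \<omega>T]) simp
  have z2: "avg T (\<lambda>t. cis (of_int (p - m) * \<omega> * t)) = (if p = m then 1 else 0)"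
    using avg_cis[OF T_pos \<omega>T, of "p - m"] avg_const[OF T_pos, of 1] by auto
  have "avg T (\<lambda>t. h n t * cis (- (of_int m * \<omega>) * t) - (a n * cis (of_int (p - m) * \<omega> * t) + b n * cis (of_int (- m) * \<omega> * t)))
    = avg T (\<lambda>t. h n t * cis (- (of_int m * \<omega>) * t)) - (a n * avg T (\<lambda>t. cis (of_int (p - m) * \<omega> * t)) + b n * avg T (\<lambda>t. cis (of_int (- m) * \<omega> * t)))"
    using avg_diff[OF c1(1) continuous_on_add[OF c1(2,3)], of T] avg_add[OF c1(2,3), of T] by (simp only: avg_cmult)
  then show "avg T (\<lambda>t. h n t * cis (- (of_int m * \<omega>) * t)) - (if p = m then a n else 0) =
     avg T (\<lambda>t. (h n t - (a n * cis (of_int p * \<omega> * t) + b n)) * cis (- (of_int m * \<omega>) * t))"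
    unfolding f z1 z2 by (cases "p = m") simp_all
qed

text \<open>The twist leaves the forced harmonic \<open>\<plusminus>p\<close> off resonance, so that its amplitude is read off from the forcing to leading order.\<close>

lemma ubig_fourier_site:
  fixes p :: int
  assumes p: "p = 1 \<or> p = -1"
    and F: "\<And>n t. (F n has_vector_derivative (- \<i> * (of_real c * (F n t + G n t) + h1 n t))) (at t)" "\<And>n t. F n (t + T) = F n t"
    and G: "\<And>n t. (G n has_vector_derivative (\<i> * (of_real c * (F n t + G n t) + h2 n t))) (at t)" "\<And>n t. G n (t + T) = G n t"
    and h: "\<And>n. continuous_on UNIV (h1 n)" "\<And>n. continuous_on UNIV (h2 n)"
    and a: "ubig (\<lambda>n t. h1 n t - (a1 n * cis (of_int p * \<omega> * t) + b1 n)) g" "ubig (\<lambda>n t. h2 n t - (a2 n * cis (of_int (- p) * \<omega> * t) + b2 n)) g"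
  shows "ubig (\<lambda>n t. avg T (\<lambda>t. F n t * cis (- (of_int p * \<omega>) * t)) - a1 n * of_real ((c - of_int p * \<omega>) / \<omega>\<^sup>2)) g"
    and "ubig (\<lambda>n t. avg T (\<lambda>t. G n t * cis (- (of_int (- p) * \<omega>) * t)) - a2 n * of_real ((c - of_int p * \<omega>) / \<omega>\<^sup>2)) g"
proof -
  let ?ft = "\<lambda>m h. avg T (\<lambda>t. h t * cis (- (of_int m * \<omega>) * t))"
  have per0: "F n T = F n 0" "G n T = G n 0" for n using F(2)[of n 0] G(2)[of n 0] by simp_all
  have p0: "p \<noteq> 0" "- p \<noteq> 0" "p \<noteq> - p" "- p \<noteq> p" using p by auto
  have w0: "complex_of_real \<omega> \<noteq> 0" using \<omega>_pos by simp
  have pp: "of_int p * of_int p = (1 :: complex)" using p by auto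
  note f = phase_action_fourier[OF T_pos \<omega>T _ F(1) per0(1) G(1) per0(2) h]
  have e1: "ubig (\<lambda>n t. ?ft p (h1 n) - a1 n) g" "ubig (\<lambda>n t. ?ft p (h2 n) - 0) g"
    using ubig_fourier[OF h(1) p0(1) a(1)] ubig_fourier[OF h(2) p0(1) a(2)] p0 by simp_all
  have e2: "ubig (\<lambda>n t. ?ft (- p) (h1 n) - 0) g" "ubig (\<lambda>n t. ?ft (- p) (h2 n) - a2 n) g"
    using ubig_fourier[OF h(1) p0(2) a(1)] ubig_fourier[OF h(2) p0(2) a(2)] p0 by simp_all
  define W where "W = complex_of_real \<omega>"
  define q where "q = (of_int p :: complex)"
  have f1: "?ft p (F n) = - ?ft p (h1 n) * (q / W) - of_real c * (?ft p (h2 n) - ?ft p (h1 n)) * (1 / W\<^sup>2)" for n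
    using p f(1)[OF p0(1), of n] unfolding q_def W_def by (elim disjE) simp_all
  have f2: "?ft (- p) (G n) = - ?ft (- p) (h2 n) * (q / W) + of_real c * (?ft (- p) (h2 n) - ?ft (- p) (h1 n)) * (1 / W\<^sup>2)" for n
    using p f(2)[OF p0(2), of n] unfolding q_def W_def by (elim disjE) simp_all
  have val: "of_real ((c - of_int p * \<omega>) / \<omega>\<^sup>2) = of_real c * (1 / W\<^sup>2) - q / W"
    using w0 by (simp add: W_def q_def diff_divide_distrib power2_eq_square)
  have "ubig (\<lambda>n t. (of_real c * (1 / W\<^sup>2) - q / W) * (?ft p (h1 n) - a1 n) - (of_real c * (1 / W\<^sup>2)) * (?ft p (h2 n) - 0)) g"
    by (intro ubig_diff ubig_cmult e1)
  then show "ubig (\<lambda>n t. ?ft p (F n) - a1 n * of_real ((c - of_int p * \<omega>) / \<omega>\<^sup>2)) g"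
    by (rule ubig_eq) (simp only: f1 val, simp add: algebra_simps)
  have "ubig (\<lambda>n t. (of_real c * (1 / W\<^sup>2) - q / W) * (?ft (- p) (h2 n) - a2 n) - (of_real c * (1 / W\<^sup>2)) * (?ft (- p) (h1 n) - 0)) g"
    by (intro ubig_diff ubig_cmult e2)
  then show "ubig (\<lambda>n t. ?ft (- p) (G n) - a2 n * of_real ((c - of_int p * \<omega>) / \<omega>\<^sup>2)) g"
    by (rule ubig_eq) (simp only: f2 val, simp add: algebra_simps)
qed

text \<open>The relative rotation of the two halves of the chain.  The sites \<open>\<plusminus>2\<close> rotate with their excited neighbours, which moves the jump of
  the angle to bonds between empty sites and keeps the residual at these sites small.\<close>

definition \<sigma> :: "'a mod_ring \<Rightarrow> real" where
  "\<sigma> j = (if j = 1 \<or> j = 2 then 1 else if j = -1 \<or> j = -2 then -1 else 0)"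

lemma \<sigma>_eqs [simp]: "\<sigma> 0 = 0" "\<sigma> 1 = 1" "\<sigma> 2 = 1" "\<sigma> (-1) = -1" "\<sigma> (-2) = -1"
  by (simp_all add: \<sigma>_def)

lemma \<sigma>_bound: "\<bar>\<sigma> j\<bar> \<le> 1" by (simp add: \<sigma>_def)

abbreviation "rr \<equiv> \<lambda>(j :: 'a mod_ring) (t :: real). complex_of_real (r j)"

lemma resid_rr:
  "resid rr \<sigma> 1 t = \<i> * of_real (r 0) * cis (of_int (-1) * \<omega> * t)"
  "resid rr \<sigma> (-1) t = - \<i> * of_real (r 0) * cis (of_int (-1) * \<omega> * t)"
  "resid rr \<sigma> 0 t = - \<i> * of_real (r 1 - r (-1)) * cis (of_int 1 * \<omega> * t)"
  "j \<notin> {-1, 0, 1} \<Longrightarrow> resid rr \<sigma> j t = 0"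
proof -
  show "resid rr \<sigma> 1 t = \<i> * of_real (r 0) * cis (of_int (-1) * \<omega> * t)"
    by (simp add: resid_def \<theta>_def mult_ac del: r_eqs)
  show "resid rr \<sigma> (-1) t = - \<i> * of_real (r 0) * cis (of_int (-1) * \<omega> * t)"
    by (simp add: resid_def \<theta>_def mult_ac del: r_eqs(1))
  show "resid rr \<sigma> 0 t = - \<i> * of_real (r 1 - r (-1)) * cis (of_int 1 * \<omega> * t)"
    by (simp add: resid_def \<theta>_def algebra_simps del: r_eqs)
  assume j: "j \<notin> {-1, 0, 1}"
  have p: "j + 1 \<notin> {-1, 0, 1} \<or> j = -2"
    using j by (auto simp: eq_neg_iff_add_eq_0 add.assoc)
  have q: "j - 1 \<notin> {-1, 0, 1} \<or> j = 2"
    using j by (auto simp: eq_neg_iff_add_eq_0 diff_eq_eq)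
  have "of_real (r (j + 1)) * complex_of_real (\<sigma> j - \<sigma> (j + 1)) = 0" using p r_sq(3) by auto
  moreover have "of_real (r (j - 1)) * complex_of_real (\<sigma> j - \<sigma> (j - 1)) = 0" using q r_sq(3) by auto
  ultimately show "resid rr \<sigma> j t = 0" by (simp only: resid_def mult.assoc) simp
qed

text \<open>A combination of the gauge mode, the time mode and the relative phase mode.\<close>

definition mF :: "real \<Rightarrow> 'a chain \<Rightarrow> complex \<Rightarrow> complex \<Rightarrow> complex \<Rightarrow> 'a chain" where
  "mF \<epsilon> \<rho> \<alpha> \<beta> d j t = \<i> * (\<alpha> * \<rho> j t + \<beta> * Zt \<epsilon> \<rho> j t + d * of_real (\<sigma> j) * \<rho> j t)"

definition mG :: "real \<Rightarrow> 'a chain \<Rightarrow> complex \<Rightarrow> complex \<Rightarrow> complex \<Rightarrow> 'a chain" where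
  "mG \<epsilon> \<rho> \<alpha> \<beta> d j t = - \<i> * (\<alpha> * cnj (\<rho> j t) + \<beta> * cnj (Zt \<epsilon> \<rho> j t) + d * of_real (\<sigma> j) * cnj (\<rho> j t))"

end

section \<open>Slow modes to leading order\<close>

text \<open>A sequence of perturbations with rate \<open>\<kappa> n\<close> tending to zero, split into the combination of phase modes with coefficients \<open>\<alpha>\<close>, \<open>\<beta>\<close>, \<open>d\<close>
  and a remainder \<open>v\<close> whose phases vanish at time 0.  The constants \<open>m\<close> are the forces of the instability argument; for Floquet modes they are zero.\<close>

locale mode_seq = resonant_chain I \<omega> T s r k
  for I \<omega> T s :: real and r :: "'a::nontriv mod_ring \<Rightarrow> real" and k :: "'a mod_ring \<Rightarrow> int" +
  fixes C0 :: real and \<epsilon> :: "nat \<Rightarrow> real" and \<kappa> :: "nat \<Rightarrow> complex" and \<rho> :: "nat \<Rightarrow> 'a chain"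
    and \<alpha> \<beta> d :: "nat \<Rightarrow> complex" and m :: "nat \<Rightarrow> 'a mod_ring \<Rightarrow> complex"
    and vF vG :: "nat \<Rightarrow> 'a chain"
  assumes C0: "C0 \<ge> 0" and eps: "\<And>n. \<epsilon> n > 0" and lim: "(\<lambda>n. \<epsilon> n + cmod (\<kappa> n)) \<longlonglongrightarrow> 0"
    and orb: "\<And>n. orbit C0 (\<epsilon> n) (\<rho> n)"
    and per: "\<And>n j t. vF n j (t + T) = vF n j t" "\<And>n j t. vG n j (t + T) = vG n j t"
    and ph0: "\<And>n j. j \<in> {-1, 0, 1} \<Longrightarrow> vF n j 0 - vG n j 0 = 0"
    and m0: "\<And>n j. j \<notin> {-1, 0, 1} \<Longrightarrow> m n j = 0"
    and ode: "\<And>n. lin_sol (\<epsilon> n) (\<rho> n) (\<kappa> n)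
       (\<lambda>j t. - \<i> * m n j + d n * of_real (\<epsilon> n) * resid (\<rho> n) \<sigma> j t - \<i> * \<kappa> n * mF (\<epsilon> n) (\<rho> n) (\<alpha> n) (\<beta> n) (d n) j t)
       (\<lambda>j t. \<i> * m n j + d n * of_real (\<epsilon> n) * cnj (resid (\<rho> n) \<sigma> j t) + \<i> * \<kappa> n * mG (\<epsilon> n) (\<rho> n) (\<alpha> n) (\<beta> n) (d n) j t)
       (vF n) (vG n)"
begin

text \<open>All estimates are in terms of the small parameter \<open>\<eta>\<close>, the first-order size \<open>\<delta>\<close> of the remainder \<open>v\<close>, and the size \<open>E\<close> of
  the terms that are neglected.  The leading order of the phase of site \<open>j\<close> is \<open>cph n j\<close>.\<close>

definition "\<eta> n = \<epsilon> n + cmod (\<kappa> n)"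
definition "c n = cmod (\<alpha> n) + cmod (\<beta> n) + cmod (d n)"
definition "\<delta> n = \<epsilon> n * cmod (d n) + cmod (\<kappa> n) * c n"
definition "E n = \<eta> n * \<delta> n"
definition "cph n j = \<alpha> n + \<beta> n * of_int (k j) * of_real \<omega> + d n * of_real (\<sigma> j)"

lemma nonneg: "c n \<ge> 0" "\<delta> n \<ge> 0" "\<eta> n \<ge> 0" "E n \<ge> 0" "\<epsilon> n \<ge> 0"
  using eps[of n] by (auto simp: c_def \<delta>_def \<eta>_def E_def)

lemma dom: "\<epsilon> n \<le> \<eta> n" "cmod (\<kappa> n) \<le> \<eta> n" "\<epsilon> n * cmod (d n) \<le> \<delta> n" "cmod (\<kappa> n) * c n \<le> \<delta> n" "cmod (d n) \<le> c n" "cmod (\<alpha> n) \<le> c n" "cmod (\<beta> n) \<le> c n"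
  using eps[of n] nonneg[of n] by (auto simp: \<eta>_def \<delta>_def c_def)

lemma domE: "\<epsilon> n * \<delta> n \<le> E n" "cmod (\<kappa> n) * \<delta> n \<le> E n" "\<epsilon> n * (cmod (\<kappa> n) * c n) \<le> E n" "\<epsilon> n * (\<epsilon> n * cmod (d n)) \<le> E n"
  unfolding E_def using dom[of n] nonneg[of n] by (auto intro!: mult_mono)

lemma eps_lim: "\<epsilon> \<longlonglongrightarrow> 0" and eta_lim: "\<eta> \<longlonglongrightarrow> 0"
proof -
  show e: "\<eta> \<longlonglongrightarrow> 0" using lim unfolding \<eta>_def .
  show "\<epsilon> \<longlonglongrightarrow> 0" by (rule tendsto_sandwich[OF _ _ tendsto_const e]) (use nonneg dom in auto)
qed

lemma eps_le_1: "\<forall>\<^sub>F n in sequentially. \<epsilon> n \<le> 1"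
  using order_tendstoD(2)[OF eps_lim, of 1] by (auto elim: eventually_mono)

lemma ubig_eps_1: "ubig f \<epsilon> \<Longrightarrow> ubig f (\<lambda>_. 1)"
  by (rule ubig_trans[of f \<epsilon> 1]) (use eps_le_1 in auto)

lemma ubig_const: "ubig (\<lambda>n t. a) (\<lambda>_. 1)" by (rule ubigI[of _ "cmod a"]) auto

lemma ubig_scalars: "ubig (\<lambda>n t. of_real (\<epsilon> n)) \<epsilon>" "ubig (\<lambda>n t. \<kappa> n) (\<lambda>n. cmod (\<kappa> n))" "ubig (\<lambda>n t. d n) (\<lambda>n. cmod (d n))"
  "ubig (\<lambda>n t. \<alpha> n) c" "ubig (\<lambda>n t. \<beta> n) c" "ubig (\<lambda>n t. d n) c" "ubig (\<lambda>n t. \<theta> i j t) (\<lambda>_. 1)" "ubig (\<lambda>n t. cnj (\<theta> i j t)) (\<lambda>_. 1)"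
  using nonneg dom by (auto intro!: ubigI[of _ 1])

lemma ubig_\<rho>_diff: "ubig (\<lambda>n t. \<rho> n j t - of_real (r j)) \<epsilon>"
  by (rule ubigI[of _ C0]) (use orbitD(5)[OF orb] C0 in auto)

lemma ubig_rhs: "ubig (\<lambda>n t. orbit_rhs (\<epsilon> n) (\<rho> n) j t) \<epsilon>"
  by (rule ubigI[of _ C0]) (use orbitD(6)[OF orb] C0 in auto)

lemma ubig_\<rho>: "ubig (\<lambda>n t. \<rho> n j t) (\<lambda>_. 1)"
  using ubig_add[OF ubig_eps_1[OF ubig_\<rho>_diff[of j]] ubig_const[of "of_real (r j)"]] by simp

lemma ubig_\<rho>_non: "j \<notin> {-1, 0, 1} \<Longrightarrow> ubig (\<lambda>n t. \<rho> n j t) \<epsilon>"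
  using ubig_\<rho>_diff[of j] r_sq(3)[of j] by simp

lemma ubig_Z_diff: "ubig (\<lambda>n t. Zt (\<epsilon> n) (\<rho> n) j t - of_int (k j) * of_real \<omega> * of_real (r j)) \<epsilon>"
  by (rule ubig_eq[OF ubig_add[OF ubig_cmult[OF ubig_\<rho>_diff[of j], of "of_int (k j) * of_real \<omega>"] ubig_cmult[OF ubig_rhs[of j], of \<i>]]])
     (simp add: Zt_def algebra_simps)

lemma ubig_mF_diff:
  "ubig (\<lambda>n t. mF (\<epsilon> n) (\<rho> n) (\<alpha> n) (\<beta> n) (d n) j t - \<i> * of_real (r j) * cph n j) (\<lambda>n. \<epsilon> n * c n)"
  "ubig (\<lambda>n t. mG (\<epsilon> n) (\<rho> n) (\<alpha> n) (\<beta> n) (d n) j t + \<i> * of_real (r j) * cph n j) (\<lambda>n. \<epsilon> n * c n)"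
proof -
  note a = ubig_mult_le[OF ubig_\<rho>_diff[of j] ubig_scalars(4)] ubig_mult_le[OF ubig_Z_diff[of j] ubig_scalars(5)] ubig_mult_le[OF ubig_\<rho>_diff[of j] ubig_scalars(6)]
  have "ubig (\<lambda>n t. \<i> * ((\<rho> n j t - of_real (r j)) * \<alpha> n + (Zt (\<epsilon> n) (\<rho> n) j t - of_int (k j) * of_real \<omega> * of_real (r j)) * \<beta> n + of_real (\<sigma> j) * ((\<rho> n j t - of_real (r j)) * d n))) (\<lambda>n. \<epsilon> n * c n)"
    by (intro ubig_cmult ubig_add a) auto
  then show "ubig (\<lambda>n t. mF (\<epsilon> n) (\<rho> n) (\<alpha> n) (\<beta> n) (d n) j t - \<i> * of_real (r j) * cph n j) (\<lambda>n. \<epsilon> n * c n)"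
    by (rule ubig_eq) (simp add: mF_def cph_def algebra_simps)
  note b = ubig_mult_le[OF ubig_cnj[OF ubig_\<rho>_diff[of j]] ubig_scalars(4)] ubig_mult_le[OF ubig_cnj[OF ubig_Z_diff[of j]] ubig_scalars(5)] ubig_mult_le[OF ubig_cnj[OF ubig_\<rho>_diff[of j]] ubig_scalars(6)]
  have "ubig (\<lambda>n t. (- \<i>) * (cnj (\<rho> n j t - of_real (r j)) * \<alpha> n + cnj (Zt (\<epsilon> n) (\<rho> n) j t - of_int (k j) * of_real \<omega> * of_real (r j)) * \<beta> n + of_real (\<sigma> j) * (cnj (\<rho> n j t - of_real (r j)) * d n))) (\<lambda>n. \<epsilon> n * c n)"
    by (intro ubig_cmult ubig_add b) auto
  then show "ubig (\<lambda>n t. mG (\<epsilon> n) (\<rho> n) (\<alpha> n) (\<beta> n) (d n) j t + \<i> * of_real (r j) * cph n j) (\<lambda>n. \<epsilon> n * c n)"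
    by (rule ubig_eq) (simp add: mG_def cph_def algebra_simps)
qed

lemma ubig_resid_diff: "ubig (\<lambda>n t. resid (\<rho> n) \<sigma> j t - resid rr \<sigma> j t) \<epsilon>"
proof -
  have "ubig (\<lambda>n t. \<i> * (of_real (\<sigma> j - \<sigma> (j + 1)) * (\<theta> j (j + 1) t * (\<rho> n (j + 1) t - of_real (r (j + 1)))) +
      of_real (\<sigma> j - \<sigma> (j - 1)) * (\<theta> j (j - 1) t * (\<rho> n (j - 1) t - of_real (r (j - 1)))))) \<epsilon>"
    by (intro ubig_cmult ubig_add ubig_mult_le[OF ubig_scalars(7) ubig_\<rho>_diff]) auto
  then show ?thesis by (rule ubig_eq) (simp add: resid_def algebra_simps)
qed

text \<open>\<open>eF\<close> and \<open>eG\<close> collect the terms of the equation for \<open>v\<close> that are small multiples of \<open>v\<close>, \<open>hF\<close> and \<open>hG\<close> all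
  terms except the decoupled linear part and the force \<open>m\<close>.\<close>

definition "eF n j t = (2 * \<rho> n j t * cnj (\<rho> n j t) - 2 * of_real ((r j)\<^sup>2) + 2 * of_real (\<epsilon> n)) * vF n j t + ((\<rho> n j t)\<^sup>2 - of_real ((r j)\<^sup>2)) * vG n j t
   - of_real (\<epsilon> n) * nbr j (vF n) t - \<i> * (\<kappa> n * vF n j t)"
definition "eG n j t = (2 * \<rho> n j t * cnj (\<rho> n j t) - 2 * of_real ((r j)\<^sup>2) + 2 * of_real (\<epsilon> n)) * vG n j t + ((cnj (\<rho> n j t))\<^sup>2 - of_real ((r j)\<^sup>2)) * vF n j t
   - of_real (\<epsilon> n) * nbr' j (vG n) t + \<i> * (\<kappa> n * vG n j t)"
definition "hF n j t = eF n j t + (d n * of_real (\<epsilon> n) * resid (\<rho> n) \<sigma> j t - \<i> * \<kappa> n * mF (\<epsilon> n) (\<rho> n) (\<alpha> n) (\<beta> n) (d n) j t)"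
definition "hG n j t = eG n j t + (d n * of_real (\<epsilon> n) * cnj (resid (\<rho> n) \<sigma> j t) + \<i> * \<kappa> n * mG (\<epsilon> n) (\<rho> n) (\<alpha> n) (\<beta> n) (d n) j t)"

lemma site_ode:
  assumes "j \<in> {-1, 0, 1}"
  shows "(vF n j has_vector_derivative - \<i> * (of_real ((r j)\<^sup>2) * (vF n j t + vG n j t) + hF n j t) - m n j) (at t)"
    "(vG n j has_vector_derivative \<i> * (of_real ((r j)\<^sup>2) * (vF n j t + vG n j t) + hG n j t) - m n j) (at t)"
proof -
  have "of_int (k j) * \<omega> = 1 + (r j)\<^sup>2" using r_sq(1)[OF assms] by simp
  then have kw: "of_int (k j) * complex_of_real \<omega> = 1 + of_real ((r j)\<^sup>2)"
    by (metis of_real_1 of_real_add of_real_mult of_real_of_int_eq)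
  then have kw': "1 - of_int (k j) * complex_of_real \<omega> = - of_real ((r j)\<^sup>2)" by simp
  show "(vF n j has_vector_derivative - \<i> * (of_real ((r j)\<^sup>2) * (vF n j t + vG n j t) + hF n j t) - m n j) (at t)"
    by (rule has_vector_derivative_eq_rhs[OF lin_solD(1)[OF ode]]) (unfold linF_def kw' hF_def eF_def, simp add: algebra_simps)
  show "(vG n j has_vector_derivative \<i> * (of_real ((r j)\<^sup>2) * (vF n j t + vG n j t) + hG n j t) - m n j) (at t)"
    by (rule has_vector_derivative_eq_rhs[OF lin_solD(2)[OF ode]]) (unfold linG_def kw' hG_def eG_def, simp add: algebra_simps)
qed

lemma site_ode_non:
  assumes "j \<notin> {-1, 0, 1}"
  shows "(vF n j has_vector_derivative - \<i> * (vF n j t + hF n j t)) (at t)"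
    "(vG n j has_vector_derivative \<i> * (vG n j t + hG n j t)) (at t)"
  by (rule has_vector_derivative_eq_rhs[OF lin_solD(1)[OF ode]] has_vector_derivative_eq_rhs[OF lin_solD(2)[OF ode]],
      simp add: linF_def linG_def r_sq(3,4)[OF assms] m0[OF assms] hF_def eF_def hG_def eG_def algebra_simps)+

lemma v_cont: "continuous_on UNIV (vF n j)" "continuous_on UNIV (vG n j)"
  by (rule lin_sol_cont[OF ode])+

lemma \<rho>_cont: "continuous_on UNIV (\<rho> n j)" by (rule orbit_cont(1)[OF orb])

lemma Z_cont: "continuous_on UNIV (Zt (\<epsilon> n) (\<rho> n) j)"
  unfolding Zt_def by (intro continuous_intros \<rho>_cont orbit_cont(2)[OF orb])

lemma h_cont: "continuous_on UNIV (hF n j)" "continuous_on UNIV (hG n j)"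
  unfolding hF_def hG_def eF_def eG_def nbr_def nbr'_def resid_def mF_def mG_def
  by (intro continuous_intros v_cont \<rho>_cont Z_cont \<theta>_cont)+

lemma apriori:
  assumes h: "ubig (\<lambda>n. hF n j) g" "ubig (\<lambda>n. hG n j) g"
  shows "ubig (\<lambda>n. vF n j) g" "ubig (\<lambda>n. vG n j) g"
proof -
  obtain C C' where C: "C \<ge> 0" "\<forall>\<^sub>F n in sequentially. \<forall>t. cmod (hF n j t) \<le> C * g n" "C' \<ge> 0" "\<forall>\<^sub>F n in sequentially. \<forall>t. cmod (hG n j t) \<le> C' * g n"
    using h unfolding ubig_def by blast
  let ?B = "C + C'"
  have B: "\<forall>\<^sub>F n in sequentially. \<forall>t. cmod (hF n j t) \<le> ?B * g n \<and> cmod (hG n j t) \<le> ?B * g n"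
    using C(2,4)
  proof eventually_elim
    case (elim n)
    have "0 \<le> C * g n" "0 \<le> C' * g n" using elim norm_ge_zero order_trans by blast+
    then show ?case using elim by (simp add: distrib_right add_increasing add_increasing2)
  qed
  have "\<exists>K\<ge>0. \<forall>\<^sub>F n in sequentially. \<forall>t. cmod (vF n j t) \<le> K * g n \<and> cmod (vG n j t) \<le> K * g n"
  proof (cases "j \<in> {-1, 0, 1}")
    case True
    let ?c = "(r j)\<^sup>2"
    let ?K = "(1/?c + 4*T + T) * (1 + ?c * T)"
    have c: "?c > 0" by (rule r_sq(2)[OF True])
    have "\<forall>\<^sub>F n in sequentially. \<forall>t. cmod (vF n j t) \<le> (?K * ?B) * g n \<and> cmod (vG n j t) \<le> (?K * ?B) * g n"
      using B
    proof eventually_elim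
      case (elim n)
      have "cmod (vF n j t) \<le> ?K * (?B * g n)" for t
        by (rule phase_action_bound(2)[OF T_pos c site_ode(1)[OF True] per(1) site_ode(2)[OF True] per(2) h_cont _ _ ph0[OF True]]) (use elim in auto)
      moreover have "cmod (vG n j t) \<le> ?K * (?B * g n)" for t
        by (rule phase_action_bound(3)[OF T_pos c site_ode(1)[OF True] per(1) site_ode(2)[OF True] per(2) h_cont _ _ ph0[OF True]]) (use elim in auto)
      ultimately show ?case by (simp only: mult.assoc) simp
    qed
    then show ?thesis using c T_pos C by (intro exI[of _ "?K * ?B"]) auto
  next
    case False
    let ?q = "cmod (1 - cis T)"
    have q: "?q > 0" using nonres(1) by simp
    have "\<forall>\<^sub>F n in sequentially. \<forall>t. cmod (vF n j t) \<le> (T / ?q * ?B) * g n \<and> cmod (vG n j t) \<le> (T / ?q * ?B) * g n"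
      using B
    proof eventually_elim
      case (elim n)
      have d: "(vF n j has_vector_derivative - \<i> * hF n j t - \<i> * vF n j t) (at t)" "(vG n j has_vector_derivative \<i> * hG n j t - (- \<i>) * vG n j t) (at t)" for t
        by (rule has_vector_derivative_eq_rhs[OF site_ode_non(1)[OF False]] has_vector_derivative_eq_rhs[OF site_ode_non(2)[OF False]], simp add: algebra_simps)+
      have "norm (1 - exp (\<i> * of_real T)) * norm (vF n j t) \<le> (?B * g n) * T" for t
        by (rule periodic_linear_bound[OF T_pos d(1) per(1)])
           (use elim in \<open>auto simp: norm_mult\<close>)
      moreover have "norm (1 - exp ((- \<i>) * of_real T)) * norm (vG n j t) \<le> (?B * g n) * T" for t
        by (rule periodic_linear_bound[OF T_pos d(2) per(2)])
           (use elim in \<open>auto simp: norm_mult\<close>)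
      moreover have "exp (\<i> * of_real T) = cis T" "exp ((- \<i>) * of_real T) = cnj (cis T)" by (simp_all add: cis_conv_exp exp_cnj)
      moreover have "cmod (1 - cnj (cis T)) = ?q" by (metis complex_cnj_diff complex_cnj_one complex_mod_cnj)
      ultimately have "?q * norm (vF n j t) \<le> (?B * g n) * T" "?q * norm (vG n j t) \<le> (?B * g n) * T" for t by metis+
      then show ?case using q by (simp add: pos_le_divide_eq mult_ac)
    qed
    then show ?thesis using q T_pos C by (intro exI[of _ "T / ?q * ?B"]) auto
  qed
  then obtain K where K: "K \<ge> 0" "\<forall>\<^sub>F n in sequentially. \<forall>t. cmod (vF n j t) \<le> K * g n \<and> cmod (vG n j t) \<le> K * g n" by blast
  show "ubig (\<lambda>n. vF n j) g" "ubig (\<lambda>n. vG n j) g" unfolding ubig_def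
    using K(1) by (intro exI[of _ K] conjI eventually_mono[OF K(2)]; blast)+
qed

lemma ubig_e:
  assumes v: "\<And>j. ubig (\<lambda>n. vF n j) W" "\<And>j. ubig (\<lambda>n. vG n j) W" and W: "\<And>n. W n \<ge> 0"
  shows "ubig (\<lambda>n. eF n j) (\<lambda>n. \<eta> n * W n)" "ubig (\<lambda>n. eG n j) (\<lambda>n. \<eta> n * W n)"
proof -
  have le: "\<epsilon> n * W n \<le> \<eta> n * W n" "cmod (\<kappa> n) * W n \<le> \<eta> n * W n" for n using dom[of n] W[of n] by (auto intro: mult_right_mono)
  have u: "ubig (\<lambda>n t. \<rho> n j t - of_real (r j)) \<epsilon>" "ubig (\<lambda>n t. cnj (\<rho> n j t - of_real (r j))) \<epsilon>" by (rule ubig_\<rho>_diff ubig_cnj[OF ubig_\<rho>_diff])+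
  have "ubig (\<lambda>n t. 2 * ((\<rho> n j t - of_real (r j)) * cnj (\<rho> n j t)) + (2 * of_real (r j)) * cnj (\<rho> n j t - of_real (r j)) + 2 * of_real (\<epsilon> n)) \<epsilon>"
    by (intro ubig_add ubig_cmult ubig_mult_le[OF u(1) ubig_cnj[OF ubig_\<rho>]] u ubig_scalars) auto
  then have c1: "ubig (\<lambda>n t. 2 * \<rho> n j t * cnj (\<rho> n j t) - 2 * of_real ((r j)\<^sup>2) + 2 * of_real (\<epsilon> n)) \<epsilon>"
    by (rule ubig_eq) (simp add: algebra_simps power2_eq_square)
  have "ubig (\<lambda>n t. (\<rho> n j t - of_real (r j)) * \<rho> n j t + of_real (r j) * (\<rho> n j t - of_real (r j))) \<epsilon>"
    by (intro ubig_add ubig_cmult ubig_mult_le[OF u(1) ubig_\<rho>] u) auto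
  then have c2: "ubig (\<lambda>n t. (\<rho> n j t)\<^sup>2 - of_real ((r j)\<^sup>2)) \<epsilon>"
    by (rule ubig_eq) (simp add: algebra_simps power2_eq_square)
  have c3: "ubig (\<lambda>n t. (cnj (\<rho> n j t))\<^sup>2 - of_real ((r j)\<^sup>2)) \<epsilon>"
    by (rule ubig_eq[OF ubig_cnj[OF c2]]) simp
  have n: "ubig (\<lambda>n t. nbr j (vF n) t) W" "ubig (\<lambda>n t. nbr' j (vG n) t) W" unfolding nbr_def nbr'_def
    by (intro ubig_add ubig_mult_le[OF ubig_scalars(7) v(1)] ubig_mult_le[OF ubig_scalars(8) v(2)]; simp)+
  note k = ubig_mult_le[OF ubig_scalars(2) v(1) le(2)] ubig_mult_le[OF ubig_scalars(2) v(2) le(2)]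
  show "ubig (\<lambda>n. eF n j) (\<lambda>n. \<eta> n * W n)" unfolding eF_def
    by (intro ubig_add ubig_diff ubig_cmult k ubig_mult_le[OF c1 v(1) le(1)] ubig_mult_le[OF c2 v(2) le(1)] ubig_mult_le[OF ubig_scalars(1) n(1) le(1)])
  show "ubig (\<lambda>n. eG n j) (\<lambda>n. \<eta> n * W n)" unfolding eG_def
    by (intro ubig_add ubig_diff ubig_cmult k ubig_mult_le[OF c1 v(2) le(1)] ubig_mult_le[OF c3 v(1) le(1)] ubig_mult_le[OF ubig_scalars(1) n(2) le(1)])
qed

end

context resonant_chain
begin

lemma ubig_avg0:
  assumes h: "\<And>n. continuous_on UNIV (h n)" and p: "p \<noteq> 0"
    and a: "ubig (\<lambda>n t. h n t - (a n * cis (of_int p * \<omega> * t) + b n)) g"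
  shows "ubig (\<lambda>n t. avg T (h n) - b n) g"
proof (rule ubig_eq[OF ubig_avg[OF T_pos a]])
  fix n and t :: real
  have c: "continuous_on UNIV (\<lambda>t. a n * cis (of_int p * \<omega> * t))" by (intro continuous_on_mult continuous_on_const cont_cis)
  have "avg T (\<lambda>t. h n t - (a n * cis (of_int p * \<omega> * t) + b n)) = avg T (h n) - (a n * avg T (\<lambda>t. cis (of_int p * \<omega> * t)) + b n)"
    using avg_diff[OF h[of n] continuous_on_add[OF c continuous_on_const[of UNIV "b n"]], of T] avg_add[OF c continuous_on_const[of UNIV "b n"], of T]
    by (simp only: avg_cmult avg_const[OF T_pos])
  then show "avg T (h n) - b n = avg T (\<lambda>t. h n t - (a n * cis (of_int p * \<omega> * t) + b n))"
    by (simp add: avg_cis[OF T_pos \<omega>T p])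
qed

text \<open>The harmonic and the complex amplitude with which the residual current drives an excited site.\<close>

definition pj :: "'a mod_ring \<Rightarrow> int" where "pj j = (if j = 0 then 1 else -1)"

definition Aj :: "'a mod_ring \<Rightarrow> complex" where
  "Aj j = (if j = 1 then \<i> * of_real (r 0) else if j = -1 then - \<i> * of_real (r 0) else - \<i> * of_real (r 1 - r (-1)))"

lemma resid_rr_exc: "j \<in> {-1, 0, 1} \<Longrightarrow> resid rr \<sigma> j t = Aj j * cis (of_int (pj j) * \<omega> * t)"
  using resid_rr(1-3)[of t] unfolding Aj_def pj_def by (auto simp del: r_eqs)

lemma pj: "pj j = 1 \<or> pj j = -1" "pj j \<noteq> 0" by (auto simp: pj_def)

end

context mode_seq
begin

lemma ubig_cph: "ubig (\<lambda>n t. cph n j) c"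
proof -
  have "ubig (\<lambda>n t. \<alpha> n + (of_int (k j) * of_real \<omega>) * \<beta> n + of_real (\<sigma> j) * d n) c"
    by (intro ubig_add ubig_cmult ubig_scalars)
  then show ?thesis by (rule ubig_eq) (simp add: cph_def mult_ac)
qed

lemma ubig_eps_c: "ubig f (\<lambda>n. \<epsilon> n * c n) \<Longrightarrow> ubig f c"
proof (rule ubig_trans[of f _ 1])
  show "\<forall>\<^sub>F n in sequentially. \<epsilon> n * c n \<le> 1 * c n"
    using eps_le_1 by eventually_elim (rule mult_right_mono[OF _ nonneg(1)])
qed auto

lemma ubig_m: "ubig (\<lambda>n t. mF (\<epsilon> n) (\<rho> n) (\<alpha> n) (\<beta> n) (d n) j t) c" "ubig (\<lambda>n t. mG (\<epsilon> n) (\<rho> n) (\<alpha> n) (\<beta> n) (d n) j t) c"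
proof -
  have a: "ubig (\<lambda>n t. (\<i> * of_real (r j)) * cph n j) c" by (rule ubig_cmult[OF ubig_cph])
  show "ubig (\<lambda>n t. mF (\<epsilon> n) (\<rho> n) (\<alpha> n) (\<beta> n) (d n) j t) c"
    by (rule ubig_eq[OF ubig_add[OF ubig_eps_c[OF ubig_mF_diff(1)[of j]] a]]) simp
  show "ubig (\<lambda>n t. mG (\<epsilon> n) (\<rho> n) (\<alpha> n) (\<beta> n) (d n) j t) c"
    by (rule ubig_eq[OF ubig_diff[OF ubig_eps_c[OF ubig_mF_diff(2)[of j]] a]]) simp
qed

lemma ubig_resid: "ubig (\<lambda>n t. resid (\<rho> n) \<sigma> j t) (\<lambda>_. 1)"
proof -
  have "cmod (resid rr \<sigma> j t) \<le> \<bar>r (j + 1)\<bar> * \<bar>\<sigma> j - \<sigma> (j + 1)\<bar> + \<bar>r (j - 1)\<bar> * \<bar>\<sigma> j - \<sigma> (j - 1)\<bar>" for t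
    unfolding resid_def norm_mult[of \<i>] norm_ii mult_1
    by (rule norm_triangle_mono) (simp_all only: norm_mult \<theta>_norm norm_of_real mult_1 order_refl)
  then have "ubig (\<lambda>n t. resid rr \<sigma> j t) (\<lambda>_. 1)" by (intro ubigI) auto
  from ubig_add[OF ubig_eps_1[OF ubig_resid_diff[of j]] this] show ?thesis by simp
qed

lemma ubig_d_eps: "ubig (\<lambda>n t. d n * of_real (\<epsilon> n)) (\<lambda>n. \<epsilon> n * cmod (d n))"
  by (rule ubig_mult_le[OF ubig_scalars(3,1)]) simp

text \<open>The supremum \<open>V\<close> of the remainder satisfies \<open>V \<le> C (\<eta> V + \<delta>)\<close>, and \<open>\<eta>\<close> tends to zero.\<close>

lemma ubig_v: "ubig (\<lambda>n. vF n j) \<delta>" "ubig (\<lambda>n. vG n j) \<delta>"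
proof -
  define M where "M = (\<lambda>n (j, t). max (cmod (vF n j t)) (cmod (vG n j t)))"
  define V where "V = (\<lambda>n. Sup (range (M n)))"
  have bdd: "bdd_above (range (M n))" for n
  proof -
    obtain B B' where B: "\<And>j t. cmod (vF n j t) \<le> B j" "\<And>j t. cmod (vG n j t) \<le> B' j"
      using periodic_bounded[OF T_pos v_cont(1) per(1)] periodic_bounded[OF T_pos v_cont(2) per(2)] by metis
    have B0: "0 \<le> B j" "0 \<le> B' j" for j using B norm_ge_zero order_trans by blast+
    have "M n x \<le> (\<Sum>j\<in>UNIV. B j + B' j)" for x
    proof (cases x)
      case (Pair j t)
      have "M n x \<le> B j + B' j" unfolding Pair M_def using B[of j t] B0[of j] by simp
      also have "\<dots> \<le> (\<Sum>j\<in>UNIV. B j + B' j)" by (rule member_le_sum) (use B0 in auto)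
      finally show ?thesis .
    qed
    then show ?thesis by (intro bdd_aboveI2) auto
  qed
  have up: "M n x \<le> V n" for n x unfolding V_def by (rule cSup_upper) (use bdd in auto)
  have vV: "cmod (vF n j t) \<le> V n" "cmod (vG n j t) \<le> V n" for n j t using up[of n "(j, t)"] by (simp_all add: M_def)
  have V0: "V n \<ge> 0" for n using vV(1)[of n] norm_ge_zero order_trans by blast
  have uV: "ubig (\<lambda>n. vF n j) V" "ubig (\<lambda>n. vG n j) V" for j by (rule ubigI[of _ 1], use vV in auto)+
  define g where "g = (\<lambda>n. \<eta> n * V n + \<delta> n)"
  have le: "\<eta> n * V n \<le> g n" "\<epsilon> n * cmod (d n) \<le> g n" "cmod (\<kappa> n) * c n \<le> g n" for n
    using nonneg[of n] dom[of n] V0[of n] unfolding g_def by (auto intro: add_increasing)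
  have "ubig (\<lambda>n. hF n j) g" for j unfolding hF_def
    by (intro ubig_add ubig_diff ubig_le[OF ubig_e(1)[OF uV V0] le(1)] ubig_mult_le[OF ubig_d_eps ubig_resid] ubig_mult_le[OF ubig_cmult[OF ubig_scalars(2)] ubig_m(1)])
       (use le in auto)
  moreover have "ubig (\<lambda>n. hG n j) g" for j unfolding hG_def
    by (intro ubig_add ubig_diff ubig_le[OF ubig_e(2)[OF uV V0] le(1)] ubig_mult_le[OF ubig_d_eps ubig_cnj[OF ubig_resid]] ubig_mult_le[OF ubig_cmult[OF ubig_scalars(2)] ubig_m(2)])
       (use le in auto)
  ultimately have vg: "ubig (\<lambda>n. vF n j) g" "ubig (\<lambda>n. vG n j) g" for j using apriori by blast+
  have "ubig (\<lambda>n t. \<Sum>j\<in>UNIV. of_real (cmod (vF n j t)) + of_real (cmod (vG n j t))) g"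
    by (intro ubig_sum ubig_add ubig_dom[OF vg(1)] ubig_dom[OF vg(2)]) auto
  then obtain C where C: "C \<ge> 0" "\<forall>\<^sub>F n in sequentially. \<forall>t. cmod (\<Sum>j\<in>UNIV. of_real (cmod (vF n j t)) + of_real (cmod (vG n j t))) \<le> C * g n"
    unfolding ubig_def by blast
  have small: "\<forall>\<^sub>F n in sequentially. C * \<eta> n \<le> 1 / 2"
  proof -
    have "(\<lambda>n. C * \<eta> n) \<longlonglongrightarrow> 0" using tendsto_mult_right_zero[OF eta_lim] .
    from order_tendstoD(2)[OF this, of "1/2"] show ?thesis by (auto elim: eventually_mono)
  qed
  have Vd: "\<forall>\<^sub>F n in sequentially. V n \<le> (2 * C) * \<delta> n"
    using C(2) small
  proof eventually_elim
    case (elim n)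
    have "M n x \<le> C * g n" for x
    proof (cases x)
      case (Pair j t)
      let ?f = "\<lambda>j. cmod (vF n j t) + cmod (vG n j t)"
      have "M n x \<le> ?f j" unfolding Pair M_def by simp
      also have "\<dots> \<le> (\<Sum>j\<in>UNIV. ?f j)" by (rule member_le_sum) auto
      also have "\<dots> = cmod (of_real (\<Sum>j\<in>UNIV. ?f j))" by (simp only: norm_of_real) (simp add: sum_nonneg)
      also have "\<dots> = cmod (\<Sum>j\<in>UNIV. of_real (cmod (vF n j t)) + of_real (cmod (vG n j t)))" by simp
      also have "\<dots> \<le> C * g n" using elim(1) by blast
      finally show ?thesis .
    qed
    then have "V n \<le> C * g n" unfolding V_def by (intro cSup_least) auto
    also have "\<dots> = C * \<eta> n * V n + C * \<delta> n" by (simp add: g_def algebra_simps)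
    also have "\<dots> \<le> 1 / 2 * V n + C * \<delta> n" using elim(2) V0[of n] by (intro add_right_mono mult_right_mono) auto
    finally show ?case by simp
  qed
  show "ubig (\<lambda>n. vF n j) \<delta>" "ubig (\<lambda>n. vG n j) \<delta>"
    by (rule ubig_trans[OF uV(1) Vd], use C in simp, rule ubig_trans[OF uV(2) Vd], use C in simp)
qed

lemma ubig_eE: "ubig (\<lambda>n. eF n j) E" "ubig (\<lambda>n. eG n j) E"
  using ubig_e[OF ubig_v nonneg(2)] unfolding E_def by simp_all

lemma h_approx:
  "ubig (\<lambda>n t. hF n j t - (d n * of_real (\<epsilon> n) * resid rr \<sigma> j t + \<kappa> n * (of_real (r j) * cph n j))) E"
  "ubig (\<lambda>n t. hG n j t - (d n * of_real (\<epsilon> n) * cnj (resid rr \<sigma> j t) + \<kappa> n * (of_real (r j) * cph n j))) E"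
proof -
  have le: "\<epsilon> n * cmod (d n) * \<epsilon> n \<le> E n" "cmod (\<kappa> n) * (\<epsilon> n * c n) \<le> E n" for n
    using domE(3,4)[of n] by (simp_all add: mult_ac)
  have a: "ubig (\<lambda>n t. eF n j t + (d n * of_real (\<epsilon> n) * (resid (\<rho> n) \<sigma> j t - resid rr \<sigma> j t) -
      \<i> * (\<kappa> n * (mF (\<epsilon> n) (\<rho> n) (\<alpha> n) (\<beta> n) (d n) j t - \<i> * of_real (r j) * cph n j)))) E"
    by (intro ubig_add ubig_diff ubig_eE ubig_cmult ubig_mult_le[OF ubig_d_eps ubig_resid_diff le(1)] ubig_mult_le[OF ubig_scalars(2) ubig_mF_diff(1) le(2)])
  show "ubig (\<lambda>n t. hF n j t - (d n * of_real (\<epsilon> n) * resid rr \<sigma> j t + \<kappa> n * (of_real (r j) * cph n j))) E"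
    by (rule ubig_eq[OF a]) (simp add: hF_def algebra_simps)
  have cn: "ubig (\<lambda>n t. cnj (resid (\<rho> n) \<sigma> j t) - cnj (resid rr \<sigma> j t)) \<epsilon>"
    by (rule ubig_eq[OF ubig_cnj[OF ubig_resid_diff]]) simp
  have b: "ubig (\<lambda>n t. eG n j t + (d n * of_real (\<epsilon> n) * (cnj (resid (\<rho> n) \<sigma> j t) - cnj (resid rr \<sigma> j t)) +
      \<i> * (\<kappa> n * (mG (\<epsilon> n) (\<rho> n) (\<alpha> n) (\<beta> n) (d n) j t + \<i> * of_real (r j) * cph n j)))) E"
    by (intro ubig_add ubig_eE ubig_cmult ubig_mult_le[OF ubig_d_eps cn le(1)] ubig_mult_le[OF ubig_scalars(2) ubig_mF_diff(2) le(2)])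
  show "ubig (\<lambda>n t. hG n j t - (d n * of_real (\<epsilon> n) * cnj (resid rr \<sigma> j t) + \<kappa> n * (of_real (r j) * cph n j))) E"
    by (rule ubig_eq[OF b]) (simp add: hG_def algebra_simps)
qed

lemma ubig_v_non:
  assumes "j \<notin> {-1, 0, 1}" shows "ubig (\<lambda>n. vF n j) E" "ubig (\<lambda>n. vG n j) E"
proof -
  have "ubig (\<lambda>n. hF n j) E" by (rule ubig_eq[OF h_approx(1)[of j]]) (simp add: resid_rr(4)[OF assms] r_sq(3)[OF assms])
  moreover have "ubig (\<lambda>n. hG n j) E" by (rule ubig_eq[OF h_approx(2)[of j]]) (simp add: resid_rr(4)[OF assms] r_sq(3)[OF assms])
  ultimately show "ubig (\<lambda>n. vF n j) E" "ubig (\<lambda>n. vG n j) E" by (rule apriori)+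
qed

lemma h_approx_exc:
  assumes "j \<in> {-1, 0, 1}"
  shows "ubig (\<lambda>n t. hF n j t - (d n * of_real (\<epsilon> n) * Aj j * cis (of_int (pj j) * \<omega> * t) + \<kappa> n * (of_real (r j) * cph n j))) E"
    "ubig (\<lambda>n t. hG n j t - (d n * of_real (\<epsilon> n) * cnj (Aj j) * cis (of_int (- pj j) * \<omega> * t) + \<kappa> n * (of_real (r j) * cph n j))) E"
proof -
  show "ubig (\<lambda>n t. hF n j t - (d n * of_real (\<epsilon> n) * Aj j * cis (of_int (pj j) * \<omega> * t) + \<kappa> n * (of_real (r j) * cph n j))) E"
    by (rule ubig_eq[OF h_approx(1)[of j]]) (simp add: resid_rr_exc[OF assms] mult_ac)
  show "ubig (\<lambda>n t. hG n j t - (d n * of_real (\<epsilon> n) * cnj (Aj j) * cis (of_int (- pj j) * \<omega> * t) + \<kappa> n * (of_real (r j) * cph n j))) E"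
    by (rule ubig_eq[OF h_approx(2)[of j]]) (simp add: resid_rr_exc[OF assms] cis_cnj mult_ac)
qed

text \<open>The phase of site \<open>j\<close> drifts at the rate \<open>\<kappa> cph\<close>; a twist can follow this drift only with a proportional mean displacement of the action.\<close>

lemma phase_drift:
  assumes j: "j \<in> {-1, 0, 1}"
  shows "ubig (\<lambda>n t. of_real (r j) * avg T (\<lambda>t. vF n j t + vG n j t) + \<kappa> n * cph n j) E"
proof -
  have eq: "of_real (2 * (r j)\<^sup>2) * avg T (\<lambda>t. vF n j t + vG n j t) = - (avg T (hF n j) + avg T (hG n j))" for n
  proof -
    have "((\<lambda>t. vF n j t - vG n j t) has_vector_derivative - \<i> * (of_real (2 * (r j)\<^sup>2) * (vF n j t + vG n j t) + (hF n j t + hG n j t))) (at t)" for t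
      by (rule has_vector_derivative_eq_rhs[OF has_vector_derivative_diff[OF site_ode(1)[OF j] site_ode(2)[OF j]]]) (simp add: algebra_simps)
    from avg_deriv[OF T_pos this] have "avg T (\<lambda>t. - \<i> * (of_real (2 * (r j)\<^sup>2) * (vF n j t + vG n j t) + (hF n j t + hG n j t))) = 0"
      using per(1)[of n j 0] per(2)[of n j 0] by simp
    then have "- \<i> * (of_real (2 * (r j)\<^sup>2) * (avg T (vF n j) + avg T (vG n j)) + avg T (\<lambda>t. hF n j t + hG n j t)) = 0"
      by (subst (asm) avg_lin) (auto intro!: v_cont continuous_on_add h_cont)
    then show ?thesis
      using avg_add[OF v_cont(1)[of n j] v_cont(2)[of n j], of T] avg_add[OF h_cont(1)[of n j] h_cont(2)[of n j], of T]
      by (simp add: add_eq_0_iff)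
  qed
  note a = ubig_avg0[OF h_cont(1) pj(2) h_approx_exc(1)[OF j]]
  have p': "- pj j \<noteq> 0" using pj(2)[of j] by simp
  note b = ubig_avg0[OF h_cont(2) p' h_approx_exc(2)[OF j]]
  have r0: "r j \<noteq> 0" using r_eq_0_iff j by blast
  show ?thesis
  proof (rule ubig_eq[OF ubig_cmult[OF ubig_add[OF a b], of "- 1 / (2 * of_real (r j))"]])
    fix n and t :: real
    have "of_real (r j) * avg T (\<lambda>t. vF n j t + vG n j t) = (1 / (2 * of_real (r j))) * (of_real (2 * (r j)\<^sup>2) * avg T (\<lambda>t. vF n j t + vG n j t))"
      using r0 by (simp add: power2_eq_square)
    also have "\<dots> = (- 1 / (2 * of_real (r j))) * (avg T (hF n j) + avg T (hG n j))" unfolding eq by (simp only: mult_minus_right minus_divide_left[symmetric] mult_minus_left)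
    finally show "of_real (r j) * avg T (\<lambda>t. vF n j t + vG n j t) + \<kappa> n * cph n j =
        - 1 / (2 * of_real (r j)) * (avg T (hF n j) - \<kappa> n * (of_real (r j) * cph n j) + (avg T (hG n j) - \<kappa> n * (of_real (r j) * cph n j)))"
      using r0 by (simp only:) (simp add: add_divide_distrib diff_divide_distrib algebra_simps)
  qed
qed

text \<open>The mean norm carried by site \<open>j\<close>.\<close>

definition "P n j = avg T (\<lambda>t. cnj (\<rho> n j t) * vF n j t + \<rho> n j t * vG n j t)"

lemma P_approx: "ubig (\<lambda>n t. P n j - of_real (r j) * avg T (\<lambda>t. vF n j t + vG n j t)) E"
proof -
  have e: "ubig (\<lambda>n t. cnj (\<rho> n j t - of_real (r j)) * vF n j t + (\<rho> n j t - of_real (r j)) * vG n j t) E"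
    by (intro ubig_add ubig_mult_le[OF ubig_cnj[OF ubig_\<rho>_diff] ubig_v(1) domE(1)] ubig_mult_le[OF ubig_\<rho>_diff ubig_v(2) domE(1)])
  show ?thesis
  proof (rule ubig_eq[OF ubig_avg[OF T_pos e]])
    fix n and t :: real
    have c: "continuous_on UNIV (\<lambda>t. cnj (\<rho> n j t) * vF n j t + \<rho> n j t * vG n j t)" "continuous_on UNIV (\<lambda>t. of_real (r j) * (vF n j t + vG n j t))"
      by (intro continuous_intros \<rho>_cont v_cont)+
    have "(\<lambda>t. cnj (\<rho> n j t - of_real (r j)) * vF n j t + (\<rho> n j t - of_real (r j)) * vG n j t) =
       (\<lambda>t. (cnj (\<rho> n j t) * vF n j t + \<rho> n j t * vG n j t) - of_real (r j) * (vF n j t + vG n j t))" by (simp add: fun_eq_iff algebra_simps)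
    then show "P n j - of_real (r j) * avg T (\<lambda>t. vF n j t + vG n j t) = avg T (\<lambda>t. cnj (\<rho> n j t - of_real (r j)) * vF n j t + (\<rho> n j t - of_real (r j)) * vG n j t)"
      using avg_diff[OF c, of T] by (simp only: P_def avg_cmult)
  qed
qed

lemma P_exc: "j \<in> {-1, 0, 1} \<Longrightarrow> ubig (\<lambda>n t. P n j + \<kappa> n * cph n j) E"
  by (rule ubig_eq[OF ubig_add[OF P_approx[of j] phase_drift]]) (simp_all add: algebra_simps)

lemma P_non: "j \<notin> {-1, 0, 1} \<Longrightarrow> ubig (\<lambda>n t. P n j) E"
  by (rule ubig_eq[OF P_approx[of j]]) (simp add: r_sq(3))

definition "ft p h = avg T (\<lambda>t. h t * cis (- (of_int p * \<omega>) * t))"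

lemma v_fourier:
  assumes j: "j \<in> {-1, 0, 1}"
  shows "ubig (\<lambda>n t. ft (pj j) (vF n j) - d n * of_real (\<epsilon> n) * Aj j * of_real (((r j)\<^sup>2 - of_int (pj j) * \<omega>) / \<omega>\<^sup>2)) E"
    "ubig (\<lambda>n t. ft (- pj j) (vG n j) - d n * of_real (\<epsilon> n) * cnj (Aj j) * of_real (((r j)\<^sup>2 - of_int (pj j) * \<omega>) / \<omega>\<^sup>2)) E"
proof -
  have F: "(vF n j has_vector_derivative - \<i> * (of_real ((r j)\<^sup>2) * (vF n j t + vG n j t) + (hF n j t - \<i> * m n j))) (at t)" for n t
    by (rule has_vector_derivative_eq_rhs[OF site_ode(1)[OF j]]) (simp add: algebra_simps)
  have G: "(vG n j has_vector_derivative \<i> * (of_real ((r j)\<^sup>2) * (vF n j t + vG n j t) + (hG n j t + \<i> * m n j))) (at t)" for n t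
    by (rule has_vector_derivative_eq_rhs[OF site_ode(2)[OF j]]) (simp add: algebra_simps)
  have c: "continuous_on UNIV (\<lambda>t. hF n j t - \<i> * m n j)" "continuous_on UNIV (\<lambda>t. hG n j t + \<i> * m n j)" for n by (intro continuous_intros h_cont)+
  have a: "ubig (\<lambda>n t. (hF n j t - \<i> * m n j) - (d n * of_real (\<epsilon> n) * Aj j * cis (of_int (pj j) * \<omega> * t) + (\<kappa> n * (of_real (r j) * cph n j) - \<i> * m n j))) E"
    by (rule ubig_eq[OF h_approx_exc(1)[OF j]]) simp
  have b: "ubig (\<lambda>n t. (hG n j t + \<i> * m n j) - (d n * of_real (\<epsilon> n) * cnj (Aj j) * cis (of_int (- pj j) * \<omega> * t) + (\<kappa> n * (of_real (r j) * cph n j) + \<i> * m n j))) E"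
    by (rule ubig_eq[OF h_approx_exc(2)[OF j]]) simp
  show "ubig (\<lambda>n t. ft (pj j) (vF n j) - d n * of_real (\<epsilon> n) * Aj j * of_real (((r j)\<^sup>2 - of_int (pj j) * \<omega>) / \<omega>\<^sup>2)) E"
    "ubig (\<lambda>n t. ft (- pj j) (vG n j) - d n * of_real (\<epsilon> n) * cnj (Aj j) * of_real (((r j)\<^sup>2 - of_int (pj j) * \<omega>) / \<omega>\<^sup>2)) E"
    unfolding ft_def by (rule ubig_fourier_site[OF pj(1) F per(1) G per(2) c a b])+
qed

text \<open>The first-order response of the orbit to the coupling.  It enters the balance at the same order as the response of the perturbation.\<close>

lemma orbit_fourier:
  assumes j: "j \<in> {-1, 0, 1}"
  defines "B \<equiv> if j = 0 then r 1 + r (-1) else r 0"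
  shows "ubig (\<lambda>n t. ft (pj j) (\<lambda>t. \<rho> n j t - of_real (r j)) + of_real (\<epsilon> n) * of_real B * of_real (((r j)\<^sup>2 - of_int (pj j) * \<omega>) / \<omega>\<^sup>2)) (\<lambda>n. \<epsilon> n * \<epsilon> n)"
    "ubig (\<lambda>n t. ft (- pj j) (\<lambda>t. cnj (\<rho> n j t - of_real (r j))) + of_real (\<epsilon> n) * of_real B * of_real (((r j)\<^sup>2 - of_int (pj j) * \<omega>) / \<omega>\<^sup>2)) (\<lambda>n. \<epsilon> n * \<epsilon> n)"
proof -
  let ?u = "\<lambda>n t. \<rho> n j t - of_real (r j)"
  let ?h = "\<lambda>n t. \<i> * orbit_rhs (\<epsilon> n) (\<rho> n) j t - of_real ((r j)\<^sup>2) * (?u n t + cnj (?u n t))"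
  have F: "(?u n has_vector_derivative - \<i> * (of_real ((r j)\<^sup>2) * (?u n t + cnj (?u n t)) + ?h n t)) (at t)" for n t
    by (rule has_vector_derivative_eq_rhs[OF has_vector_derivative_diff[OF orbitD(1)[OF orb] has_vector_derivative_const]]) (simp add: algebra_simps)
  have G: "((\<lambda>t. cnj (?u n t)) has_vector_derivative \<i> * (of_real ((r j)\<^sup>2) * (?u n t + cnj (?u n t)) + cnj (?h n t))) (at t)" for n t
    by (rule has_vector_derivative_eq_rhs[OF cnj_vderiv[OF F]]) (simp add: algebra_simps)
  have pF: "?u n (t + T) = ?u n t" for n t by (simp add: orbitD(2)[OF orb])
  then have pG: "cnj (?u n (t + T)) = cnj (?u n t)" for n t by simp
  have c: "continuous_on UNIV (?h n)" "continuous_on UNIV (\<lambda>t. cnj (?h n t))" for n by (intro continuous_intros \<rho>_cont orbit_cont(2)[OF orb])+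
  have "of_int (k j) * \<omega> = 1 + (r j)\<^sup>2" using r_sq(1)[OF j] by simp
  then have kw: "of_int (k j) * complex_of_real \<omega> = 1 + of_real ((r j)\<^sup>2)"
    by (metis of_real_1 of_real_add of_real_mult of_real_of_int_eq)
  then have kw': "1 - of_int (k j) * complex_of_real \<omega> = - of_real ((r j)\<^sup>2)" by simp
  have h1: "?h n t = of_real (r j) * (2 * (?u n t * cnj (?u n t)) + ?u n t * ?u n t) + ?u n t * (?u n t * cnj (?u n t))
      + of_real (\<epsilon> n) * (2 * ?u n t - (\<theta> j (j + 1) t * (\<rho> n (j + 1) t - of_real (r (j + 1))) + \<theta> j (j - 1) t * (\<rho> n (j - 1) t - of_real (r (j - 1)))))
      + of_real (\<epsilon> n) * (2 * of_real (r j) - (\<theta> j (j + 1) t * of_real (r (j + 1)) + \<theta> j (j - 1) t * of_real (r (j - 1))))" for n t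
    unfolding orbit_rhs_def nbr_def kw' by (simp add: algebra_simps power2_eq_square)
  have nb: "\<theta> j (j + 1) t * of_real (r (j + 1)) + \<theta> j (j - 1) t * of_real (r (j - 1)) = of_real B * cis (of_int (pj j) * \<omega> * t)" for t
    using j unfolding B_def by (auto simp: \<theta>_def pj_def algebra_simps simp del: r_eqs(1-3))
  have uu: "ubig (\<lambda>n t. ?u n t * ?u n t) (\<lambda>n. \<epsilon> n * \<epsilon> n)" "ubig (\<lambda>n t. ?u n t * cnj (?u n t)) (\<lambda>n. \<epsilon> n * \<epsilon> n)"
    by (rule ubig_mult_le[OF ubig_\<rho>_diff ubig_\<rho>_diff] ubig_mult_le[OF ubig_\<rho>_diff ubig_cnj[OF ubig_\<rho>_diff]], simp)+
  have "ubig (\<lambda>n t. of_real (r j) * (2 * (?u n t * cnj (?u n t)) + ?u n t * ?u n t) + ?u n t * (?u n t * cnj (?u n t))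
      + of_real (\<epsilon> n) * (2 * ?u n t - (\<theta> j (j + 1) t * (\<rho> n (j + 1) t - of_real (r (j + 1))) + \<theta> j (j - 1) t * (\<rho> n (j - 1) t - of_real (r (j - 1)))))) (\<lambda>n. \<epsilon> n * \<epsilon> n)"
    by (intro ubig_add ubig_cmult uu ubig_mult_le[OF ubig_eps_1[OF ubig_\<rho>_diff] uu(2)] ubig_mult_le[OF ubig_scalars(1), of _ \<epsilon>]
        ubig_diff ubig_\<rho>_diff ubig_mult_le[OF ubig_scalars(7) ubig_\<rho>_diff]) auto
  then have a: "ubig (\<lambda>n t. ?h n t - ((- (of_real (\<epsilon> n) * of_real B)) * cis (of_int (pj j) * \<omega> * t) + 2 * of_real (\<epsilon> n) * of_real (r j))) (\<lambda>n. \<epsilon> n * \<epsilon> n)"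
    by (rule ubig_eq) (unfold h1 nb, simp add: algebra_simps)
  have b: "ubig (\<lambda>n t. cnj (?h n t) - ((- (of_real (\<epsilon> n) * of_real B)) * cis (of_int (- pj j) * \<omega> * t) + 2 * of_real (\<epsilon> n) * of_real (r j))) (\<lambda>n. \<epsilon> n * \<epsilon> n)"
    by (rule ubig_eq[OF ubig_cnj[OF a]]) (simp add: cis_cnj)
  note f = ubig_fourier_site[OF pj(1) F pF G pG c a b]
  show "ubig (\<lambda>n t. ft (pj j) (\<lambda>t. \<rho> n j t - of_real (r j)) + of_real (\<epsilon> n) * of_real B * of_real (((r j)\<^sup>2 - of_int (pj j) * \<omega>) / \<omega>\<^sup>2)) (\<lambda>n. \<epsilon> n * \<epsilon> n)"
    by (rule ubig_eq[OF f(1)]) (simp add: ft_def)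
  show "ubig (\<lambda>n t. ft (- pj j) (\<lambda>t. cnj (\<rho> n j t - of_real (r j))) + of_real (\<epsilon> n) * of_real B * of_real (((r j)\<^sup>2 - of_int (pj j) * \<omega>) / \<omega>\<^sup>2)) (\<lambda>n. \<epsilon> n * \<epsilon> n)"
    by (rule ubig_eq[OF f(2)]) (simp add: ft_def)
qed

section \<open>The norm balance of an outer site\<close>

lemma avg_\<rho>_deriv: "avg T (\<lambda>t. cnj (\<rho> n j t) * orbit_rhs (\<epsilon> n) (\<rho> n) j t + \<rho> n j t * cnj (orbit_rhs (\<epsilon> n) (\<rho> n) j t)) = 0"
proof (rule avg_deriv[OF T_pos, of "\<lambda>t. cnj (\<rho> n j t) * \<rho> n j t"])
  show "((\<lambda>t. cnj (\<rho> n j t) * \<rho> n j t) has_vector_derivative cnj (\<rho> n j t) * orbit_rhs (\<epsilon> n) (\<rho> n) j t + \<rho> n j t * cnj (orbit_rhs (\<epsilon> n) (\<rho> n) j t)) (at t)" for t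
    by (rule has_vector_derivative_eq_rhs[OF has_vector_derivative_mult[OF cnj_vderiv[OF orbitD(1)[OF orb]] orbitD(1)[OF orb]]]) simp
  show "cnj (\<rho> n j T) * \<rho> n j T = cnj (\<rho> n j 0) * \<rho> n j 0" using orbitD(2)[OF orb, of n j 0] by simp
qed

lemma rhs_cont: "continuous_on UNIV (orbit_rhs (\<epsilon> n) (\<rho> n) j)" by (rule orbit_cont(2)[OF orb])

lemma m_pairing: "cnj (\<rho> n j t) * mF (\<epsilon> n) (\<rho> n) (\<alpha> n) (\<beta> n) (d n) j t + \<rho> n j t * mG (\<epsilon> n) (\<rho> n) (\<alpha> n) (\<beta> n) (d n) j t
   = - \<beta> n * (cnj (\<rho> n j t) * orbit_rhs (\<epsilon> n) (\<rho> n) j t + \<rho> n j t * cnj (orbit_rhs (\<epsilon> n) (\<rho> n) j t))"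
  by (simp add: mF_def mG_def Zt_def algebra_simps)

text \<open>The perturbation of the current into site 1 and, as \<open>X\<close>, the mean correlation across the bond between 0 and 1.\<close>

definition "br n t = vF n 1 t * nbr' 1 (\<lambda>j t. cnj (\<rho> n j t)) t - cnj (\<rho> n 1 t) * nbr 1 (vF n) t - vG n 1 t * nbr 1 (\<rho> n) t + \<rho> n 1 t * nbr' 1 (vG n) t"

definition "X n = avg T (\<lambda>t. \<theta> 1 0 t * \<rho> n 0 t * cnj (\<rho> n 1 t))"

lemma br_cont: "continuous_on UNIV (br n)"
  unfolding br_def nbr_def nbr'_def by (intro continuous_intros \<theta>_cont \<rho>_cont v_cont)

text \<open>The norm balance of site 1 averaged over a period.  The gauge mode and the relative phase mode do not change the norm of a site,
  and the change due to the time mode has mean zero.\<close>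

lemma balance: "\<kappa> n * P n 1 + m n 1 * avg T (\<lambda>t. \<rho> n 1 t + cnj (\<rho> n 1 t)) = - \<i> * of_real (\<epsilon> n) * avg T (br n) + d n * of_real (\<epsilon> n) * (X n + cnj (X n))"
proof -
  define q where "q = (\<lambda>t. cnj (\<rho> n 1 t) * vF n 1 t + \<rho> n 1 t * vG n 1 t)"
  define z where "z = (\<lambda>t. cnj (\<rho> n 1 t) * orbit_rhs (\<epsilon> n) (\<rho> n) 1 t + \<rho> n 1 t * cnj (orbit_rhs (\<epsilon> n) (\<rho> n) 1 t))"
  define x where "x = (\<lambda>t. \<theta> 1 0 t * \<rho> n 0 t * cnj (\<rho> n 1 t))"
  define y where "y = (\<lambda>t. \<rho> n 1 t + cnj (\<rho> n 1 t))"
  have res: "resid (\<rho> n) \<sigma> 1 t = \<i> * (\<theta> 1 0 t * \<rho> n 0 t)" for t by (simp add: resid_def)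
  have d: "(q has_vector_derivative (- \<i> * of_real (\<epsilon> n)) * br n t + ((- m n 1) * y t + ((d n * of_real (\<epsilon> n)) * (x t + cnj (x t)) + ((\<kappa> n * \<beta> n) * z t + (- \<kappa> n) * q t)))) (at t)" for t
  proof (unfold q_def, rule has_vector_derivative_eq_rhs[OF flux_deriv[OF orb ode]])
    let ?H = "- \<i> * m n 1 + d n * of_real (\<epsilon> n) * resid (\<rho> n) \<sigma> 1 t - \<i> * \<kappa> n * mF (\<epsilon> n) (\<rho> n) (\<alpha> n) (\<beta> n) (d n) 1 t"
    let ?K = "\<i> * m n 1 + d n * of_real (\<epsilon> n) * cnj (resid (\<rho> n) \<sigma> 1 t) + \<i> * \<kappa> n * mG (\<epsilon> n) (\<rho> n) (\<alpha> n) (\<beta> n) (d n) 1 t"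
    have "cnj (\<rho> n 1 t) * ?H - \<rho> n 1 t * ?K = - \<i> * m n 1 * y t + d n * of_real (\<epsilon> n) * (\<i> * (x t + cnj (x t)))
        - \<i> * \<kappa> n * (cnj (\<rho> n 1 t) * mF (\<epsilon> n) (\<rho> n) (\<alpha> n) (\<beta> n) (d n) 1 t + \<rho> n 1 t * mG (\<epsilon> n) (\<rho> n) (\<alpha> n) (\<beta> n) (d n) 1 t)"
      unfolding res x_def y_def by (simp add: algebra_simps)
    also have "\<dots> = - \<i> * m n 1 * y t + d n * of_real (\<epsilon> n) * (\<i> * (x t + cnj (x t))) + \<i> * \<kappa> n * (\<beta> n * z t)"
      unfolding m_pairing z_def by (simp add: algebra_simps)
    finally have e: "cnj (\<rho> n 1 t) * ?H - \<rho> n 1 t * ?K = - \<i> * m n 1 * y t + d n * of_real (\<epsilon> n) * (\<i> * (x t + cnj (x t))) + \<i> * \<kappa> n * (\<beta> n * z t)" .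
    show "- \<i> * of_real (\<epsilon> n) * (vF n 1 t * nbr' 1 (\<lambda>j t. cnj (\<rho> n j t)) t - cnj (\<rho> n 1 t) * nbr 1 (vF n) t - vG n 1 t * nbr 1 (\<rho> n) t + \<rho> n 1 t * nbr' 1 (vG n) t) -
      \<i> * (cnj (\<rho> n 1 t) * ?H - \<rho> n 1 t * ?K) - \<kappa> n * (cnj (\<rho> n 1 t) * vF n 1 t + \<rho> n 1 t * vG n 1 t) =
      (- \<i> * of_real (\<epsilon> n)) * br n t + ((- m n 1) * y t + ((d n * of_real (\<epsilon> n)) * (x t + cnj (x t)) + ((\<kappa> n * \<beta> n) * z t + (- \<kappa> n) * (cnj (\<rho> n 1 t) * vF n 1 t + \<rho> n 1 t * vG n 1 t))))"
      unfolding e br_def by (simp add: algebra_simps)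
  qed
  have c: "continuous_on UNIV q" "continuous_on UNIV z" "continuous_on UNIV x" "continuous_on UNIV y" "continuous_on UNIV (\<lambda>t. cnj (x t))"
    unfolding q_def z_def x_def y_def by (intro continuous_intros \<theta>_cont \<rho>_cont v_cont rhs_cont)+
  have "avg T (\<lambda>t. (- \<i> * of_real (\<epsilon> n)) * br n t + ((- m n 1) * y t + ((d n * of_real (\<epsilon> n)) * (x t + cnj (x t)) + ((\<kappa> n * \<beta> n) * z t + (- \<kappa> n) * q t)))) = 0"
    by (rule avg_deriv[OF T_pos d]) (use per(1)[of n 1 0] per(2)[of n 1 0] orbitD(2)[OF orb, of n 1 0] in \<open>simp add: q_def\<close>)
  moreover have "avg T (\<lambda>t. (- \<i> * of_real (\<epsilon> n)) * br n t + ((- m n 1) * y t + ((d n * of_real (\<epsilon> n)) * (x t + cnj (x t)) + ((\<kappa> n * \<beta> n) * z t + (- \<kappa> n) * q t))))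
     = (- \<i> * of_real (\<epsilon> n)) * avg T (br n) + ((- m n 1) * avg T y + ((d n * of_real (\<epsilon> n)) * (avg T x + cnj (avg T x)) + ((\<kappa> n * \<beta> n) * avg T z + (- \<kappa> n) * avg T q)))"
  proof -
    note i = continuous_on_add continuous_on_mult continuous_on_const c br_cont
    have "avg T (\<lambda>t. (- \<i> * of_real (\<epsilon> n)) * br n t + ((- m n 1) * y t + ((d n * of_real (\<epsilon> n)) * (x t + cnj (x t)) + ((\<kappa> n * \<beta> n) * z t + (- \<kappa> n) * q t))))
      = avg T (\<lambda>t. (- \<i> * of_real (\<epsilon> n)) * br n t) + avg T (\<lambda>t. (- m n 1) * y t + ((d n * of_real (\<epsilon> n)) * (x t + cnj (x t)) + ((\<kappa> n * \<beta> n) * z t + (- \<kappa> n) * q t)))"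
      by (rule avg_add) (intro i)+
    also have "avg T (\<lambda>t. (- m n 1) * y t + ((d n * of_real (\<epsilon> n)) * (x t + cnj (x t)) + ((\<kappa> n * \<beta> n) * z t + (- \<kappa> n) * q t)))
      = avg T (\<lambda>t. (- m n 1) * y t) + avg T (\<lambda>t. (d n * of_real (\<epsilon> n)) * (x t + cnj (x t)) + ((\<kappa> n * \<beta> n) * z t + (- \<kappa> n) * q t))"
      by (rule avg_add) (intro i)+
    also have "avg T (\<lambda>t. (d n * of_real (\<epsilon> n)) * (x t + cnj (x t)) + ((\<kappa> n * \<beta> n) * z t + (- \<kappa> n) * q t))
      = avg T (\<lambda>t. (d n * of_real (\<epsilon> n)) * (x t + cnj (x t))) + avg T (\<lambda>t. (\<kappa> n * \<beta> n) * z t + (- \<kappa> n) * q t)"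
      by (rule avg_add) (intro i)+
    also have "avg T (\<lambda>t. (\<kappa> n * \<beta> n) * z t + (- \<kappa> n) * q t) = avg T (\<lambda>t. (\<kappa> n * \<beta> n) * z t) + avg T (\<lambda>t. (- \<kappa> n) * q t)"
      by (rule avg_add) (intro i)+
    finally show ?thesis
      using avg_add[OF c(3,5), of T] by (simp only: avg_cmult avg_cnj)
  qed
  moreover have "avg T z = 0" unfolding z_def by (rule avg_\<rho>_deriv)
  moreover have "avg T q = P n 1" unfolding q_def P_def ..
  ultimately show ?thesis unfolding X_def x_def[symmetric] y_def[symmetric] by (simp add: algebra_simps)
qed

text \<open>The response coefficients of the harmonics at site 1 and at site 0.\<close>

definition "qI = ((r 1)\<^sup>2 + \<omega>) / \<omega>\<^sup>2"
definition "qJ = ((r 0)\<^sup>2 - \<omega>) / \<omega>\<^sup>2"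

text \<open>At \<open>\<epsilon> = 0\<close> the correlation oscillates with mean zero; its mean at first order comes from the first harmonics of the orbit at the sites 0 and 1.\<close>

lemma X_approx: "ubig (\<lambda>n t. X n + of_real (\<epsilon> n) * of_real (r 1 * (r 1 + r (-1)) * qJ + (r 0)\<^sup>2 * qI)) (\<lambda>n. \<epsilon> n * \<epsilon> n)"
proof -
  let ?u = "\<lambda>n t. \<rho> n 0 t - of_real (r 0)" and ?v = "\<lambda>n t. cnj (\<rho> n 1 t - of_real (r 1))"
  have th: "\<theta> 1 0 t = cis (of_int (-1) * \<omega> * t)" "\<theta> 1 0 t = cis (- (of_int 1 * \<omega>) * t)" for t by (simp_all add: \<theta>_def)
  have a: "ubig (\<lambda>n t. ft 1 (?u n) + of_real (\<epsilon> n) * of_real (r 1 + r (-1)) * of_real qJ) (\<lambda>n. \<epsilon> n * \<epsilon> n)"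
    using orbit_fourier(1)[of 0] by (simp add: pj_def qJ_def del: r_eqs of_real_add)
  have b: "ubig (\<lambda>n t. ft 1 (?v n) + of_real (\<epsilon> n) * of_real (r 0) * of_real qI) (\<lambda>n. \<epsilon> n * \<epsilon> n)"
    using orbit_fourier(2)[of 1] by (simp add: pj_def qI_def del: r_eqs complex_cnj_diff)
  have e: "ubig (\<lambda>n t. \<theta> 1 0 t * (?u n t * ?v n t)) (\<lambda>n. \<epsilon> n * \<epsilon> n)"
    by (rule ubig_mult_le[OF ubig_scalars(7) ubig_mult_le[OF ubig_\<rho>_diff ubig_cnj[OF ubig_\<rho>_diff] order_refl]]) simp
  have "ubig (\<lambda>n t. of_real (r 1) * (ft 1 (?u n) + of_real (\<epsilon> n) * of_real (r 1 + r (-1)) * of_real qJ) +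
      of_real (r 0) * (ft 1 (?v n) + of_real (\<epsilon> n) * of_real (r 0) * of_real qI) + avg T (\<lambda>t. \<theta> 1 0 t * (?u n t * ?v n t))) (\<lambda>n. \<epsilon> n * \<epsilon> n)"
    by (intro ubig_add ubig_cmult a b ubig_avg[OF T_pos e])
  then show ?thesis
  proof (rule ubig_eq)
    fix n and t :: real
    have c: "continuous_on UNIV (\<lambda>t. ?u n t * cis (- (of_int 1 * \<omega>) * t))" "continuous_on UNIV (\<lambda>t. ?v n t * cis (- (of_int 1 * \<omega>) * t))"
      "continuous_on UNIV (\<lambda>t. \<theta> 1 0 t * (?u n t * ?v n t))" "continuous_on UNIV (\<lambda>t. cis (of_int (-1) * \<omega> * t))"
      by (intro continuous_intros \<theta>_cont \<rho>_cont cont_cis)+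
    have "(\<lambda>t. \<theta> 1 0 t * \<rho> n 0 t * cnj (\<rho> n 1 t)) = (\<lambda>t. (of_real (r 0) * of_real (r 1)) * cis (of_int (-1) * \<omega> * t) +
        (of_real (r 1) * (?u n t * cis (- (of_int 1 * \<omega>) * t)) + (of_real (r 0) * (?v n t * cis (- (of_int 1 * \<omega>) * t)) + \<theta> 1 0 t * (?u n t * ?v n t))))"
      unfolding th(1)[symmetric] th(2)[symmetric] by (simp add: fun_eq_iff algebra_simps)
    moreover have "avg T (\<lambda>t. (of_real (r 0) * of_real (r 1)) * cis (of_int (-1) * \<omega> * t) +
        (of_real (r 1) * (?u n t * cis (- (of_int 1 * \<omega>) * t)) + (of_real (r 0) * (?v n t * cis (- (of_int 1 * \<omega>) * t)) + \<theta> 1 0 t * (?u n t * ?v n t))))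
       = (of_real (r 0) * of_real (r 1)) * avg T (\<lambda>t. cis (of_int (-1) * \<omega> * t)) + (of_real (r 1) * ft 1 (?u n) + (of_real (r 0) * ft 1 (?v n) + avg T (\<lambda>t. \<theta> 1 0 t * (?u n t * ?v n t))))"
    proof -
      note i = continuous_on_add continuous_on_mult[OF continuous_on_const] c
      show ?thesis unfolding ft_def avg_cmult[symmetric]
        by (subst avg_add, (intro i)+, subst avg_add, (intro i)+, subst avg_add, (intro i)+, rule refl)
    qed
    moreover have "avg T (\<lambda>t. cis (of_int (-1) * \<omega> * t)) = 0" by (rule avg_cis[OF T_pos \<omega>T]) simp
    ultimately have key: "X n = of_real (r 1) * ft 1 (?u n) + (of_real (r 0) * ft 1 (?v n) + avg T (\<lambda>t. \<theta> 1 0 t * (?u n t * ?v n t)))"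
      by (simp only: X_def mult_zero_right add_0)
    define U where "U = ft 1 (?u n)"
    define V where "V = ft 1 (?v n)"
    define R where "R = avg T (\<lambda>t. \<theta> 1 0 t * (?u n t * ?v n t))"
    show "X n + of_real (\<epsilon> n) * of_real (r 1 * (r 1 + r (-1)) * qJ + (r 0)\<^sup>2 * qI) =
      of_real (r 1) * (ft 1 (?u n) + of_real (\<epsilon> n) * of_real (r 1 + r (-1)) * of_real qJ) +
      of_real (r 0) * (ft 1 (?v n) + of_real (\<epsilon> n) * of_real (r 0) * of_real qI) + avg T (\<lambda>t. \<theta> 1 0 t * (?u n t * ?v n t))"
      unfolding key U_def[symmetric] V_def[symmetric] R_def[symmetric] by (simp add: power2_eq_square algebra_simps del: r_eqs)
  qed
qed

text \<open>As for \<open>X_approx\<close>, with the first harmonics of the perturbation instead of those of the orbit.\<close>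

lemma br_approx: "ubig (\<lambda>n t. avg T (br n) - (2 * \<i>) * (d n * of_real (\<epsilon> n)) * of_real ((r 0)\<^sup>2 * qI + r 1 * (r 1 - r (-1)) * qJ)) E"
proof -
  have th: "\<theta> 1 0 t = cis (- (of_int 1 * \<omega>) * t)" "cnj (\<theta> 1 0 t) = cis (- (of_int (-1) * \<omega>) * t)" for t
    by (simp_all add: \<theta>_def cis_cnj)
  let ?u = "\<lambda>n j t. \<rho> n j t - of_real (r j)"
  have non2: "(2 :: 'a mod_ring) \<notin> {-1, 0, 1}" by simp
  have e\<rho>: "ubig (\<lambda>n t. a n t * (b n t * f n t)) E" if "ubig a (\<lambda>_. 1)" "ubig b \<epsilon>" "ubig f \<delta>" for a b f
    by (rule ubig_mult_le[OF that(1) ubig_mult_le[OF that(2,3) domE(1)]]) simp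
  have e2: "ubig (\<lambda>n t. a n t * (b n t * f n t)) E" if "ubig a (\<lambda>_. 1)" "ubig b (\<lambda>_. 1)" "ubig f E" for a b f
    by (rule ubig_mult_le[OF that(1) ubig_mult_le[OF that(2,3)]]) auto
  note th1 = ubig_scalars(7,8)
  have err: "ubig (\<lambda>n t. cnj (\<theta> 1 0 t) * (cnj (?u n 0 t) * vF n 1 t) + cnj (\<theta> 1 2 t) * (cnj (\<rho> n 2 t) * vF n 1 t)
     - \<theta> 1 0 t * (cnj (?u n 1 t) * vF n 0 t) - cnj (\<rho> n 1 t) * (\<theta> 1 2 t * vF n 2 t)
     - \<theta> 1 0 t * (?u n 0 t * vG n 1 t) - \<theta> 1 2 t * (\<rho> n 2 t * vG n 1 t)
     + cnj (\<theta> 1 0 t) * (?u n 1 t * vG n 0 t) + \<rho> n 1 t * (cnj (\<theta> 1 2 t) * vG n 2 t)) E"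
    by (intro ubig_add ubig_diff e\<rho> e2 th1 ubig_\<rho> ubig_cnj[OF ubig_\<rho>] ubig_v ubig_\<rho>_diff ubig_cnj[OF ubig_\<rho>_diff] ubig_\<rho>_non[OF non2]
        ubig_cnj[OF ubig_\<rho>_non[OF non2]] ubig_v_non[OF non2])
  let ?main = "\<lambda>n t. of_real (r 0) * (vF n 1 t * cnj (\<theta> 1 0 t)) - of_real (r 1) * (vF n 0 t * \<theta> 1 0 t) - of_real (r 0) * (vG n 1 t * \<theta> 1 0 t) + of_real (r 1) * (vG n 0 t * cnj (\<theta> 1 0 t))"
  have 1: "ubig (\<lambda>n t. br n t - ?main n t) E"
    by (rule ubig_eq[OF err]) (simp add: br_def nbr_def nbr'_def algebra_simps del: r_eqs)
  have c: "continuous_on UNIV (\<lambda>t. vF n i t * cis (a * t))" "continuous_on UNIV (\<lambda>t. vG n i t * cis (a * t))" for n i a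
    by (intro continuous_intros v_cont cont_cis)+
  have am: "avg T (?main n) = of_real (r 0) * ft (-1) (vF n 1) - of_real (r 1) * ft 1 (vF n 0) - of_real (r 0) * ft 1 (vG n 1) + of_real (r 1) * ft (-1) (vG n 0)" for n
  proof -
    note i = continuous_on_add continuous_on_diff continuous_on_mult[OF continuous_on_const] c
    show ?thesis unfolding th(2) unfolding th(1) ft_def avg_cmult[symmetric]
      by (subst avg_add, (intro i)+, subst avg_diff, (intro i)+, subst avg_diff, (intro i)+, rule refl)
  qed
  have cm: "continuous_on UNIV (?main n)" for n by (intro continuous_intros v_cont \<theta>_cont)
  have 2: "ubig (\<lambda>n t. avg T (br n) - avg T (?main n)) E"
    by (rule ubig_eq[OF ubig_avg[OF T_pos 1]]) (simp only: avg_diff[OF br_cont cm])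
  have f1: "ubig (\<lambda>n t. ft (-1) (vF n 1) - d n * of_real (\<epsilon> n) * (\<i> * of_real (r 0)) * of_real qI) E"
    "ubig (\<lambda>n t. ft 1 (vG n 1) - d n * of_real (\<epsilon> n) * (- \<i> * of_real (r 0)) * of_real qI) E"
    using v_fourier[of 1] by (simp_all add: pj_def qI_def Aj_def del: r_eqs)
  have f0: "ubig (\<lambda>n t. ft 1 (vF n 0) - d n * of_real (\<epsilon> n) * (- \<i> * of_real (r 1 - r (-1))) * of_real qJ) E"
    "ubig (\<lambda>n t. ft (-1) (vG n 0) - d n * of_real (\<epsilon> n) * (\<i> * of_real (r 1 - r (-1))) * of_real qJ) E"
    using v_fourier[of 0] by (simp_all add: pj_def qJ_def Aj_def del: r_eqs of_real_diff)
  have "ubig (\<lambda>n t. (avg T (br n) - avg T (?main n)) +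
      (of_real (r 0) * (ft (-1) (vF n 1) - d n * of_real (\<epsilon> n) * (\<i> * of_real (r 0)) * of_real qI)
     - of_real (r 1) * (ft 1 (vF n 0) - d n * of_real (\<epsilon> n) * (- \<i> * of_real (r 1 - r (-1))) * of_real qJ)
     - of_real (r 0) * (ft 1 (vG n 1) - d n * of_real (\<epsilon> n) * (- \<i> * of_real (r 0)) * of_real qI)
     + of_real (r 1) * (ft (-1) (vG n 0) - d n * of_real (\<epsilon> n) * (\<i> * of_real (r 1 - r (-1))) * of_real qJ))) E"
    by (intro ubig_add[OF 2] ubig_add ubig_diff ubig_cmult f1 f0)
  then show ?thesis by (rule ubig_eq) (unfold am, simp add: power2_eq_square algebra_simps del: r_eqs)
qed

text \<open>In the sum of the contributions of \<open>br_approx\<close> and \<open>X_approx\<close> all self-interactions cancel.  What survives is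
  \<open>- 4 r\<^sub>1 r\<^sub>-\<^sub>1 qJ d \<epsilon>\<^sup>2\<close>, the interaction of the outer sites through site 0, and \<open>r\<^sub>1 r\<^sub>-\<^sub>1 qJ = s I\<^sup>2 / \<omega>\<^sup>2\<close>.\<close>

lemma flux_balance:
  "ubig (\<lambda>n t. m n 1 * avg T (\<lambda>t. \<rho> n 1 t + cnj (\<rho> n 1 t)) - \<kappa> n * (\<kappa> n * cph n 1) + of_real (4 * s * I\<^sup>2 / \<omega>\<^sup>2) * (of_real (\<epsilon> n))\<^sup>2 * d n) (\<lambda>n. \<eta> n * E n)"
proof -
  have le: "\<epsilon> n * E n \<le> \<eta> n * E n" "cmod (\<kappa> n) * E n \<le> \<eta> n * E n" "\<epsilon> n * cmod (d n) * (\<epsilon> n * \<epsilon> n) \<le> \<eta> n * E n" for n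
  proof -
    show a: "\<epsilon> n * E n \<le> \<eta> n * E n" "cmod (\<kappa> n) * E n \<le> \<eta> n * E n" using dom[of n] nonneg[of n] by (auto intro: mult_right_mono)
    have "\<epsilon> n * (\<epsilon> n * (\<epsilon> n * cmod (d n))) \<le> \<epsilon> n * E n" using domE(4)[of n] nonneg(5)[of n] by (rule mult_left_mono)
    then show "\<epsilon> n * cmod (d n) * (\<epsilon> n * \<epsilon> n) \<le> \<eta> n * E n" using a(1) by (simp add: mult_ac)
  qed
  let ?b = "\<lambda>n. avg T (br n) - (2 * \<i>) * (d n * of_real (\<epsilon> n)) * of_real ((r 0)\<^sup>2 * qI + r 1 * (r 1 - r (-1)) * qJ)"
  let ?x = "\<lambda>n. X n + of_real (\<epsilon> n) * of_real (r 1 * (r 1 + r (-1)) * qJ + (r 0)\<^sup>2 * qI)"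
  have xx: "ubig (\<lambda>n t. ?x n + cnj (?x n)) (\<lambda>n. \<epsilon> n * \<epsilon> n)" by (rule ubig_add[OF X_approx ubig_cnj[OF X_approx]])
  have "ubig (\<lambda>n t. - (\<kappa> n * (P n 1 + \<kappa> n * cph n 1)) + ((- \<i>) * (of_real (\<epsilon> n) * ?b n) + d n * of_real (\<epsilon> n) * (?x n + cnj (?x n)))) (\<lambda>n. \<eta> n * E n)"
    by (intro ubig_add ubig_uminus ubig_cmult ubig_mult_le[OF ubig_scalars(2) P_exc le(2)] ubig_mult_le[OF ubig_scalars(1) br_approx le(1)] ubig_mult_le[OF ubig_d_eps xx le(3)]) auto
  then show ?thesis
  proof (rule ubig_eq)
    fix n and t :: real
    have "(r 0)\<^sup>2 - \<omega> = I" using I \<omega> by simp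
    moreover have "r 1 * r (-1) = s * I" using I by simp
    ultimately have qJ: "r 1 * r (-1) * qJ = s * I\<^sup>2 / \<omega>\<^sup>2" by (simp add: qJ_def power2_eq_square del: r_eqs)
    have x: "?x n + cnj (?x n) = (X n + cnj (X n)) + 2 * of_real (\<epsilon> n) * of_real (r 1 * (r 1 + r (-1)) * qJ + (r 0)\<^sup>2 * qI)" by simp
    have mm: "m n 1 * avg T (\<lambda>t. \<rho> n 1 t + cnj (\<rho> n 1 t)) = - (\<kappa> n * P n 1) + (- \<i> * of_real (\<epsilon> n) * avg T (br n) + d n * of_real (\<epsilon> n) * (X n + cnj (X n)))"
      using balance[of n] by (simp add: algebra_simps)
    have val: "of_real (4 * s * I\<^sup>2 / \<omega>\<^sup>2) = (4 :: complex) * of_real (r 1) * of_real (r (-1)) * of_real qJ"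
    proof -
      have "4 * s * I\<^sup>2 / \<omega>\<^sup>2 = 4 * r 1 * r (-1) * qJ" using qJ by (simp del: r_eqs)
      then show ?thesis by (simp only: of_real_mult of_real_numeral)
    qed
    show "m n 1 * avg T (\<lambda>t. \<rho> n 1 t + cnj (\<rho> n 1 t)) - \<kappa> n * (\<kappa> n * cph n 1) + of_real (4 * s * I\<^sup>2 / \<omega>\<^sup>2) * (of_real (\<epsilon> n))\<^sup>2 * d n =
      - (\<kappa> n * (P n 1 + \<kappa> n * cph n 1)) + ((- \<i>) * (of_real (\<epsilon> n) * ?b n) + d n * of_real (\<epsilon> n) * (?x n + cnj (?x n)))"
      unfolding x mm val by (simp add: power2_eq_square algebra_simps del: r_eqs)
  qed
qed

end

section \<open>Multipliers near 1\<close>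

context resonant_chain
begin

lemma exp_ne_1: "Re \<nu> < 0 \<Longrightarrow> exp (\<nu> * of_real T) \<noteq> 1"
proof -
  assume "Re \<nu> < 0"
  then have "cmod (exp (\<nu> * of_real T)) < 1" using T_pos by (simp add: mult_neg_pos)
  then show ?thesis by (metis less_irrefl norm_one)
qed

lemma symplectic_zero:
  assumes "free_sol \<epsilon> \<rho> \<kappa> F G" "free_sol \<epsilon> \<rho> \<kappa>' F' G'"
    and per: "\<And>j t. F j (t + T) = F j t" "\<And>j t. G j (t + T) = G j t" "\<And>j t. F' j (t + T) = F' j t" "\<And>j t. G' j (t + T) = G' j t"
    and neg: "Re (\<kappa> + \<kappa>') < 0"
  shows "(\<Sum>j\<in>UNIV. F' j t * G j t - G' j t * F j t) = 0"
  by (rule periodic_linear_zero[OF symplectic_deriv[OF assms(1,2)] _ less_imp_le[OF neg] exp_ne_1[OF neg]]) (simp add: per)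

lemma gauge_mode:
  assumes "orbit C \<epsilon> \<rho>" shows "free_sol \<epsilon> \<rho> 0 (\<lambda>j t. \<i> * \<rho> j t) (\<lambda>j t. - \<i> * cnj (\<rho> j t))"
  using partial_gauge[OF assms, of "\<lambda>_. 1"] by (simp add: resid_def)

lemma Zt_period: "orbit C \<epsilon> \<rho> \<Longrightarrow> Zt \<epsilon> \<rho> j (t + T) = Zt \<epsilon> \<rho> j t"
  by (simp add: Zt_def orbit_rhs_def nbr_def \<theta>_period orbitD(2))

text \<open>Complex conjugation in the complexified phase space, which exchanges the two components.\<close>

lemma lin_sol_conj:
  assumes "free_sol \<epsilon> \<rho> \<kappa> F G"
  shows "free_sol \<epsilon> \<rho> (cnj \<kappa>) (\<lambda>j t. cnj (G j t)) (\<lambda>j t. cnj (F j t))"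
  unfolding lin_sol_def
proof (intro allI conjI)
  fix j t
  show "((\<lambda>t. cnj (G j t)) has_vector_derivative - \<i> * (linF \<epsilon> \<rho> (\<lambda>j t. cnj (G j t)) (\<lambda>j t. cnj (F j t)) j t + 0) - cnj \<kappa> * cnj (G j t)) (at t)"
    by (rule has_vector_derivative_eq_rhs[OF cnj_vderiv[OF lin_solD(2)[OF assms]]]) (simp add: linF_def linG_def nbr_def nbr'_def algebra_simps)
  show "((\<lambda>t. cnj (F j t)) has_vector_derivative \<i> * (linG \<epsilon> \<rho> (\<lambda>j t. cnj (G j t)) (\<lambda>j t. cnj (F j t)) j t + 0) - cnj \<kappa> * cnj (F j t)) (at t)"
    by (rule has_vector_derivative_eq_rhs[OF cnj_vderiv[OF lin_solD(1)[OF assms]]]) (simp add: linF_def linG_def nbr_def nbr'_def algebra_simps)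
qed

text \<open>The Krein form is the symplectic form of a solution and its conjugate.  It is conserved, and on a solution that decays exponentially over a period this is possible only if it vanishes.\<close>

lemma krein_zero:
  assumes l: "free_sol \<epsilon> \<rho> \<kappa> F G"
    and per: "\<And>j t. F j (t + T) = F j t" "\<And>j t. G j (t + T) = G j t" and neg: "Re \<kappa> < 0"
  shows "(\<Sum>j\<in>UNIV. F j t * cnj (F j t) - G j t * cnj (G j t)) = 0"
proof -
  have "(\<Sum>j\<in>UNIV. cnj (G j t) * G j t - cnj (F j t) * F j t) = 0"
    by (rule symplectic_zero[OF l lin_sol_conj[OF l]]) (use per neg in auto)
  then have "- (\<Sum>j\<in>UNIV. cnj (G j t) * G j t - cnj (F j t) * F j t) = 0" by simp
  then show ?thesis unfolding sum_negf[symmetric] by (simp add: mult.commute)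
qed

lemma UNIV_exc: "(UNIV :: 'a mod_ring set) = insert (-1) (insert 0 (insert 1 (UNIV - {-1, 0, 1})))" by auto

lemma sum_exc: "(\<Sum>j\<in>UNIV. f j) = f (-1) + f 0 + f 1 + (\<Sum>j\<in>UNIV - {-1, 0, 1}. f j)" for f :: "'a mod_ring \<Rightarrow> complex"
  by (subst UNIV_exc) (simp add: add.assoc)

end

text \<open>Decaying Floquet solutions, in decomposed form.\<close>

locale mode_free = mode_seq I \<omega> T s r k C0 \<epsilon> \<kappa> \<rho> \<alpha> \<beta> d m vF vG
  for I \<omega> T s :: real and r :: "'a::nontriv mod_ring \<Rightarrow> real" and k :: "'a mod_ring \<Rightarrow> int"
    and C0 \<epsilon> \<kappa> \<rho> \<alpha> \<beta> d m vF vG +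
  fixes pF pG :: "nat \<Rightarrow> 'a chain"
  assumes m_zero: "\<And>n j. m n j = 0" and kneg: "\<And>n. Re (\<kappa> n) < 0"
    and pF: "\<And>n j t. pF n j t = mF (\<epsilon> n) (\<rho> n) (\<alpha> n) (\<beta> n) (d n) j t + vF n j t"
    and pG: "\<And>n j t. pG n j t = mG (\<epsilon> n) (\<rho> n) (\<alpha> n) (\<beta> n) (d n) j t + vG n j t"
    and p_sol: "\<And>n. free_sol (\<epsilon> n) (\<rho> n) (\<kappa> n) (pF n) (pG n)"
    and p_ne: "\<And>n. \<exists>j t. pF n j t \<noteq> 0 \<or> pG n j t \<noteq> 0"
begin

lemma p_per: "pF n j (t + T) = pF n j t" "pG n j (t + T) = pG n j t"
  by (simp_all add: pF pG mF_def mG_def per orbitD(2)[OF orb] Zt_period[OF orb])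

text \<open>Symplectic orthogonality to the gauge mode.\<close>

lemma gauge_constraint: "(\<Sum>j\<in>UNIV. P n j) = 0"
proof -
  let ?z = "\<lambda>j t. cnj (\<rho> n j t) * orbit_rhs (\<epsilon> n) (\<rho> n) j t + \<rho> n j t * cnj (orbit_rhs (\<epsilon> n) (\<rho> n) j t)"
  let ?q = "\<lambda>j t. cnj (\<rho> n j t) * vF n j t + \<rho> n j t * vG n j t"
  have "(\<Sum>j\<in>UNIV. (\<i> * \<rho> n j t) * pG n j t - (- \<i> * cnj (\<rho> n j t)) * pF n j t) = 0" for t
    by (rule symplectic_zero[OF p_sol gauge_mode[OF orb]]) (use p_per kneg orbitD(2)[OF orb] in auto)
  moreover have "(\<i> * \<rho> n j t) * pG n j t - (- \<i> * cnj (\<rho> n j t)) * pF n j t = \<i> * (?q j t - \<beta> n * ?z j t)" for j t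
  proof -
    have "(\<i> * \<rho> n j t) * pG n j t - (- \<i> * cnj (\<rho> n j t)) * pF n j t = \<i> * (?q j t + (cnj (\<rho> n j t) * mF (\<epsilon> n) (\<rho> n) (\<alpha> n) (\<beta> n) (d n) j t + \<rho> n j t * mG (\<epsilon> n) (\<rho> n) (\<alpha> n) (\<beta> n) (d n) j t))"
      unfolding pF pG by (simp add: algebra_simps)
    then show ?thesis unfolding m_pairing by simp
  qed
  ultimately have "(\<Sum>j\<in>UNIV. \<i> * (?q j t - \<beta> n * ?z j t)) = 0" for t by simp
  then have "(\<Sum>j\<in>UNIV. ?q j t - \<beta> n * ?z j t) = 0" for t unfolding sum_distrib_left[symmetric] by simp
  then have "avg T (\<lambda>t. \<Sum>j\<in>UNIV. ?q j t - \<beta> n * ?z j t) = 0" by (simp add: avg_def)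
  moreover have "avg T (\<lambda>t. \<Sum>j\<in>UNIV. ?q j t - \<beta> n * ?z j t) = (\<Sum>j\<in>UNIV. avg T (\<lambda>t. ?q j t - \<beta> n * ?z j t))"
    by (rule avg_sum) (auto intro!: continuous_intros \<rho>_cont v_cont rhs_cont)
  moreover have "avg T (\<lambda>t. ?q j t - \<beta> n * ?z j t) = P n j" for j
  proof -
    have "avg T (\<lambda>t. ?q j t - \<beta> n * ?z j t) = avg T (?q j) - avg T (\<lambda>t. \<beta> n * ?z j t)"
      by (rule avg_diff) (intro continuous_intros \<rho>_cont v_cont rhs_cont)+
    then show ?thesis by (simp only: avg_cmult avg_\<rho>_deriv P_def) simp
  qed
  ultimately show ?thesis by simp
qed

text \<open>Symplectic orthogonality to the time mode.\<close>

lemma time_constraint: "(\<Sum>j\<in>UNIV. avg T (\<lambda>t. Zt (\<epsilon> n) (\<rho> n) j t * vG n j t + cnj (Zt (\<epsilon> n) (\<rho> n) j t) * vF n j t)) = 0"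
proof -
  let ?z = "\<lambda>j t. cnj (\<rho> n j t) * orbit_rhs (\<epsilon> n) (\<rho> n) j t + \<rho> n j t * cnj (orbit_rhs (\<epsilon> n) (\<rho> n) j t)"
  let ?q = "\<lambda>j t. Zt (\<epsilon> n) (\<rho> n) j t * vG n j t + cnj (Zt (\<epsilon> n) (\<rho> n) j t) * vF n j t"
  let ?a = "\<lambda>j. \<alpha> n + d n * of_real (\<sigma> j)"
  have "(\<Sum>j\<in>UNIV. (\<i> * Zt (\<epsilon> n) (\<rho> n) j t) * pG n j t - (- \<i> * cnj (Zt (\<epsilon> n) (\<rho> n) j t)) * pF n j t) = 0" for t
    by (rule symplectic_zero[OF p_sol time_mode[OF orb]]) (use p_per kneg Zt_period[OF orb] in auto)
  moreover have "(\<i> * Zt (\<epsilon> n) (\<rho> n) j t) * pG n j t - (- \<i> * cnj (Zt (\<epsilon> n) (\<rho> n) j t)) * pF n j t = \<i> * (?q j t + ?a j * ?z j t)" for j t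
    unfolding pF pG mF_def mG_def by (simp add: Zt_def algebra_simps)
  ultimately have "(\<Sum>j\<in>UNIV. \<i> * (?q j t + ?a j * ?z j t)) = 0" for t by simp
  then have "(\<Sum>j\<in>UNIV. ?q j t + ?a j * ?z j t) = 0" for t unfolding sum_distrib_left[symmetric] by simp
  then have "avg T (\<lambda>t. \<Sum>j\<in>UNIV. ?q j t + ?a j * ?z j t) = 0" by (simp add: avg_def)
  moreover have "avg T (\<lambda>t. \<Sum>j\<in>UNIV. ?q j t + ?a j * ?z j t) = (\<Sum>j\<in>UNIV. avg T (\<lambda>t. ?q j t + ?a j * ?z j t))"
    by (rule avg_sum) (auto intro!: continuous_intros \<rho>_cont v_cont rhs_cont Z_cont)
  moreover have "avg T (\<lambda>t. ?q j t + ?a j * ?z j t) = avg T (?q j)" for j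
  proof -
    have "avg T (\<lambda>t. ?q j t + ?a j * ?z j t) = avg T (?q j) + avg T (\<lambda>t. ?a j * ?z j t)"
      by (rule avg_add) (intro continuous_intros \<rho>_cont v_cont rhs_cont Z_cont)+
    then show ?thesis by (simp only: avg_cmult avg_\<rho>_deriv) simp
  qed
  ultimately show ?thesis by simp
qed

lemma time_approx: "ubig (\<lambda>n t. avg T (\<lambda>t. Zt (\<epsilon> n) (\<rho> n) j t * vG n j t + cnj (Zt (\<epsilon> n) (\<rho> n) j t) * vF n j t) - of_int (k j) * of_real \<omega> * P n j) E"
proof -
  have e: "ubig (\<lambda>n t. \<i> * (orbit_rhs (\<epsilon> n) (\<rho> n) j t * vG n j t) - \<i> * (cnj (orbit_rhs (\<epsilon> n) (\<rho> n) j t) * vF n j t)) E"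
    by (intro ubig_diff ubig_cmult ubig_mult_le[OF ubig_rhs ubig_v(2) domE(1)] ubig_mult_le[OF ubig_cnj[OF ubig_rhs] ubig_v(1) domE(1)])
  show ?thesis
  proof (rule ubig_eq[OF ubig_avg[OF T_pos e]])
    fix n and t :: real
    have f: "(\<lambda>t. \<i> * (orbit_rhs (\<epsilon> n) (\<rho> n) j t * vG n j t) - \<i> * (cnj (orbit_rhs (\<epsilon> n) (\<rho> n) j t) * vF n j t)) =
      (\<lambda>t. (Zt (\<epsilon> n) (\<rho> n) j t * vG n j t + cnj (Zt (\<epsilon> n) (\<rho> n) j t) * vF n j t) - (of_int (k j) * of_real \<omega>) * (cnj (\<rho> n j t) * vF n j t + \<rho> n j t * vG n j t))"
      by (simp add: fun_eq_iff Zt_def algebra_simps)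
    show "avg T (\<lambda>t. Zt (\<epsilon> n) (\<rho> n) j t * vG n j t + cnj (Zt (\<epsilon> n) (\<rho> n) j t) * vF n j t) - of_int (k j) * of_real \<omega> * P n j =
      avg T (\<lambda>t. \<i> * (orbit_rhs (\<epsilon> n) (\<rho> n) j t * vG n j t) - \<i> * (cnj (orbit_rhs (\<epsilon> n) (\<rho> n) j t) * vF n j t))"
      unfolding f P_def avg_cmult[symmetric] by (rule avg_diff[symmetric]) (intro continuous_intros \<rho>_cont v_cont Z_cont)+
  qed
qed

text \<open>The two orthogonality relations determine the mean norms at site 0 and on the pair \<open>-1, 1\<close> to leading order, and by \<open>P_exc\<close> the rates \<open>\<kappa> \<alpha>\<close>
  and \<open>\<kappa> \<beta>\<close>; the frequency ratio 2 makes the relations independent.\<close>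

lemma sym_small: "ubig (\<lambda>n t. \<kappa> n * \<alpha> n) E" "ubig (\<lambda>n t. \<kappa> n * \<beta> n) E"
proof -
  have "ubig (\<lambda>n t. - (\<Sum>j\<in>UNIV - {-1, 0, 1}. P n j)) E" by (intro ubig_uminus ubig_sum P_non) auto
  then have g: "ubig (\<lambda>n t. P n (-1) + P n 0 + P n 1) E"
    by (rule ubig_eq) (use gauge_constraint sum_exc[of "P _"] in \<open>simp add: eq_neg_iff_add_eq_0\<close>)
  have "ubig (\<lambda>n t. - (\<Sum>j\<in>UNIV. (avg T (\<lambda>t. Zt (\<epsilon> n) (\<rho> n) j t * vG n j t + cnj (Zt (\<epsilon> n) (\<rho> n) j t) * vF n j t) - of_int (k j) * of_real \<omega> * P n j))) E"
    by (intro ubig_uminus ubig_sum time_approx) auto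
  then have "ubig (\<lambda>n t. \<Sum>j\<in>UNIV. of_int (k j) * of_real \<omega> * P n j) E"
    by (rule ubig_eq) (simp add: sum_subtractf time_constraint)
  then have h0: "ubig (\<lambda>n t. of_real \<omega> * (P n (-1) + 2 * P n 0 + P n 1)) E"
    by (rule ubig_eq) (simp add: sum_exc r_sq(4) algebra_simps)
  have w: "complex_of_real \<omega> \<noteq> 0" using \<omega>_pos by simp
  have h: "ubig (\<lambda>n t. P n (-1) + 2 * P n 0 + P n 1) E"
    by (rule ubig_eq[OF ubig_cmult[OF h0, of "1 / of_real \<omega>"]]) (use w in simp)
  have p0: "ubig (\<lambda>n t. P n 0) E" by (rule ubig_eq[OF ubig_diff[OF h g]]) simp
  have p1: "ubig (\<lambda>n t. P n (-1) + P n 1) E" by (rule ubig_eq[OF ubig_diff[OF g p0]]) simp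
  have c0: "ubig (\<lambda>n t. \<kappa> n * cph n 0) E" by (rule ubig_eq[OF ubig_diff[OF P_exc[of 0] p0]]) simp_all
  have c1: "ubig (\<lambda>n t. \<kappa> n * (cph n (-1) + cph n 1)) E"
    by (rule ubig_eq[OF ubig_diff[OF ubig_add[OF P_exc[of "-1"] P_exc[of 1]] p1]]) (simp_all add: algebra_simps)
  show "ubig (\<lambda>n t. \<kappa> n * \<alpha> n) E"
    by (rule ubig_eq[OF ubig_diff[OF c1 c0]]) (simp add: cph_def algebra_simps)
  show "ubig (\<lambda>n t. \<kappa> n * \<beta> n) E"
    by (rule ubig_eq[OF ubig_cmult[OF ubig_diff[OF c0 ubig_cmult[OF c1, of "1/2"]], of "1 / of_real \<omega>"]]) (use w in \<open>simp add: cph_def algebra_simps\<close>)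
qed

definition "Y n = cmod (\<kappa> n) * (cmod (\<alpha> n) + cmod (\<beta> n))"

text \<open>Since \<open>E\<close> contains \<open>\<alpha>\<close> and \<open>\<beta>\<close> only with an additional small factor, these can be absorbed, and \<open>d\<close> is the only relevant amplitude.\<close>

lemma sizes: "\<exists>K\<ge>0. \<forall>\<^sub>F n in sequentially. Y n \<le> K * ((\<eta> n)\<^sup>2 * cmod (d n)) \<and> E n \<le> 2 * ((\<eta> n)\<^sup>2 * cmod (d n)) \<and> \<delta> n \<le> 2 * (\<eta> n * cmod (d n))"
proof -
  obtain K1 where K1: "K1 \<ge> 0" "\<forall>\<^sub>F n in sequentially. \<forall>t::real. cmod (\<kappa> n * \<alpha> n) \<le> K1 * E n" using sym_small(1) unfolding ubig_def by blast
  obtain K2 where K2: "K2 \<ge> 0" "\<forall>\<^sub>F n in sequentially. \<forall>t::real. cmod (\<kappa> n * \<beta> n) \<le> K2 * E n" using sym_small(2) unfolding ubig_def by blast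
  define K where "K = K1 + K2"
  have K: "K \<ge> 0" using K1 K2 by (simp add: K_def)
  have small: "\<forall>\<^sub>F n in sequentially. (2 * K) * \<eta> n \<le> 1"
    using order_tendstoD(2)[OF tendsto_mult_right_zero[OF eta_lim, of "2 * K"], of 1] by (auto elim: eventually_mono)
  have "\<forall>\<^sub>F n in sequentially. Y n \<le> (2 * K) * ((\<eta> n)\<^sup>2 * cmod (d n)) \<and> E n \<le> 2 * ((\<eta> n)\<^sup>2 * cmod (d n)) \<and> \<delta> n \<le> 2 * (\<eta> n * cmod (d n))"
    using K1(2) K2(2) small
  proof eventually_elim
    case (elim n)
    let ?h = "\<eta> n" and ?d = "cmod (d n)"
    have h0: "?h \<ge> 0" by (rule nonneg(3))
    have Y0: "Y n \<ge> 0" by (simp add: Y_def)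
    have del: "\<delta> n = ?h * ?d + Y n" by (simp add: \<delta>_def \<eta>_def Y_def c_def algebra_simps)
    have Ee: "E n = ?h * (?h * ?d) + ?h * Y n" unfolding E_def del by (simp add: algebra_simps)
    have "Y n \<le> K * E n" using elim(1,2) by (simp add: Y_def K_def norm_mult algebra_simps)
    also have "\<dots> = K * (?h * (?h * ?d)) + (K * ?h) * Y n" unfolding Ee by (simp add: algebra_simps)
    also have "(K * ?h) * Y n \<le> (1/2) * Y n" using elim(3) Y0 by (intro mult_right_mono) auto
    finally have Y: "Y n \<le> (2 * K) * (?h * (?h * ?d))" by simp
    also have "\<dots> = ((2 * K) * ?h) * (?h * ?d)" by (simp add: mult_ac)
    also have "\<dots> \<le> 1 * (?h * ?d)" using elim(3) h0 by (intro mult_right_mono) auto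
    finally have Y1: "Y n \<le> ?h * ?d" by simp
    have "?h * Y n \<le> ?h * (?h * ?d)" using Y1 h0 by (rule mult_left_mono)
    then show ?case using Y Y1 unfolding Ee del by (simp add: power2_eq_square mult_ac)
  qed
  then show ?thesis using K by (intro exI[of _ "2 * K"]) auto
qed

lemma d_ne: "\<forall>\<^sub>F n in sequentially. d n \<noteq> 0"
proof -
  obtain K where K: "\<forall>\<^sub>F n in sequentially. Y n \<le> K * ((\<eta> n)\<^sup>2 * cmod (d n)) \<and> E n \<le> 2 * ((\<eta> n)\<^sup>2 * cmod (d n)) \<and> \<delta> n \<le> 2 * (\<eta> n * cmod (d n))" using sizes by blast
  have "\<forall>\<^sub>F n in sequentially. \<forall>j. \<forall>t. \<delta> n = 0 \<longrightarrow> vF n j t = 0 \<and> vG n j t = 0"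
  proof (rule eventually_all_finite)
    fix j
    obtain C C' where "\<forall>\<^sub>F n in sequentially. \<forall>t. cmod (vF n j t) \<le> C * \<delta> n" "\<forall>\<^sub>F n in sequentially. \<forall>t. cmod (vG n j t) \<le> C' * \<delta> n"
      using ubig_v[of j] unfolding ubig_def by blast
    then show "\<forall>\<^sub>F n in sequentially. \<forall>t. \<delta> n = 0 \<longrightarrow> vF n j t = 0 \<and> vG n j t = 0" by eventually_elim auto
  qed
  with K show ?thesis
  proof eventually_elim
    case (elim n)
    show ?case
    proof
      assume d: "d n = 0"
      have "\<delta> n = 0" using elim(1) d nonneg(2)[of n] by simp
      then have v: "vF n j t = 0" "vG n j t = 0" for j t using elim(2) by blast+
      have "Y n \<le> 0" using elim(1) d by simp
      moreover have "\<kappa> n \<noteq> 0" using kneg[of n] by auto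
      ultimately have "cmod (\<alpha> n) + cmod (\<beta> n) \<le> 0" unfolding Y_def by (simp add: mult_le_0_iff)
      then have "\<alpha> n = 0" "\<beta> n = 0" by (smt (verit) norm_ge_zero norm_eq_zero)+
      then have "pF n j t = 0" "pG n j t = 0" for j t by (simp_all add: pF pG v d mF_def mG_def)
      then show False using p_ne[of n] by blast
    qed
  qed
qed

lemma cph_small: "ubig (\<lambda>n t. \<kappa> n * cph n 1 - \<kappa> n * d n) E" "ubig (\<lambda>n t. \<kappa> n * cph n (-1) + \<kappa> n * d n) E"
proof -
  have "ubig (\<lambda>n t. \<kappa> n * \<alpha> n + of_real \<omega> * (\<kappa> n * \<beta> n)) E" by (intro ubig_add ubig_cmult sym_small)
  then show "ubig (\<lambda>n t. \<kappa> n * cph n 1 - \<kappa> n * d n) E" "ubig (\<lambda>n t. \<kappa> n * cph n (-1) + \<kappa> n * d n) E"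
    by (rule ubig_eq, simp add: cph_def algebra_simps)+
qed

lemma exponent_eq: "\<exists>C\<ge>0. \<forall>\<^sub>F n in sequentially. cmod ((\<kappa> n)\<^sup>2 - of_real (4 * s * I\<^sup>2 / \<omega>\<^sup>2) * (of_real (\<epsilon> n))\<^sup>2) \<le> C * (\<eta> n) ^ 3"
proof -
  let ?\<mu> = "complex_of_real (4 * s * I\<^sup>2 / \<omega>\<^sup>2)"
  have le: "cmod (\<kappa> n) * E n \<le> \<eta> n * E n" for n using dom[of n] nonneg[of n] by (auto intro: mult_right_mono)
  have "ubig (\<lambda>n t. (m n 1 * avg T (\<lambda>t. \<rho> n 1 t + cnj (\<rho> n 1 t)) - \<kappa> n * (\<kappa> n * cph n 1) + ?\<mu> * (of_real (\<epsilon> n))\<^sup>2 * d n) + \<kappa> n * (\<kappa> n * cph n 1 - \<kappa> n * d n)) (\<lambda>n. \<eta> n * E n)"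
    by (intro ubig_add flux_balance ubig_mult_le[OF ubig_scalars(2) cph_small(1) le])
  then have "ubig (\<lambda>n t. ((\<kappa> n)\<^sup>2 - ?\<mu> * (of_real (\<epsilon> n))\<^sup>2) * d n) (\<lambda>n. \<eta> n * E n)"
    by (rule ubig_dom) (simp add: m_zero norm_minus_commute power2_eq_square algebra_simps)
  then obtain C where C: "C \<ge> 0" "\<forall>\<^sub>F n in sequentially. \<forall>t::real. cmod (((\<kappa> n)\<^sup>2 - ?\<mu> * (of_real (\<epsilon> n))\<^sup>2) * d n) \<le> C * (\<eta> n * E n)" unfolding ubig_def by blast
  obtain K where K: "\<forall>\<^sub>F n in sequentially. Y n \<le> K * ((\<eta> n)\<^sup>2 * cmod (d n)) \<and> E n \<le> 2 * ((\<eta> n)\<^sup>2 * cmod (d n)) \<and> \<delta> n \<le> 2 * (\<eta> n * cmod (d n))" using sizes by blast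
  have "\<forall>\<^sub>F n in sequentially. cmod ((\<kappa> n)\<^sup>2 - ?\<mu> * (of_real (\<epsilon> n))\<^sup>2) \<le> (2 * C) * (\<eta> n) ^ 3"
    using C(2) K d_ne
  proof eventually_elim
    case (elim n)
    have "cmod ((\<kappa> n)\<^sup>2 - ?\<mu> * (of_real (\<epsilon> n))\<^sup>2) * cmod (d n) \<le> C * (\<eta> n * E n)" using elim(1) by (simp add: norm_mult)
    also have "\<dots> \<le> C * (\<eta> n * (2 * ((\<eta> n)\<^sup>2 * cmod (d n))))" using elim(2) C(1) nonneg(3)[of n] by (intro mult_left_mono) auto
    also have "\<dots> = ((2 * C) * (\<eta> n) ^ 3) * cmod (d n)" by (simp add: power2_eq_square power3_eq_cube)
    finally show ?case using elim(3) by simp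
  qed
  then show ?thesis using C(1) by (intro exI[of _ "2 * C"]) auto
qed

text \<open>The solution without its relative phase part.  It is small compared with \<open>d\<close>, so the Krein form is dominated by its pairing with the phase part.\<close>

definition "xF n j t = \<i> * (\<alpha> n * \<rho> n j t + \<beta> n * Zt (\<epsilon> n) (\<rho> n) j t) + vF n j t"
definition "xG n j t = - \<i> * (\<alpha> n * cnj (\<rho> n j t) + \<beta> n * cnj (Zt (\<epsilon> n) (\<rho> n) j t)) + vG n j t"

lemma x_cont: "continuous_on UNIV (xF n j)" "continuous_on UNIV (xG n j)"
  unfolding xF_def xG_def by (intro continuous_intros \<rho>_cont Z_cont v_cont)+

text \<open>The contribution of site \<open>j\<close> to the mean Krein form.\<close>

definition "kr n j = - \<i> * of_real (\<sigma> j) * (cnj (d n) * P n j) + \<i> * of_real (\<sigma> j) * (d n * cnj (P n j)) + avg T (\<lambda>t. xF n j t * cnj (xF n j t) - xG n j t * cnj (xG n j t))"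

lemma krein_mean: "(\<Sum>j\<in>UNIV. kr n j) = 0"
proof -
  let ?q = "\<lambda>j t. cnj (\<rho> n j t) * xF n j t + \<rho> n j t * xG n j t"
  let ?x = "\<lambda>j t. xF n j t * cnj (xF n j t) - xG n j t * cnj (xG n j t)"
  let ?k = "\<lambda>j t. (- \<i> * of_real (\<sigma> j) * cnj (d n)) * ?q j t + (\<i> * of_real (\<sigma> j) * d n) * cnj (?q j t) + ?x j t"
  have p: "pF n j t = \<i> * d n * of_real (\<sigma> j) * \<rho> n j t + xF n j t" "pG n j t = - \<i> * d n * of_real (\<sigma> j) * cnj (\<rho> n j t) + xG n j t" for j t
    by (simp_all add: pF pG mF_def mG_def xF_def xG_def algebra_simps)
  have "pF n j t * cnj (pF n j t) - pG n j t * cnj (pG n j t) = ?k j t" for j t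
    unfolding p by (simp add: algebra_simps)
  then have "(\<Sum>j\<in>UNIV. ?k j t) = 0" for t
    using krein_zero[OF p_sol p_per kneg, of n t] by simp
  then have "avg T (\<lambda>t. \<Sum>j\<in>UNIV. ?k j t) = 0" by (simp add: avg_def)
  moreover have cq: "continuous_on UNIV (?q j)" "continuous_on UNIV (?x j)" for j by (intro continuous_intros \<rho>_cont x_cont)+
  have "avg T (\<lambda>t. \<Sum>j\<in>UNIV. ?k j t) = (\<Sum>j\<in>UNIV. avg T (?k j))"
    by (rule avg_sum) (auto intro!: continuous_intros \<rho>_cont x_cont)
  moreover have "avg T (?k j) = kr n j" for j
  proof -
    have q: "avg T (?q j) = P n j"
    proof -
      let ?z = "\<lambda>t. cnj (\<rho> n j t) * orbit_rhs (\<epsilon> n) (\<rho> n) j t + \<rho> n j t * cnj (orbit_rhs (\<epsilon> n) (\<rho> n) j t)"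
      have e: "?q j = (\<lambda>t. (cnj (\<rho> n j t) * vF n j t + \<rho> n j t * vG n j t) - \<beta> n * ?z t)"
        by (simp add: fun_eq_iff xF_def xG_def Zt_def algebra_simps)
      have "avg T (\<lambda>t. (cnj (\<rho> n j t) * vF n j t + \<rho> n j t * vG n j t) - \<beta> n * ?z t) = avg T (\<lambda>t. cnj (\<rho> n j t) * vF n j t + \<rho> n j t * vG n j t) - avg T (\<lambda>t. \<beta> n * ?z t)"
        by (rule avg_diff) (intro continuous_intros \<rho>_cont v_cont rhs_cont)+
      then show ?thesis unfolding e by (simp only: avg_cmult avg_\<rho>_deriv P_def) simp
    qed
    have 1: "avg T (?k j) = avg T (\<lambda>t. (- \<i> * of_real (\<sigma> j) * cnj (d n)) * ?q j t + (\<i> * of_real (\<sigma> j) * d n) * cnj (?q j t)) + avg T (?x j)"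
      by (rule avg_add) (intro continuous_intros \<rho>_cont x_cont)+
    have 2: "avg T (\<lambda>t. (- \<i> * of_real (\<sigma> j) * cnj (d n)) * ?q j t + (\<i> * of_real (\<sigma> j) * d n) * cnj (?q j t))
      = avg T (\<lambda>t. (- \<i> * of_real (\<sigma> j) * cnj (d n)) * ?q j t) + avg T (\<lambda>t. (\<i> * of_real (\<sigma> j) * d n) * cnj (?q j t))"
      by (rule avg_add) (intro continuous_intros \<rho>_cont x_cont)+
    show ?thesis unfolding 1 2 avg_cmult avg_cnj q kr_def by (simp add: mult.assoc)
  qed
  ultimately show ?thesis by simp
qed

text \<open>By \<open>exponent_eq\<close> the two small parameters \<open>\<epsilon>\<close> and \<open>\<kappa>\<close> are of the same order.\<close>

lemma eta_kappa: "\<exists>C>0. \<forall>\<^sub>F n in sequentially. \<eta> n \<le> C * cmod (\<kappa> n) \<and> (\<eta> n)\<^sup>2 \<le> C * (\<epsilon> n)\<^sup>2"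
proof -
  define \<mu> where "\<mu> = 4 * I\<^sup>2 / \<omega>\<^sup>2"
  have mu: "\<mu> > 0" using I \<omega>_pos by (simp add: \<mu>_def)
  obtain C where C: "C \<ge> 0" "\<forall>\<^sub>F n in sequentially. cmod ((\<kappa> n)\<^sup>2 - of_real (4 * s * I\<^sup>2 / \<omega>\<^sup>2) * (of_real (\<epsilon> n))\<^sup>2) \<le> C * (\<eta> n) ^ 3"
    using exponent_eq by blast
  have small: "\<forall>\<^sub>F n in sequentially. (C * (4 + 4 / \<mu>)) * \<eta> n \<le> 1"
    using order_tendstoD(2)[OF tendsto_mult_right_zero[OF eta_lim, of "C * (4 + 4 / \<mu>)"], of 1] by (auto elim: eventually_mono)
  define K where "K = 4 * (1 + \<mu>) + 4 * (1 + 1 / \<mu>)"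
  have K: "K \<ge> 1" "K \<ge> 4 * (1 + \<mu>)" "K \<ge> 4 * (1 + 1 / \<mu>)" using mu by (simp_all add: K_def)
  have "\<forall>\<^sub>F n in sequentially. \<eta> n \<le> K * cmod (\<kappa> n) \<and> (\<eta> n)\<^sup>2 \<le> K * (\<epsilon> n)\<^sup>2"
    using C(2) small
  proof eventually_elim
    case (elim n)
    let ?e = "(\<epsilon> n)\<^sup>2" and ?k = "(cmod (\<kappa> n))\<^sup>2" and ?h = "(\<eta> n)\<^sup>2"
    have h0: "\<eta> n \<ge> 0" by (rule nonneg(3))
    have nm: "cmod (of_real (4 * s * I\<^sup>2 / \<omega>\<^sup>2) * (of_real (\<epsilon> n))\<^sup>2) = \<mu> * ?e"
      using s mu eps[of n] by (auto simp: \<mu>_def norm_mult norm_power norm_divide)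
    have d: "\<bar>?k - \<mu> * ?e\<bar> \<le> C * (\<eta> n) ^ 3"
      using norm_triangle_ineq3[of "(\<kappa> n)\<^sup>2" "of_real (4 * s * I\<^sup>2 / \<omega>\<^sup>2) * (of_real (\<epsilon> n))\<^sup>2"] elim(1) unfolding nm norm_power by linarith
    have "2 * (\<epsilon> n * cmod (\<kappa> n)) \<le> ?e + ?k" using sum_squares_bound[of "\<epsilon> n" "cmod (\<kappa> n)"] by simp
    then have h: "?h \<le> 2 * ?e + 2 * ?k" by (simp add: \<eta>_def power2_sum)
    have "C * \<eta> n * 4 \<le> (C * (4 + 4 / \<mu>)) * \<eta> n" using C(1) h0 mu by (simp add: algebra_simps)
    then have c1: "C * \<eta> n * 4 \<le> 1" using elim(2) by linarith
    have "C * \<eta> n * (4 / \<mu>) \<le> (C * (4 + 4 / \<mu>)) * \<eta> n" using C(1) h0 mu by (simp add: algebra_simps)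
    then have c2: "C * \<eta> n * (4 / \<mu>) \<le> 1" using elim(2) by linarith
    have half: "a \<le> h / 2" if "b \<le> 1 * h" "a = b / 2" for a b h :: real using that by simp
    have cub: "C * (\<eta> n) ^ 3 = (C * \<eta> n) * ?h" by (simp add: power2_eq_square power3_eq_cube)
    have "(C * \<eta> n * 4) * ?h \<le> 1 * ?h" using c1 by (intro mult_right_mono) auto
    moreover have "2 * (C * (\<eta> n) ^ 3) = ((C * \<eta> n * 4) * ?h) / 2" unfolding cub by simp
    ultimately have s1: "2 * (C * (\<eta> n) ^ 3) \<le> ?h / 2" by (rule half)
    have "(C * \<eta> n * (4 / \<mu>)) * ?h \<le> 1 * ?h" using c2 by (intro mult_right_mono) auto
    moreover have "(2 / \<mu>) * (C * (\<eta> n) ^ 3) = ((C * \<eta> n * (4 / \<mu>)) * ?h) / 2" unfolding cub by simp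
    ultimately have s2: "(2 / \<mu>) * (C * (\<eta> n) ^ 3) \<le> ?h / 2" by (rule half)
    have ab: "x \<le> y + z \<and> y \<le> x + z" if "\<bar>x - y\<bar> \<le> z" for x y z :: real using that by linarith
    note d1 = conjunct1[OF ab[OF d]] and d2 = conjunct2[OF ab[OF d]]
    have "?h \<le> 2 * ?e + 2 * (\<mu> * ?e + C * (\<eta> n) ^ 3)" by (rule order_trans[OF h]) (use d1 in simp)
    then have "?h \<le> (4 * (1 + \<mu>)) * ?e" using s1 by (simp add: algebra_simps)
    also have "\<dots> \<le> K * ?e" using K by (intro mult_right_mono) auto
    finally have A: "?h \<le> K * ?e" .
    have "(2 / \<mu>) * (\<mu> * ?e) \<le> (2 / \<mu>) * (?k + C * (\<eta> n) ^ 3)" using mu d2 by (intro mult_left_mono) auto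
    then have "2 * ?e \<le> (2 / \<mu>) * ?k + ?h / 2" using mu s2 by (simp add: distrib_left)
    then have "?h \<le> (4 * (1 + 1 / \<mu>)) * ?k" using h by (simp add: algebra_simps)
    also have "\<dots> \<le> K * ?k" using K by (intro mult_right_mono) auto
    also have "\<dots> \<le> (K * K) * ?k" using K by (intro mult_right_mono) auto
    finally have "?h \<le> (K * cmod (\<kappa> n))\<^sup>2" unfolding power_mult_distrib power2_eq_square[of K] .
    then have "\<eta> n \<le> K * cmod (\<kappa> n)" by (rule power2_le_imp_le) (use K in auto)
    with A show ?case by simp
  qed
  then show ?thesis using K by (intro exI[of _ K]) auto
qed

text \<open>To leading order the Krein form is \<open>- 4 \<bar>d\<bar>\<^sup>2 Im \<kappa>\<close>, up to terms of size \<open>\<eta>\<^sup>2 \<bar>d\<bar>\<^sup>2\<close>, and it vanishes.\<close>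

lemma imaginary_part: "\<exists>C\<ge>0. \<forall>\<^sub>F n in sequentially. \<bar>Im (\<kappa> n)\<bar> \<le> C * (\<eta> n)\<^sup>2"
proof -
  obtain K where K: "K \<ge> 0" and sz: "\<forall>\<^sub>F n in sequentially. Y n \<le> K * ((\<eta> n)\<^sup>2 * cmod (d n)) \<and> E n \<le> 2 * ((\<eta> n)\<^sup>2 * cmod (d n)) \<and> \<delta> n \<le> 2 * (\<eta> n * cmod (d n))" using sizes by blast
  obtain C where C: "C > 0" and ek: "\<forall>\<^sub>F n in sequentially. \<eta> n \<le> C * cmod (\<kappa> n) \<and> (\<eta> n)\<^sup>2 \<le> C * (\<epsilon> n)\<^sup>2" using eta_kappa by blast
  define g where "g n = \<eta> n * cmod (d n)" for n
  define G where "G n = (\<eta> n)\<^sup>2 * cmod (d n)" for n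
  have fromE: "ubig f E \<Longrightarrow> ubig f G" for f
    by (rule ubig_trans[of f E 2]) (use sz in \<open>auto elim: eventually_mono simp: G_def\<close>)
  have from\<delta>: "ubig f \<delta> \<Longrightarrow> ubig f g" for f
    by (rule ubig_trans[of f \<delta> 2]) (use sz in \<open>auto elim: eventually_mono simp: g_def\<close>)
  have ab: "\<forall>\<^sub>F n in sequentially. cmod (\<alpha> n) + cmod (\<beta> n) \<le> (K * C) * g n"
    using sz ek
  proof eventually_elim
    case (elim n)
    have k: "cmod (\<kappa> n) > 0" using kneg[of n] by auto
    have "(cmod (\<alpha> n) + cmod (\<beta> n)) * cmod (\<kappa> n) \<le> K * ((\<eta> n)\<^sup>2 * cmod (d n))" using elim(1) by (simp add: Y_def mult.commute)
    also have "\<dots> = (K * g n) * \<eta> n" by (simp add: g_def power2_eq_square)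
    also have "\<dots> \<le> (K * g n) * (C * cmod (\<kappa> n))" using elim(2) K nonneg(3)[of n] by (intro mult_left_mono) (auto simp: g_def)
    also have "\<dots> = ((K * C) * g n) * cmod (\<kappa> n)" by simp
    finally show ?case using k by (simp only: mult_le_cancel_right_pos)
  qed
  have al: "ubig (\<lambda>n t. \<alpha> n) g" "ubig (\<lambda>n t. \<beta> n) g" unfolding ubig_def
    using K C by (intro exI[of _ "K * C"] conjI eventually_mono[OF ab]; auto intro: order_trans[rotated])+
  have Z1: "ubig (\<lambda>n t. Zt (\<epsilon> n) (\<rho> n) j t) (\<lambda>_. 1)" for j
    using ubig_add[OF ubig_eps_1[OF ubig_Z_diff[of j]] ubig_const[of "of_int (k j) * of_real \<omega> * of_real (r j)"]] by simp
  have x: "ubig (\<lambda>n. xF n j) g" "ubig (\<lambda>n. xG n j) g" for j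
    unfolding xF_def xG_def
    by (intro ubig_add ubig_cmult from\<delta>[OF ubig_v(1)] from\<delta>[OF ubig_v(2)] ubig_mult_le[OF al(1) ubig_\<rho>] ubig_mult_le[OF al(2) Z1]
        ubig_mult_le[OF al(1) ubig_cnj[OF ubig_\<rho>]] ubig_mult_le[OF al(2) ubig_cnj[OF Z1]]; simp)+
  define G2 where "G2 n = cmod (d n) * G n" for n
  have gg: "g n * g n \<le> G2 n" for n by (simp add: g_def G2_def G_def power2_eq_square mult_ac)
  have xx: "ubig (\<lambda>n t. avg T (\<lambda>t. xF n j t * cnj (xF n j t) - xG n j t * cnj (xG n j t))) G2" for j
    by (intro ubig_avg[OF T_pos] ubig_diff ubig_mult_le[OF x(1) ubig_cnj[OF x(1)] gg] ubig_mult_le[OF x(2) ubig_cnj[OF x(2)] gg])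
  have dG: "ubig (\<lambda>n t. cnj (d n) * f n t) G2" "ubig (\<lambda>n t. d n * f n t) G2" if "ubig f G" for f
    by (rule ubig_mult_le[OF ubig_cnj[OF ubig_scalars(3)] that] ubig_mult_le[OF ubig_scalars(3) that], simp add: G2_def)+
  have gen: "ubig (\<lambda>n t. kr n j - of_real (\<sigma> j * \<tau>) * (\<i> * (cnj (d n) * d n) * (\<kappa> n - cnj (\<kappa> n)))) G2"
    if "ubig (\<lambda>n t. P n j + of_real \<tau> * (\<kappa> n * d n)) G" for j \<tau>
  proof -
    have "ubig (\<lambda>n t. (- \<i> * of_real (\<sigma> j)) * (cnj (d n) * (P n j + of_real \<tau> * (\<kappa> n * d n))) + (\<i> * of_real (\<sigma> j)) * (d n * cnj (P n j + of_real \<tau> * (\<kappa> n * d n)))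
      + avg T (\<lambda>t. xF n j t * cnj (xF n j t) - xG n j t * cnj (xG n j t))) G2"
      by (intro ubig_add ubig_cmult dG that ubig_cnj[OF that] xx)
    then show ?thesis by (rule ubig_eq) (simp add: kr_def algebra_simps)
  qed
  have P1: "ubig (\<lambda>n t. P n 1 + of_real 1 * (\<kappa> n * d n)) G"
    by (rule fromE, rule ubig_eq[OF ubig_diff[OF P_exc[of 1] cph_small(1)]]) auto
  have Pm: "ubig (\<lambda>n t. P n (-1) + of_real (-1) * (\<kappa> n * d n)) G"
    by (rule fromE, rule ubig_eq[OF ubig_diff[OF P_exc[of "-1"] cph_small(2)]]) auto
  let ?b = "\<lambda>n. \<i> * (cnj (d n) * d n) * (\<kappa> n - cnj (\<kappa> n))"
  have k1: "ubig (\<lambda>n t. kr n 1 - ?b n) G2" using gen[OF P1] by simp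
  have km: "ubig (\<lambda>n t. kr n (-1) - ?b n) G2" using gen[OF Pm] by simp
  have k0: "ubig (\<lambda>n t. kr n 0) G2" by (rule ubig_eq[OF xx[of 0]]) (simp add: kr_def)
  have kn: "ubig (\<lambda>n t. kr n j) G2" if "j \<notin> {-1, 0, 1}" for j
    using gen[of j 0] fromE[OF P_non[OF that]] by simp
  have "ubig (\<lambda>n t. (kr n (-1) - ?b n) + kr n 0 + (kr n 1 - ?b n) + (\<Sum>j\<in>UNIV - {-1, 0, 1}. kr n j)) G2"
    by (intro ubig_add k1 km k0 ubig_sum kn) auto
  then have "ubig (\<lambda>n t. 2 * ?b n) G2"
  proof (rule ubig_dom)
    fix n and t :: real
    have kz: "kr n (-1) + kr n 0 + kr n 1 + (\<Sum>j\<in>UNIV - {-1, 0, 1}. kr n j) = 0"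
      using krein_mean[of n] unfolding sum_exc[of "kr n"] .
    have sh: "(a - x) + b + (e - x) + f = (a + b + e + f) - 2 * x" for a b e f x :: complex by simp
    have kx: "(kr n (-1) - ?b n) + kr n 0 + (kr n 1 - ?b n) + (\<Sum>j\<in>UNIV - {-1, 0, 1}. kr n j) = - (2 * ?b n)"
      unfolding sh kz by (rule diff_0)
    show "cmod (2 * ?b n) \<le> cmod ((kr n (-1) - ?b n) + kr n 0 + (kr n 1 - ?b n) + (\<Sum>j\<in>UNIV - {-1, 0, 1}. kr n j))"
      unfolding kx by (simp only: norm_minus_cancel order_refl)
  qed
  then obtain C4 where C4: "C4 \<ge> 0" "\<forall>\<^sub>F n in sequentially. \<forall>t::real. cmod (2 * ?b n) \<le> C4 * G2 n" unfolding ubig_def by blast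
  have "\<forall>\<^sub>F n in sequentially. \<bar>Im (\<kappa> n)\<bar> \<le> C4 * (\<eta> n)\<^sup>2"
    using C4(2) d_ne
  proof eventually_elim
    case (elim n)
    have "\<kappa> n - cnj (\<kappa> n) = 2 * \<i> * of_real (Im (\<kappa> n))" by (simp add: complex_eq_iff)
    then have "cmod (2 * ?b n) = (cmod (d n))\<^sup>2 * (4 * \<bar>Im (\<kappa> n)\<bar>)" by (simp add: norm_mult power2_eq_square)
    moreover have "C4 * G2 n = (cmod (d n))\<^sup>2 * (C4 * (\<eta> n)\<^sup>2)" by (simp add: G2_def G_def power2_eq_square)
    ultimately have "(cmod (d n))\<^sup>2 * (4 * \<bar>Im (\<kappa> n)\<bar>) \<le> (cmod (d n))\<^sup>2 * (C4 * (\<eta> n)\<^sup>2)" using elim(1) by metis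
    then have "4 * \<bar>Im (\<kappa> n)\<bar> \<le> C4 * (\<eta> n)\<^sup>2" using elim(2) by simp
    then show ?case by simp
  qed
  then show ?thesis using C4(1) by blast
qed

text \<open>For \<open>s = -1\<close> the exponents would be imaginary of order \<open>\<epsilon>\<close>, whereas their imaginary part is of order \<open>\<epsilon>\<^sup>2\<close>.\<close>

lemma no_small_exponents:
  assumes "s = -1" shows False
proof -
  define \<mu> where "\<mu> = 4 * I\<^sup>2 / \<omega>\<^sup>2"
  have mu: "\<mu> > 0" using I \<omega>_pos by (simp add: \<mu>_def)
  obtain C where C: "C \<ge> 0" "\<forall>\<^sub>F n in sequentially. cmod ((\<kappa> n)\<^sup>2 - of_real (4 * s * I\<^sup>2 / \<omega>\<^sup>2) * (of_real (\<epsilon> n))\<^sup>2) \<le> C * (\<eta> n) ^ 3" using exponent_eq by blast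
  obtain C2 where C2: "C2 \<ge> 0" "\<forall>\<^sub>F n in sequentially. \<bar>Im (\<kappa> n)\<bar> \<le> C2 * (\<eta> n)\<^sup>2" using imaginary_part by blast
  obtain K where K: "K > 0" "\<forall>\<^sub>F n in sequentially. \<eta> n \<le> K * cmod (\<kappa> n) \<and> (\<eta> n)\<^sup>2 \<le> K * (\<epsilon> n)\<^sup>2" using eta_kappa by blast
  have small: "\<forall>\<^sub>F n in sequentially. ((C + C2\<^sup>2) * K) * \<eta> n < \<mu>" "\<forall>\<^sub>F n in sequentially. \<eta> n < 1"
    using order_tendstoD(2)[OF tendsto_mult_right_zero[OF eta_lim, of "(C + C2\<^sup>2) * K"] mu] order_tendstoD(2)[OF eta_lim, of 1] by auto
  have "\<forall>\<^sub>F n in sequentially. False"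
    using C(2) C2(2) K(2) small
  proof eventually_elim
    case (elim n)
    let ?h = "\<eta> n"
    have h0: "?h \<ge> 0" by (rule nonneg(3))
    have "of_real (4 * s * I\<^sup>2 / \<omega>\<^sup>2) * (of_real (\<epsilon> n))\<^sup>2 = complex_of_real (- (\<mu> * (\<epsilon> n)\<^sup>2))" using assms by (simp add: \<mu>_def)
    then have "Re ((\<kappa> n)\<^sup>2) + \<mu> * (\<epsilon> n)\<^sup>2 \<le> C * ?h ^ 3"
      using elim(1) complex_Re_le_cmod[of "(\<kappa> n)\<^sup>2 - of_real (4 * s * I\<^sup>2 / \<omega>\<^sup>2) * (of_real (\<epsilon> n))\<^sup>2"] by simp
    moreover have "Re ((\<kappa> n)\<^sup>2) \<ge> - ((Im (\<kappa> n))\<^sup>2)" by (simp add: power2_eq_square)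
    moreover have "(Im (\<kappa> n))\<^sup>2 \<le> (C2 * ?h\<^sup>2)\<^sup>2" using elim(2) by (metis abs_ge_zero power2_abs power_mono)
    moreover have "(C2 * ?h\<^sup>2)\<^sup>2 \<le> C2\<^sup>2 * ?h ^ 3"
    proof -
      have "(C2 * ?h\<^sup>2)\<^sup>2 = (C2\<^sup>2 * ?h ^ 3) * ?h" by (simp add: power2_eq_square power3_eq_cube)
      also have "\<dots> \<le> (C2\<^sup>2 * ?h ^ 3) * 1" using h0 elim(5) by (intro mult_left_mono) auto
      finally show ?thesis by simp
    qed
    ultimately have "\<mu> * (\<epsilon> n)\<^sup>2 \<le> (C + C2\<^sup>2) * ?h ^ 3" by (simp add: distrib_right)
    also have "\<dots> = ((C + C2\<^sup>2) * ?h) * ?h\<^sup>2" by (simp add: power2_eq_square power3_eq_cube)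
    also have "\<dots> \<le> ((C + C2\<^sup>2) * ?h) * (K * (\<epsilon> n)\<^sup>2)" using elim(3) h0 C(1) by (intro mult_left_mono) auto
    also have "\<dots> = (((C + C2\<^sup>2) * K) * ?h) * (\<epsilon> n)\<^sup>2" by simp
    finally have "\<mu> \<le> ((C + C2\<^sup>2) * K) * ?h" using eps[of n] by simp
    then show False using elim(4) by simp
  qed
  then show False by simp
qed

end

section \<open>Multipliers away from 1\<close>

context resonant_chain
begin

lemma frame_error:
  assumes o: "orbit C \<epsilon> \<rho>" and C: "C \<ge> 0" and e: "0 < \<epsilon>" "\<epsilon> \<le> 1"
    and M: "\<And>i. cmod (F i t) \<le> M" "\<And>i. cmod (G i t) \<le> M"
  shows "cmod (linF \<epsilon> \<rho> F G j t - ((of_real (r j))\<^sup>2 * (F j t + G j t) + (if j \<in> {-1, 0, 1} then 0 else F j t))) \<le> ((4 + 6 * (1 + 2 * I + C) * C) * \<epsilon>) * M"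
    and "cmod (linG \<epsilon> \<rho> F G j t - ((of_real (r j))\<^sup>2 * (F j t + G j t) + (if j \<in> {-1, 0, 1} then 0 else G j t))) \<le> ((4 + 6 * (1 + 2 * I + C) * C) * \<epsilon>) * M"
proof -
  define R where "R = 1 + 2 * I + C"
  have M0: "M \<ge> 0" using M(1)[of 0] norm_ge_zero order_trans by blast
  have R0: "R \<ge> 0" using I C by (simp add: R_def)
  let ?p = "\<rho> j t" and ?r = "complex_of_real (r j)"
  have dp: "cmod (?p - ?r) \<le> C * \<epsilon>" by (rule orbitD(5)[OF o])
  have dp': "cmod (cnj ?p - ?r) \<le> C * \<epsilon>" using dp by (metis complex_cnj_complex_of_real complex_cnj_diff complex_mod_cnj)
  have rR: "cmod ?r \<le> R" using r_bound(1)[of j] C by (simp add: R_def)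
  have ce: "C * \<epsilon> \<le> C" using C e by (simp add: mult_left_le)
  have pR: "cmod ?p \<le> R"
  proof -
    have "cmod ?p \<le> cmod (?p - ?r) + cmod ?r" using norm_triangle_ineq[of "?p - ?r" ?r] by simp
    then show ?thesis using dp ce r_bound(1)[of j] by (simp add: R_def)
  qed
  have q1: "cmod (?p * cnj ?p - ?r\<^sup>2) \<le> 2 * R * C * \<epsilon>"
  proof -
    have "?p * cnj ?p - ?r\<^sup>2 = ?p * (cnj ?p - ?r) + ?r * (?p - ?r)" by (simp add: algebra_simps power2_eq_square)
    moreover have "cmod (?p * (cnj ?p - ?r)) \<le> R * (C * \<epsilon>)" "cmod (?r * (?p - ?r)) \<le> R * (C * \<epsilon>)"
      unfolding norm_mult by (intro mult_mono pR rR dp dp' R0 norm_ge_zero)+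
    ultimately show ?thesis using norm_triangle_ineq[of "?p * (cnj ?p - ?r)" "?r * (?p - ?r)"] by simp
  qed
  have q2: "cmod (?p\<^sup>2 - ?r\<^sup>2) \<le> 2 * R * C * \<epsilon>"
  proof -
    have "?p\<^sup>2 - ?r\<^sup>2 = ?p * (?p - ?r) + ?r * (?p - ?r)" by (simp add: algebra_simps power2_eq_square)
    moreover have "cmod (?p * (?p - ?r)) \<le> R * (C * \<epsilon>)" "cmod (?r * (?p - ?r)) \<le> R * (C * \<epsilon>)"
      unfolding norm_mult by (intro mult_mono pR rR dp dp' R0 norm_ge_zero)+
    ultimately show ?thesis using norm_triangle_ineq[of "?p * (?p - ?r)" "?r * (?p - ?r)"] by simp
  qed
  have main: "cmod (linF \<epsilon> \<rho> F G j t - ((of_real (r j))\<^sup>2 * (F j t + G j t) + (if j \<in> {-1, 0, 1} then 0 else F j t))) \<le> ((4 + 6 * R * C) * \<epsilon>) * M"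
    if M: "\<And>i. cmod (F i t) \<le> M" "\<And>i. cmod (G i t) \<le> M" for F G
  proof -
    have kr: "1 - of_int (k j) * of_real \<omega> + ?r\<^sup>2 = (if j \<in> {-1, 0, 1} then 0 else 1 :: complex)"
    proof (cases "j \<in> {-1, 0, 1}")
      case True
      have "?r\<^sup>2 = of_real ((r j)\<^sup>2)" by simp
      also have "\<dots> = of_int (k j) * of_real \<omega> - 1" unfolding r_sq(1)[OF True] by simp
      finally show ?thesis using True by simp
    next
      case False then show ?thesis by (simp add: r_sq(3,4) del: insert_iff)
    qed
    let ?a = "2 * of_real \<epsilon> * F j t" and ?b = "2 * (?p * cnj ?p - ?r\<^sup>2) * F j t" and ?c = "(?p\<^sup>2 - ?r\<^sup>2) * G j t" and ?d = "of_real \<epsilon> * nbr j F t"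
    have "linF \<epsilon> \<rho> F G j t - (?r\<^sup>2 * (F j t + G j t) + (if j \<in> {-1, 0, 1} then 0 else F j t)) =
       linF \<epsilon> \<rho> F G j t - (?r\<^sup>2 * (F j t + G j t) + (1 - of_int (k j) * of_real \<omega> + ?r\<^sup>2) * F j t)"
      unfolding kr by simp
    also have "\<dots> = ?a + ?b + ?c - ?d" by (simp add: linF_def algebra_simps)
    finally have eq: "linF \<epsilon> \<rho> F G j t - (?r\<^sup>2 * (F j t + G j t) + (if j \<in> {-1, 0, 1} then 0 else F j t)) = ?a + ?b + ?c - ?d" .
    have a: "cmod ?a \<le> (2 * \<epsilon>) * M" using M(1)[of j] e by (simp add: norm_mult)
    have b: "cmod ?b \<le> (2 * (2 * R * C * \<epsilon>)) * M" unfolding norm_mult using q1 M(1)[of j] R0 C e by (intro mult_mono) auto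
    have c: "cmod ?c \<le> (2 * R * C * \<epsilon>) * M" unfolding norm_mult using q2 M(2)[of j] R0 C e by (intro mult_mono) auto
    have d: "cmod ?d \<le> (2 * \<epsilon>) * M"
    proof -
      have "cmod (nbr j F t) \<le> cmod (F (j + 1) t) + cmod (F (j - 1) t)"
        unfolding nbr_def by (rule order_trans[OF norm_triangle_ineq]) (simp add: norm_mult)
      then have "cmod (nbr j F t) \<le> 2 * M" using M(1)[of "j + 1"] M(1)[of "j - 1"] by simp
      then show ?thesis using e by (simp add: norm_mult)
    qed
    have "cmod (?a + ?b + ?c - ?d) \<le> cmod ?a + cmod ?b + cmod ?c + cmod ?d"
      using norm_triangle_ineq4[of "?a + ?b + ?c" ?d] norm_triangle_ineq[of "?a + ?b" ?c] norm_triangle_ineq[of ?a ?b] by linarith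
    then show ?thesis unfolding eq using a b c d by (simp add: algebra_simps)
  qed
  show "cmod (linF \<epsilon> \<rho> F G j t - ((of_real (r j))\<^sup>2 * (F j t + G j t) + (if j \<in> {-1, 0, 1} then 0 else F j t))) \<le> ((4 + 6 * (1 + 2 * I + C) * C) * \<epsilon>) * M"
    using main[of F G] M unfolding R_def by blast
  have "linG \<epsilon> \<rho> F G j t - ((of_real (r j))\<^sup>2 * (F j t + G j t) + (if j \<in> {-1, 0, 1} then 0 else G j t)) =
     cnj (linF \<epsilon> \<rho> (\<lambda>j t. cnj (G j t)) (\<lambda>j t. cnj (F j t)) j t - ((of_real (r j))\<^sup>2 * (cnj (G j t) + cnj (F j t)) + (if j \<in> {-1, 0, 1} then 0 else cnj (G j t))))"
    by (simp add: linF_def linG_def nbr_def nbr'_def algebra_simps)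
  then show "cmod (linG \<epsilon> \<rho> F G j t - ((of_real (r j))\<^sup>2 * (F j t + G j t) + (if j \<in> {-1, 0, 1} then 0 else G j t))) \<le> ((4 + 6 * (1 + 2 * I + C) * C) * \<epsilon>) * M"
    using main[of "\<lambda>j t. cnj (G j t)" "\<lambda>j t. cnj (F j t)"] M unfolding R_def by (simp only: complex_mod_cnj)
qed

text \<open>If the Krein form vanishes, one half of the variables bounds the other.\<close>

lemma krein_bound:
  fixes f g :: "'a mod_ring \<Rightarrow> complex"
  assumes "(\<Sum>j\<in>UNIV. f j * cnj (f j) - g j * cnj (g j)) = 0" and b: "\<And>j. cmod (f j) \<le> b"
  shows "cmod (g j) \<le> real CARD('a mod_ring) * b"
proof -
  let ?n = "real CARD('a mod_ring)"
  have n1: "?n \<ge> 1" using card by simp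
  have b0: "b \<ge> 0" using b[of 0] norm_ge_zero order_trans by blast
  have "complex_of_real (\<Sum>j\<in>UNIV. (cmod (f j))\<^sup>2 - (cmod (g j))\<^sup>2) = 0" using assms(1) by (simp only: of_real_sum of_real_diff complex_norm_square)
  then have eq: "(\<Sum>j\<in>UNIV. (cmod (f j))\<^sup>2) = (\<Sum>j\<in>UNIV. (cmod (g j))\<^sup>2)" unfolding of_real_eq_0_iff sum_subtractf by simp
  have "(cmod (g j))\<^sup>2 \<le> (\<Sum>j\<in>UNIV. (cmod (g j))\<^sup>2)" by (rule member_le_sum) auto
  also have "\<dots> \<le> (\<Sum>j\<in>(UNIV :: 'a mod_ring set). b\<^sup>2)" unfolding eq[symmetric] by (intro sum_mono power_mono b) auto
  also have "\<dots> = ?n * b\<^sup>2" by simp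
  also have "\<dots> \<le> (?n * ?n) * b\<^sup>2" using n1 by (intro mult_right_mono) auto
  also have "\<dots> = (?n * b)\<^sup>2" by (simp only: power_mult_distrib power2_eq_square[of ?n])
  finally show ?thesis by (rule power2_le_imp_le) (use b0 in simp)
qed

lemma sin_T: "sin T \<noteq> 0"
proof
  assume "sin T = 0"
  then have "cos (2 * T) = 1" "sin (2 * T) = 0" by (simp_all only: cos_double_sin sin_double) simp_all
  then have "cis (2 * T) = 1" by (simp add: complex_eq_iff)
  then show False using nonres by simp
qed

lemma off_resonance: "\<bar>sin T\<bar> / 2 \<le> cmod (1 - z * cis T) \<or> \<bar>sin T\<bar> / 2 \<le> cmod (1 - z * cis (- T))"
proof (rule ccontr)
  assume "\<not> ?thesis"
  then have a: "cmod (1 - z * cis T) < \<bar>sin T\<bar> / 2" "cmod (1 - z * cis (- T)) < \<bar>sin T\<bar> / 2" by auto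
  have "z * (2 * \<i> * of_real (sin T)) = (1 - z * cis (- T)) - (1 - z * cis T)" by (simp add: complex_eq_iff algebra_simps)
  then have "cmod (z * (2 * \<i> * of_real (sin T))) \<le> cmod (1 - z * cis (- T)) + cmod (1 - z * cis T)"
    by (simp only: norm_triangle_ineq4)
  then have "cmod (z * (2 * \<i> * of_real (sin T))) < \<bar>sin T\<bar>" using a by linarith
  then have "cmod z * (2 * \<bar>sin T\<bar>) < 1 * \<bar>sin T\<bar>" by (simp add: norm_mult)
  then have "(2 * cmod z) * \<bar>sin T\<bar> < 1 * \<bar>sin T\<bar>" by (simp add: mult_ac)
  then have z: "2 * cmod z < 1" by (simp only: mult_less_cancel_right)
  have "1 - cmod z \<le> cmod (1 - z * cis T)" using norm_triangle_ineq2[of 1 "z * cis T"] by (simp add: norm_mult)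
  moreover have "\<bar>sin T\<bar> \<le> 1" by simp
  ultimately show False using a(1) z by linarith
qed

text \<open>Only the three excited sites have multipliers near 1 in the uncoupled limit.  At the remaining sites the multipliers are near
  \<open>cis (- T)\<close> for \<open>F\<close> and near \<open>cis T\<close> for \<open>G\<close>.  A multiplier cannot be close to both, and the Krein form transfers the estimate of
  one half of the variables to the other.\<close>

lemma large_exponents:
  assumes C: "C \<ge> 0" and h: "\<eta>0 > 0"
  shows "\<exists>\<epsilon>1>0. \<forall>\<epsilon> \<rho> \<kappa> F G. 0 < \<epsilon> \<and> \<epsilon> < \<epsilon>1 \<and> orbit C \<epsilon> \<rho> \<and> free_sol \<epsilon> \<rho> \<kappa> F G \<and>
     (\<forall>j t. F j (t + T) = F j t) \<and> (\<forall>j t. G j (t + T) = G j t) \<and> Re \<kappa> < 0 \<and> \<eta>0 \<le> cmod (1 - exp (\<kappa> * of_real T)) \<longrightarrow> (\<forall>j t. F j t = 0 \<and> G j t = 0)"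
proof -
  define K where "K = 4 + 6 * (1 + 2 * I + C) * C"
  \<comment> \<open>the distance from resonance given by \<open>off_resonance\<close>\<close>
  define b where "b = \<bar>sin T\<bar> / 2"
  define A1 where "A1 = 2 * K * T / \<eta>0"
  define A2 where "A2 = (2 * (1 + 2 * I) * A1 + 2 * K) * T / \<eta>0"
  define A3 where "A3 = K * T / b"
  define A where "A = A1 + A2 + A3"
  define n where "n = real CARD('a mod_ring)"
  have K: "K \<ge> 0" using I C by (simp add: K_def)
  have b: "b > 0" using sin_T by (simp add: b_def)
  have As: "A1 \<ge> 0" "A2 \<ge> 0" "A3 \<ge> 0" "A \<ge> 0" using K T_pos h b I by (simp_all add: A1_def A2_def A3_def A_def)
  have n1: "n \<ge> 0" by (simp add: n_def)
  define \<epsilon>1 where "\<epsilon>1 = min 1 (1 / (2 * ((2 + n) * (A + 1))))"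
  have pos: "2 * ((2 + n) * (A + 1)) > 0" using As n1 by simp
  show ?thesis
  proof (intro exI[of _ \<epsilon>1] conjI allI impI; (elim conjE)?)
    show "\<epsilon>1 > 0" using pos by (simp add: \<epsilon>1_def)
  next
    fix \<epsilon> \<rho> \<kappa> F G j t
    assume e: "0 < \<epsilon>" "\<epsilon> < \<epsilon>1" and o: "orbit C \<epsilon> \<rho>" and l: "free_sol \<epsilon> \<rho> \<kappa> F G"
      and per: "\<forall>j t. F j (t + T) = F j t" "\<forall>j t. G j (t + T) = G j t" and neg: "Re \<kappa> < 0" and big: "\<eta>0 \<le> cmod (1 - exp (\<kappa> * of_real T))"
    have e1: "\<epsilon> \<le> 1" and e2: "\<epsilon> \<le> 1 / (2 * ((2 + n) * (A + 1)))" using e by (simp_all add: \<epsilon>1_def)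
    have small: "((2 + n) * A) * \<epsilon> \<le> 1 / 2"
    proof -
      have "\<epsilon> * (2 * ((2 + n) * (A + 1))) \<le> 1" using e2 pos by (simp add: pos_le_divide_eq)
      moreover have "((2 + n) * A) * \<epsilon> \<le> ((2 + n) * (A + 1)) * \<epsilon>" using n1 e by (intro mult_right_mono mult_left_mono) auto
      moreover have "\<epsilon> * (2 * ((2 + n) * (A + 1))) = 2 * (((2 + n) * (A + 1)) * \<epsilon>)" by simp
      ultimately show ?thesis by linarith
    qed
    let ?h = "\<lambda>(j, t). cmod (F j t) + cmod (G j t)"
    have bd: "\<exists>M0. \<forall>x. ?h x \<le> M0"
    proof -
      obtain B B' where B: "\<And>j t. cmod (F j t) \<le> B j" "\<And>j t. cmod (G j t) \<le> B' j"
        using periodic_bounded[OF T_pos lin_sol_cont(1)[OF l]] periodic_bounded[OF T_pos lin_sol_cont(2)[OF l]] per by metis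
      have B0: "0 \<le> B j" "0 \<le> B' j" for j using B norm_ge_zero order_trans by blast+
      have "?h (j, t) \<le> (\<Sum>j\<in>UNIV. B j + B' j)" for j t
      proof -
        have "?h (j, t) \<le> B j + B' j" using B[of j t] by simp
        also have "\<dots> \<le> (\<Sum>j\<in>UNIV. B j + B' j)" by (rule member_le_sum) (use B0 in auto)
        finally show ?thesis .
      qed
      then show ?thesis by (intro exI[of _ "\<Sum>j\<in>UNIV. B j + B' j"]) auto
    qed
    then obtain M0 where M0: "\<And>x. ?h x \<le> M0" by blast
    have step: "?h x \<le> 0 + M / 2" if hM: "\<And>x. ?h x \<le> M" for M x
    proof -
      have hM': "cmod (F j t) + cmod (G j t) \<le> M" for j t using hM[of "(j, t)"] by simp
      have M: "cmod (F j t) \<le> M" "cmod (G j t) \<le> M" for j t using hM'[of j t] norm_ge_zero[of "F j t"] norm_ge_zero[of "G j t"] by linarith+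
      have M0: "M \<ge> 0" using M(1)[of 0 0] norm_ge_zero order_trans by blast
      define D where "D = \<epsilon> * M"
      have D0: "D \<ge> 0" using e M0 by (simp add: D_def)
      note err = frame_error[OF o C e(1) e1, of F _ M G, OF M, folded K_def]
      define eF where "eF j t = linF \<epsilon> \<rho> F G j t - ((of_real (r j))\<^sup>2 * (F j t + G j t) + (if j \<in> {-1, 0, 1} then 0 else F j t))" for j t
      define eG where "eG j t = linG \<epsilon> \<rho> F G j t - ((of_real (r j))\<^sup>2 * (F j t + G j t) + (if j \<in> {-1, 0, 1} then 0 else G j t))" for j t
      have eb: "cmod (eF j t) \<le> K * D" "cmod (eG j t) \<le> K * D" for j t
        using err(1)[of j t] err(2)[of j t] unfolding eF_def eG_def D_def by (simp_all only: mult.assoc)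
      have exc: "cmod (F j t) \<le> A * D \<and> cmod (G j t) \<le> A * D" if j: "j \<in> {-1, 0, 1}" for j t
      proof -
        have dS: "((\<lambda>t. F j t + G j t) has_vector_derivative (- \<i> * (eF j t - eG j t)) - \<kappa> * (F j t + G j t)) (at t)" for t
          by (rule has_vector_derivative_eq_rhs[OF has_vector_derivative_add[OF lin_solD[OF l]]]) (use j in \<open>simp add: eF_def eG_def algebra_simps\<close>)
        have dD: "((\<lambda>t. F j t - G j t) has_vector_derivative (- \<i> * (2 * (of_real (r j))\<^sup>2 * (F j t + G j t) + (eF j t + eG j t))) - \<kappa> * (F j t - G j t)) (at t)" for t
          by (rule has_vector_derivative_eq_rhs[OF has_vector_derivative_diff[OF lin_solD[OF l]]]) (use j in \<open>simp add: eF_def eG_def algebra_simps\<close>)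
        have b1: "cmod (- \<i> * (eF j t - eG j t)) \<le> 2 * K * D" for t
          using norm_triangle_ineq4[of "eF j t" "eG j t"] eb[of j t] by (simp add: norm_mult)
        have "cmod (1 - exp (\<kappa> * of_real T)) * cmod (F j t + G j t) \<le> (2 * K * D) * T" for t
          by (rule periodic_linear_bound[OF T_pos dS _ b1]) (use per neg in auto)
        then have "\<eta>0 * cmod (F j t + G j t) \<le> (2 * K * D) * T" for t using big by (meson mult_right_mono norm_ge_zero order_trans)
        then have S: "cmod (F j t + G j t) \<le> A1 * D" for t using h by (simp add: A1_def field_simps)
        have b2: "cmod (- \<i> * (2 * (of_real (r j))\<^sup>2 * (F j t + G j t) + (eF j t + eG j t))) \<le> (2 * (1 + 2 * I) * A1 + 2 * K) * D" for t
        proof -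
          have "cmod ((2 * (of_real (r j))\<^sup>2) * (F j t + G j t)) \<le> (2 * (1 + 2 * I)) * (A1 * D)"
            unfolding norm_mult[of "2 * (of_real (r j))\<^sup>2"] using S[of t] r_bound(2)[of j] I by (intro mult_mono) (auto simp: norm_mult norm_power)
          then have "cmod ((2 * (of_real (r j))\<^sup>2) * (F j t + G j t) + (eF j t + eG j t)) \<le> (2 * (1 + 2 * I)) * (A1 * D) + (K * D + K * D)"
            using eb[of j t] by (meson add_mono norm_triangle_le order_trans norm_triangle_ineq)
          moreover have "cmod (- \<i> * x) = cmod x" for x by (simp add: norm_mult)
          moreover have "(2 * (1 + 2 * I)) * (A1 * D) + (K * D + K * D) = (2 * (1 + 2 * I) * A1 + 2 * K) * D" by (simp add: algebra_simps)
          ultimately show ?thesis by simp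
        qed
        have "cmod (1 - exp (\<kappa> * of_real T)) * cmod (F j t - G j t) \<le> ((2 * (1 + 2 * I) * A1 + 2 * K) * D) * T" for t
          by (rule periodic_linear_bound[OF T_pos dD _ b2]) (use per neg in auto)
        then have "\<eta>0 * cmod (F j t - G j t) \<le> ((2 * (1 + 2 * I) * A1 + 2 * K) * D) * T" for t using big by (meson mult_right_mono norm_ge_zero order_trans)
        then have Dd: "cmod (F j t - G j t) \<le> A2 * D" using h by (simp add: A2_def field_simps)
        have AA: "A * D = A1 * D + A2 * D + A3 * D" by (simp add: A_def algebra_simps)
        have p: "A1 * D \<ge> 0" "A2 * D \<ge> 0" "A3 * D \<ge> 0" using As D0 by simp_all
        have "2 * F j t = (F j t + G j t) + (F j t - G j t)" "2 * G j t = (F j t + G j t) - (F j t - G j t)" by simp_all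
        then have "cmod (2 * F j t) \<le> A1 * D + A2 * D" "cmod (2 * G j t) \<le> A1 * D + A2 * D"
          using norm_triangle_ineq[of "F j t + G j t" "F j t - G j t"] norm_triangle_ineq4[of "F j t + G j t" "F j t - G j t"] S[of t] Dd by (simp_all only:)
        then show ?thesis unfolding AA using p by (simp add: norm_mult)
      qed
      have A3D: "A3 * D \<le> A * D" using As D0 by (intro mult_right_mono) (auto simp: A_def)
      have expT: "exp ((\<kappa> + \<i>) * of_real T) = exp (\<kappa> * of_real T) * cis T" "exp ((\<kappa> - \<i>) * of_real T) = exp (\<kappa> * of_real T) * cis (- T)"
        unfolding cis_conv_exp exp_add[symmetric] by (simp_all add: algebra_simps)
      have nonF: "cmod (F j t) \<le> A * D" if j: "j \<notin> {-1, 0, 1}" and z: "b \<le> cmod (1 - exp (\<kappa> * of_real T) * cis T)" for j t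
      proof -
        have "cmod (1 - exp ((\<kappa> + \<i>) * of_real T)) * cmod (F j t) \<le> (K * D) * T"
        proof (rule periodic_linear_bound[OF T_pos, where h = "\<lambda>t. - \<i> * eF j t"])
          show "(F j has_vector_derivative - \<i> * eF j t - (\<kappa> + \<i>) * F j t) (at t)" for t
            by (rule has_vector_derivative_eq_rhs[OF lin_solD(1)[OF l]]) (use j r_sq(3)[OF j] in \<open>simp add: eF_def algebra_simps\<close>)
        qed (use per neg eb in \<open>auto simp: norm_mult\<close>)
        then have "b * cmod (F j t) \<le> (K * D) * T" unfolding expT using z by (meson mult_right_mono norm_ge_zero order_trans)
        then have "cmod (F j t) \<le> A3 * D" using b by (simp add: A3_def field_simps)
        then show ?thesis using A3D by simp
      qed
      have nonG: "cmod (G j t) \<le> A * D" if j: "j \<notin> {-1, 0, 1}" and z: "b \<le> cmod (1 - exp (\<kappa> * of_real T) * cis (- T))" for j t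
      proof -
        have "cmod (1 - exp ((\<kappa> - \<i>) * of_real T)) * cmod (G j t) \<le> (K * D) * T"
        proof (rule periodic_linear_bound[OF T_pos, where h = "\<lambda>t. \<i> * eG j t"])
          show "(G j has_vector_derivative \<i> * eG j t - (\<kappa> - \<i>) * G j t) (at t)" for t
            by (rule has_vector_derivative_eq_rhs[OF lin_solD(2)[OF l]]) (use j r_sq(3)[OF j] in \<open>simp add: eG_def algebra_simps\<close>)
        qed (use per neg eb in \<open>auto simp: norm_mult\<close>)
        then have "b * cmod (G j t) \<le> (K * D) * T" unfolding expT using z by (meson mult_right_mono norm_ge_zero order_trans)
        then have "cmod (G j t) \<le> A3 * D" using b by (simp add: A3_def field_simps)
        then show ?thesis using A3D by simp
      qed
      have kz: "(\<Sum>j\<in>UNIV. F j t * cnj (F j t) - G j t * cnj (G j t)) = 0" for t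
        by (rule krein_zero[OF l _ _ neg]) (use per in auto)
      then have kz': "(\<Sum>j\<in>UNIV. G j t * cnj (G j t) - F j t * cnj (F j t)) = 0" for t
      proof -
        have "(\<Sum>j\<in>UNIV. G j t * cnj (G j t) - F j t * cnj (F j t)) = - (\<Sum>j\<in>UNIV. F j t * cnj (F j t) - G j t * cnj (G j t))"
          unfolding sum_negf[symmetric] by simp
        then show ?thesis using kz by simp
      qed
      have tot: "cmod (F j t) + cmod (G j t) \<le> A * D + n * (A * D)" for j t
        using off_resonance[of "exp (\<kappa> * of_real T)"]
      proof
        assume z: "\<bar>sin T\<bar> / 2 \<le> cmod (1 - exp (\<kappa> * of_real T) * cis T)"
        then have "cmod (F j t) \<le> A * D" for j t using exc[of j t] nonF[of j t] unfolding b_def by blast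
        from this[of j t] krein_bound[OF kz[of t] this] show ?thesis unfolding n_def by (rule add_mono)
      next
        assume z: "\<bar>sin T\<bar> / 2 \<le> cmod (1 - exp (\<kappa> * of_real T) * cis (- T))"
        then have "cmod (G j t) \<le> A * D" for j t using exc[of j t] nonG[of j t] unfolding b_def by blast
        from add_mono[OF this[of j t] krein_bound[OF kz'[of t] this]] show ?thesis unfolding n_def by (simp only: add.commute)
      qed
      obtain j t where x: "x = (j, t)" by (cases x)
      have "cmod (F j t) + cmod (G j t) \<le> A * D + n * (A * D)" by (rule tot)
      also have "\<dots> \<le> ((2 + n) * A) * D" using As D0 by (simp add: algebra_simps)
      also have "\<dots> = (((2 + n) * A) * \<epsilon>) * M" by (simp add: D_def)
      also have "\<dots> \<le> (1 / 2) * M" using small M0 by (intro mult_right_mono) auto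
      finally show ?thesis by (simp add: x)
    qed
    have "?h (j, t) \<le> 2 * 0" by (rule halving[where h = ?h, OF M0 step])
    then have *: "cmod (F j t) + cmod (G j t) \<le> 0" by simp
    show "F j t = 0" using * norm_ge_zero[of "G j t"] by (simp only: norm_le_zero_iff[symmetric])
    show "G j t = 0" using * norm_ge_zero[of "F j t"] by (simp only: norm_le_zero_iff[symmetric])
  qed
qed

section \<open>Linear stability\<close>

text \<open>Subtracting symmetry modes and a multiple of the relative phase mode makes the phases of the remainder vanish at time 0.  The three
  conditions can be met because the frequency ratio 2 separates the time mode from the gauge mode.\<close>

lemma mode_decomposition:
  assumes o: "orbit C \<epsilon> \<rho>" and C: "C \<ge> 0" and e: "\<epsilon> > 0" and sm: "small (C * \<epsilon>)"
    and l: "free_sol \<epsilon> \<rho> \<kappa> F G"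
    and per: "\<And>j t. F j (t + T) = F j t" "\<And>j t. G j (t + T) = G j t"
  shows "\<exists>\<alpha> \<beta> d vF vG. (\<forall>j t. vF j (t + T) = vF j t) \<and> (\<forall>j t. vG j (t + T) = vG j t) \<and> (\<forall>j\<in>{-1, 0, 1}. vF j 0 - vG j 0 = 0) \<and>
     lin_sol \<epsilon> \<rho> \<kappa> (\<lambda>j t. - \<i> * 0 + d * of_real \<epsilon> * resid \<rho> \<sigma> j t - \<i> * \<kappa> * mF \<epsilon> \<rho> \<alpha> \<beta> d j t)
       (\<lambda>j t. \<i> * 0 + d * of_real \<epsilon> * cnj (resid \<rho> \<sigma> j t) + \<i> * \<kappa> * mG \<epsilon> \<rho> \<alpha> \<beta> d j t) vF vG \<and>
     (\<forall>j t. F j t = mF \<epsilon> \<rho> \<alpha> \<beta> d j t + vF j t) \<and> (\<forall>j t. G j t = mG \<epsilon> \<rho> \<alpha> \<beta> d j t + vG j t)"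
proof -
  define p where "p j = \<rho> j 0" for j
  define z where "z j = Zt \<epsilon> \<rho> j 0" for j
  define y where "y j = z j / p j" for j
  define c where "c j = (F j 0 - G j 0) / (2 * \<i> * p j)" for j
  have pr: "cnj (\<rho> j 0) = \<rho> j 0" for j using orbitD(3)[OF o, of j 0] by simp
  have zr: "cnj (Zt \<epsilon> \<rho> j 0) = Zt \<epsilon> \<rho> j 0" for j
    by (simp add: Zt_def orbit_rhs_def nbr_def \<theta>_def pr algebra_simps)
  have lo: "sqrt I / 2 \<le> cmod (p j)" if j: "j \<in> {-1, 0, 1}" for j
  proof -
    have "sqrt I \<le> \<bar>r j\<bar>" using j I s by (auto simp: r abs_mult)
    moreover have "cmod (of_real (r j)) - cmod (p j) \<le> cmod (of_real (r j) - p j)" by (rule norm_triangle_ineq2)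
    moreover have "cmod (of_real (r j) - p j) \<le> C * \<epsilon>" using orbitD(5)[OF o, of j 0] by (simp add: p_def norm_minus_commute)
    ultimately show ?thesis using sm unfolding small_def by simp
  qed
  have sI: "sqrt I / 2 > 0" using I by simp
  have p0: "p j \<noteq> 0" if "j \<in> {-1, 0, 1}" for j using lo[OF that] sI by auto
  have yb: "cmod (y j - of_int (k j) * of_real \<omega>) < \<omega> / 2" if j: "j \<in> {-1, 0, 1}" for j
  proof -
    have "y j - of_int (k j) * of_real \<omega> = \<i> * orbit_rhs \<epsilon> \<rho> j 0 / p j" using p0[OF j] by (simp add: y_def z_def p_def Zt_def field_simps)
    then have "cmod (y j - of_int (k j) * of_real \<omega>) * cmod (p j) = cmod (orbit_rhs \<epsilon> \<rho> j 0)" using p0[OF j] by (simp add: norm_divide norm_mult)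
    also have "\<dots> \<le> C * \<epsilon>" by (rule orbitD(6)[OF o])
    also have "\<dots> < (\<omega> / 2) * (sqrt I / 2)" using sm \<omega>_pos unfolding small_def by (simp add: field_simps)
    also have "\<dots> \<le> (\<omega> / 2) * cmod (p j)" using lo[OF j] \<omega>_pos by (intro mult_left_mono) auto
    finally show ?thesis by (rule mult_right_less_imp_less) simp
  qed
  define D where "D = y 1 + y (-1) - 2 * y 0"
  have D: "D \<noteq> 0"
  proof
    assume "D = 0"
    define a where "a j = y j - of_int (k j) * of_real \<omega>" for j
    have eq: "2 * complex_of_real \<omega> = a 1 + a (-1) - (a 0 + a 0)" using \<open>D = 0\<close> by (simp add: D_def a_def algebra_simps)
    have "cmod (2 * complex_of_real \<omega>) \<le> (cmod (a 1) + cmod (a (-1))) + (cmod (a 0) + cmod (a 0))"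
      unfolding eq using norm_triangle_ineq4[of "a 1 + a (-1)" "a 0 + a 0"] norm_triangle_ineq[of "a 1" "a (-1)"] norm_triangle_ineq[of "a 0" "a 0"] by linarith
    moreover have "cmod (2 * complex_of_real \<omega>) = 2 * \<omega>" using \<omega>_pos by (simp add: norm_mult)
    moreover have "cmod (a 1) < \<omega> / 2" "cmod (a (-1)) < \<omega> / 2" "cmod (a 0) < \<omega> / 2" unfolding a_def by (rule yb, simp)+
    ultimately show False by linarith
  qed
  define \<beta> where "\<beta> = (c 1 + c (-1) - 2 * c 0) / D"
  define \<alpha> where "\<alpha> = c 0 - \<beta> * y 0"
  define d where "d = c 1 - \<alpha> - \<beta> * y 1"
  have bD: "\<beta> * D = c 1 + c (-1) - 2 * c 0" using D by (simp add: \<beta>_def)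
  have "c (-1) - (\<alpha> + \<beta> * y (-1) + d * of_real (\<sigma> (-1))) = (c 1 + c (-1) - 2 * c 0) - \<beta> * D"
    by (simp add: d_def \<alpha>_def D_def algebra_simps)
  then have cm: "\<alpha> + \<beta> * y (-1) + d * of_real (\<sigma> (-1)) = c (-1)" using bD by simp
  have sol: "\<alpha> + \<beta> * y j + d * of_real (\<sigma> j) = c j" if "j \<in> {-1, 0, 1}" for j
    using that cm by (auto simp: d_def \<alpha>_def)
  define vF where "vF j t = F j t - mF \<epsilon> \<rho> \<alpha> \<beta> d j t" for j t
  define vG where "vG j t = G j t - mG \<epsilon> \<rho> \<alpha> \<beta> d j t" for j t
  have "lin_sol \<epsilon> \<rho> \<kappa> (\<lambda>j t. - \<i> * 0 + d * of_real \<epsilon> * resid \<rho> \<sigma> j t - \<i> * \<kappa> * mF \<epsilon> \<rho> \<alpha> \<beta> d j t)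
       (\<lambda>j t. \<i> * 0 + d * of_real \<epsilon> * cnj (resid \<rho> \<sigma> j t) + \<i> * \<kappa> * mG \<epsilon> \<rho> \<alpha> \<beta> d j t) vF vG"
  proof -
    let ?c = "\<lambda>H K F G. lin_sol \<epsilon> \<rho> \<kappa> H K F G"
    note L = lin_sol_comb[OF lin_sol_comb[OF lin_sol_comb[OF l lin_sol_exponent[OF gauge_mode[OF o]], of \<alpha>] lin_sol_exponent[OF time_mode[OF o]], of \<beta>]
        lin_sol_exponent[OF partial_gauge[OF o, of \<sigma>]], of d]
    have eqs: "(\<lambda>j t. - \<i> * 0 + d * of_real \<epsilon> * resid \<rho> \<sigma> j t - \<i> * \<kappa> * mF \<epsilon> \<rho> \<alpha> \<beta> d j t) =
       (\<lambda>j t. 0 - \<alpha> * (0 + \<i> * \<kappa> * (\<i> * \<rho> j t)) - \<beta> * (0 + \<i> * \<kappa> * (\<i> * Zt \<epsilon> \<rho> j t)) - d * (- of_real \<epsilon> * resid \<rho> \<sigma> j t + \<i> * \<kappa> * (\<i> * of_real (\<sigma> j) * \<rho> j t)))"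
      "(\<lambda>j t. \<i> * 0 + d * of_real \<epsilon> * cnj (resid \<rho> \<sigma> j t) + \<i> * \<kappa> * mG \<epsilon> \<rho> \<alpha> \<beta> d j t) =
       (\<lambda>j t. 0 - \<alpha> * (0 - \<i> * \<kappa> * (- \<i> * cnj (\<rho> j t))) - \<beta> * (0 - \<i> * \<kappa> * (- \<i> * cnj (Zt \<epsilon> \<rho> j t))) - d * (- of_real \<epsilon> * cnj (resid \<rho> \<sigma> j t) - \<i> * \<kappa> * (- \<i> * of_real (\<sigma> j) * cnj (\<rho> j t))))"
      "vF = (\<lambda>j t. F j t - \<alpha> * (\<i> * \<rho> j t) - \<beta> * (\<i> * Zt \<epsilon> \<rho> j t) - d * (\<i> * of_real (\<sigma> j) * \<rho> j t))"
      "vG = (\<lambda>j t. G j t - \<alpha> * (- \<i> * cnj (\<rho> j t)) - \<beta> * (- \<i> * cnj (Zt \<epsilon> \<rho> j t)) - d * (- \<i> * of_real (\<sigma> j) * cnj (\<rho> j t)))"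
      by (simp_all add: fun_eq_iff vF_def vG_def mF_def mG_def algebra_simps)
    show ?thesis unfolding eqs by (rule L)
  qed
  moreover have "vF j 0 - vG j 0 = 0" if j: "j \<in> {-1, 0, 1}" for j
  proof -
    have "vF j 0 - vG j 0 = (F j 0 - G j 0) - (mF \<epsilon> \<rho> \<alpha> \<beta> d j 0 - mG \<epsilon> \<rho> \<alpha> \<beta> d j 0)" by (simp add: vF_def vG_def)
    also have "mF \<epsilon> \<rho> \<alpha> \<beta> d j 0 - mG \<epsilon> \<rho> \<alpha> \<beta> d j 0 = 2 * \<i> * (\<alpha> * p j + \<beta> * z j + d * of_real (\<sigma> j) * p j)"
      by (simp add: mF_def mG_def pr zr p_def z_def algebra_simps)
    also have "\<alpha> * p j + \<beta> * z j + d * of_real (\<sigma> j) * p j = (\<alpha> + \<beta> * y j + d * of_real (\<sigma> j)) * p j"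
      using p0[OF j] by (simp add: y_def distrib_right)
    also have "2 * \<i> * ((\<alpha> + \<beta> * y j + d * of_real (\<sigma> j)) * p j) = F j 0 - G j 0"
      unfolding sol[OF j] using p0[OF j] by (simp add: c_def)
    finally show ?thesis by simp
  qed
  moreover have "vF j (t + T) = vF j t" "vG j (t + T) = vG j t" for j t
    by (simp_all add: vF_def vG_def mF_def mG_def per orbitD(2)[OF o] Zt_period[OF o])
  moreover have "F j t = mF \<epsilon> \<rho> \<alpha> \<beta> d j t + vF j t" "G j t = mG \<epsilon> \<rho> \<alpha> \<beta> d j t + vG j t" for j t by (simp_all add: vF_def vG_def)
  ultimately show ?thesis by blast
qed

text \<open>The bounds on \<open>Im \<kappa>\<close> fix the branch of the logarithm, so that a multiplier near 1 has an exponent near 0.\<close>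

lemma no_decaying_modes:
  assumes s: "s = -1" and C: "C \<ge> 0"
  shows "\<exists>\<epsilon>1>0. \<forall>\<epsilon> \<rho> \<kappa> F G. 0 < \<epsilon> \<and> \<epsilon> < \<epsilon>1 \<and> orbit C \<epsilon> \<rho> \<and> free_sol \<epsilon> \<rho> \<kappa> F G \<and>
     (\<forall>j t. F j (t + T) = F j t) \<and> (\<forall>j t. G j (t + T) = G j t) \<and> Re \<kappa> < 0 \<and> - pi < Im \<kappa> * T \<and> Im \<kappa> * T \<le> pi \<longrightarrow> (\<forall>j t. F j t = 0 \<and> G j t = 0)"
proof (rule ccontr)
  assume neg: "\<not> ?thesis"
  define B where "B \<epsilon> \<rho> \<kappa> F G \<longleftrightarrow> orbit C \<epsilon> \<rho> \<and> free_sol \<epsilon> \<rho> \<kappa> F G \<and>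
     (\<forall>j t. F j (t + T) = F j t) \<and> (\<forall>j t. G j (t + T) = G j t) \<and> Re \<kappa> < 0 \<and> - pi < Im \<kappa> * T \<and> Im \<kappa> * T \<le> pi \<and> (\<exists>j t. F j t \<noteq> 0 \<or> G j t \<noteq> 0)"
    for \<epsilon> \<rho> \<kappa> F G
  define Q where "Q \<epsilon> \<rho> \<kappa> F G \<alpha> \<beta> d vF vG \<longleftrightarrow> (\<forall>j t. vF j (t + T) = vF j t) \<and> (\<forall>j t. vG j (t + T) = vG j t) \<and> (\<forall>j\<in>{-1, 0, 1}. vF j 0 - vG j 0 = 0) \<and>
     lin_sol \<epsilon> \<rho> \<kappa> (\<lambda>j t. - \<i> * 0 + d * of_real \<epsilon> * resid \<rho> \<sigma> j t - \<i> * \<kappa> * mF \<epsilon> \<rho> \<alpha> \<beta> d j t)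
       (\<lambda>j t. \<i> * 0 + d * of_real \<epsilon> * cnj (resid \<rho> \<sigma> j t) + \<i> * \<kappa> * mG \<epsilon> \<rho> \<alpha> \<beta> d j t) vF vG \<and>
     (\<forall>j t. F j t = mF \<epsilon> \<rho> \<alpha> \<beta> d j t + vF j t) \<and> (\<forall>j t. G j t = mG \<epsilon> \<rho> \<alpha> \<beta> d j t + vG j t)"
    for \<epsilon> \<rho> \<kappa> F G \<alpha> \<beta> d vF vG
  obtain \<delta>0 where \<delta>0: "\<delta>0 > 0" "\<And>\<delta>. 0 \<le> \<delta> \<Longrightarrow> \<delta> < \<delta>0 \<Longrightarrow> small \<delta>" using small_eventually by blast
  have "\<exists>\<epsilon> \<rho> \<kappa> F G \<alpha> \<beta> d vF vG. 0 < \<epsilon> \<and> \<epsilon> < inverse (real (Suc n)) \<and> B \<epsilon> \<rho> \<kappa> F G \<and> Q \<epsilon> \<rho> \<kappa> F G \<alpha> \<beta> d vF vG" for n :: nat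
  proof -
    define e where "e = min (inverse (real (Suc n))) (\<delta>0 / (C + 1))"
    have e0: "e > 0" using \<delta>0(1) C by (simp add: e_def)
    obtain \<epsilon> \<rho> \<kappa> F G where b: "0 < \<epsilon>" "\<epsilon> < e" "B \<epsilon> \<rho> \<kappa> F G" using neg e0 unfolding B_def by blast
    have "C * \<epsilon> < \<delta>0"
    proof -
      have "\<epsilon> * (C + 1) < \<delta>0" using b(2) C unfolding e_def by (simp add: pos_less_divide_eq)
      then show ?thesis using b(1) by (simp add: algebra_simps)
    qed
    then have "small (C * \<epsilon>)" using b(1) C by (intro \<delta>0(2)) auto
    with b have "\<exists>\<alpha> \<beta> d vF vG. Q \<epsilon> \<rho> \<kappa> F G \<alpha> \<beta> d vF vG" unfolding Q_def B_def by (intro mode_decomposition[OF _ C]) auto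
    with b show ?thesis unfolding e_def by (meson min_less_iff_conj)
  qed
  then obtain \<epsilon> \<rho> \<kappa> F G \<alpha> \<beta> d vF vG where e: "\<And>n. 0 < \<epsilon> n" "\<And>n. \<epsilon> n < inverse (real (Suc n))"
    and b: "\<And>n. B (\<epsilon> n) (\<rho> n) (\<kappa> n) (F n) (G n)" and q: "\<And>n. Q (\<epsilon> n) (\<rho> n) (\<kappa> n) (F n) (G n) (\<alpha> n) (\<beta> n) (d n) (vF n) (vG n)"
    by metis
  have el: "\<epsilon> \<longlonglongrightarrow> 0"
    by (rule tendsto_sandwich[OF _ _ tendsto_const LIMSEQ_inverse_real_of_nat]) (auto intro!: eventuallyI less_imp_le e simp del: of_nat_Suc)
  have "(\<lambda>n. exp (\<kappa> n * of_real T)) \<longlonglongrightarrow> 1"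
  proof (rule tendstoI)
    fix \<eta>0 :: real assume h: "\<eta>0 > 0"
    obtain \<epsilon>1 where e1: "\<epsilon>1 > 0" "\<forall>\<epsilon> \<rho> \<kappa> F G. 0 < \<epsilon> \<and> \<epsilon> < \<epsilon>1 \<and> orbit C \<epsilon> \<rho> \<and> free_sol \<epsilon> \<rho> \<kappa> F G \<and>
       (\<forall>j t. F j (t + T) = F j t) \<and> (\<forall>j t. G j (t + T) = G j t) \<and> Re \<kappa> < 0 \<and> \<eta>0 \<le> cmod (1 - exp (\<kappa> * of_real T)) \<longrightarrow> (\<forall>j t. F j t = 0 \<and> G j t = 0)"
      using large_exponents[OF C h] by blast
    show "\<forall>\<^sub>F n in sequentially. dist (exp (\<kappa> n * of_real T)) 1 < \<eta>0"
      using order_tendstoD(2)[OF el e1(1)]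
    proof eventually_elim
      case (elim n)
      have "\<not> \<eta>0 \<le> cmod (1 - exp (\<kappa> n * of_real T))" using e1(2) elim b[of n] e(1)[of n] unfolding B_def by blast
      then show ?case by (simp add: dist_norm norm_minus_commute)
    qed
  qed
  then have "(\<lambda>n. Ln (exp (\<kappa> n * of_real T))) \<longlonglongrightarrow> Ln 1" by (rule tendsto_Ln) simp
  moreover have "Ln (exp (\<kappa> n * of_real T)) = \<kappa> n * of_real T" for n
    using b[of n] by (intro Ln_exp) (auto simp: B_def)
  ultimately have "(\<lambda>n. \<kappa> n * of_real T) \<longlonglongrightarrow> 0" by simp
  then have "(\<lambda>n. (\<kappa> n * of_real T) / of_real T) \<longlonglongrightarrow> 0 / of_real T" by (rule tendsto_divide) (use T_pos in auto)
  then have kl: "\<kappa> \<longlonglongrightarrow> 0" using T_pos by simp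
  have lim: "(\<lambda>n. \<epsilon> n + cmod (\<kappa> n)) \<longlonglongrightarrow> 0" using tendsto_add[OF el tendsto_norm[OF kl]] by simp
  have "mode_free I \<omega> T s r k C \<epsilon> \<kappa> \<rho> \<alpha> \<beta> d (\<lambda>_ _. 0) vF vG F G"
    by unfold_locales (use C e lim b q in \<open>auto simp: B_def Q_def\<close>)
  then show False by (rule mode_free.no_small_exponents[OF _ s])
qed

lemma lin_sol_exp:
  assumes l: "free_sol \<epsilon> \<rho> 0 f g"
  shows "free_sol \<epsilon> \<rho> \<kappa> (\<lambda>j t. exp (- \<kappa> * of_real t) * f j t) (\<lambda>j t. exp (- \<kappa> * of_real t) * g j t)"
proof -
  have e: "((\<lambda>t. exp (- \<kappa> * of_real t)) has_vector_derivative - \<kappa> * exp (- \<kappa> * of_real t)) (at t)" for t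
  proof -
    have "((\<lambda>z. exp (- \<kappa> * z)) has_field_derivative - \<kappa> * exp (- \<kappa> * of_real t)) (at (of_real t))"
      by (auto intro!: derivative_eq_intros)
    from has_vector_derivative_real_field[OF this] show ?thesis by simp
  qed
  show ?thesis unfolding lin_sol_def
  proof (intro allI conjI)
    fix j t
    show "((\<lambda>t. exp (- \<kappa> * of_real t) * f j t) has_vector_derivative - \<i> * (linF \<epsilon> \<rho> (\<lambda>j t. exp (- \<kappa> * of_real t) * f j t) (\<lambda>j t. exp (- \<kappa> * of_real t) * g j t) j t + 0) - \<kappa> * (exp (- \<kappa> * of_real t) * f j t)) (at t)"
      by (rule has_vector_derivative_eq_rhs[OF has_vector_derivative_mult[OF e lin_solD(1)[OF l]]]) (simp add: linF_def nbr_def algebra_simps)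
    show "((\<lambda>t. exp (- \<kappa> * of_real t) * g j t) has_vector_derivative \<i> * (linG \<epsilon> \<rho> (\<lambda>j t. exp (- \<kappa> * of_real t) * f j t) (\<lambda>j t. exp (- \<kappa> * of_real t) * g j t) j t + 0) - \<kappa> * (exp (- \<kappa> * of_real t) * g j t)) (at t)"
      by (rule has_vector_derivative_eq_rhs[OF has_vector_derivative_mult[OF e lin_solD(2)[OF l]]]) (simp add: linG_def nbr'_def algebra_simps)
  qed
qed

text \<open>Time reversal, which exchanges decaying and growing solutions.\<close>

lemma lin_sol_reverse:
  assumes o: "orbit C \<epsilon> \<rho>" and l: "free_sol \<epsilon> \<rho> 0 f g"
  shows "free_sol \<epsilon> \<rho> 0 (\<lambda>j t. g j (- t)) (\<lambda>j t. f j (- t))"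
  unfolding lin_sol_def
proof (intro allI conjI)
  fix j t
  have p: "\<rho> j (- t) = cnj (\<rho> j t)" "cnj (\<rho> j (- t)) = \<rho> j t" by (simp_all add: orbitD(3)[OF o])
  have th: "\<theta> j i (- t) = cnj (\<theta> j i t)" "cnj (\<theta> j i (- t)) = \<theta> j i t" for i by (simp_all add: \<theta>_minus)
  show "((\<lambda>t. g j (- t)) has_vector_derivative - \<i> * (linF \<epsilon> \<rho> (\<lambda>j t. g j (- t)) (\<lambda>j t. f j (- t)) j t + 0) - 0 * g j (- t)) (at t)"
    by (rule has_vector_derivative_eq_rhs[OF flip_vderiv[OF lin_solD(2)[OF l]]]) (simp add: linF_def linG_def nbr_def nbr'_def p th algebra_simps)
  show "((\<lambda>t. f j (- t)) has_vector_derivative \<i> * (linG \<epsilon> \<rho> (\<lambda>j t. g j (- t)) (\<lambda>j t. f j (- t)) j t + 0) - 0 * f j (- t)) (at t)"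
    by (rule has_vector_derivative_eq_rhs[OF flip_vderiv[OF lin_solD(1)[OF l]]]) (simp add: linF_def linG_def nbr_def nbr'_def p th algebra_simps)
qed

text \<open>The exponent is a logarithm of \<open>\<mu>\<close>, divided by \<open>T\<close>, if \<open>\<mu>\<close> lies inside the unit circle.  Time reversal replaces \<open>\<mu>\<close> by \<open>1 / \<mu>\<close>.\<close>

lemma unit_multipliers:
  assumes s: "s = -1" and C: "C \<ge> 0"
  shows "\<exists>\<epsilon>1>0. \<forall>\<epsilon> \<rho> \<mu> f g. 0 < \<epsilon> \<and> \<epsilon> < \<epsilon>1 \<and> orbit C \<epsilon> \<rho> \<and> free_sol \<epsilon> \<rho> 0 f g \<and> \<mu> \<noteq> 0 \<and>
     (\<forall>j t. f j (t + T) = \<mu> * f j t) \<and> (\<forall>j t. g j (t + T) = \<mu> * g j t) \<and> (\<exists>j t. f j t \<noteq> 0 \<or> g j t \<noteq> 0) \<longrightarrow> cmod \<mu> = 1"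
proof -
  obtain \<epsilon>1 where e1: "\<epsilon>1 > 0" "\<forall>\<epsilon> \<rho> \<kappa> F G. 0 < \<epsilon> \<and> \<epsilon> < \<epsilon>1 \<and> orbit C \<epsilon> \<rho> \<and> free_sol \<epsilon> \<rho> \<kappa> F G \<and>
     (\<forall>j t. F j (t + T) = F j t) \<and> (\<forall>j t. G j (t + T) = G j t) \<and> Re \<kappa> < 0 \<and> - pi < Im \<kappa> * T \<and> Im \<kappa> * T \<le> pi \<longrightarrow> (\<forall>j t. F j t = 0 \<and> G j t = 0)"
    using no_decaying_modes[OF s C] by blast
  have contr: "\<not> cmod \<mu> < 1" if e: "0 < \<epsilon>" "\<epsilon> < \<epsilon>1" and o: "orbit C \<epsilon> \<rho>" and l: "free_sol \<epsilon> \<rho> 0 f g" and m: "\<mu> \<noteq> 0"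
    and per: "\<And>j t. f j (t + T) = \<mu> * f j t" "\<And>j t. g j (t + T) = \<mu> * g j t" and ne: "\<exists>j t. f j t \<noteq> 0 \<or> g j t \<noteq> 0" for \<epsilon> \<rho> \<mu> f g
  proof
    assume lt: "cmod \<mu> < 1"
    define \<kappa> where "\<kappa> = Ln \<mu> / of_real T"
    have kT: "\<kappa> * of_real T = Ln \<mu>" using T_pos by (simp add: \<kappa>_def)
    then have kT': "exp (\<kappa> * of_real T) = \<mu>" using m by simp
    have Re: "Re \<kappa> * T = ln (cmod \<mu>)" "Im \<kappa> * T = Im (Ln \<mu>)" unfolding kT[symmetric] Re_Ln[OF m, symmetric] by simp_all
    have "Re \<kappa> * T < 0" unfolding Re using lt m by simp
    then have neg: "Re \<kappa> < 0" using T_pos by (simp add: mult_less_0_iff)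
    have im: "- pi < Im \<kappa> * T" "Im \<kappa> * T \<le> pi" unfolding Re using m by (auto intro: mpi_less_Im_Ln Im_Ln_le_pi)
    let ?e = "\<lambda>t. exp (- \<kappa> * of_real t)"
    have eT: "?e (t + T) * (\<mu> * x) = ?e t * x" for t x
    proof -
      have "?e (t + T) * (exp (\<kappa> * of_real T) * x) = (?e (t + T) * exp (\<kappa> * of_real T)) * x" by simp
      also have "?e (t + T) * exp (\<kappa> * of_real T) = ?e t" unfolding exp_add[symmetric] by (simp add: algebra_simps)
      finally show ?thesis unfolding kT' .
    qed
    have "?e t * f j t = 0 \<and> ?e t * g j t = 0" for j t
      by (rule e1(2)[rule_format, of \<epsilon> \<rho> \<kappa> "\<lambda>j t. ?e t * f j t" "\<lambda>j t. ?e t * g j t" j t], intro conjI allI)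
         (simp_all only: e o lin_sol_exp[OF l, of \<kappa>] neg im eT per)
    then show False using ne by simp
  qed
  have main: "cmod \<mu> = 1" if e: "0 < \<epsilon>" "\<epsilon> < \<epsilon>1" and o: "orbit C \<epsilon> \<rho>" and l: "free_sol \<epsilon> \<rho> 0 f g" and m: "\<mu> \<noteq> 0"
    and per: "\<And>j t. f j (t + T) = \<mu> * f j t" "\<And>j t. g j (t + T) = \<mu> * g j t" and ne: "\<exists>j t. f j t \<noteq> 0 \<or> g j t \<noteq> 0" for \<epsilon> \<rho> \<mu> f g
  proof -
    have "\<not> cmod \<mu> < 1" by (rule contr[OF e o l m per ne])
    moreover have "\<not> cmod (1 / \<mu>) < 1"
    proof (rule contr[OF e o lin_sol_reverse[OF o l]])
      show "1 / \<mu> \<noteq> 0" using m by simp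
      show "g j (- (t + T)) = 1 / \<mu> * g j (- t)" for j t using per(2)[of j "- (t + T)"] m by simp
      show "f j (- (t + T)) = 1 / \<mu> * f j (- t)" for j t using per(1)[of j "- (t + T)"] m by simp
      obtain j t where "f j t \<noteq> 0 \<or> g j t \<noteq> 0" using ne by blast
      then show "\<exists>j t. g j (- t) \<noteq> 0 \<or> f j (- t) \<noteq> 0" by (intro exI[of _ j] exI[of _ "- t"]) auto
    qed
    ultimately show ?thesis using m by (simp add: norm_divide)
  qed
  show ?thesis
    by (intro exI[of _ \<epsilon>1] conjI e1(1) allI impI; elim conjE) (rule main; assumption?; blast)
qed

lemma lin_field_bound: "norm (lin_field \<epsilon> \<psi> w) \<le> (real CARD('b mod_ring) * (1 + 4 * \<bar>\<epsilon>\<bar> + 3 * (norm \<psi>)\<^sup>2)) * norm w"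
  for \<psi> :: "complex ^ ('b::nontriv) mod_ring"
proof -
  have "cmod (lin_field \<epsilon> \<psi> w $ j) \<le> (1 + 4 * \<bar>\<epsilon>\<bar> + 3 * (norm \<psi>)\<^sup>2) * norm w" for j
  proof -
    let ?p = "\<psi> $ j"
    have pj: "cmod ?p \<le> norm \<psi>" by (rule Finite_Cartesian_Product.norm_nth_le)
    have wj: "cmod (w $ i) \<le> norm w" for i by (rule Finite_Cartesian_Product.norm_nth_le)
    have p2: "(cmod ?p)\<^sup>2 \<le> (norm \<psi>)\<^sup>2" using pj by (intro power_mono) auto
    have "cmod (1 + 2 * of_real \<epsilon> + 2 * ?p * cnj ?p) \<le> cmod (1 :: complex) + cmod (2 * complex_of_real \<epsilon>) + cmod (2 * ?p * cnj ?p)"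
      by (intro norm_triangle_le add_mono order_refl)
    then have "cmod (1 + 2 * of_real \<epsilon> + 2 * ?p * cnj ?p) \<le> 1 + 2 * \<bar>\<epsilon>\<bar> + 2 * (norm \<psi>)\<^sup>2"
      using p2 by (simp add: norm_mult power2_eq_square)
    then have 1: "cmod ((1 + 2 * of_real \<epsilon> + 2 * ?p * cnj ?p) * w $ j) \<le> (1 + 2 * \<bar>\<epsilon>\<bar> + 2 * (norm \<psi>)\<^sup>2) * norm w"
      unfolding norm_mult by (intro mult_mono wj) auto
    have 2: "cmod (?p\<^sup>2 * cnj (w $ j)) \<le> (norm \<psi>)\<^sup>2 * norm w"
      unfolding norm_mult norm_power complex_mod_cnj by (intro mult_mono p2 wj) auto
    have "cmod (w $ (j + 1) + w $ (j - 1)) \<le> 2 * norm w" using wj[of "j + 1"] wj[of "j - 1"] norm_triangle_ineq[of "w $ (j + 1)" "w $ (j - 1)"] by linarith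
    then have 3: "cmod (of_real \<epsilon> * (w $ (j + 1) + w $ (j - 1))) \<le> \<bar>\<epsilon>\<bar> * (2 * norm w)"
      unfolding norm_mult norm_of_real by (intro mult_left_mono) auto
    have "cmod (lin_field \<epsilon> \<psi> w $ j) = cmod ((1 + 2 * of_real \<epsilon> + 2 * ?p * cnj ?p) * w $ j + ?p\<^sup>2 * cnj (w $ j) - of_real \<epsilon> * (w $ (j + 1) + w $ (j - 1)))"
      unfolding lin_field_def vec_lambda_beta by (simp only: norm_mult norm_minus_cancel norm_ii mult_1)
    also have "\<dots> \<le> (1 + 2 * \<bar>\<epsilon>\<bar> + 2 * (norm \<psi>)\<^sup>2) * norm w + (norm \<psi>)\<^sup>2 * norm w + \<bar>\<epsilon>\<bar> * (2 * norm w)"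
      by (rule order_trans[OF norm_triangle3]) (intro add_mono 1 2 3)
    finally show ?thesis by (simp add: algebra_simps)
  qed
  from vec_norm_le[OF this] show ?thesis by (simp add: mult.assoc)
qed

lemma lin_field_comb: "lin_field \<epsilon> \<psi> (a *\<^sub>R u + b *\<^sub>R v) = a *\<^sub>R lin_field \<epsilon> \<psi> u + b *\<^sub>R lin_field \<epsilon> \<psi> v"
  unfolding lin_field_def vec_eq_iff vector_add_component vector_scaleR_component vec_lambda_beta
  by (simp add: scaleR_conv_of_real algebra_simps)

lemma lin_unique:
  fixes U V :: "real \<Rightarrow> complex ^ ('b::nontriv) mod_ring"
  assumes g: "solution_of (dnls_field \<epsilon>) \<gamma>"
    and U: "\<And>t. (U has_vector_derivative lin_field \<epsilon> (\<gamma> t) (U t)) (at t)" and V: "\<And>t. (V has_vector_derivative lin_field \<epsilon> (\<gamma> t) (V t)) (at t)"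
    and 0: "U 0 = V 0"
  shows "U t = V t"
proof -
  have n: "norm (\<gamma> t) = norm (\<gamma> 0)" for t by (rule norm_conserved[OF g])
  have "(\<lambda>t. U t - V t) t = 0"
  proof (rule gronwall_zero)
    show "((\<lambda>t. U t - V t) has_vector_derivative lin_field \<epsilon> (\<gamma> t) (U t - V t)) (at t)" for t
      by (rule has_vector_derivative_eq_rhs[OF has_vector_derivative_diff[OF U V]]) (use lin_field_comb[of \<epsilon> "\<gamma> t" 1 "U t" "-1" "V t"] in simp)
    show "norm (lin_field \<epsilon> (\<gamma> t) (U t - V t)) \<le> (real CARD('b mod_ring) * (1 + 4 * \<bar>\<epsilon>\<bar> + 3 * (norm (\<gamma> 0))\<^sup>2)) * norm (U t - V t)" for t
      using lin_field_bound[of \<epsilon> "\<gamma> t" "U t - V t"] by (simp only: n[of t])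
  qed (simp add: 0)
  then show ?thesis by simp
qed

text \<open>Passing to the rotating frame turns real solutions along any orbit of the torus into pairs with \<open>G = cnj F\<close> along the reference orbit.\<close>

lemma to_frame:
  fixes U :: "real \<Rightarrow> complex ^ 'a mod_ring"
  assumes U: "\<And>t. (U has_vector_derivative lin_field \<epsilon> (tor \<rho> (a + \<omega> * t, b + 2 * \<omega> * t)) (U t)) (at t)"
  defines "A \<equiv> \<lambda>j t. cis (2 * a - b) * (cis (of_int (k j) * \<omega> * t) * U (t - (b - a) / \<omega>) $ j)"
  shows "free_sol \<epsilon> \<rho> 0 A (\<lambda>j t. cnj (A j t))"
proof -
  define \<tau> where "\<tau> = (b - a) / \<omega>"
  define c where "c = cis (2 * a - b)"
  define w where "w j t = cis (of_int (k j) * \<omega> * t)" for j t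
  have A: "A = (\<lambda>j t. c * (w j t * U (t - \<tau>) $ j))" by (simp add: A_def c_def w_def \<tau>_def)
  have cc: "c * cnj c = 1" "w j t * cnj (w j t) = 1" for j t by (simp_all add: c_def w_def cis_cnj cis_mult)
  have th: "\<theta> j i t = w j t * cnj (w i t)" for i j t by (simp add: \<theta>_def w_def cis_cnj cis_mult algebra_simps)
  have psi: "tor \<rho> (a + \<omega> * (t - \<tau>), b + 2 * \<omega> * (t - \<tau>)) $ j = cnj c * (cnj (w j t) * \<rho> j t)" for j t
    unfolding tor_flow \<tau>_def[symmetric] by (simp add: gam_def c_def w_def cis_cnj)
  have dA: "(A j has_vector_derivative - \<i> * (linF \<epsilon> \<rho> A (\<lambda>j t. cnj (A j t)) j t + 0) - 0 * A j t) (at t)" for j t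
  proof -
    let ?q = "U (t - \<tau>)" and ?p = "cnj c * (cnj (w j t) * \<rho> j t)"
    have ring: "c * (w * (- \<i> * ((1 + 2 * of_real e + 2 * p * p') * q + p\<^sup>2 * q' - of_real e * (q1 + q2))) + \<i> * of_real (of_int k * \<omega>) * w * q)
      = - \<i> * ((1 + 2 * of_real e + 2 * (p * p') - of_int k * of_real \<omega>) * (c * (w * q)) + c * (w * (p\<^sup>2 * q')) - of_real e * (c * (w * q1) + c * (w * q2)))"
      for c w p p' q q' q1 q2 :: complex and e :: real and k :: int by (simp add: algebra_simps)
    have "((\<lambda>t. U (t - \<tau>)) has_vector_derivative lin_field \<epsilon> (tor \<rho> (a + \<omega> * (t - \<tau>), b + 2 * \<omega> * (t - \<tau>))) (U (t - \<tau>))) (at t)"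
      using shift_vderiv[of U "\<lambda>t. lin_field \<epsilon> (tor \<rho> (a + \<omega> * t, b + 2 * \<omega> * t)) (U t)" "- \<tau>", OF U] by simp
    from nth_vderiv[OF this, of j]
    have dU: "((\<lambda>t. U (t - \<tau>) $ j) has_vector_derivative - \<i> * ((1 + 2 * of_real \<epsilon> + 2 * ?p * cnj ?p) * ?q $ j + ?p\<^sup>2 * cnj (?q $ j) - of_real \<epsilon> * (?q $ (j + 1) + ?q $ (j - 1)))) (at t)"
      unfolding lin_field_def vec_lambda_beta psi .
    have dw: "(w j has_vector_derivative \<i> * of_real (of_int (k j) * \<omega>) * w j t) (at t)" unfolding w_def by (rule cis_vderiv)
    have e1: "?p * cnj ?p = \<rho> j t * cnj (\<rho> j t)"
    proof -
      have "?p * cnj ?p = (c * cnj c) * (w j t * cnj (w j t)) * (\<rho> j t * cnj (\<rho> j t))" by simp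
      then show ?thesis unfolding cc by simp
    qed
    have e2: "c * (w j t * (?p\<^sup>2 * cnj (?q $ j))) = (\<rho> j t)\<^sup>2 * cnj (A j t)"
    proof -
      have "c * (w j t * (?p\<^sup>2 * cnj (?q $ j))) = (c * cnj c) * (w j t * cnj (w j t)) * ((\<rho> j t)\<^sup>2 * cnj (A j t))"
        by (simp add: A power2_eq_square)
      then show ?thesis unfolding cc by simp
    qed
    have e3: "c * (w j t * ?q $ i) = \<theta> j i t * A i t" for i
    proof -
      have "\<theta> j i t * A i t = (w i t * cnj (w i t)) * (c * (w j t * ?q $ i))" by (simp add: A th)
      then show ?thesis unfolding cc by simp
    qed
    have "(A j has_vector_derivative c * (w j t * (- \<i> * ((1 + 2 * of_real \<epsilon> + 2 * ?p * cnj ?p) * ?q $ j + ?p\<^sup>2 * cnj (?q $ j) - of_real \<epsilon> * (?q $ (j + 1) + ?q $ (j - 1)))) + \<i> * of_real (of_int (k j) * \<omega>) * w j t * ?q $ j)) (at t)"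
      unfolding A by (intro has_vector_derivative_mult_right has_vector_derivative_mult dU dw)
    moreover have "c * (w j t * (- \<i> * ((1 + 2 * of_real \<epsilon> + 2 * ?p * cnj ?p) * ?q $ j + ?p\<^sup>2 * cnj (?q $ j) - of_real \<epsilon> * (?q $ (j + 1) + ?q $ (j - 1)))) + \<i> * of_real (of_int (k j) * \<omega>) * w j t * ?q $ j)
      = - \<i> * (linF \<epsilon> \<rho> A (\<lambda>j t. cnj (A j t)) j t + 0) - 0 * A j t"
    proof -
      have "c * (w j t * (- \<i> * ((1 + 2 * of_real \<epsilon> + 2 * ?p * cnj ?p) * ?q $ j + ?p\<^sup>2 * cnj (?q $ j) - of_real \<epsilon> * (?q $ (j + 1) + ?q $ (j - 1)))) + \<i> * of_real (of_int (k j) * \<omega>) * w j t * ?q $ j)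
        = - \<i> * ((1 + 2 * of_real \<epsilon> + 2 * (?p * cnj ?p) - of_int (k j) * of_real \<omega>) * (c * (w j t * ?q $ j)) + c * (w j t * (?p\<^sup>2 * cnj (?q $ j)))
          - of_real \<epsilon> * (c * (w j t * ?q $ (j + 1)) + c * (w j t * ?q $ (j - 1))))"
        by (rule ring)
      also have "\<dots> = - \<i> * ((1 + 2 * of_real \<epsilon> + 2 * (\<rho> j t * cnj (\<rho> j t)) - of_int (k j) * of_real \<omega>) * A j t + (\<rho> j t)\<^sup>2 * cnj (A j t)
          - of_real \<epsilon> * (\<theta> j (j + 1) t * A (j + 1) t + \<theta> j (j - 1) t * A (j - 1) t))"
        unfolding e1 e2 e3[of "j + 1"] e3[of "j - 1"] by (simp add: A)
      finally show ?thesis by (simp add: linF_def nbr_def algebra_simps)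
    qed
    ultimately show ?thesis by (rule has_vector_derivative_eq_rhs)
  qed
  show ?thesis unfolding lin_sol_def
  proof (intro allI conjI)
    fix j t
    show "(A j has_vector_derivative - \<i> * (linF \<epsilon> \<rho> A (\<lambda>j t. cnj (A j t)) j t + 0) - 0 * A j t) (at t)" by (rule dA)
    show "((\<lambda>t. cnj (A j t)) has_vector_derivative \<i> * (linG \<epsilon> \<rho> A (\<lambda>j t. cnj (A j t)) j t + 0) - 0 * cnj (A j t)) (at t)"
      by (rule has_vector_derivative_eq_rhs[OF cnj_vderiv[OF dA]]) (simp add: linF_def linG_def nbr_def nbr'_def algebra_simps)
  qed
qed

lemma torus_orbit:
  assumes o: "orbit C \<epsilon> \<rho>" and g: "periodic_orbit (dnls_field \<epsilon>) T \<gamma>" "range \<gamma> \<subseteq> range (tor \<rho>)"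
  obtains a b where "\<gamma> = (\<lambda>t. tor \<rho> (a + \<omega> * t, b + 2 * \<omega> * t))"
proof -
  have "solution_of (dnls_field \<epsilon>) \<gamma>" "\<gamma> 0 \<in> range (tor \<rho>)" using g unfolding periodic_orbit_def by auto
  from tor_solution_unique[OF o this] show ?thesis using that by blast
qed

text \<open>A complex multiplier with real and imaginary parts \<open>U\<close>, \<open>V\<close> of its solution gives the pair \<open>f = A U + \<i> A V\<close>,
  \<open>g = cnj (A U) + \<i> cnj (A V)\<close> in the rotating frame.\<close>

lemma torus_stable:
  assumes s: "s = -1" and C: "C \<ge> 0"
  shows "\<exists>\<epsilon>1>0. \<forall>\<epsilon> \<rho>. 0 < \<epsilon> \<and> \<epsilon> < \<epsilon>1 \<and> orbit C \<epsilon> \<rho> \<longrightarrow> linearly_stable (dnls_field \<epsilon>) T (range (tor \<rho>))"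
proof -
  obtain \<epsilon>1 where e1: "\<epsilon>1 > 0" "\<forall>\<epsilon> \<rho> \<mu> f g. 0 < \<epsilon> \<and> \<epsilon> < \<epsilon>1 \<and> orbit C \<epsilon> \<rho> \<and> free_sol \<epsilon> \<rho> 0 f g \<and> \<mu> \<noteq> 0 \<and>
     (\<forall>j t. f j (t + T) = \<mu> * f j t) \<and> (\<forall>j t. g j (t + T) = \<mu> * g j t) \<and> (\<exists>j t. f j t \<noteq> 0 \<or> g j t \<noteq> 0) \<longrightarrow> cmod \<mu> = 1"
    using unit_multipliers[OF s C] by blast
  have "cmod \<mu> = 1"
    if e: "0 < \<epsilon>" "\<epsilon> < \<epsilon>1" and o: "orbit C \<epsilon> \<rho>" and g: "periodic_orbit (dnls_field \<epsilon>) T \<gamma>" "range \<gamma> \<subseteq> range (tor \<rho>)"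
      and m: "floquet_multiplier (dnls_field \<epsilon>) T \<gamma> \<mu>" for \<epsilon> \<rho> \<gamma> \<mu>
  proof -
    obtain a b where \<gamma>: "\<gamma> = (\<lambda>t. tor \<rho> (a + \<omega> * t, b + 2 * \<omega> * t))" by (rule torus_orbit[OF o g])
    have sol: "solution_of (dnls_field \<epsilon>) \<gamma>" and gT: "\<gamma> (t + T) = \<gamma> t" for t using g(1) unfolding periodic_orbit_def by auto
    obtain \<Phi> u v where F: "fundamental_solution (dnls_field \<epsilon>) \<gamma> \<Phi>" and ne: "(u, v) \<noteq> (0, 0)"
      and uv: "\<Phi> T u = Re \<mu> *\<^sub>R u - Im \<mu> *\<^sub>R v" "\<Phi> T v = Im \<mu> *\<^sub>R u + Re \<mu> *\<^sub>R v"
      using m unfolding floquet_multiplier_def complex_eigenvalue_def by blast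
    define U where "U = (\<lambda>t. \<Phi> t u)"
    define V where "V = (\<lambda>t. \<Phi> t v)"
    have dU: "(U has_vector_derivative lin_field \<epsilon> (\<gamma> t) (U t)) (at t)" and dV: "(V has_vector_derivative lin_field \<epsilon> (\<gamma> t) (V t)) (at t)" for t
      using F unfolding fundamental_solution_def U_def V_def field_deriv by blast+
    have 0: "U 0 = u" "V 0 = v" using F unfolding fundamental_solution_def U_def V_def by blast+
    have shift: "((\<lambda>t. X (t + T)) has_vector_derivative lin_field \<epsilon> (\<gamma> t) (X (t + T))) (at t)"
      if "\<And>t. (X has_vector_derivative lin_field \<epsilon> (\<gamma> t) (X t)) (at t)" for X t
      using shift_vderiv[of X "\<lambda>t. lin_field \<epsilon> (\<gamma> t) (X t)" T t, OF that] unfolding gT .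
    have comb: "((\<lambda>t. x *\<^sub>R U t + y *\<^sub>R V t) has_vector_derivative lin_field \<epsilon> (\<gamma> t) (x *\<^sub>R U t + y *\<^sub>R V t)) (at t)" for x y t
      unfolding lin_field_comb by (auto intro!: derivative_eq_intros dU dV)
    have UT: "U (t + T) = Re \<mu> *\<^sub>R U t + (- Im \<mu>) *\<^sub>R V t" for t
      by (rule lin_unique[OF sol shift[OF dU] comb]) (use uv(1) 0 in \<open>simp add: U_def\<close>)
    have VT: "V (t + T) = Im \<mu> *\<^sub>R U t + Re \<mu> *\<^sub>R V t" for t
      by (rule lin_unique[OF sol shift[OF dV] comb]) (use uv(2) 0 in \<open>simp add: V_def\<close>)
    define A where "A X j t = cis (2 * a - b) * (cis (of_int (k j) * \<omega> * t) * X (t - (b - a) / \<omega>) $ j)" for X :: "real \<Rightarrow> complex ^ 'a mod_ring" and j t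
    define f where "f j t = A U j t - (- \<i>) * A V j t" for j t
    define g where "g j t = cnj (A U j t) - (- \<i>) * cnj (A V j t)" for j t
    have lA: "free_sol \<epsilon> \<rho> 0 (A U) (\<lambda>j t. cnj (A U j t))" "free_sol \<epsilon> \<rho> 0 (A V) (\<lambda>j t. cnj (A V j t))"
      using to_frame[of U \<epsilon> \<rho> a b] to_frame[of V \<epsilon> \<rho> a b] dU dV unfolding \<gamma> A_def by blast+
    have l: "free_sol \<epsilon> \<rho> 0 f g"
      using lin_sol_comb[OF lA(1) lA(2), of "- \<i>"] unfolding f_def g_def by simp
    have wT: "cis (of_int (k j) * \<omega> * (t + T)) = cis (of_int (k j) * \<omega> * t)" for j t
    proof -
      have "of_int (k j) * \<omega> * (t + T) = of_int (k j) * \<omega> * t + of_int (k j) * \<omega> * T" by (simp add: algebra_simps)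
      then show ?thesis by (simp only: cis_mult[symmetric] cis_period[OF \<omega>T]) simp
    qed
    have tT: "t + T - (b - a) / \<omega> = (t - (b - a) / \<omega>) + T" for t by simp
    have AT: "A U j (t + T) = of_real (Re \<mu>) * A U j t - of_real (Im \<mu>) * A V j t" "A V j (t + T) = of_real (Im \<mu>) * A U j t + of_real (Re \<mu>) * A V j t" for j t
      unfolding A_def wT tT UT VT vector_add_component vector_scaleR_component by (simp_all add: scaleR_conv_of_real algebra_simps)
    have mu: "\<mu> = of_real (Re \<mu>) + \<i> * of_real (Im \<mu>)" by (simp add: complex_eq_iff)
    have ring: "(x * u - y * v) - (- \<i>) * (y * u + x * v) = (x + \<i> * y) * (u - (- \<i>) * v)" for x y u v :: complex
    proof -
      have "(x + \<i> * y) * (u - (- \<i>) * v) = x * u + (\<i> * \<i>) * (y * v) + \<i> * (y * u + x * v)" by (simp add: algebra_simps)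
      then show ?thesis by (simp add: algebra_simps)
    qed
    have per: "f j (t + T) = \<mu> * f j t" "g j (t + T) = \<mu> * g j t" for j t
    proof -
      show "f j (t + T) = \<mu> * f j t" unfolding f_def AT ring mu[symmetric] ..
      show "g j (t + T) = \<mu> * g j t" unfolding g_def AT complex_cnj_diff complex_cnj_add complex_cnj_mult complex_cnj_complex_of_real ring mu[symmetric] ..
    qed
    have ne': "\<exists>j t. f j t \<noteq> 0 \<or> g j t \<noteq> 0"
    proof (rule ccontr)
      assume "\<not> ?thesis"
      then have z: "A U j t + \<i> * A V j t = 0" "cnj (A U j t) + \<i> * cnj (A V j t) = 0" for j t unfolding f_def g_def by auto
      have "A U j t = 0 \<and> A V j t = 0" for j t
        using z[of j t] by (auto simp: complex_eq_iff)
      then have "A U j ((b - a) / \<omega>) = 0" "A V j ((b - a) / \<omega>) = 0" for j by blast+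
      then have "u $ j = 0" "v $ j = 0" for j unfolding A_def diff_self 0 by simp_all
      then have "u = 0" "v = 0" by (simp_all add: vec_eq_iff)
      then show False using ne by simp
    qed
    have "\<mu> \<noteq> 0"
    proof
      assume "\<mu> = 0"
      then have "f j t = 0" "g j t = 0" for j t using per[of j "t - T"] by simp_all
      then show False using ne' by simp
    qed
    then show ?thesis using e1(2) e o l per ne' by blast
  qed
  then show ?thesis unfolding linearly_stable_def using e1(1) by blast
qed

lemma fundamental_exists:
  fixes \<gamma> :: "real \<Rightarrow> complex ^ ('b::nontriv) mod_ring"
  assumes g: "solution_of (dnls_field \<epsilon>) \<gamma>"
  shows "\<exists>\<Phi>. fundamental_solution (dnls_field \<epsilon>) \<gamma> \<Phi>"
proof -
  let ?A = "\<lambda>t. lin_field \<epsilon> (\<gamma> t)"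
  let ?L = "real CARD('b mod_ring) * (1 + 4 * \<bar>\<epsilon>\<bar> + 3 * (norm (\<gamma> 0))\<^sup>2)"
  have n: "norm (\<gamma> t) = norm (\<gamma> 0)" for t by (rule norm_conserved[OF g])
  have bd: "norm (?A t x) \<le> ?L * norm x" for t x using lin_field_bound[of \<epsilon> "\<gamma> t" x] by (simp only: n[of t])
  have lin: "bounded_linear (?A t)" for t
  proof (rule bounded_linear_intro[of _ ?L])
    show "?A t (x + y) = ?A t x + ?A t y" for x y using lin_field_comb[of \<epsilon> "\<gamma> t" 1 x 1 y] by simp
    show "?A t (c *\<^sub>R x) = c *\<^sub>R ?A t x" for c x using lin_field_comb[of \<epsilon> "\<gamma> t" c x 0 x] by simp
    show "norm (?A t x) \<le> norm x * ?L" for x using bd[of t x] by (simp only: mult.commute)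
  qed
  have cg: "continuous_on UNIV \<gamma>" using g unfolding solution_of_def by (intro cont_deriv) blast
  have "\<exists>x. x 0 = v \<and> (\<forall>t. (x has_vector_derivative ?A t (x t)) (at t))" for v
  proof (rule linear_ode_exists[OF lin _ bd])
    show "?L > 0" by (intro mult_pos_pos add_pos_nonneg) auto
    show "continuous_on UNIV (\<lambda>t. ?A t (x t))" if x: "continuous_on UNIV x" for x :: "real \<Rightarrow> complex ^ 'b mod_ring"
    proof -
      have c: "continuous_on UNIV (\<lambda>t. x t $ i)" "continuous_on UNIV (\<lambda>t. \<gamma> t $ i)" for i by (intro continuous_intros x cg)+
      show ?thesis unfolding lin_field_def by (intro continuous_on_vec_lambda continuous_on_mult continuous_on_diff continuous_on_add continuous_on_power continuous_on_cnj continuous_on_const c)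
    qed
  qed
  then have "\<forall>v. \<exists>x. x 0 = v \<and> (\<forall>t. (x has_vector_derivative ?A t (x t)) (at t))" by (rule allI)
  from choice[OF this] obtain X where X: "\<forall>v. X v 0 = v \<and> (\<forall>t. (X v has_vector_derivative ?A t (X v t)) (at t))" ..
  show ?thesis unfolding fundamental_solution_def field_deriv
    by (rule exI[of _ "\<lambda>t v. X v t"]) (rule X)
qed

text \<open>Returning from the rotating frame, for a real exponent.  The rotation of the frame is \<open>T\<close>-periodic and does not change the multiplier.\<close>

lemma growing_multiplier:
  assumes o: "orbit C \<epsilon> \<rho>"
    and A: "\<And>j t. (A j has_vector_derivative - \<i> * linF \<epsilon> \<rho> A (\<lambda>j t. cnj (A j t)) j t - of_real l * A j t) (at t)" and per: "\<And>j t. A j (t + T) = A j t"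
    and ne: "A j0 t0 \<noteq> 0"
  shows "floquet_multiplier (dnls_field \<epsilon>) T (\<lambda>t. tor \<rho> (a + \<omega> * t, b + 2 * \<omega> * t)) (of_real (exp (l * T)))"
proof -
  let ?\<gamma> = "\<lambda>t. tor \<rho> (a + \<omega> * t, b + 2 * \<omega> * t)"
  define \<tau> where "\<tau> = (b - a) / \<omega>"
  define c where "c = cis (b - 2 * a)"
  define w where "w j t = cis (- (of_int (k j) * \<omega>) * t)" for j t
  define E where "E t = complex_of_real (exp (l * t))" for t
  have cc: "c * cnj c = 1" "w j t * cnj (w j t) = 1" for j t by (simp_all add: c_def w_def cis_cnj cis_mult)
  have E: "cnj (E t) = E t" "E t \<noteq> 0" for t by (simp_all add: E_def)
  have th: "w j t * \<theta> j i t = w i t" for i j t unfolding \<theta>_def w_def cis_mult by (simp add: algebra_simps)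
  define V where "V t = (\<chi> j. E t * (w j t * A j t))" for t
  have dV: "(V has_vector_derivative lin_field \<epsilon> (gam \<rho> t) (V t)) (at t)" for t
  proof -
    have dE: "(E has_vector_derivative of_real l * E t) (at t)"
    proof -
      have "((\<lambda>t. exp (l * t)) has_vector_derivative l * exp (l * t)) (at t)"
        unfolding has_real_derivative_iff_has_vector_derivative[symmetric] by (auto intro!: derivative_eq_intros)
      from bounded_linear.has_vector_derivative[OF bounded_linear_of_real this] show ?thesis
        unfolding E_def[abs_def] by simp
    qed
    have dw: "(w j has_vector_derivative \<i> * of_real (- (of_int (k j) * \<omega>)) * w j t) (at t)" for j unfolding w_def by (rule cis_vderiv)
    have "(V has_vector_derivative (\<chi> j. E t * (w j t * (- \<i> * linF \<epsilon> \<rho> A (\<lambda>j t. cnj (A j t)) j t - of_real l * A j t) + \<i> * of_real (- (of_int (k j) * \<omega>)) * w j t * A j t) + of_real l * E t * (w j t * A j t))) (at t)"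
      unfolding V_def by (intro chi_vderiv has_vector_derivative_mult dE dw A)
    moreover have "(\<chi> j. E t * (w j t * (- \<i> * linF \<epsilon> \<rho> A (\<lambda>j t. cnj (A j t)) j t - of_real l * A j t) + \<i> * of_real (- (of_int (k j) * \<omega>)) * w j t * A j t) + of_real l * E t * (w j t * A j t))
       = lin_field \<epsilon> (gam \<rho> t) (V t)"
      unfolding vec_eq_iff
    proof
      fix j
      let ?p = "w j t * \<rho> j t"
      have e1: "?p * cnj ?p = \<rho> j t * cnj (\<rho> j t)"
      proof -
        have "?p * cnj ?p = (w j t * cnj (w j t)) * (\<rho> j t * cnj (\<rho> j t))" by simp
        then show ?thesis unfolding cc by simp
      qed
      have e2: "?p\<^sup>2 * cnj (E t * (w j t * A j t)) = E t * (w j t * ((\<rho> j t)\<^sup>2 * cnj (A j t)))"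
      proof -
        have "?p\<^sup>2 * cnj (E t * (w j t * A j t)) = (w j t * cnj (w j t)) * (E t * (w j t * ((\<rho> j t)\<^sup>2 * cnj (A j t))))"
          by (simp add: E power2_eq_square)
        then show ?thesis unfolding cc by simp
      qed
      have e3: "E t * (w i t * A i t) = E t * (w j t * (\<theta> j i t * A i t))" for i unfolding th[of j t i, symmetric] by simp
      have "lin_field \<epsilon> (gam \<rho> t) (V t) $ j = - \<i> * ((1 + 2 * of_real \<epsilon> + 2 * (?p * cnj ?p)) * (E t * (w j t * A j t)) + ?p\<^sup>2 * cnj (E t * (w j t * A j t))
         - of_real \<epsilon> * (E t * (w (j + 1) t * A (j + 1) t) + E t * (w (j - 1) t * A (j - 1) t)))"
        by (simp add: lin_field_def gam_def V_def w_def mult.assoc)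
      also have "\<dots> = - \<i> * ((1 + 2 * of_real \<epsilon> + 2 * (\<rho> j t * cnj (\<rho> j t))) * (E t * (w j t * A j t)) + E t * (w j t * ((\<rho> j t)\<^sup>2 * cnj (A j t)))
         - of_real \<epsilon> * (E t * (w j t * (\<theta> j (j + 1) t * A (j + 1) t)) + E t * (w j t * (\<theta> j (j - 1) t * A (j - 1) t))))"
        unfolding e1 e2 e3[of "j + 1"] e3[of "j - 1"] ..
      finally show "(\<chi> j. E t * (w j t * (- \<i> * linF \<epsilon> \<rho> A (\<lambda>j t. cnj (A j t)) j t - of_real l * A j t) + \<i> * of_real (- (of_int (k j) * \<omega>)) * w j t * A j t) + of_real l * E t * (w j t * A j t)) $ j = lin_field \<epsilon> (gam \<rho> t) (V t) $ j"
        by (simp add: linF_def nbr_def algebra_simps)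
    qed
    ultimately show ?thesis by (rule has_vector_derivative_eq_rhs)
  qed
  define U where "U t = (\<chi> j. c * V (t + \<tau>) $ j)" for t
  have dU: "(U has_vector_derivative lin_field \<epsilon> (?\<gamma> t) (U t)) (at t)" for t
  proof -
    have "(U has_vector_derivative (\<chi> j. c * lin_field \<epsilon> (gam \<rho> (t + \<tau>)) (V (t + \<tau>)) $ j)) (at t)"
      unfolding U_def by (intro chi_vderiv has_vector_derivative_mult_right nth_vderiv shift_vderiv dV)
    moreover have "(\<chi> j. c * lin_field \<epsilon> (gam \<rho> (t + \<tau>)) (V (t + \<tau>)) $ j) = lin_field \<epsilon> (?\<gamma> t) (U t)"
      unfolding vec_eq_iff
    proof
      fix j
      let ?p = "gam \<rho> (t + \<tau>) $ j" and ?q = "\<lambda>j. V (t + \<tau>) $ j"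
      have "lin_field \<epsilon> (?\<gamma> t) (U t) $ j = - \<i> * ((1 + 2 * of_real \<epsilon> + 2 * (c * ?p) * cnj (c * ?p)) * (c * ?q j) + (c * ?p)\<^sup>2 * cnj (c * ?q j) - of_real \<epsilon> * (c * ?q (j + 1) + c * ?q (j - 1)))"
        unfolding tor_flow \<tau>_def[symmetric] c_def[symmetric] by (simp add: lin_field_def U_def)
      also have "\<dots> = - \<i> * ((1 + 2 * of_real \<epsilon> + 2 * (c * cnj c) * (?p * cnj ?p)) * (c * ?q j) + (c * cnj c) * (c * (?p\<^sup>2 * cnj (?q j))) - of_real \<epsilon> * (c * ?q (j + 1) + c * ?q (j - 1)))"
        by (simp add: power2_eq_square)
      finally show "(\<chi> j. c * lin_field \<epsilon> (gam \<rho> (t + \<tau>)) (V (t + \<tau>)) $ j) $ j = lin_field \<epsilon> (?\<gamma> t) (U t) $ j"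
        unfolding cc by (simp add: lin_field_def algebra_simps)
    qed
    ultimately show ?thesis by (rule has_vector_derivative_eq_rhs)
  qed
  have wT: "w j (t + T) = w j t" for j t
  proof -
    have "- (of_int (k j) * \<omega>) * (t + T) = - (of_int (k j) * \<omega>) * t + of_int (- k j) * \<omega> * T" by (simp add: algebra_simps)
    then show ?thesis unfolding w_def by (simp only: cis_mult[symmetric] cis_period[OF \<omega>T]) simp
  qed
  have ET: "E (t + T) = E t * of_real (exp (l * T))" for t by (simp add: E_def distrib_left exp_add)
  have UT: "U (t + T) = exp (l * T) *\<^sub>R U t" for t
  proof -
    have "t + T + \<tau> = (t + \<tau>) + T" by simp
    then show ?thesis unfolding U_def V_def vec_eq_iff vector_scaleR_component vec_lambda_beta
      by (simp only: ET wT per) (simp add: scaleR_conv_of_real mult_ac)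
  qed
  have sol: "solution_of (dnls_field \<epsilon>) ?\<gamma>" by (rule tor_solution[OF o])
  obtain \<Phi> where F: "fundamental_solution (dnls_field \<epsilon>) ?\<gamma> \<Phi>" using fundamental_exists[OF sol] by blast
  have "\<Phi> t (U 0) = U t" for t
    by (rule lin_unique[OF sol _ dU]) (use F in \<open>auto simp: fundamental_solution_def field_deriv\<close>)
  then have FT: "\<Phi> T (U 0) = exp (l * T) *\<^sub>R U 0" using UT[of 0] by simp
  have l0: "lin_field \<epsilon> \<psi> 0 = 0" for \<psi> :: "complex ^ 'a mod_ring" by (simp add: lin_field_def vec_eq_iff)
  have F0: "\<Phi> t 0 = 0" for t
    by (rule lin_unique[OF sol, of "\<lambda>t. \<Phi> t 0" "\<lambda>_. 0"]) (use F in \<open>auto simp: fundamental_solution_def field_deriv l0\<close>)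
  have U0: "U 0 \<noteq> 0"
  proof
    assume z: "U 0 = 0"
    have "U t = 0" for t by (rule lin_unique[OF sol dU, of "\<lambda>_. 0"]) (simp_all add: z l0)
    from this[of "t0 - \<tau>"] have "U (t0 - \<tau>) $ j0 = 0" by simp
    then have "c * (E t0 * (w j0 t0 * A j0 t0)) = 0" by (simp add: U_def V_def)
    then show False using ne by (simp add: c_def E_def w_def)
  qed
  have "complex_eigenvalue (\<Phi> T) (of_real (exp (l * T)))" unfolding complex_eigenvalue_def
    by (rule exI[of _ "U 0"], rule exI[of _ "0"]) (use U0 FT in \<open>simp add: F0\<close>)
  then show ?thesis using F unfolding floquet_multiplier_def by blast
qed

section \<open>Linear instability\<close>

text \<open>What remains of the linearised equation for the remainder \<open>v\<close> after the decoupled linear part has been split off, when the phase modes are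
  \<open>\<alpha> = \<beta> = 0\<close>, \<open>d = 1\<close> and the exponent is the real number \<open>l\<close>.\<close>

definition hl :: "real \<Rightarrow> 'a chain \<Rightarrow> real \<Rightarrow> real \<Rightarrow> complex ^ 'a mod_ring \<Rightarrow> complex ^ 'a mod_ring" where
  "hl \<epsilon> \<rho> l t x = (\<chi> j. (linF \<epsilon> \<rho> (\<lambda>j _. x $ j) (\<lambda>j _. cnj (x $ j)) j t
       - ((of_real (r j))\<^sup>2 * (x $ j + cnj (x $ j)) + (if j \<in> {-1, 0, 1} then 0 else x $ j)))
     - \<i> * of_real l * x $ j + of_real \<epsilon> * resid \<rho> \<sigma> j t + of_real l * of_real (\<sigma> j) * \<rho> j t)"

text \<open>A real perturbation with unit relative phase and growth rate \<open>l\<close>, held by the constant forces \<open>m\<close>.  The bound 1 selects the solution that the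
  contraction finds.\<close>

definition psol :: "real \<Rightarrow> 'a chain \<Rightarrow> real \<Rightarrow> (real \<Rightarrow> complex ^ 'a mod_ring) \<Rightarrow> ('a mod_ring \<Rightarrow> real) \<Rightarrow> bool" where
  "psol \<epsilon> \<rho> l u m \<longleftrightarrow> slv T cc (\<lambda>t. hl \<epsilon> \<rho> l t (u t)) u m \<and> (\<forall>t. norm (u t) \<le> 1)"

lemma psol_period: "psol \<epsilon> \<rho> l u m \<Longrightarrow> u (t + T) = u t" by (simp add: psol_def slv_def)

lemma psol_phase: "psol \<epsilon> \<rho> l u m \<Longrightarrow> j \<in> {-1, 0, 1} \<Longrightarrow> Im (u 0 $ j) = 0"
proof -
  assume p: "psol \<epsilon> \<rho> l u m" and j: "j \<in> {-1, 0, 1}"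
  have "cc j \<noteq> 0" using r_eq_0_iff[of j] j by simp
  then show ?thesis using p unfolding psol_def slv_def by presburger
qed

lemma psol_m: "psol \<epsilon> \<rho> l u m \<Longrightarrow> j \<notin> {-1, 0, 1} \<Longrightarrow> m j = 0"
proof -
  assume p: "psol \<epsilon> \<rho> l u m" and j: "j \<notin> {-1, 0, 1}"
  have "cc j = 0" using r_eq_0_iff[of j] j by simp
  then show ?thesis using p unfolding psol_def slv_def by presburger
qed

lemma psol_lin:
  assumes p: "psol \<epsilon> \<rho> l u m"
  shows "lin_sol \<epsilon> \<rho> (of_real l) (\<lambda>j t. - \<i> * of_real (m j) + 1 * of_real \<epsilon> * resid \<rho> \<sigma> j t - \<i> * of_real l * mF \<epsilon> \<rho> 0 0 1 j t)
      (\<lambda>j t. \<i> * of_real (m j) + 1 * of_real \<epsilon> * cnj (resid \<rho> \<sigma> j t) + \<i> * of_real l * mG \<epsilon> \<rho> 0 0 1 j t) (\<lambda>j t. u t $ j) (\<lambda>j t. cnj (u t $ j))"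
proof -
  let ?H = "\<lambda>j t. - \<i> * of_real (m j) + 1 * of_real \<epsilon> * resid \<rho> \<sigma> j t - \<i> * of_real l * mF \<epsilon> \<rho> 0 0 1 j t"
  let ?F = "\<lambda>j t. u t $ j" and ?G = "\<lambda>j t. cnj (u t $ j)"
  have L: "linF \<epsilon> \<rho> (\<lambda>j _. u t $ j) (\<lambda>j _. cnj (u t $ j)) j t = linF \<epsilon> \<rho> ?F ?G j t" for j t by (simp add: linF_def nbr_def)
  have d: "(?F j has_vector_derivative - \<i> * (linF \<epsilon> \<rho> ?F ?G j t + ?H j t) - of_real l * ?F j t) (at t)" for j t
  proof (cases "j \<in> {-1, 0, 1}")
    case True
    then have "cc j \<noteq> 0" using r_eq_0_iff[of j] by simp
    then have "(?F j has_vector_derivative - \<i> * (of_real (cc j) * (u t $ j + cnj (u t $ j)) + hl \<epsilon> \<rho> l t (u t) $ j) - of_real (m j)) (at t)"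
      using p unfolding psol_def slv_def by presburger
    then show ?thesis by (rule has_vector_derivative_eq_rhs) (use True in \<open>simp add: hl_def L mF_def algebra_simps\<close>)
  next
    case False
    then have "r j = 0" using r_eq_0_iff[of j] by simp
    then have "cc j = 0" by simp
    then have "(?F j has_vector_derivative - \<i> * (u t $ j + hl \<epsilon> \<rho> l t (u t) $ j)) (at t)" "m j = 0"
      using p unfolding psol_def slv_def by presburger+
    note * = this(1) and m = this(2)
    show ?thesis by (rule has_vector_derivative_eq_rhs[OF *]) (use False \<open>r j = 0\<close> m in \<open>simp add: hl_def L mF_def algebra_simps\<close>)
  qed
  show ?thesis unfolding lin_sol_def
  proof (intro allI conjI)
    fix j t
    show "(?F j has_vector_derivative - \<i> * (linF \<epsilon> \<rho> ?F ?G j t + ?H j t) - of_real l * ?F j t) (at t)" by (rule d)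
    show "(?G j has_vector_derivative \<i> * (linG \<epsilon> \<rho> ?F ?G j t + (\<i> * of_real (m j) + 1 * of_real \<epsilon> * cnj (resid \<rho> \<sigma> j t) + \<i> * of_real l * mG \<epsilon> \<rho> 0 0 1 j t)) - of_real l * ?G j t) (at t)"
      by (rule has_vector_derivative_eq_rhs[OF cnj_vderiv[OF d]]) (simp add: linF_def linG_def nbr_def nbr'_def mF_def mG_def algebra_simps)
  qed
qed

lemma hl_cont: assumes "orbit C \<epsilon> \<rho>" "continuous_on UNIV u" shows "continuous_on UNIV (\<lambda>t. hl \<epsilon> \<rho> l t (u t))"
proof -
  have c: "continuous_on UNIV (\<lambda>t. u t $ j)" for j by (intro continuous_intros assms)
  have if': "continuous_on UNIV (\<lambda>t. if b then 0 else u t $ j)" for b j using c by (cases b) simp_all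
  show ?thesis unfolding hl_def linF_def nbr_def resid_def
    by (intro continuous_on_vec_lambda continuous_on_mult continuous_on_diff continuous_on_add continuous_on_power continuous_on_cnj continuous_on_minus continuous_on_const c if' \<theta>_cont orbit_cont[OF assms(1)])
qed

lemma hl_period: "orbit C \<epsilon> \<rho> \<Longrightarrow> hl \<epsilon> \<rho> l (t + T) x = hl \<epsilon> \<rho> l t x"
  by (simp add: hl_def linF_def nbr_def resid_def \<theta>_period orbitD(2))

lemma orbit_norm: "orbit C \<epsilon> \<rho> \<Longrightarrow> C \<ge> 0 \<Longrightarrow> \<epsilon> \<le> 1 \<Longrightarrow> cmod (\<rho> j t) \<le> 1 + 2 * I + C"
proof -
  assume o: "orbit C \<epsilon> \<rho>" and C: "C \<ge> 0" and e: "\<epsilon> \<le> 1"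
  have "cmod (\<rho> j t) \<le> cmod (\<rho> j t - of_real (r j)) + cmod (of_real (r j))" using norm_triangle_ineq[of "\<rho> j t - of_real (r j)" "of_real (r j)"] by simp
  moreover have "C * \<epsilon> \<le> C" using C e by (simp add: mult_left_le)
  moreover have "cmod (of_real (r j)) \<le> 1 + 2 * I" using r_bound(1)[of j] by simp
  ultimately show ?thesis using orbitD(5)[OF o, of j t] by linarith
qed

lemma hl_lip:
  assumes o: "orbit C \<epsilon> \<rho>" and C: "C \<ge> 0" and e: "0 < \<epsilon>" "\<epsilon> \<le> 1" and l: "0 \<le> l"
  shows "norm (hl \<epsilon> \<rho> l t x - hl \<epsilon> \<rho> l t y) \<le> (real CARD('a mod_ring) * ((4 + 6 * (1 + 2 * I + C) * C) * \<epsilon> + l)) * norm (x - y)"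
proof -
  define K where "K = (4 + 6 * (1 + 2 * I + C) * C) * \<epsilon>"
  have "cmod ((hl \<epsilon> \<rho> l t x - hl \<epsilon> \<rho> l t y) $ j) \<le> (K + l) * norm (x - y)" for j
  proof -
    let ?z = "\<lambda>j (_ :: real). (x - y) $ j"
    let ?e = "linF \<epsilon> \<rho> ?z (\<lambda>j t. cnj (?z j t)) j t - ((of_real (r j))\<^sup>2 * (?z j t + cnj (?z j t)) + (if j \<in> {-1, 0, 1} then 0 else ?z j t))"
    have zb: "cmod ((x - y) $ i) \<le> norm (x - y)" for i by (rule Finite_Cartesian_Product.norm_nth_le)
    have b: "cmod ?e \<le> K * norm (x - y)" unfolding K_def
      by (rule frame_error(1)[OF o C e]) (use zb in \<open>auto simp del: vector_minus_component complex_cnj_diff\<close>)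
    have b2: "cmod (\<i> * of_real l * (x - y) $ j) \<le> l * norm (x - y)" unfolding norm_mult using l zb[of j] by (simp add: mult_left_mono)
    have "(hl \<epsilon> \<rho> l t x - hl \<epsilon> \<rho> l t y) $ j = ?e - \<i> * of_real l * (x - y) $ j"
      by (simp add: hl_def linF_def nbr_def algebra_simps)
    then have "cmod ((hl \<epsilon> \<rho> l t x - hl \<epsilon> \<rho> l t y) $ j) \<le> cmod ?e + cmod (\<i> * of_real l * (x - y) $ j)" using norm_triangle_ineq4 by metis
    then show ?thesis using b b2 by (simp add: distrib_right)
  qed
  from vec_norm_le[OF this] show ?thesis by (simp add: K_def mult.assoc)
qed

lemma hl_0:
  assumes o: "orbit C \<epsilon> \<rho>" and C: "C \<ge> 0" and e: "0 < \<epsilon>" "\<epsilon> \<le> 1" and l: "0 \<le> l"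
  shows "norm (hl \<epsilon> \<rho> l t 0) \<le> real CARD('a mod_ring) * ((4 * \<epsilon> + l) * (1 + 2 * I + C))"
proof (rule vec_norm_le)
  fix j
  let ?R = "1 + 2 * I + C"
  note b = orbit_norm[OF o C e(2)]
  have s2: "\<bar>\<sigma> i - \<sigma> j\<bar> \<le> 2" for i j using \<sigma>_bound[of i] \<sigma>_bound[of j] by linarith
  have t: "cmod (\<theta> j i t * \<rho> i t * of_real (\<sigma> j - \<sigma> i)) \<le> ?R * 2" for i
    unfolding norm_mult norm_of_real using b[of i t] s2[of j i] I C by (intro mult_mono) auto
  have "cmod (resid \<rho> \<sigma> j t) \<le> ?R * 2 + ?R * 2"
    unfolding resid_def by (simp only: norm_mult[of \<i>] norm_ii mult_1) (rule norm_triangle_mono[OF t t])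
  then have 1: "cmod (of_real \<epsilon> * resid \<rho> \<sigma> j t) \<le> \<epsilon> * (4 * ?R)" unfolding norm_mult norm_of_real using e by (intro mult_mono) auto
  have 2: "cmod (of_real l * of_real (\<sigma> j) * \<rho> j t) \<le> l * 1 * ?R" unfolding norm_mult norm_of_real
    using \<sigma>_bound[of j] b[of j t] l by (intro mult_mono) auto
  have "hl \<epsilon> \<rho> l t 0 $ j = of_real \<epsilon> * resid \<rho> \<sigma> j t + of_real l * of_real (\<sigma> j) * \<rho> j t" by (simp add: hl_def linF_def nbr_def)
  then have "cmod (hl \<epsilon> \<rho> l t 0 $ j) \<le> \<epsilon> * (4 * ?R) + l * 1 * ?R" using norm_triangle_mono[OF 1 2] by simp
  then show "cmod (hl \<epsilon> \<rho> l t 0 $ j) \<le> (4 * \<epsilon> + l) * ?R" by (simp add: algebra_simps)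
qed

lemma hl_exponent:
  assumes o: "orbit C \<epsilon> \<rho>" and C: "C \<ge> 0" and e: "\<epsilon> \<le> 1" and x: "norm x \<le> 1"
  shows "norm (hl \<epsilon> \<rho> l t x - hl \<epsilon> \<rho> l' t x) \<le> real CARD('a mod_ring) * (\<bar>l - l'\<bar> * (2 + 2 * I + C))"
proof (rule vec_norm_le)
  fix j
  have "cmod (x $ j) \<le> norm x" by (rule Finite_Cartesian_Product.norm_nth_le)
  then have xj: "cmod (- \<i> * x $ j) \<le> 1" using x by (simp add: norm_mult)
  have s: "cmod (of_real (\<sigma> j) * \<rho> j t) \<le> 1 * (1 + 2 * I + C)" unfolding norm_mult norm_of_real
    using \<sigma>_bound[of j] orbit_norm[OF o C e, of j t] by (intro mult_mono) auto
  have "(hl \<epsilon> \<rho> l t x - hl \<epsilon> \<rho> l' t x) $ j = of_real (l - l') * (- \<i> * x $ j + of_real (\<sigma> j) * \<rho> j t)" by (simp add: hl_def algebra_simps)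
  also have "cmod \<dots> \<le> \<bar>l - l'\<bar> * (1 + 1 * (1 + 2 * I + C))" unfolding norm_mult[of "of_real (l - l')"] norm_of_real
    by (rule mult_left_mono[OF norm_triangle_mono[OF xj s]]) simp
  finally show "cmod ((hl \<epsilon> \<rho> l t x - hl \<epsilon> \<rho> l' t x) $ j) \<le> \<bar>l - l'\<bar> * (2 + 2 * I + C)" by (simp add: add.assoc)
qed

definition "lip_const C \<epsilon> l = real CARD('a mod_ring) * ((4 + 6 * (1 + 2 * I + C) * C) * \<epsilon> + l)"

lemma lip_const_nonneg: "C \<ge> 0 \<Longrightarrow> \<epsilon> \<ge> 0 \<Longrightarrow> l \<ge> 0 \<Longrightarrow> lip_const C \<epsilon> l \<ge> 0"
  using I unfolding lip_const_def by (intro mult_nonneg_nonneg add_nonneg_nonneg) auto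

lemma psol_exists:
  assumes o: "orbit C \<epsilon> \<rho>" and C: "C \<ge> 0" and e: "0 < \<epsilon>" "\<epsilon> \<le> 1" and l: "0 \<le> l"
    and small: "slv_const T cc * lip_const C \<epsilon> l \<le> 1/2" "2 * slv_const T cc * (real CARD('a mod_ring) * ((4 * \<epsilon> + l) * (1 + 2 * I + C))) \<le> 1"
  shows "\<exists>u m. psol \<epsilon> \<rho> l u m"
  unfolding psol_def
proof (rule slv_fixpoint[OF T_pos nonres(1)])
  show "norm (hl \<epsilon> \<rho> l t x - hl \<epsilon> \<rho> l t y) \<le> lip_const C \<epsilon> l * norm (x - y)" for t x y unfolding lip_const_def by (rule hl_lip[OF o C e l])
  show "lip_const C \<epsilon> l \<ge> 0" by (rule lip_const_nonneg) (use C e l in auto)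
qed (use hl_cont[OF o] hl_period[OF o] small hl_0[OF o C e l] in auto)

lemma psol_perturb:
  assumes o: "orbit C \<epsilon> \<rho>" and C: "C \<ge> 0" and e: "0 < \<epsilon>" "\<epsilon> \<le> 1" and l: "0 \<le> l"
    and small: "slv_const T cc * lip_const C \<epsilon> l \<le> 1/2" and p: "psol \<epsilon> \<rho> l u m" and p': "psol \<epsilon> \<rho> l' u' m'"
  defines "D \<equiv> real CARD('a mod_ring) * (\<bar>l - l'\<bar> * (2 + 2 * I + C))"
  shows "norm (u t - u' t) \<le> 2 * (slv_const T cc * D)" "\<bar>m j - m' j\<bar> \<le> lip_const C \<epsilon> l * (2 * (slv_const T cc * D)) + D"
proof -
  have cc0: "\<And>j. cc j \<ge> 0" by simp
  have lip: "norm (hl \<epsilon> \<rho> l t x - hl \<epsilon> \<rho> l t y) \<le> lip_const C \<epsilon> l * norm (x - y)" for t x y unfolding lip_const_def by (rule hl_lip[OF o C e l])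
  have q: "lip_const C \<epsilon> l \<ge> 0" by (rule lip_const_nonneg) (use C e l in auto)
  have s: "slv T cc (\<lambda>t. hl \<epsilon> \<rho> l t (u t)) u m" "slv T cc (\<lambda>t. hl \<epsilon> \<rho> l' t (u' t)) u' m'" and b: "\<And>t. norm (u t) \<le> 1" "\<And>t. norm (u' t) \<le> 1"
    using p p' unfolding psol_def by blast+
  note d = hl_exponent[OF o C e(2), folded D_def]
  show "norm (u t - u' t) \<le> 2 * (slv_const T cc * D)"
    by (rule slv_perturb(1)[where n = "hl \<epsilon> \<rho> l" and n' = "hl \<epsilon> \<rho> l'" and R = 1, OF T_pos nonres(1) cc0 s hl_cont[OF o] hl_cont[OF o] b lip q small]) (use d in \<open>auto simp: D_def\<close>)
  show "\<bar>m j - m' j\<bar> \<le> lip_const C \<epsilon> l * (2 * (slv_const T cc * D)) + D"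
    by (rule slv_perturb(2)[where n = "hl \<epsilon> \<rho> l" and n' = "hl \<epsilon> \<rho> l'" and R = 1, OF T_pos nonres(1) cc0 s hl_cont[OF o] hl_cont[OF o] b lip q small]) (use d in \<open>auto simp: D_def\<close>)
qed

lemma \<sigma>_minus: "\<sigma> (- j) = - \<sigma> j"
proof -
  have "- j = 1 \<longleftrightarrow> j = -1" "- j = -1 \<longleftrightarrow> j = 1" "- j = 2 \<longleftrightarrow> j = -2" "- j = -2 \<longleftrightarrow> j = 2" by (metis minus_minus)+
  then show ?thesis unfolding \<sigma>_def using sites_distinct by auto
qed

text \<open>The orbit is even and the relative phase odd, so by uniqueness the perturbation is odd; one force remains.\<close>

lemma psol_antisym:
  assumes s: "s = 1" and o: "orbit C \<epsilon> \<rho>" and C: "C \<ge> 0" and e: "0 < \<epsilon>" "\<epsilon> \<le> 1" and l: "0 \<le> l"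
    and small: "slv_const T cc * lip_const C \<epsilon> l \<le> 1/2" and p: "psol \<epsilon> \<rho> l u m"
  shows "m (- j) = - m j"
proof -
  have th: "\<theta> (- j) (- j + 1) t = \<theta> j (j - 1) t" "\<theta> (- j) (- j - 1) t = \<theta> j (j + 1) t" for j t
    using \<theta>_reflect[of j "j - 1" t] \<theta>_reflect[of j "j + 1" t] by simp_all
  have sg: "\<sigma> (- j + 1) = - \<sigma> (j - 1)" "\<sigma> (- j - 1) = - \<sigma> (j + 1)" for j
    using \<sigma>_minus[of "j - 1"] \<sigma>_minus[of "j + 1"] by simp_all
  have rho: "\<rho> (- j) = \<rho> j" "\<rho> (- j + 1) = \<rho> (j - 1)" "\<rho> (- j - 1) = \<rho> (j + 1)" for j
    using orbitD(4)[OF o s, of j] orbitD(4)[OF o s, of "j - 1"] orbitD(4)[OF o s, of "j + 1"] by simp_all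
  have jm: "- (j + 1) = - j - 1" "- (j - 1) = - j + 1" for j :: "'a mod_ring" by simp_all
  have ex: "- j \<in> {-1, 0, 1} \<longleftrightarrow> j \<in> {-1, 0, 1}" for j :: "'a mod_ring"
  proof -
    have "- j = 1 \<longleftrightarrow> j = -1" "- j = -1 \<longleftrightarrow> j = 1" by (metis minus_minus)+
    then show ?thesis by auto
  qed
  have h: "hl \<epsilon> \<rho> l t (\<chi> j. - (u t $ (- j))) = (\<chi> j. - (hl \<epsilon> \<rho> l t (u t) $ (- j)))" for t
    unfolding vec_eq_iff hl_def vec_lambda_beta linF_def nbr_def resid_def jm th sg rho \<sigma>_minus k_minus r_reflect[OF s] ex
    by (simp add: algebra_simps)
  have "slv T cc (\<lambda>t. - (\<chi> j. hl \<epsilon> \<rho> l t (u t) $ (- j))) (\<lambda>t. - (\<chi> j. u t $ (- j))) (\<lambda>j. - m (- j))"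
    by (rule slv_uminus[OF slv_permute]) (use p r_reflect[OF s] in \<open>auto simp: psol_def\<close>)
  moreover have mv: "- (\<chi> j. f j) = (\<chi> j. - f j)" for f :: "'a mod_ring \<Rightarrow> complex" by (simp add: vec_eq_iff)
  ultimately have s': "slv T cc (\<lambda>t. hl \<epsilon> \<rho> l t (\<chi> j. - (u t $ (- j)))) (\<lambda>t. \<chi> j. - (u t $ (- j))) (\<lambda>j. - m (- j))" by (simp only: mv h)
  have "norm (\<chi> j. - (x $ (- j))) = norm x" for x :: "complex ^ 'a mod_ring"
    unfolding norm_vec_def L2_set_def vec_lambda_beta norm_minus_cancel
    by (rule arg_cong[of _ _ sqrt], rule sum.reindex_bij_witness[of _ uminus uminus]) auto
  then have p': "psol \<epsilon> \<rho> l (\<lambda>t. \<chi> j. - (u t $ (- j))) (\<lambda>j. - m (- j))" using s' p by (simp add: psol_def)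
  have "\<bar>m j - - m (- j)\<bar> \<le> 0" using psol_perturb(2)[OF o C e l small p p', of j] by simp
  then show ?thesis by simp
qed

end

lemma (in mode_seq) phase_flux:
  assumes "\<And>n. \<alpha> n = 0" "\<And>n. \<beta> n = 0" "\<And>n. d n = 1"
  shows "ubig (\<lambda>n t. m n 1 * avg T (\<lambda>t. \<rho> n 1 t + cnj (\<rho> n 1 t)) - (\<kappa> n)\<^sup>2 + of_real (4 * s * I\<^sup>2 / \<omega>\<^sup>2) * (of_real (\<epsilon> n))\<^sup>2) (\<lambda>n. (\<epsilon> n + cmod (\<kappa> n)) ^ 3)"
proof -
  have "\<eta> n * E n = (\<epsilon> n + cmod (\<kappa> n)) ^ 3" for n
    by (simp add: E_def \<eta>_def \<delta>_def c_def assms power3_eq_cube)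
  moreover have "cph n 1 = 1" for n by (simp add: cph_def assms)
  ultimately show ?thesis using flux_balance by (simp add: assms power2_eq_square)
qed

context resonant_chain
begin

text \<open>This is \<open>phase_flux\<close>, made uniform by applying it to a sequence of counterexamples with \<open>\<epsilon> \<longlonglongrightarrow> 0\<close>.\<close>

lemma force_estimate:
  assumes s: "s = 1" and C: "C \<ge> 0" and M: "M \<ge> 0"
  shows "\<exists>\<epsilon>1>0. \<forall>\<epsilon> \<rho> l u m. 0 < \<epsilon> \<and> \<epsilon> < \<epsilon>1 \<and> orbit C \<epsilon> \<rho> \<and> 0 \<le> l \<and> l \<le> M * \<epsilon> \<and> psol \<epsilon> \<rho> l u m \<longrightarrow>
     cmod (of_real (m 1) * avg T (\<lambda>t. \<rho> 1 t + cnj (\<rho> 1 t)) - (of_real l)\<^sup>2 + of_real (4 * I\<^sup>2 / \<omega>\<^sup>2) * (of_real \<epsilon>)\<^sup>2) \<le> (4 * I\<^sup>2 / \<omega>\<^sup>2) / 2 * \<epsilon>\<^sup>2"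
proof (rule ccontr)
  assume neg: "\<not> ?thesis"
  define \<mu> where "\<mu> = 4 * I\<^sup>2 / \<omega>\<^sup>2"
  have mu: "\<mu> > 0" using I \<omega>_pos by (simp add: \<mu>_def)
  define X where "X \<epsilon> \<rho> l m = of_real (m 1) * avg T (\<lambda>t. \<rho> 1 t + cnj (\<rho> 1 t)) - (of_real l)\<^sup>2 + of_real \<mu> * (of_real \<epsilon>)\<^sup>2" for \<epsilon> and \<rho> :: "'a chain" and l and m :: "'a mod_ring \<Rightarrow> real"
  define B where "B \<epsilon> \<rho> l u m \<longleftrightarrow> orbit C \<epsilon> \<rho> \<and> 0 \<le> l \<and> l \<le> M * \<epsilon> \<and> psol \<epsilon> \<rho> l u m \<and> \<mu> / 2 * \<epsilon>\<^sup>2 < cmod (X \<epsilon> \<rho> l m)" for \<epsilon> \<rho> l u m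
  have "\<exists>\<epsilon> \<rho> l u m. 0 < \<epsilon> \<and> \<epsilon> < inverse (real (Suc n)) \<and> B \<epsilon> \<rho> l u m" for n :: nat
  proof -
    have "inverse (real (Suc n)) > 0" by simp
    then show ?thesis using neg unfolding B_def X_def \<mu>_def not_le[symmetric] by blast
  qed
  then obtain \<epsilon> \<rho> l u m where e: "\<And>n. 0 < \<epsilon> n" "\<And>n. \<epsilon> n < inverse (real (Suc n))" and b: "\<And>n. B (\<epsilon> n) (\<rho> n) (l n) (u n) (m n)"
    by metis
  have o: "\<And>n. orbit C (\<epsilon> n) (\<rho> n)" and l: "\<And>n. 0 \<le> l n" "\<And>n. l n \<le> M * \<epsilon> n" and p: "\<And>n. psol (\<epsilon> n) (\<rho> n) (l n) (u n) (m n)"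
    and big: "\<And>n. \<mu> / 2 * (\<epsilon> n)\<^sup>2 < cmod (X (\<epsilon> n) (\<rho> n) (l n) (m n))" using b unfolding B_def by blast+
  have el: "\<epsilon> \<longlonglongrightarrow> 0"
    by (rule tendsto_sandwich[OF _ _ tendsto_const LIMSEQ_inverse_real_of_nat]) (auto intro!: eventuallyI less_imp_le e simp del: of_nat_Suc)
  have "l \<longlonglongrightarrow> 0" by (rule tendsto_sandwich[OF _ _ tendsto_const tendsto_mult_right_zero[OF el, of M]]) (use l in auto)
  from tendsto_add[OF el this] have lim: "(\<lambda>n. \<epsilon> n + cmod (of_real (l n))) \<longlonglongrightarrow> 0" using l(1) by simp
  have ms: "mode_seq I \<omega> T s r k C \<epsilon> (\<lambda>n. of_real (l n)) \<rho> (\<lambda>_. 0) (\<lambda>_. 0) (\<lambda>_. 1) (\<lambda>n j. of_real (m n j)) (\<lambda>n j t. u n t $ j) (\<lambda>n j t. cnj (u n t $ j))"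
    by unfold_locales (use C e(1) lim o psol_period[OF p] psol_phase[OF p] psol_m[OF p] psol_lin[OF p] in \<open>auto simp: complex_eq_iff\<close>)
  have "ubig (\<lambda>n t. X (\<epsilon> n) (\<rho> n) (l n) (m n)) (\<lambda>n. (\<epsilon> n + cmod (of_real (l n))) ^ 3)"
    using mode_seq.phase_flux[OF ms] unfolding X_def \<mu>_def s by simp
  then obtain K where K: "K \<ge> 0" "\<forall>\<^sub>F n in sequentially. \<forall>t :: real. cmod (X (\<epsilon> n) (\<rho> n) (l n) (m n)) \<le> K * (\<epsilon> n + cmod (of_real (l n))) ^ 3"
    unfolding ubig_def by blast
  have sm: "\<forall>\<^sub>F n in sequentially. (K * (1 + M) ^ 3) * \<epsilon> n < \<mu> / 2"
    by (rule order_tendstoD(2)[OF tendsto_mult_right_zero[OF el]]) (use mu in simp)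
  have "\<forall>\<^sub>F n in sequentially. False"
    using K(2) sm
  proof eventually_elim
    case (elim n)
    have "\<epsilon> n + cmod (of_real (l n)) \<le> (1 + M) * \<epsilon> n" using l[of n] by (simp add: distrib_right)
    then have "(\<epsilon> n + cmod (of_real (l n))) ^ 3 \<le> ((1 + M) * \<epsilon> n) ^ 3" using e(1)[of n] by (intro power_mono) auto
    then have "K * (\<epsilon> n + cmod (of_real (l n))) ^ 3 \<le> K * ((1 + M) * \<epsilon> n) ^ 3" using K(1) by (rule mult_left_mono)
    also have "\<dots> = ((K * (1 + M) ^ 3) * \<epsilon> n) * (\<epsilon> n)\<^sup>2" by (simp add: power_mult_distrib power3_eq_cube[of "\<epsilon> n"] power2_eq_square)
    also have "\<dots> \<le> \<mu> / 2 * (\<epsilon> n)\<^sup>2" using elim(2) by (intro mult_right_mono) auto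
    finally show False using big[of n] elim(1) by (meson not_le order_trans)
  qed
  then show False by simp
qed

text \<open>The force needed to hold the relative phase has opposite signs at \<open>l = 0\<close>, where the interaction alone acts, and at
  \<open>l = 2 (2 I / \<omega>) \<epsilon>\<close>, where inertia dominates.  At the zero in between no force is needed.\<close>

lemma growing_mode:
  assumes s: "s = 1" and C: "C \<ge> 0"
  shows "\<exists>\<epsilon>1>0. \<forall>\<epsilon> \<rho>. 0 < \<epsilon> \<and> \<epsilon> < \<epsilon>1 \<and> orbit C \<epsilon> \<rho> \<longrightarrow> (\<exists>l>0. \<exists>u. psol \<epsilon> \<rho> l u (\<lambda>_. 0))"
proof -
  define \<mu> where "\<mu> = 4 * I\<^sup>2 / \<omega>\<^sup>2"
  have mu: "\<mu> > 0" using I \<omega>_pos by (simp add: \<mu>_def)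
  \<comment> \<open>\<open>M * \<epsilon>\<close> is twice the predicted rate\<close>
  define M where "M = 2 * sqrt \<mu>"
  have M: "M > 0" "M\<^sup>2 = 4 * \<mu>" using mu by (simp_all add: M_def power_mult_distrib)
  obtain \<epsilon>a where ea: "\<epsilon>a > 0" "\<forall>\<epsilon> \<rho> l u m. 0 < \<epsilon> \<and> \<epsilon> < \<epsilon>a \<and> orbit C \<epsilon> \<rho> \<and> 0 \<le> l \<and> l \<le> M * \<epsilon> \<and> psol \<epsilon> \<rho> l u m \<longrightarrow>
     cmod (of_real (m 1) * avg T (\<lambda>t. \<rho> 1 t + cnj (\<rho> 1 t)) - (of_real l)\<^sup>2 + of_real \<mu> * (of_real \<epsilon>)\<^sup>2) \<le> \<mu> / 2 * \<epsilon>\<^sup>2"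
    using force_estimate[OF s C less_imp_le[OF M(1)]] unfolding \<mu>_def by blast
  define n where "n = real CARD('a mod_ring)"
  define S where "S = slv_const T cc"
  have S: "S \<ge> 0" unfolding S_def by (rule slv_const_nonneg[OF T_pos]) simp
  have n: "n \<ge> 0" by (simp add: n_def)
  define A where "A = S * (n * ((4 + 6 * (1 + 2 * I + C) * C) + M))"
  define B where "B = 2 * S * (n * ((4 + M) * (1 + 2 * I + C)))"
  have AB: "A \<ge> 0" "B \<ge> 0" using S n I C M by (simp_all add: A_def B_def)
  define \<epsilon>1 where "\<epsilon>1 = min (min \<epsilon>a 1) (1 / (2 * A + B + 1))"
  have e1: "\<epsilon>1 > 0" using ea(1) AB by (simp add: \<epsilon>1_def add_nonneg_pos)
  have "\<exists>l>0. \<exists>u. psol \<epsilon> \<rho> l u (\<lambda>_. 0)" if e: "0 < \<epsilon>" "\<epsilon> < \<epsilon>1" and o: "orbit C \<epsilon> \<rho>" for \<epsilon> \<rho>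
  proof -
    have e': "\<epsilon> \<le> 1" "\<epsilon> < \<epsilon>a" using e by (simp_all add: \<epsilon>1_def)
    have "\<epsilon> < 1 / (2 * A + B + 1)" using e by (simp add: \<epsilon>1_def)
    then have small: "\<epsilon> * (2 * A + B + 1) < 1" using AB by (subst (asm) pos_less_divide_eq) auto
    have sA: "2 * (A * \<epsilon>) \<le> 1" "B * \<epsilon> \<le> 1"
    proof -
      have "0 \<le> A * \<epsilon>" "0 \<le> B * \<epsilon>" using AB e by simp_all
      then show "2 * (A * \<epsilon>) \<le> 1" "B * \<epsilon> \<le> 1" using small e(1) by (simp_all add: algebra_simps)
    qed
    have sm1: "S * lip_const C \<epsilon> l \<le> 1/2" and sm2: "2 * S * (n * ((4 * \<epsilon> + l) * (1 + 2 * I + C))) \<le> 1" if l: "0 \<le> l" "l \<le> M * \<epsilon>" for l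
    proof -
      have "S * (n * ((4 + 6 * (1 + 2 * I + C) * C) * \<epsilon> + l)) \<le> S * (n * ((4 + 6 * (1 + 2 * I + C) * C) * \<epsilon> + M * \<epsilon>))"
        using l S n by (intro mult_left_mono add_left_mono) auto
      also have "\<dots> = A * \<epsilon>" by (simp add: A_def algebra_simps)
      finally show "S * lip_const C \<epsilon> l \<le> 1/2" using sA(1) unfolding lip_const_def n_def by simp
      have "2 * S * (n * ((4 * \<epsilon> + l) * (1 + 2 * I + C))) \<le> 2 * S * (n * ((4 * \<epsilon> + M * \<epsilon>) * (1 + 2 * I + C)))"
        using l S n I C by (intro mult_left_mono mult_right_mono add_left_mono) auto
      also have "\<dots> = B * \<epsilon>" by (simp add: B_def algebra_simps)
      finally show "2 * S * (n * ((4 * \<epsilon> + l) * (1 + 2 * I + C))) \<le> 1" using sA(2) by simp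
    qed
    have "\<forall>l. \<exists>um. 0 \<le> l \<and> l \<le> M * \<epsilon> \<longrightarrow> psol \<epsilon> \<rho> l (fst um) (snd um)"
    proof
      fix l
      show "\<exists>um. 0 \<le> l \<and> l \<le> M * \<epsilon> \<longrightarrow> psol \<epsilon> \<rho> l (fst um) (snd um)"
      proof (cases "0 \<le> l \<and> l \<le> M * \<epsilon>")
        case True
        then obtain u m where "psol \<epsilon> \<rho> l u m" using psol_exists[OF o C e(1) e'(1) _ sm1[unfolded S_def] sm2[unfolded S_def n_def], of l] by blast
        then show ?thesis by (intro exI[of _ "(u, m)"]) simp
      qed auto
    qed
    from choice[OF this] obtain um where um: "\<forall>l. 0 \<le> l \<and> l \<le> M * \<epsilon> \<longrightarrow> psol \<epsilon> \<rho> l (fst (um l)) (snd (um l))" ..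
    define u where "u l = fst (um l)" for l
    define m where "m l = snd (um l)" for l
    have p: "psol \<epsilon> \<rho> l (u l) (m l)" if "0 \<le> l" "l \<le> M * \<epsilon>" for l using um that by (simp add: u_def m_def)
    let ?b = "M * \<epsilon>"
    have b0: "0 \<le> ?b" using M(1) e(1) by simp
    define L where "L = n * (2 + 2 * I + C)"
    have L0: "L \<ge> 0" using n I C by (simp add: L_def)
    define Q where "Q = lip_const C \<epsilon> ?b * (2 * (S * L)) + L"
    have cont: "continuous_on {0..?b} (\<lambda>l. m l 1)"
    proof (rule continuous_onI)
      fix l and x :: real assume l: "l \<in> {0..?b}" and x: "x > 0"
      have Q0: "Q \<ge> 0" unfolding Q_def using lip_const_nonneg[OF C, of \<epsilon> ?b] e(1) b0 S L0 by simp
      show "\<exists>d>0. \<forall>l'\<in>{0..?b}. dist l' l < d \<longrightarrow> dist (m l' 1) (m l 1) \<le> x"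
      proof (intro exI[of _ "x / (Q + 1)"] conjI ballI impI)
        show "x / (Q + 1) > 0" using x Q0 by simp
        fix l' assume l': "l' \<in> {0..?b}" and d: "dist l' l < x / (Q + 1)"
        have l0': "0 \<le> l'" "l' \<le> ?b" and l0: "0 \<le> l" "l \<le> ?b" using l l' by auto
        let ?D = "n * (\<bar>l' - l\<bar> * (2 + 2 * I + C))"
        have D: "?D = L * \<bar>l' - l\<bar>" by (simp add: L_def)
        have "\<bar>m l' 1 - m l 1\<bar> \<le> lip_const C \<epsilon> l' * (2 * (S * ?D)) + ?D"
          unfolding n_def S_def by (rule psol_perturb(2)[OF o C e(1) e'(1) l0'(1) sm1[OF l0', unfolded S_def] p[OF l0'] p[OF l0]])
        also have "\<dots> \<le> lip_const C \<epsilon> ?b * (2 * (S * ?D)) + ?D"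
        proof -
          have "lip_const C \<epsilon> l' \<le> lip_const C \<epsilon> ?b" unfolding lip_const_def using l0'(2) by (intro mult_left_mono) auto
          then show ?thesis using S L0 unfolding D by (intro add_right_mono mult_right_mono) auto
        qed
        also have "\<dots> = Q * \<bar>l' - l\<bar>" unfolding D Q_def by (simp add: algebra_simps)
        also have "\<dots> \<le> (Q + 1) * \<bar>l' - l\<bar>" by (intro mult_right_mono) auto
        also have "\<dots> \<le> x" using d Q0 by (simp add: dist_real_def field_simps)
        finally show "dist (m l' 1) (m l 1) \<le> x" by (simp add: dist_real_def)
      qed
    qed
    define a where "a = Re (avg T (\<lambda>t. \<rho> 1 t + cnj (\<rho> 1 t)))"
    have est: "\<bar>m l 1 * a - l\<^sup>2 + \<mu> * \<epsilon>\<^sup>2\<bar> \<le> \<mu> / 2 * \<epsilon>\<^sup>2" if l: "0 \<le> l" "l \<le> ?b" for l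
    proof -
      let ?X = "of_real (m l 1) * avg T (\<lambda>t. \<rho> 1 t + cnj (\<rho> 1 t)) - (of_real l)\<^sup>2 + of_real \<mu> * (of_real \<epsilon>)\<^sup>2"
      have R: "Re ?X = m l 1 * a - l\<^sup>2 + \<mu> * \<epsilon>\<^sup>2" by (simp add: a_def power2_eq_square)
      have "cmod ?X \<le> \<mu> / 2 * \<epsilon>\<^sup>2" using ea(2) e(1) e'(2) o l p[OF l] by blast
      from order_trans[OF abs_Re_le_cmod this] show ?thesis unfolding R .
    qed
    have mue: "\<mu> * \<epsilon>\<^sup>2 > 0" using mu e(1) by simp
    have sgn: "x < 0" if "\<bar>x - 0 + y\<bar> \<le> y / 2" "0 < y" for x y :: real using that by linarith
    have sgn': "x > 0" if "\<bar>x - 4 * y + y\<bar> \<le> y / 2" "0 < y" for x y :: real using that by linarith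
    have f0: "m 0 1 * a < 0" by (rule sgn[OF _ mue]) (use est[of 0] b0 in simp)
    have fb: "m ?b 1 * a > 0"
    proof -
      have sq: "?b\<^sup>2 = 4 * (\<mu> * \<epsilon>\<^sup>2)" by (simp add: power_mult_distrib M(2))
      show ?thesis by (rule sgn'[OF _ mue]) (use est[OF b0 order_refl] in \<open>simp only: sq times_divide_eq_left\<close>)
    qed
    have "\<exists>l\<ge>0. l \<le> ?b \<and> m l 1 * a = 0"
      by (rule IVT'[of "\<lambda>l. m l 1 * a"]) (use f0 fb b0 in \<open>auto intro!: continuous_intros cont\<close>)
    then obtain l where l: "0 \<le> l" "l \<le> ?b" "m l 1 * a = 0" by blast
    have "a \<noteq> 0" using f0 by auto
    then have m1: "m l 1 = 0" using l(3) by simp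
    have "l \<noteq> 0" using f0 l(3) by auto
    then have lp: "l > 0" using l(1) by simp
    note anti = psol_antisym[OF s o C e(1) e'(1) l(1) sm1[OF l(1,2), unfolded S_def] p[OF l(1,2)]]
    have "m l j = 0" for j
    proof (cases "j \<in> {-1, 0, 1}")
      case True
      then show ?thesis using anti[of 1] anti[of 0] m1 by auto
    next
      case False then show ?thesis by (rule psol_m[OF p[OF l(1,2)]])
    qed
    then have "m l = (\<lambda>_. 0)" by (simp add: fun_eq_iff)
    then have "psol \<epsilon> \<rho> l (u l) (\<lambda>_. 0)" using p[OF l(1,2)] by simp
    then show ?thesis using lp by blast
  qed
  then show ?thesis using e1 by blast
qed

lemma torus_unstable:
  assumes s: "s = 1" and C: "C \<ge> 0"
  shows "\<exists>\<epsilon>1>0. \<forall>\<epsilon> \<rho>. 0 < \<epsilon> \<and> \<epsilon> < \<epsilon>1 \<and> orbit C \<epsilon> \<rho> \<longrightarrow> linearly_unstable (dnls_field \<epsilon>) T (range (tor \<rho>))"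
proof -
  obtain \<epsilon>a where ea: "\<epsilon>a > 0" "\<forall>\<epsilon> \<rho>. 0 < \<epsilon> \<and> \<epsilon> < \<epsilon>a \<and> orbit C \<epsilon> \<rho> \<longrightarrow> (\<exists>l>0. \<exists>u. psol \<epsilon> \<rho> l u (\<lambda>_. 0))" using growing_mode[OF s C] by blast
  define \<epsilon>1 where "\<epsilon>1 = min \<epsilon>a (sqrt I / (C + 1))"
  have e1: "\<epsilon>1 > 0" using ea(1) I C by (simp add: \<epsilon>1_def)
  have "linearly_unstable (dnls_field \<epsilon>) T (range (tor \<rho>))" if e: "0 < \<epsilon>" "\<epsilon> < \<epsilon>1" and o: "orbit C \<epsilon> \<rho>" for \<epsilon> \<rho>
  proof -
    obtain l u where l: "l > 0" and p: "psol \<epsilon> \<rho> l u (\<lambda>_. 0)" using ea(2)[rule_format, of \<epsilon> \<rho>] e o unfolding \<epsilon>1_def by auto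
    define A where "A j t = u t $ j - (- 1) * (\<i> * of_real (\<sigma> j) * \<rho> j t)" for j t
    define B where "B j t = cnj (u t $ j) - (- 1) * (- \<i> * of_real (\<sigma> j) * cnj (\<rho> j t))" for j t
    have B: "B = (\<lambda>j t. cnj (A j t))" by (simp add: A_def B_def fun_eq_iff)
    have dA: "(A j has_vector_derivative - \<i> * linF \<epsilon> \<rho> A (\<lambda>j t. cnj (A j t)) j t - of_real l * A j t) (at t)" for j t
    proof -
      have "lin_sol \<epsilon> \<rho> (of_real l) (\<lambda>j t. (- \<i> * of_real 0 + 1 * of_real \<epsilon> * resid \<rho> \<sigma> j t - \<i> * of_real l * mF \<epsilon> \<rho> 0 0 1 j t) - (- 1) * (- of_real \<epsilon> * resid \<rho> \<sigma> j t + \<i> * of_real l * (\<i> * of_real (\<sigma> j) * \<rho> j t)))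
        (\<lambda>j t. (\<i> * of_real 0 + 1 * of_real \<epsilon> * cnj (resid \<rho> \<sigma> j t) + \<i> * of_real l * mG \<epsilon> \<rho> 0 0 1 j t) - (- 1) * (- of_real \<epsilon> * cnj (resid \<rho> \<sigma> j t) - \<i> * of_real l * (- \<i> * of_real (\<sigma> j) * cnj (\<rho> j t)))) A B"
        unfolding A_def[abs_def] B_def[abs_def] by (rule lin_sol_comb[OF psol_lin[OF p] lin_sol_exponent[OF partial_gauge[OF o]]])
      from lin_solD(1)[OF this, of j t] show ?thesis
        unfolding B by (rule has_vector_derivative_eq_rhs) (simp add: mF_def)
    qed
    have perA: "A j (t + T) = A j t" for j t by (simp add: A_def psol_period[OF p] orbitD(2)[OF o])
    have ne: "A 1 0 \<noteq> 0"
    proof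
      assume "A 1 0 = 0"
      then have "Im (A 1 0) = 0" by simp
      then have "Re (\<rho> 1 0) = 0" using psol_phase[OF p, of 1] by (simp add: A_def)
      then have "Re (\<rho> 1 0 - of_real (r 1)) = - sqrt I" using s by simp
      then have "sqrt I \<le> cmod (\<rho> 1 0 - of_real (r 1))" using abs_Re_le_cmod[of "\<rho> 1 0 - of_real (r 1)"] I by simp
      also have "\<dots> \<le> C * \<epsilon>" by (rule orbitD(5)[OF o])
      also have "\<dots> \<le> \<epsilon> * (C + 1)" using e(1) by (simp add: algebra_simps)
      also have "\<dots> < sqrt I" using e(2) C by (simp add: \<epsilon>1_def pos_less_divide_eq)
      finally show False by simp
    qed
    show ?thesis unfolding linearly_unstable_def
    proof (intro allI impI; elim conjE)
      fix \<gamma> assume g: "periodic_orbit (dnls_field \<epsilon>) T \<gamma>" "range \<gamma> \<subseteq> range (tor \<rho>)"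
      obtain a b where \<gamma>: "\<gamma> = (\<lambda>t. tor \<rho> (a + \<omega> * t, b + 2 * \<omega> * t))" by (rule torus_orbit[OF o g])
      have "floquet_multiplier (dnls_field \<epsilon>) T \<gamma> (of_real (exp (l * T)))" unfolding \<gamma> by (rule growing_multiplier[OF o dA perA ne])
      moreover have "cmod (of_real (exp (l * T))) > 1" using l T_pos by simp
      ultimately show "\<exists>\<mu>. floquet_multiplier (dnls_field \<epsilon>) T \<gamma> \<mu> \<and> cmod \<mu> > 1" by blast
    qed
  qed
  then show ?thesis using e1 by blast
qed

lemma torus_family:
  "\<exists>\<T>. (\<exists>\<epsilon>\<^sub>0>0. \<forall>\<epsilon>. 0 < \<epsilon> \<and> \<epsilon> < \<epsilon>\<^sub>0 \<longrightarrow> torus2 (\<T> \<epsilon>) \<and> invariant_under (dnls_field \<epsilon>) (\<T> \<epsilon>) \<and>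
        foliated_by_periodic_orbits (dnls_field \<epsilon>) T (\<T> \<epsilon>)) \<and>
     ((\<lambda>\<epsilon>. hausdorff_distance (\<T> \<epsilon>) (range (tor (\<lambda>j t. of_real (r j))))) \<longlongrightarrow> 0) (at_right 0) \<and>
     (s = 1 \<longrightarrow> (\<forall>\<^sub>F \<epsilon> in at_right 0. linearly_unstable (dnls_field \<epsilon>) T (\<T> \<epsilon>))) \<and>
     (s = -1 \<longrightarrow> (\<forall>\<^sub>F \<epsilon> in at_right 0. linearly_stable (dnls_field \<epsilon>) T (\<T> \<epsilon>)))"
proof -
  obtain C \<epsilon>0 where C: "C > 0" and e0: "\<epsilon>0 > 0" and ex: "\<forall>\<epsilon>. 0 < \<epsilon> \<and> \<epsilon> < \<epsilon>0 \<longrightarrow> (\<exists>\<rho>. orbit C \<epsilon> \<rho>)" using orbit_exists by blast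
  obtain \<delta>0 where d0: "\<delta>0 > 0" "\<forall>\<delta>. 0 \<le> \<delta> \<and> \<delta> < \<delta>0 \<longrightarrow> small \<delta>" using small_eventually by blast
  define \<rho> where "\<rho> \<epsilon> = (SOME \<rho>. orbit C \<epsilon> \<rho>)" for \<epsilon>
  have o: "orbit C \<epsilon> (\<rho> \<epsilon>)" if "0 < \<epsilon>" "\<epsilon> < \<epsilon>0" for \<epsilon>
  proof -
    have "\<exists>\<rho>. orbit C \<epsilon> \<rho>" using ex that by simp
    from someI_ex[OF this] show ?thesis unfolding \<rho>_def .
  qed
  have ev: "\<forall>\<^sub>F \<epsilon> in at_right 0. 0 < \<epsilon> \<and> \<epsilon> < e" if "e > 0" for e :: real
    using that unfolding eventually_at_right_field by (intro exI[of _ e]) auto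
  show ?thesis
  proof (intro exI[of _ "\<lambda>\<epsilon>. range (tor (\<rho> \<epsilon>))"] conjI impI)
    show "\<exists>\<epsilon>\<^sub>0>0. \<forall>\<epsilon>. 0 < \<epsilon> \<and> \<epsilon> < \<epsilon>\<^sub>0 \<longrightarrow> torus2 (range (tor (\<rho> \<epsilon>))) \<and> invariant_under (dnls_field \<epsilon>) (range (tor (\<rho> \<epsilon>))) \<and>
        foliated_by_periodic_orbits (dnls_field \<epsilon>) T (range (tor (\<rho> \<epsilon>)))"
    proof (intro exI[of _ "min \<epsilon>0 (\<delta>0 / C)"] conjI allI impI)
      show "0 < min \<epsilon>0 (\<delta>0 / C)" using e0 d0 C by simp
      fix \<epsilon> assume e: "0 < \<epsilon> \<and> \<epsilon> < min \<epsilon>0 (\<delta>0 / C)"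
      then have oe: "orbit C \<epsilon> (\<rho> \<epsilon>)" by (intro o) auto
      have "C * \<epsilon> < \<delta>0" using e C by (simp add: field_simps)
      then have sm: "small (C * \<epsilon>)" using d0(2) e C by simp
      show "torus2 (range (tor (\<rho> \<epsilon>)))" by (rule tor_torus2[OF oe sm])
      show "invariant_under (dnls_field \<epsilon>) (range (tor (\<rho> \<epsilon>)))" by (rule tor_invariant[OF oe])
      show "foliated_by_periodic_orbits (dnls_field \<epsilon>) T (range (tor (\<rho> \<epsilon>)))" by (rule tor_foliated[OF oe sm])
    qed
    let ?h = "\<lambda>\<epsilon>. hausdorff_distance (range (tor (\<rho> \<epsilon>))) (range (tor (\<lambda>j t. of_real (r j))))"
    let ?b = "\<lambda>\<epsilon>. real CARD('a mod_ring) * (C * \<epsilon>)"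
    show "(?h \<longlongrightarrow> 0) (at_right 0)"
    proof (rule tendsto_sandwich[of "\<lambda>_. 0" ?h _ ?b])
      have h: "0 \<le> ?h \<epsilon> \<and> ?h \<epsilon> \<le> ?b \<epsilon>" if e: "0 < \<epsilon> \<and> \<epsilon> < \<epsilon>0" for \<epsilon>
      proof -
        have oe: "orbit C \<epsilon> (\<rho> \<epsilon>)" using e by (intro o) auto
        have d: "dist (tor (\<rho> \<epsilon>) p) (tor (\<lambda>j t. of_real (r j)) p) \<le> ?b \<epsilon>" for p by (rule tor_dist[OF oe])
        show ?thesis by (intro conjI hausdorff_le(1)[OF d] hausdorff_le(2)[OF d])
      qed
      show "\<forall>\<^sub>F \<epsilon> in at_right 0. 0 \<le> ?h \<epsilon>" "\<forall>\<^sub>F \<epsilon> in at_right 0. ?h \<epsilon> \<le> ?b \<epsilon>"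
        by (rule eventually_mono[OF ev[OF e0]], rule conjunct1[OF h] conjunct2[OF h], assumption)+
      have "(?b \<longlongrightarrow> real CARD('a mod_ring) * (C * 0)) (at_right 0)" by (intro tendsto_intros)
      then show "(?b \<longlongrightarrow> 0) (at_right 0)" by simp
    qed simp
  next
    assume "s = 1"
    then obtain \<epsilon>1 where e1: "\<epsilon>1 > 0" "\<forall>\<epsilon> \<rho>. 0 < \<epsilon> \<and> \<epsilon> < \<epsilon>1 \<and> orbit C \<epsilon> \<rho> \<longrightarrow> linearly_unstable (dnls_field \<epsilon>) T (range (tor \<rho>))"
      using torus_unstable[OF _ less_imp_le[OF C]] by blast
    show "\<forall>\<^sub>F \<epsilon> in at_right 0. linearly_unstable (dnls_field \<epsilon>) T (range (tor (\<rho> \<epsilon>)))"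
      using ev[OF e0] ev[OF e1(1)] by eventually_elim (use e1(2) o in blast)
  next
    assume "s = -1"
    then obtain \<epsilon>1 where e1: "\<epsilon>1 > 0" "\<forall>\<epsilon> \<rho>. 0 < \<epsilon> \<and> \<epsilon> < \<epsilon>1 \<and> orbit C \<epsilon> \<rho> \<longrightarrow> linearly_stable (dnls_field \<epsilon>) T (range (tor \<rho>))"
      using torus_stable[OF _ less_imp_le[OF C]] by blast
    show "\<forall>\<^sub>F \<epsilon> in at_right 0. linearly_stable (dnls_field \<epsilon>) T (range (tor (\<rho> \<epsilon>)))"
      using ev[OF e0] ev[OF e1(1)] by eventually_elim (use e1(2) o in blast)
  qed
qed

end

theorem mainTheorem7:
  fixes N :: nat and I \<omega> T :: real
  assumes "6 \<le> N" and "N \<le> 10"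
    and "CARD('a::nontriv) = 2 * N + 1"
    and "I > 0" and "\<omega> = 1 + I" and "T = 2 * pi / \<omega>"
    and "\<forall>k::int. k \<noteq> 0 \<longrightarrow>
           of_int k * \<omega> + 1 \<noteq> 0 \<and> of_int k * \<omega> - 1 \<noteq> 0 \<and>
           of_int k * \<omega> + 2 \<noteq> 0 \<and> of_int k * \<omega> - 2 \<noteq> 0"
  shows "\<exists>\<T> :: real \<Rightarrow> real \<Rightarrow> (complex ^ 'a mod_ring) set.
     (\<forall>q\<in>{0, pi}.
        (\<exists>\<epsilon>\<^sub>0>0. \<forall>\<epsilon>. 0 < \<epsilon> \<and> \<epsilon> < \<epsilon>\<^sub>0 \<longrightarrow>
           torus2 (\<T> q \<epsilon>) \<and> invariant_under (dnls_field \<epsilon>) (\<T> q \<epsilon>) \<and>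
           foliated_by_periodic_orbits (dnls_field \<epsilon>) T (\<T> q \<epsilon>)) \<and>
        ((\<lambda>\<epsilon>. hausdorff_distance (\<T> q \<epsilon>) (unperturbed_torus I q)) \<longlongrightarrow> 0) (at_right 0)) \<and>
     (\<forall>\<^sub>F \<epsilon> in at_right 0. linearly_unstable (dnls_field \<epsilon>) T (\<T> 0 \<epsilon>)) \<and>
     (\<forall>\<^sub>F \<epsilon> in at_right 0. linearly_stable (dnls_field \<epsilon>) T (\<T> pi \<epsilon>))"
proof -
  have w: "\<omega> > 0" using assms(4,5) by simp
  have T: "T * \<omega> = 2 * pi" using assms(6) w by simp
  have int: "T \<noteq> 2 * pi * of_int k" "2 * T \<noteq> 2 * pi * of_int k" for k :: int
  proof -
    show "T \<noteq> 2 * pi * of_int k"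
    proof
      assume t: "T = 2 * pi * of_int k"
      then have "2 * pi * (of_int k * \<omega>) = 2 * pi * 1" using T by (simp add: mult_ac)
      then have k: "of_int k * \<omega> = 1" by (subst (asm) mult_cancel_left) simp
      then have "k \<noteq> 0" by auto
      then show False using assms(7) k by auto
    qed
    show "2 * T \<noteq> 2 * pi * of_int k"
    proof
      assume t: "2 * T = 2 * pi * of_int k"
      have "2 * pi * (of_int k * \<omega>) = 2 * T * \<omega>" unfolding t by simp
      also have "\<dots> = 2 * pi * 2" using T by simp
      finally have k: "of_int k * \<omega> = 2" by (subst (asm) mult_cancel_left) simp
      then have "k \<noteq> 0" by auto
      then show False using assms(7) k by auto
    qed
  qed
  have nonres: "cis T \<noteq> 1" "cis (2 * T) \<noteq> 1"
    using cis_eq_cis[of T 0] cis_eq_cis[of "2 * T" 0] int by auto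
  define r where "r s = (\<lambda>j :: 'a mod_ring. if j = 0 then sqrt (1 + 2 * I) else if j = 1 then s * sqrt I else if j = -1 then sqrt I else 0)" for s
  define k where "k = (\<lambda>j :: 'a mod_ring. if j = 0 then 2 else if j = 1 \<or> j = -1 then 1 else 0 :: int)"
  have rc: "resonant_chain I \<omega> T s (r s) k" if "s = 1 \<or> s = -1" for s
    by unfold_locales (use assms nonres that in \<open>simp_all add: r_def k_def\<close>)
  have rc1: "resonant_chain I \<omega> T 1 (r 1) k" and rcm: "resonant_chain I \<omega> T (-1) (r (-1)) k" by (rule rc, simp)+
  note f1 = resonant_chain.torus_family[OF rc1, folded resonant_chain.unperturbed_torus_eq[OF rc1, of 0, simplified]]
  note fm = resonant_chain.torus_family[OF rcm, folded resonant_chain.unperturbed_torus_eq[OF rcm, of pi, simplified]]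
  obtain \<T>1 where t1: "\<exists>\<epsilon>\<^sub>0>0. \<forall>\<epsilon>. 0 < \<epsilon> \<and> \<epsilon> < \<epsilon>\<^sub>0 \<longrightarrow> torus2 (\<T>1 \<epsilon>) \<and> invariant_under (dnls_field \<epsilon>) (\<T>1 \<epsilon>) \<and> foliated_by_periodic_orbits (dnls_field \<epsilon>) T (\<T>1 \<epsilon>)"
      "((\<lambda>\<epsilon>. hausdorff_distance (\<T>1 \<epsilon>) (unperturbed_torus I 0 :: (complex ^ 'a mod_ring) set)) \<longlongrightarrow> 0) (at_right 0)"
      "\<forall>\<^sub>F \<epsilon> in at_right 0. linearly_unstable (dnls_field \<epsilon>) T (\<T>1 \<epsilon>)"
    using f1 by auto
  obtain \<T>m where tm: "\<exists>\<epsilon>\<^sub>0>0. \<forall>\<epsilon>. 0 < \<epsilon> \<and> \<epsilon> < \<epsilon>\<^sub>0 \<longrightarrow> torus2 (\<T>m \<epsilon>) \<and> invariant_under (dnls_field \<epsilon>) (\<T>m \<epsilon>) \<and> foliated_by_periodic_orbits (dnls_field \<epsilon>) T (\<T>m \<epsilon>)"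
      "((\<lambda>\<epsilon>. hausdorff_distance (\<T>m \<epsilon>) (unperturbed_torus I pi :: (complex ^ 'a mod_ring) set)) \<longlongrightarrow> 0) (at_right 0)"
      "\<forall>\<^sub>F \<epsilon> in at_right 0. linearly_stable (dnls_field \<epsilon>) T (\<T>m \<epsilon>)"
    using fm by auto
  show ?thesis
    by (rule exI[of _ "\<lambda>q. if q = 0 then \<T>1 else \<T>m"]) (use t1 tm in simp)
qed

end
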